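(* Let $0\le q\le d$. Assume that the stationary marked point process $X=\{(X_i,M_i)\}_{i\ge1}$ is ergodic and that $\mathbb E[X([0,1]^d)^p]<\infty$ for all $p\ge1$. Moreover, assume that the reduced factorial moment measure $\alpha_{q+2}^!$ is absolutely continuous (with respect to Lebesgue measure on $\mathbb R^{d(q+1)}$), and that the distribution of the typical mark does not contain atoms. Then, almost surely, $\{n^{-d}\beta_{q,n}^{\boldsymbol b,\boldsymbol d}\}_{(\boldsymbol b,\boldsymbol d)}$ converges to $\{\bar\beta_q^{\boldsymbol b,\boldsymbol d}\}_{(\boldsymbol b,\boldsymbol d)}$ in the sup-norm of processes on $\mathcal S^2$, i.e., almost surely, $$\lim_{n\to\infty}\ \sup_{(\boldsymbol b,\boldsymbol d)\in\mathcal S^2}\Big|\frac1{n^d}\beta_{q,n}^{\boldsymbol b,\boldsymbol d}-\bar\beta_q^{\boldsymbol b,\boldsymbol d}\Big|=0.$$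
   Context: **Marked point process.** Fix $d\ge1$ and a positive integer $T$. $X=\{(X_i,M_i)\}_{i\ge1}$ is a marked point process with locations $X_i\in\mathbb R^d$ and marks $M_i\in[0,T]$. It is stationary: the distribution of $\{(X_i+x,M_i)\}_{i\ge1}$ is the same for every $x\in\mathbb R^d$. For $B\subseteq\mathbb R^d$ put $X(B):=\#\{i\ge1: X_i\in B\}$. The intensity $\lambda:=\mathbb E[X([0,1]^d)]$ is assumed positive and finite. Ergodic means ergodic with respect to the spatial shifts $\{(X_i,M_i)\}\mapsto\{(X_i+x,M_i)\}$, $x\in\mathbb R^d$. For $m\ge1$, the reduced $m$th factorial moment measure $\alpha_m^!$ on $\mathbb R^{d(m-1)}$ is determined by $$\mathbb E\Big[\sum_{\substack{i_1,\dots,i_m\ge1\\ \text{pairwise distinct}}}f(X_{i_1},\dots,X_{i_m})\Big]=\lambda\int_{\mathbb R^d}\int_{\mathbb R^{d(m-1)}}f(x_0,x_0+y_1,\dots,x_0+y_{m-1})\,\alpha_m^!(\mathrm dy_1,\dots,\mathrm dy_{m-1})\,\mathrm dx_0$$ for all measurable $f:\mathbb R^{dm}\to[0,\infty)$. The distribution $\mathbb P^0$ of the typical mark $M$ is determined by $\mathbb E^0[f(M)]=\frac1\lambda\mathbb E\big[\sum_{i:X_i\in[0,1]^d}f(M_i)\big]$ for all measurable $f:[0,\infty)\to[0,\infty)$. **Čech complex.** For a nonempty finite set $\sigma=\{x_0,\dots,x_p\}\subseteq\mathbb R^d$ let $r(\sigma):=\min\{t\ge0: B_t(x_0)\cap\cdots\cap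 B_t(x_p)\ne\varnothing\}$, where $B_t(y)$ is the closed Euclidean ball of radius $t$ around $y$. For $P\subseteq\mathbb R^d$, $\mathrm{Cech}_r(P)$ is the simplicial complex of all nonempty finite $\sigma\subseteq P$ with $r(\sigma)\le r$. **Multicover complex.** For $P\subseteq\mathbb R^d$, $r\ge0$ and an integer $k\ge1$, $\mathrm{Mult}_{(r,k)}(P)$ is the simplicial complex whose vertices are $k$-element subsets of $P$, and in which distinct $k$-element subsets $\varphi_0,\dots,\varphi_p\subseteq P$ form a $p$-simplex ($p\ge0$) if and only if $\varphi_0\cup\cdots\cup\varphi_p\in\mathrm{Cech}_r(P)$. **Multifiltration.** The index set is $\mathcal S:=[0,T]\times[0,T]\times\{1,\dots,T\}$, with $(r_1,r_2,k)\le(r_1',r_2',k')$ if and only if $r_1\le r_1'$, $r_2\le r_2'$ and $k\ge k'$ (reversed order in the last coordinate). For an integer $n\ge1$ and $(r_1,r_2,k)\in\mathcal S$ put $$\mathbb K_{(r_1,r_2,k),n}:=\mathrm{Mult}_{(r_1,k)}\big(\{X_i\in[0,n]^d: M_i\le r_2\}\big).$$ For $\boldsymbol a=(r_1,r_2,k)\le\boldsymbol a'=(r_1',r_2',k')$ the simplicial map $\mathbb K_{\boldsymbol a,n}\to\mathbb K_{\boldsymbol a',n}$ sends a vertex $\varphi$ (a $k$-element set) to the set of its $k'$ smallest elements in the lexicographic order of $\mathbb R^d$. **Persistent Betti numbers.** For $\boldsymbol b\le\boldsymbol d$ in $\mathcal S$, $$\beta_{q,n}^{\boldsymbol b,\boldsymbol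 d}:=\dim\,\mathrm{Im}\big(H_q(\mathbb K_{\boldsymbol b,n})\to H_q(\mathbb K_{\boldsymbol d,n})\big),$$ where $H_q$ is simplicial homology with $\mathbb Z/2$-coefficients. For general $(\boldsymbol b,\boldsymbol d)\in\mathcal S^2$ put $\beta_{q,n}^{\boldsymbol b,\boldsymbol d}:=\beta_{q,n}^{\boldsymbol b,\max\{\boldsymbol b,\boldsymbol d\}}$, the maximum being taken coordinatewise with respect to the order on $\mathcal S$ (so it is the numerical minimum in the third coordinate). $\bar\beta_q^{\boldsymbol b,\boldsymbol d}:=\lim_{n\to\infty}n^{-d}\,\mathbb E[\beta_{q,n}^{\boldsymbol b,\boldsymbol d}]$; this limit exists and is deterministic for every fixed $(\boldsymbol b,\boldsymbol d)$ when $X$ is ergodic with all moments $\mathbb E[X([0,1]^d)^p]$ finite. *)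

theory Defs
  imports
    "HOL-Probability.Probability"
    "HOL-Library.Z2"
    "HOL-Library.Poly_Mapping"
    "HOL-Library.Fun_Lexorder"
    "HOL-Algebra.AbelCoset"
    "Jordan_Normal_Form.Missing_VectorSpace"
begin

section \<open>Simplicial homology with coefficients in the field with two elements\<close>

text \<open>A simplicial complex is the set of its simplices, each simplex being a nonempty finite
  vertex set. Chains are finitely supported functions into \<^typ>\<open>bit\<close>, the field with two
  elements, so no orientations are needed.\<close>

definition bit_ring :: "bit ring" where
  "bit_ring = \<lparr>carrier = UNIV, mult = (*), one = 1, zero = 0, add = (+)\<rparr>"

definition chain_module :: "'v set set \<Rightarrow> nat \<Rightarrow> (bit, 'v set \<Rightarrow>\<^sub>0 bit) module" where
  "chain_module K q =
    \<lparr>carrier = {c. Poly_Mapping.keys c \<subseteq> {\<sigma> \<in> K. card \<sigma> = q + 1}},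
     mult = undefined, one = undefined, zero = 0, add = (+),
     smult = (\<lambda>a. Poly_Mapping.map ((*) a))\<rparr>"

text \<open>The condition \<open>\<sigma> \<noteq> {v}\<close> drops the empty face of a vertex: homology is not reduced.\<close>

definition chain_boundary :: "('v set \<Rightarrow>\<^sub>0 bit) \<Rightarrow> ('v set \<Rightarrow>\<^sub>0 bit)" where
  "chain_boundary c =
    (\<Sum>\<sigma>\<in>Poly_Mapping.keys c. \<Sum>v | v \<in> \<sigma> \<and> \<sigma> \<noteq> {v}. Poly_Mapping.single (\<sigma> - {v}) 1)"

definition cycles :: "'v set set \<Rightarrow> nat \<Rightarrow> ('v set \<Rightarrow>\<^sub>0 bit) set" where
  "cycles K q = {c \<in> carrier (chain_module K q). chain_boundary c = 0}"

definition boundaries :: "'v set set \<Rightarrow> nat \<Rightarrow> ('v set \<Rightarrow>\<^sub>0 bit) set" where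
  "boundaries K q = chain_boundary ` carrier (chain_module K (q + 1))"

definition quotient_module :: "('a, 'b, 'c) module_scheme \<Rightarrow> 'b set \<Rightarrow> ('a, 'b set) module" where
  "quotient_module V U =
    \<lparr>carrier = a_rcosets\<^bsub>V\<^esub> U, mult = undefined, one = undefined, zero = U, add = set_add V,
     smult = (\<lambda>a A. \<Union>x\<in>A. U +>\<^bsub>V\<^esub> (a \<odot>\<^bsub>V\<^esub> x))\<rparr>"

definition homology :: "'v set set \<Rightarrow> nat \<Rightarrow> (bit, ('v set \<Rightarrow>\<^sub>0 bit) set) module" where
  "homology K q =
    quotient_module ((chain_module K q)\<lparr>carrier := cycles K q\<rparr>) (boundaries K q)"

text \<open>As usual, a simplex whose image under the vertex map has smaller dimension is sent to zero.\<close>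

definition chain_map :: "('v \<Rightarrow> 'u) \<Rightarrow> ('v set \<Rightarrow>\<^sub>0 bit) \<Rightarrow> ('u set \<Rightarrow>\<^sub>0 bit)" where
  "chain_map f c =
    (\<Sum>\<sigma> | \<sigma> \<in> Poly_Mapping.keys c \<and> inj_on f \<sigma>. Poly_Mapping.single (f ` \<sigma>) 1)"

definition homology_map ::
    "'u set set \<Rightarrow> ('v \<Rightarrow> 'u) \<Rightarrow> nat \<Rightarrow> ('v set \<Rightarrow>\<^sub>0 bit) set \<Rightarrow> ('u set \<Rightarrow>\<^sub>0 bit) set" where
  "homology_map L f q A = (\<Union>z\<in>A. boundaries L q +>\<^bsub>chain_module L q\<^esub> chain_map f z)"

definition homology_rank :: "'v set set \<Rightarrow> 'u set set \<Rightarrow> ('v \<Rightarrow> 'u) \<Rightarrow> nat \<Rightarrow> nat" where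
  "homology_rank K L f q =
    vectorspace.dim bit_ring
      ((homology L q)\<lparr>carrier := homology_map L f q ` carrier (homology K q)\<rparr>)"


section \<open>The multicover multifiltration\<close>

definition cech_radius :: "'a::metric_space set \<Rightarrow> real" where
  "cech_radius \<sigma> = (LEAST t. 0 \<le> t \<and> (\<Inter>x\<in>\<sigma>. cball x t) \<noteq> {})"

definition cech :: "real \<Rightarrow> 'a::metric_space set \<Rightarrow> 'a set set" where
  "cech r P = {\<sigma>. finite \<sigma> \<and> \<sigma> \<noteq> {} \<and> \<sigma> \<subseteq> P \<and> cech_radius \<sigma> \<le> r}"

definition multicover :: "real \<Rightarrow> nat \<Rightarrow> 'a::metric_space set \<Rightarrow> 'a set set set" where
  "multicover r k P =
    {\<Phi>. finite \<Phi> \<and> \<Phi> \<noteq> {} \<and> (\<forall>\<phi>\<in>\<Phi>. \<phi> \<subseteq> P \<and> finite \<phi> \<and> card \<phi> = k) \<and> \<Union>\<Phi> \<in> cech r P}"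

text \<open>The \<open>k\<close> smallest elements of a finite set in the lexicographic order.\<close>

definition lex_smallest ::
    "nat \<Rightarrow> (real, 'd::{finite,linorder}) vec set \<Rightarrow> (real, 'd) vec set" where
  "lex_smallest k \<phi> = {x \<in> \<phi>. card {y \<in> \<phi>. less_fun (vec_nth y) (vec_nth x)} < k}"

text \<open>An index \<open>(r\<^sub>1, r\<^sub>2, k)\<close> consists of the radius, the mark threshold and the cover
  multiplicity. Multiplicities are ordered in reverse, whence the minimum in \<open>index_max\<close>.\<close>

type_synonym index = "real \<times> real \<times> nat"

definition index_set :: "nat \<Rightarrow> index set" where
  "index_set T = {0..real T} \<times> {0..real T} \<times> {1..T}"

definition index_max :: "index \<Rightarrow> index \<Rightarrow> index" where
  "index_max = (\<lambda>(r1, r2, k) (r1', r2', k'). (max r1 r1', max r2 r2', min k k'))"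

text \<open>In the following, \<open>x\<close> and \<open>m\<close> are the locations and marks of one realization of
  the point process.\<close>

definition filtration_complex ::
    "(nat \<Rightarrow> (real, 'd::{finite,linorder}) vec) \<Rightarrow> (nat \<Rightarrow> real) \<Rightarrow> nat \<Rightarrow> index
      \<Rightarrow> (real, 'd) vec set set set" where
  "filtration_complex x m n =
    (\<lambda>(r1, r2, k). multicover r1 k {x i |i. x i \<in> cbox 0 (vec (real n)) \<and> m i \<le> r2})"

text \<open>Persistent Betti numbers for arbitrary pairs of indices. The vertex map only depends on the
  multiplicity of the target index.\<close>

definition persistent_betti ::
    "nat \<Rightarrow> (nat \<Rightarrow> (real, 'd::{finite,linorder}) vec) \<Rightarrow> (nat \<Rightarrow> real) \<Rightarrow> nat
      \<Rightarrow> index \<Rightarrow> index \<Rightarrow> nat" where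
  "persistent_betti q x m n b d =
    (let d' = index_max b d
     in homology_rank (filtration_complex x m n b) (filtration_complex x m n d')
          (lex_smallest (snd (snd d'))) q)"


section \<open>Marked point processes\<close>

text \<open>A marked point process is given by random variables \<open>X i\<close> (locations) and \<open>M i\<close>
  (marks). Points may coincide; counts are over indices, that is, with multiplicity. Stationary
  processes of positive intensity that are ergodic have infinitely many points, so enumerating
  the points by all of \<^typ>\<open>nat\<close> is no restriction.\<close>

definition marked_point_process ::
    "'w measure \<Rightarrow> real \<Rightarrow> (nat \<Rightarrow> 'w \<Rightarrow> 'a::euclidean_space) \<Rightarrow> (nat \<Rightarrow> 'w \<Rightarrow> real) \<Rightarrow> bool" where
  "marked_point_process \<Omega> T X M \<longleftrightarrow>
    (\<forall>i. X i \<in> borel_measurable \<Omega> \<and> M i \<in> borel_measurable \<Omega>) \<and>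
    (\<forall>\<omega>\<in>space \<Omega>. (\<forall>i. M i \<omega> \<in> {0..T}) \<and> (\<forall>B. bounded B \<longrightarrow> finite {i. X i \<omega> \<in> B}))"

text \<open>The points without their enumeration form a counting measure; \<open>config_space\<close> is the space of
  integer-valued measures that are finite over bounded sets of locations, with the
  \<open>\<sigma>\<close>-algebra generated by the evaluations.\<close>

definition config :: "(nat \<Rightarrow> 'a::euclidean_space) \<Rightarrow> (nat \<Rightarrow> real) \<Rightarrow> ('a \<times> real) measure" where
  "config x m = distr (count_space UNIV) borel (\<lambda>i. (x i, m i))"

definition config_space :: "('a::euclidean_space \<times> real) measure measure" where
  "config_space =
    (SUP B \<in> sets borel. vimage_algebra
      {\<nu>. sets \<nu> = sets borel \<and> (\<forall>C\<in>sets borel. bounded (fst ` C) \<longrightarrow> emeasure \<nu> C \<in> \<nat>)}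
      (\<lambda>\<nu>. emeasure \<nu> B) borel)"

definition config_shift :: "'a::euclidean_space \<Rightarrow> ('a \<times> real) measure \<Rightarrow> ('a \<times> real) measure" where
  "config_shift v \<nu> = distr \<nu> borel (\<lambda>(x, m). (x + v, m))"

definition stationary ::
    "'w measure \<Rightarrow> (nat \<Rightarrow> 'w \<Rightarrow> 'a::euclidean_space) \<Rightarrow> (nat \<Rightarrow> 'w \<Rightarrow> real) \<Rightarrow> bool" where
  "stationary \<Omega> X M \<longleftrightarrow>
    (\<forall>v. distr \<Omega> config_space (\<lambda>\<omega>. config (\<lambda>i. X i \<omega> + v) (\<lambda>i. M i \<omega>)) =
         distr \<Omega> config_space (\<lambda>\<omega>. config (\<lambda>i. X i \<omega>) (\<lambda>i. M i \<omega>)))"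

definition ergodic ::
    "'w measure \<Rightarrow> (nat \<Rightarrow> 'w \<Rightarrow> 'a::euclidean_space) \<Rightarrow> (nat \<Rightarrow> 'w \<Rightarrow> real) \<Rightarrow> bool" where
  "ergodic \<Omega> X M \<longleftrightarrow>
    (\<forall>A\<in>sets config_space.
       (\<forall>v. \<forall>\<nu>\<in>space config_space. config_shift v \<nu> \<in> A \<longleftrightarrow> \<nu> \<in> A) \<longrightarrow>
       measure \<Omega> {\<omega> \<in> space \<Omega>. config (\<lambda>i. X i \<omega>) (\<lambda>i. M i \<omega>) \<in> A} \<in> {0, 1})"

definition point_count :: "(nat \<Rightarrow> 'a) \<Rightarrow> 'a set \<Rightarrow> ennreal" where
  "point_count x B = emeasure (count_space UNIV) {i. x i \<in> B}"

definition intensity :: "'w measure \<Rightarrow> (nat \<Rightarrow> 'w \<Rightarrow> (real, 'd::finite) vec) \<Rightarrow> ennreal" where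
  "intensity \<Omega> X = (\<integral>\<^sup>+\<omega>. point_count (\<lambda>i. X i \<omega>) (cbox 0 1) \<partial>\<Omega>)"

text \<open>Elements of the product spaces below are \<open>m\<close>-tuples of points resp. \<open>(m - 1)\<close>-tuples
  \<open>(y\<^sub>1, \<dots>, y\<^bsub>m-1\<^esub>)\<close> of differences to the zeroth point. The inner integral over
  a \<^const>\<open>count_space\<close> is the sum over all \<open>m\<close>-tuples of pairwise distinct indices.\<close>

definition reduced_factorial_moment_measure ::
    "'w measure \<Rightarrow> (nat \<Rightarrow> 'w \<Rightarrow> (real, 'd::finite) vec) \<Rightarrow> nat
      \<Rightarrow> (nat \<Rightarrow> (real, 'd) vec) measure \<Rightarrow> bool" where
  "reduced_factorial_moment_measure \<Omega> X m \<alpha> \<longleftrightarrow>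
    sets \<alpha> = sets (\<Pi>\<^sub>M j\<in>{1..<m}. borel) \<and>
    (\<forall>f :: (nat \<Rightarrow> (real, 'd) vec) \<Rightarrow> ennreal. f \<in> borel_measurable (\<Pi>\<^sub>M j\<in>{..<m}. borel) \<longrightarrow>
      (\<integral>\<^sup>+\<omega>. (\<integral>\<^sup>+\<iota>. f (\<lambda>j\<in>{..<m}. X (\<iota> j) \<omega>)
        \<partial>count_space {\<iota> \<in> {..<m} \<rightarrow>\<^sub>E UNIV. inj_on \<iota> {..<m}}) \<partial>\<Omega>) =
      intensity \<Omega> X *
        (\<integral>\<^sup>+x. (\<integral>\<^sup>+y. f (\<lambda>j\<in>{..<m}. if j = 0 then x else x + y j) \<partial>\<alpha>) \<partial>lborel))"

definition typical_mark_distribution ::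
    "'w measure \<Rightarrow> (nat \<Rightarrow> 'w \<Rightarrow> (real, 'd::finite) vec) \<Rightarrow> (nat \<Rightarrow> 'w \<Rightarrow> real)
      \<Rightarrow> real measure \<Rightarrow> bool" where
  "typical_mark_distribution \<Omega> X M P0 \<longleftrightarrow>
    sets P0 = sets borel \<and>
    (\<forall>f :: real \<Rightarrow> ennreal. f \<in> borel_measurable borel \<longrightarrow>
      (\<integral>\<^sup>+t. f t \<partial>P0) =
      (\<integral>\<^sup>+\<omega>. (\<integral>\<^sup>+i. f (M i \<omega>) \<partial>count_space {i. X i \<omega> \<in> cbox 0 1}) \<partial>\<Omega>) / intensity \<Omega> X)"

definition limiting_betti ::
    "'w measure \<Rightarrow> (nat \<Rightarrow> 'w \<Rightarrow> (real, 'd::{finite,linorder}) vec) \<Rightarrow> (nat \<Rightarrow> 'w \<Rightarrow> real)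
      \<Rightarrow> nat \<Rightarrow> index \<Rightarrow> index \<Rightarrow> real" where
  "limiting_betti \<Omega> X M q b d =
    lim (\<lambda>n. (\<integral>\<omega>. real (persistent_betti q (\<lambda>i. X i \<omega>) (\<lambda>i. M i \<omega>) n b d) \<partial>\<Omega>)
               / real n ^ CARD('d))"

end

theory Submission imports Defs begin

text \<open>
  For a fixed pair of indices, consider the persistent Betti number of the points in a bounded
  region \<open>B\<close> as a functional of \<open>B\<close>. It commutes with translations, and it is
  nearly additive: if \<open>B\<close> is cut into disjoint pieces, the complex of \<open>B\<close> differs from the disjoint
  union of the complexes of the pieces only by simplices that are contained in no piece, and a
  single simplex changes the rank of the induced map by at most one (\<open>homology_rank_stable\<close>,
  \<open>homology_rank_union\<close>, \<open>prank_compare\<close>). Such simplices have diameter at most \<open>2 * T\<close>, so they lie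
  near the cuts, and their number is controlled by powers of local point counts, all of which are
  integrable. A spatial ergodic theorem for nearly additive functionals
  (\<open>near_additive.ergodic_theorem\<close>) yields the almost sure limit of the density. It also yields a
  rate: the limit differs from the expected density in the cube of side \<open>m\<close> by at most a constant
  over \<open>m\<close>, and the constant depends only on the range and the weights, not on the functional.

  The ergodic theorem combines three classical arguments. Averaging the decompositions of a large
  cube into cubes of side \<open>m\<close> over all \<open>m ^ CARD('d)\<close> offsets compares its density with an
  ergodic average of the density in the cube of side \<open>m\<close>, up to an error of order \<open>1 / m\<close>. The
  parallelogram identity turns this into convergence in the mean square, where the limit is
  constant by ergodicity. Wiener's maximal inequality upgrades this to almost sure convergence.

  For uniformity, let a radius or a mark threshold move inside an open interval \<open>J\<close>. The Betti number
  changes by at most a constant times the number of sets of at most \<open>T * (q + 2)\<close> points and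
  radius at most \<open>T\<close> whose radius lies in \<open>J\<close>, or which contain a point with mark in \<open>J\<close>
  (\<open>region_betti_stable\<close>). These numbers are nearly additive functionals themselves. Their
  expectation in a fixed cube tends to zero when the open interval shrinks to one of its end points, so by compactness finitely many points
  cut \<open>[0, T]\<close> into gaps of small expected content, and by the rate above this expectation bounds the
  asymptotic density of the content (\<open>finite_gap_points\<close>). Moving every index to a reference
  index in the same gaps leaves only finitely many pairs, for which pointwise convergence suffices
  (\<open>uniform_law_of_large_numbers\<close>).

  To apply all this, the process is replaced by its law on the space of configurations, and
  functionals of a configuration depend on its set of atoms. Measurability is obtained by rounding
  the atoms to dyadic grids (\<open>measurable_atoms_functional\<close>).
\<close>

section \<open>Chains over the field with two elements\<close>

lemma bit_add_self: "(x::bit) + x = 0"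
  by (cases x) (simp_all del: add_bit_eq_xor)

lemma chain_add_self [simp]: "(c::'a \<Rightarrow>\<^sub>0 bit) + c = 0"
  by (rule poly_mapping_eqI) (simp add: lookup_add bit_add_self del: add_bit_eq_xor)

lemma chain_add_self_left [simp]: "(c::'a \<Rightarrow>\<^sub>0 bit) + (c + d) = d"
  by (simp add: add.assoc[symmetric])

lemma chain_add_eq_iff: "(c::'a \<Rightarrow>\<^sub>0 bit) + d = e \<longleftrightarrow> d = c + e"
  by (metis chain_add_self_left)

lemma keys_chain_add:
  "Poly_Mapping.keys ((c::'a \<Rightarrow>\<^sub>0 bit) + d) =
     (Poly_Mapping.keys c - Poly_Mapping.keys d) \<union> (Poly_Mapping.keys d - Poly_Mapping.keys c)"
  (is "?l = ?r")
proof -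
  have *: "(x + y \<noteq> 0) = ((x \<noteq> 0) \<noteq> (y \<noteq> 0))" for x y :: bit
    by (cases x; cases y) (simp_all del: add_bit_eq_xor add: bit_add_self)
  show ?thesis
    by (auto simp: in_keys_iff lookup_add * simp del: add_bit_eq_xor)
qed

lemma chain_eqI: "Poly_Mapping.keys c = Poly_Mapping.keys d \<Longrightarrow> c = (d::'a \<Rightarrow>\<^sub>0 bit)"
proof (rule poly_mapping_eqI)
  fix k assume "Poly_Mapping.keys c = Poly_Mapping.keys d"
  then have "(Poly_Mapping.lookup c k = 0) = (Poly_Mapping.lookup d k = 0)"
    by (metis in_keys_iff)
  then show "Poly_Mapping.lookup c k = Poly_Mapping.lookup d k"
    by (metis bit_not_zero_iff)
qed

text \<open>The linear extension of a map given on single simplices. Both the boundary operator and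
  the chain maps have this form, so that their algebraic rules are instances of those for
  \<open>lift\<close>.\<close>

definition lift :: "('a \<Rightarrow> ('b \<Rightarrow>\<^sub>0 bit)) \<Rightarrow> ('a \<Rightarrow>\<^sub>0 bit) \<Rightarrow> ('b \<Rightarrow>\<^sub>0 bit)" where
  "lift g c = (\<Sum>\<sigma>\<in>Poly_Mapping.keys c. g \<sigma>)"

lemma lift_zero [simp]: "lift g 0 = 0"
  by (simp add: lift_def)

lemma lift_single [simp]: "lift g (Poly_Mapping.single a 1) = g a"
  by (simp add: lift_def)

lemma lift_add: "lift g (c + d) = lift g c + lift g d"
proof -
  let ?c = "Poly_Mapping.keys c" and ?d = "Poly_Mapping.keys d"
  have "lift g (c + d) = sum g (?c - ?d) + sum g (?d - ?c)"
    unfolding lift_def keys_chain_add by (rule sum.union_disjoint) auto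
  moreover have "sum g ?c = sum g (?c - ?d) + sum g (?c \<inter> ?d)"
    by (subst sum.Int_Diff[of _ _ ?d]) (simp_all add: add.commute)
  moreover have "sum g ?d = sum g (?d - ?c) + sum g (?c \<inter> ?d)"
    by (subst sum.Int_Diff[of _ _ ?c]) (simp_all add: add.commute Int_commute)
  ultimately show ?thesis
    unfolding lift_def by (simp add: add.assoc add.left_commute[of "sum g (?c \<inter> ?d)"])
qed

lemma lift_sum: "lift g (\<Sum>i\<in>I. c i) = (\<Sum>i\<in>I. lift g (c i))"
  by (induction I rule: infinite_finite_induct) (auto simp: lift_add)

lemma lift_lift: "lift g (lift h c) = lift (\<lambda>\<sigma>. lift g (h \<sigma>)) c"
  unfolding lift_def[of h] lift_def[of "\<lambda>\<sigma>. lift g (h \<sigma>)"] by (rule lift_sum)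

lemma lift_cong: "(\<And>\<sigma>. \<sigma> \<in> Poly_Mapping.keys c \<Longrightarrow> g \<sigma> = h \<sigma>) \<Longrightarrow> lift g c = lift h c"
  by (simp add: lift_def)

lemma keys_lift: "Poly_Mapping.keys (lift g c) \<subseteq> (\<Union>\<sigma>\<in>Poly_Mapping.keys c. Poly_Mapping.keys (g \<sigma>))"
  unfolding lift_def by (rule keys_sum)

definition face_sum :: "'v set \<Rightarrow> ('v set \<Rightarrow>\<^sub>0 bit)" where
  "face_sum \<sigma> = (\<Sum>v | v \<in> \<sigma> \<and> \<sigma> \<noteq> {v}. Poly_Mapping.single (\<sigma> - {v}) 1)"

definition simplex_image :: "('v \<Rightarrow> 'u) \<Rightarrow> 'v set \<Rightarrow> ('u set \<Rightarrow>\<^sub>0 bit)" where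
  "simplex_image f \<sigma> = (if inj_on f \<sigma> then Poly_Mapping.single (f ` \<sigma>) 1 else 0)"

lemma chain_boundary_eq: "chain_boundary c = lift face_sum c"
  by (simp add: chain_boundary_def lift_def face_sum_def)

lemma chain_map_eq: "chain_map f c = lift (simplex_image f) c"
proof -
  have "{\<sigma>. \<sigma> \<in> Poly_Mapping.keys c \<and> inj_on f \<sigma>} = {\<sigma> \<in> Poly_Mapping.keys c. inj_on f \<sigma>}" by auto
  then show ?thesis
    by (simp add: chain_map_def lift_def simplex_image_def sum.inter_filter)
qed

text \<open>If \<open>f\<close> identifies two vertices \<open>a\<close> and \<open>b\<close>, the faces containing both are degenerate,
  while the face without \<open>a\<close> and the face without \<open>b\<close> have the same image and cancel modulo
  two.\<close>

lemma face_sum_simplex_image: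
  assumes "finite \<sigma>" "\<sigma> \<noteq> {}"
  shows "lift face_sum (simplex_image f \<sigma>) = lift (simplex_image f) (face_sum \<sigma>)"
proof (cases "inj_on f \<sigma>")
  case True
  show ?thesis
  proof (cases "\<exists>v. \<sigma> = {v}")
    case T: True
    then obtain v where v: "\<sigma> = {v}" by auto
    have "face_sum {w} = 0" for w
      unfolding face_sum_def by (rule sum.neutral) auto
    moreover have "face_sum {v} = 0"
      unfolding face_sum_def by (rule sum.neutral) auto
    ultimately show ?thesis using True by (simp add: v simplex_image_def)
  next
    case F: False
    have s: "{v. v \<in> \<sigma> \<and> \<sigma> \<noteq> {v}} = \<sigma>" using F by auto
    have nf: "f ` \<sigma> \<noteq> {w}" for w
    proof
      assume "f ` \<sigma> = {w}"
      then have "card \<sigma> = 1" using card_image[OF True] by simp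
      then show False using F by (auto simp: card_1_singleton_iff)
    qed
    then have fs: "{w. w \<in> f ` \<sigma> \<and> f ` \<sigma> \<noteq> {w}} = f ` \<sigma>" by auto
    have "lift face_sum (simplex_image f \<sigma>) = (\<Sum>w\<in>f ` \<sigma>. Poly_Mapping.single (f ` \<sigma> - {w}) 1)"
      using True by (simp add: simplex_image_def face_sum_def fs del: image_iff)
    also have "\<dots> = (\<Sum>v\<in>\<sigma>. Poly_Mapping.single (f ` \<sigma> - {f v}) 1)"
      by (simp add: sum.reindex[OF True])
    also have "\<dots> = (\<Sum>v\<in>\<sigma>. simplex_image f (\<sigma> - {v}))"
    proof (rule sum.cong)
      fix v assume v: "v \<in> \<sigma>"
      have "inj_on f (\<sigma> - {v})" using True by (rule inj_on_subset) auto
      moreover have "f ` (\<sigma> - {v}) = f ` \<sigma> - {f v}"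
        using inj_on_image_set_diff[OF True, of \<sigma> "{v}"] v by auto
      ultimately show "Poly_Mapping.single (f ` \<sigma> - {f v}) 1 = simplex_image f (\<sigma> - {v})"
        by (simp add: simplex_image_def)
    qed simp
    also have "\<dots> = lift (simplex_image f) (face_sum \<sigma>)"
      by (simp add: face_sum_def s lift_sum)
    finally show ?thesis .
  qed
next
  case False
  then obtain a b where ab: "a \<in> \<sigma>" "b \<in> \<sigma>" "a \<noteq> b" "f a = f b" by (auto simp: inj_on_def)
  have s: "{v. v \<in> \<sigma> \<and> \<sigma> \<noteq> {v}} = \<sigma>" using ab by auto
  have "lift (simplex_image f) (face_sum \<sigma>) = (\<Sum>v\<in>\<sigma>. simplex_image f (\<sigma> - {v}))"
    by (simp add: face_sum_def s lift_sum)
  also have "\<dots> = (\<Sum>v\<in>{a,b}. simplex_image f (\<sigma> - {v}))"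
  proof (rule sum.mono_neutral_right)
    show "\<forall>v\<in>\<sigma> - {a, b}. simplex_image f (\<sigma> - {v}) = 0"
    proof
      fix v assume "v \<in> \<sigma> - {a, b}"
      then have "\<not> inj_on f (\<sigma> - {v})" using ab by (auto simp: inj_on_def)
      then show "simplex_image f (\<sigma> - {v}) = 0" by (simp add: simplex_image_def)
    qed
  qed (use assms ab in auto)
  also have "\<dots> = simplex_image f (\<sigma> - {a}) + simplex_image f (\<sigma> - {b})" using ab by simp
  also have "simplex_image f (\<sigma> - {a}) = simplex_image f (\<sigma> - {b})"
  proof -
    have im1: "f ` (\<sigma> - {u}) = f ` \<sigma>" if u: "u \<in> \<sigma>" "v \<in> \<sigma>" "u \<noteq> v" "f u = f v" for u v
    proof -
      have "f x \<in> f ` (\<sigma> - {u})" if "x \<in> \<sigma>" for x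
        using that u by (cases "x = u") (auto intro: image_eqI[of _ _ v])
      then show ?thesis by blast
    qed
    have im: "f ` (\<sigma> - {a}) = f ` \<sigma>" "f ` (\<sigma> - {b}) = f ` \<sigma>"
      using im1[of a b] im1[of b a] ab by auto
    have c: "card (\<sigma> - {a}) = card (\<sigma> - {b})" using ab assms by simp
    have "inj_on f (\<sigma> - {a}) \<longleftrightarrow> inj_on f (\<sigma> - {b})"
      using im c assms(1) by (metis card_image eq_card_imp_inj_on finite_Diff)
    then show ?thesis by (simp add: simplex_image_def im)
  qed
  finally show ?thesis using False by (simp add: simplex_image_def[of f \<sigma>])
qed

lemma chain_boundary_chain_map:
  assumes "\<And>\<sigma>. \<sigma> \<in> Poly_Mapping.keys c \<Longrightarrow> finite \<sigma> \<and> \<sigma> \<noteq> {}"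
  shows "chain_boundary (chain_map f c) = chain_map f (chain_boundary c)"
  unfolding chain_boundary_eq chain_map_eq lift_lift
  by (rule lift_cong) (use assms face_sum_simplex_image in blast)

lemma chain_map_comp: "chain_map g (chain_map f c) = chain_map (g \<circ> f) c"
proof -
  have "lift (simplex_image g) (simplex_image f \<sigma>) = simplex_image (g \<circ> f) \<sigma>" for \<sigma>
  proof (cases "inj_on f \<sigma>")
    case True
    then have "inj_on g (f ` \<sigma>) \<longleftrightarrow> inj_on (g \<circ> f) \<sigma>"
      by (metis comp_inj_on inj_on_imageI)
    then show ?thesis using True by (simp add: simplex_image_def image_comp)
  next
    case False
    then show ?thesis by (auto simp: simplex_image_def dest: inj_on_imageI2)
  qed
  then show ?thesis by (simp add: chain_map_eq lift_lift)
qed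

lemma chain_map_cong:
  assumes "\<And>\<sigma> v. \<sigma> \<in> Poly_Mapping.keys c \<Longrightarrow> v \<in> \<sigma> \<Longrightarrow> f v = g v"
  shows "chain_map f c = chain_map g c"
  unfolding chain_map_eq
proof (rule lift_cong)
  fix \<sigma> assume s: "\<sigma> \<in> Poly_Mapping.keys c"
  have "inj_on f \<sigma> = inj_on g \<sigma>" by (rule inj_on_cong) (use assms s in auto)
  moreover have "f ` \<sigma> = g ` \<sigma>" by (rule image_cong) (use assms s in auto)
  ultimately show "simplex_image f \<sigma> = simplex_image g \<sigma>" by (simp add: simplex_image_def)
qed

definition chain_of :: "'a set \<Rightarrow> ('a \<Rightarrow>\<^sub>0 bit)" where
  "chain_of A = (\<Sum>\<sigma>\<in>A. Poly_Mapping.single \<sigma> 1)"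

lemma keys_chain_of: "finite A \<Longrightarrow> Poly_Mapping.keys (chain_of A) = A"
  by (induction A rule: finite_induct) (auto simp: chain_of_def keys_chain_add)

lemma chain_map_id: "chain_map (\<lambda>v. v) c = c"
proof -
  have "simplex_image (\<lambda>v. v) = (\<lambda>\<sigma>. Poly_Mapping.single (\<sigma>::'a set) 1)"
    by (auto simp: simplex_image_def fun_eq_iff)
  then have "chain_map (\<lambda>v. v) c = chain_of (Poly_Mapping.keys c)"
    by (simp add: chain_map_eq lift_def chain_of_def)
  then show ?thesis by (simp add: chain_eqI keys_chain_of)
qed

section \<open>Ranks in homology as cardinalities\<close>

definition qchains :: "'v set set \<Rightarrow> nat \<Rightarrow> ('v set \<Rightarrow>\<^sub>0 bit) set" where
  "qchains K q = {c. Poly_Mapping.keys c \<subseteq> {\<sigma> \<in> K. card \<sigma> = q + 1}}"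

lemma cycles_eq: "cycles K q = {c \<in> qchains K q. chain_boundary c = 0}"
  by (simp add: cycles_def qchains_def chain_module_def)

lemma boundaries_eq: "boundaries K q = chain_boundary ` qchains K (q + 1)"
  by (simp add: boundaries_def qchains_def chain_module_def)

definition chain_subspace :: "('a \<Rightarrow>\<^sub>0 bit) set \<Rightarrow> bool" where
  "chain_subspace D \<longleftrightarrow> 0 \<in> D \<and> (\<forall>x\<in>D. \<forall>y\<in>D. x + y \<in> D)"

lemma chain_subspace_qchains: "chain_subspace (qchains K q)"
  by (auto simp: chain_subspace_def qchains_def keys_chain_add)

lemma chain_boundary_add: "chain_boundary (c + d) = chain_boundary c + chain_boundary d"
  by (simp add: chain_boundary_eq lift_add)

lemma chain_boundary_zero [simp]: "chain_boundary 0 = 0"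
  by (simp add: chain_boundary_eq)

lemma chain_map_add: "chain_map f (c + d) = chain_map f c + chain_map f d"
  by (simp add: chain_map_eq lift_add)

lemma chain_map_zero [simp]: "chain_map f 0 = 0"
  by (simp add: chain_map_eq)

lemma chain_subspace_cycles: "chain_subspace (cycles K q)"
  using chain_subspace_qchains[of K q]
  by (auto simp: chain_subspace_def cycles_eq chain_boundary_add)

lemma chain_subspace_boundaries: "chain_subspace (boundaries K q)"
  using chain_subspace_qchains[of K "q + 1"]
  unfolding chain_subspace_def boundaries_eq
  by (auto simp: chain_boundary_add[symmetric] image_iff intro: bexI[of _ 0])

lemma finite_qchains:
  assumes "finite K" shows "finite (qchains K q)"
proof -
  have "Poly_Mapping.keys ` qchains K q \<subseteq> Pow K" by (auto simp: qchains_def)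
  then have "finite (Poly_Mapping.keys ` qchains K q)" using assms by (meson finite_Pow_iff finite_subset)
  then show ?thesis by (rule finite_imageD) (auto intro: inj_onI chain_eqI)
qed

lemma finite_cycles: "finite K \<Longrightarrow> finite (cycles K q)"
  by (simp add: cycles_eq finite_qchains)

definition simplicial :: "('v \<Rightarrow> 'u) \<Rightarrow> 'v set set \<Rightarrow> 'u set set \<Rightarrow> bool" where
  "simplicial f K L \<longleftrightarrow> finite K \<and> finite L \<and> (\<forall>\<sigma>\<in>K. finite \<sigma> \<and> \<sigma> \<noteq> {} \<and> f ` \<sigma> \<in> L)"

lemma chain_map_qchains:
  assumes "simplicial f K L" "c \<in> qchains K q"
  shows "chain_map f c \<in> qchains L q"
proof -
  have "Poly_Mapping.keys (simplex_image f \<sigma>) \<subseteq> {\<tau> \<in> L. card \<tau> = q + 1}" if "\<sigma> \<in> Poly_Mapping.keys c" for \<sigma>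
    using assms that by (auto simp: simplicial_def qchains_def simplex_image_def card_image)
  then show ?thesis
    unfolding chain_map_eq using keys_lift[of "simplex_image f" c] by (fastforce simp: qchains_def)
qed

lemma chain_boundary_chain_map':
  assumes "simplicial f K L" "c \<in> qchains K q"
  shows "chain_boundary (chain_map f c) = chain_map f (chain_boundary c)"
  by (rule chain_boundary_chain_map) (use assms in \<open>auto simp: simplicial_def qchains_def\<close>)

lemma chain_map_cycles:
  assumes "simplicial f K L" "c \<in> cycles K q"
  shows "chain_map f c \<in> cycles L q"
  using assms chain_map_qchains[OF assms(1)] chain_boundary_chain_map'[OF assms(1)]
  by (auto simp: cycles_eq)

lemma chain_map_boundaries:
  assumes "simplicial f K L" "c \<in> boundaries K q"
  shows "chain_map f c \<in> boundaries L q"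
proof -
  obtain x where x: "x \<in> qchains K (q + 1)" "c = chain_boundary x"
    using assms(2) by (auto simp: boundaries_eq)
  then have "chain_map f c = chain_boundary (chain_map f x)"
    by (simp only: chain_boundary_chain_map'[OF assms(1) x(1)])
  then show ?thesis using chain_map_qchains[OF assms(1) x(1)] by (auto simp: boundaries_eq)
qed

definition chain_coset :: "('a \<Rightarrow>\<^sub>0 bit) set \<Rightarrow> ('a \<Rightarrow>\<^sub>0 bit) \<Rightarrow> ('a \<Rightarrow>\<^sub>0 bit) set" where
  "chain_coset D x = (\<lambda>b. b + x) ` D"

lemma chain_coset_self: "chain_subspace D \<Longrightarrow> x \<in> chain_coset D x"
  by (auto simp: chain_coset_def chain_subspace_def image_iff intro!: bexI[of _ 0])

lemma chain_coset_eq_iff: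
  assumes "chain_subspace D"
  shows "chain_coset D x = chain_coset D y \<longleftrightarrow> x + y \<in> D"
proof
  assume "chain_coset D x = chain_coset D y"
  then have "x \<in> chain_coset D y" using chain_coset_self[OF assms, of x] by simp
  then obtain b where "b \<in> D" "x = b + y" by (auto simp: chain_coset_def)
  then show "x + y \<in> D" by (simp add: add.assoc)
next
  have *: "chain_coset D x \<subseteq> chain_coset D y" if "x + y \<in> D" for x y
  proof
    fix c assume "c \<in> chain_coset D x"
    then obtain b where b: "b \<in> D" "c = b + x" by (auto simp: chain_coset_def)
    then have "b + (x + y) \<in> D" using that assms by (auto simp: chain_subspace_def)
    moreover have "c = (b + (x + y)) + y" by (simp add: b add.assoc)
    ultimately show "c \<in> chain_coset D y" by (auto simp: chain_coset_def)
  qed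
  assume "x + y \<in> D"
  then show "chain_coset D x = chain_coset D y" using *[of x y] *[of y x] by (simp add: add.commute)
qed

lemma chain_coset_add:
  assumes "chain_subspace D"
  shows "(\<Union>a\<in>chain_coset D x. \<Union>b\<in>chain_coset D y. {a + b}) = chain_coset D (x + y)"
proof
  show "(\<Union>a\<in>chain_coset D x. \<Union>b\<in>chain_coset D y. {a + b}) \<subseteq> chain_coset D (x + y)"
  proof
    fix u assume "u \<in> (\<Union>a\<in>chain_coset D x. \<Union>b\<in>chain_coset D y. {a + b})"
    then obtain b c where *: "b \<in> D" "c \<in> D" "u = (b + x) + (c + y)" by (auto simp: chain_coset_def)
    then have "u = (b + c) + (x + y)" by (simp add: algebra_simps)
    then show "u \<in> chain_coset D (x + y)" using * assms
      by (auto simp: chain_coset_def chain_subspace_def)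
  qed
  show "chain_coset D (x + y) \<subseteq> (\<Union>a\<in>chain_coset D x. \<Union>b\<in>chain_coset D y. {a + b})"
  proof
    fix u assume "u \<in> chain_coset D (x + y)"
    then obtain b where "b \<in> D" "u = (b + x) + y" by (auto simp: chain_coset_def add.assoc)
    then show "u \<in> (\<Union>a\<in>chain_coset D x. \<Union>b\<in>chain_coset D y. {a + b})"
      using chain_coset_self[OF assms, of y] by (auto simp: chain_coset_def[of D x])
  qed
qed

text \<open>Over a finite field, dimensions are logarithms of cardinalities. Counting cosets therefore
  replaces linear algebra in all estimates of ranks.\<close>

definition chain_coset_count :: "('a \<Rightarrow>\<^sub>0 bit) set \<Rightarrow> ('b \<Rightarrow> ('a \<Rightarrow>\<^sub>0 bit)) \<Rightarrow> 'b set \<Rightarrow> nat" where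
  "chain_coset_count D f U = card ((\<lambda>z. chain_coset D (f z)) ` U)"

text \<open>Chain maps send boundaries to boundaries, so the image of a homology class does not depend
  on the representing cycle, and the cycles of the source enumerate the image of the induced
  map.\<close>

lemma homology_map_image:
  assumes "simplicial f K L"
  shows "homology_map L f q ` carrier (homology K q) =
    (\<lambda>z. chain_coset (boundaries L q) (chain_map f z)) ` cycles K q"
proof -
  have c: "carrier (homology K q) = chain_coset (boundaries K q) ` cycles K q"
    unfolding homology_def quotient_module_def
    by (auto simp: A_RCOSETS_def' a_r_coset_def' chain_module_def chain_coset_def)
  have m: "homology_map L f q A = (\<Union>z\<in>A. chain_coset (boundaries L q) (chain_map f z))" for A
    unfolding homology_map_def by (auto simp: a_r_coset_def' chain_module_def chain_coset_def)
  have "homology_map L f q (chain_coset (boundaries K q) z) = chain_coset (boundaries L q) (chain_map f z)" for z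
  proof -
    have "chain_coset (boundaries L q) (chain_map f x) = chain_coset (boundaries L q) (chain_map f z)"
      if x: "x \<in> chain_coset (boundaries K q) z" for x
    proof -
      obtain b where b: "b \<in> boundaries K q" "x = b + z" using x by (auto simp: chain_coset_def)
      then have "chain_map f x + chain_map f z = chain_map f b"
        by (simp add: chain_map_add add.assoc)
      then show ?thesis
        using chain_map_boundaries[OF assms b(1)] by (simp add: chain_coset_eq_iff chain_subspace_boundaries)
    qed
    then show ?thesis unfolding m using chain_coset_self[OF chain_subspace_boundaries, of z K q] by blast
  qed
  then show ?thesis unfolding c by (simp add: image_image)
qed

lemma field_bit_ring: "field bit_ring"
proof -
  have "cring bit_ring"
    by (rule cringI)
      (auto intro!: abelian_groupI comm_monoidI exI[of _ "_::bit"]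
        simp: bit_ring_def algebra_simps bit_add_self simp del: add_bit_eq_xor mult_bit_eq_and
        intro: bit_add_self)
  then show ?thesis
    by (rule cring.cring_fieldI2) (auto simp: bit_ring_def simp del: mult_bit_eq_and)
qed

lemma UNIV_bit: "(UNIV :: bit set) = {0, 1}"
  by (auto simp del: bit_not_zero_iff bit_not_one_iff) (metis bit_not_zero_iff)

text \<open>Coordinates with respect to a basis identify the space with the functions from the basis
  to the field.\<close>

lemma bit_space_card:
  assumes "vectorspace bit_ring W" "finite (carrier W)"
  shows "card (carrier W) = 2 ^ vectorspace.dim bit_ring W"
proof -
  interpret vectorspace bit_ring W by fact
  have "gen_set (carrier W)"
    using in_own_span[of "carrier W"] span_is_subset2[of "carrier W"] by auto
  then have "fin_dim" using assms(2) unfolding fin_dim_def by blast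
  then obtain B where B: "finite B" "basis B" using finite_basis_exists by blast
  then have BC: "B \<subseteq> carrier W" by (simp add: basis_def)
  have uniq: "\<exists>!a. a \<in> B \<rightarrow>\<^sub>E carrier bit_ring \<and> lincomb a B = v" if "v \<in> carrier W" for v
    using basis_criterion[OF B(1) BC] B(2) that by blast
  have "bij_betw (\<lambda>a. lincomb a B) (B \<rightarrow>\<^sub>E carrier bit_ring) (carrier W)"
    unfolding bij_betw_def
  proof
    have cl: "lincomb a B \<in> carrier W" if "a \<in> B \<rightarrow>\<^sub>E carrier bit_ring" for a
      using that BC by (auto intro!: lincomb_closed)
    show "inj_on (\<lambda>a. lincomb a B) (B \<rightarrow>\<^sub>E carrier bit_ring)"
      by (rule inj_onI) (metis uniq cl)
    show "(\<lambda>a. lincomb a B) ` (B \<rightarrow>\<^sub>E carrier bit_ring) = carrier W"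
      using cl uniq by (auto simp: image_iff) metis
  qed
  then have "card (carrier W) = card (B \<rightarrow>\<^sub>E carrier bit_ring)"
    by (simp add: bij_betw_same_card)
  also have "\<dots> = 2 ^ card B"
    using B(1) by (simp add: card_funcsetE bit_ring_def UNIV_bit numeral_2_eq_2)
  finally show ?thesis using dim_basis[OF B] by simp
qed

text \<open>The image of the induced map is a vector space over the field with two elements, hence its
  dimension can be read off from its cardinality. All estimates of ranks below are estimates of
  the number of cosets on the right-hand side.\<close>

theorem homology_rank_card:
  assumes "simplicial f K L"
  shows "2 ^ homology_rank K L f q = chain_coset_count (boundaries L q) (chain_map f) (cycles K q)"
proof -
  define D where "D = boundaries L q"
  define I where "I = (\<lambda>z. chain_coset D (chain_map f z)) ` cycles K q"
  define W where "W = (homology L q)\<lparr>carrier := I\<rparr>"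
  have D: "chain_subspace D" by (simp add: D_def chain_subspace_boundaries)
  have Z: "chain_subspace (cycles K q)" by (rule chain_subspace_cycles)
  have cW: "carrier W = I" by (simp add: W_def)
  have zW: "\<zero>\<^bsub>W\<^esub> = chain_coset D 0" by (simp add: W_def homology_def quotient_module_def D_def chain_coset_def)
  have aW: "chain_coset D x \<oplus>\<^bsub>W\<^esub> chain_coset D y = chain_coset D (x + y)" for x y
    using chain_coset_add[OF D, where x = x and y = y]
    by (simp add: W_def homology_def quotient_module_def set_add_def' chain_module_def)
  have map0: "Poly_Mapping.map ((*) 0) x = 0" for x :: "'b set \<Rightarrow>\<^sub>0 bit"
    by (rule poly_mapping_eqI) (simp add: Poly_Mapping.map.rep_eq when_def)
  have map1: "Poly_Mapping.map ((*) 1) x = x" for x :: "'b set \<Rightarrow>\<^sub>0 bit"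
    by (rule poly_mapping_eqI) (auto simp add: Poly_Mapping.map.rep_eq when_def)
  have s0: "(0::bit) \<odot>\<^bsub>W\<^esub> chain_coset D x = chain_coset D 0" for x
    using chain_coset_self[OF D, of x]
    by (auto simp: W_def homology_def quotient_module_def a_r_coset_def' chain_module_def map0 chain_coset_def D_def
        simp del: mult_bit_eq_and)
  have s1: "(1::bit) \<odot>\<^bsub>W\<^esub> chain_coset D x = chain_coset D x" for x
  proof -
    have "(1::bit) \<odot>\<^bsub>W\<^esub> chain_coset D x = (\<Union>y\<in>chain_coset D x. chain_coset D y)"
      by (auto simp: W_def homology_def quotient_module_def a_r_coset_def' chain_module_def map1 chain_coset_def D_def
        simp del: mult_bit_eq_and)
    also have "chain_coset D y = chain_coset D x" if y: "y \<in> chain_coset D x" for y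
    proof -
      obtain b where "b \<in> D" "y = b + x" using y by (auto simp: chain_coset_def)
      then show ?thesis by (simp add: chain_coset_eq_iff[OF D] add.assoc)
    qed
    then have "(\<Union>y\<in>chain_coset D x. chain_coset D y) = chain_coset D x" using chain_coset_self[OF D, of x] by blast
    finally show ?thesis .
  qed
  have IE: "\<exists>z\<in>cycles K q. A = chain_coset D (chain_map f z)" if "A \<in> I" for A using that by (auto simp: I_def)
  have II: "chain_coset D (chain_map f z) \<in> I" if "z \<in> cycles K q" for z using that by (auto simp: I_def)
  have I0: "chain_coset D 0 \<in> I" using II[of 0] Z by (simp add: chain_subspace_def)
  have "abelian_group W"
  proof (rule abelian_groupI)
    fix A B assume "A \<in> carrier W" "B \<in> carrier W"
    then obtain z w where *: "z \<in> cycles K q" "w \<in> cycles K q"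
      "A = chain_coset D (chain_map f z)" "B = chain_coset D (chain_map f w)" using IE cW by metis
    then have "A \<oplus>\<^bsub>W\<^esub> B = chain_coset D (chain_map f (z + w))" by (simp add: aW chain_map_add)
    moreover have "z + w \<in> cycles K q" using * Z by (auto simp: chain_subspace_def)
    ultimately show "A \<oplus>\<^bsub>W\<^esub> B \<in> carrier W" by (simp add: cW II)
    show "A \<oplus>\<^bsub>W\<^esub> B = B \<oplus>\<^bsub>W\<^esub> A" by (simp add: * aW add.commute)
  next
    fix A B C assume "A \<in> carrier W" "B \<in> carrier W" "C \<in> carrier W"
    then obtain x y z where *: "A = chain_coset D x" "B = chain_coset D y" "C = chain_coset D z" using IE cW by metis
    then show "A \<oplus>\<^bsub>W\<^esub> B \<oplus>\<^bsub>W\<^esub> C = A \<oplus>\<^bsub>W\<^esub> (B \<oplus>\<^bsub>W\<^esub> C)" by (simp add: aW add.assoc)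
  next
    fix A assume A: "A \<in> carrier W"
    then obtain x where *: "A = chain_coset D x" using IE cW by metis
    then show "\<zero>\<^bsub>W\<^esub> \<oplus>\<^bsub>W\<^esub> A = A" by (simp add: aW zW)
    show "\<exists>y\<in>carrier W. y \<oplus>\<^bsub>W\<^esub> A = \<zero>\<^bsub>W\<^esub>" by (rule bexI[OF _ A]) (simp add: * aW zW)
  qed (simp add: cW zW I0)
  moreover have "a \<odot>\<^bsub>W\<^esub> A \<in> I" if "A \<in> I" for a :: bit and A
    using IE[OF that] that I0 by (cases a) (auto simp: s0 s1)
  moreover have "(a + b) \<odot>\<^bsub>W\<^esub> A = a \<odot>\<^bsub>W\<^esub> A \<oplus>\<^bsub>W\<^esub> b \<odot>\<^bsub>W\<^esub> A" if "A \<in> I" for a b :: bit and A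
    using IE[OF that] by (cases a; cases b) (auto simp: s0 s1 aW bit_add_self simp del: add_bit_eq_xor)
  moreover have "a \<odot>\<^bsub>W\<^esub> (A \<oplus>\<^bsub>W\<^esub> B) = a \<odot>\<^bsub>W\<^esub> A \<oplus>\<^bsub>W\<^esub> a \<odot>\<^bsub>W\<^esub> B" if "A \<in> I" "B \<in> I" for a :: bit and A B
    using IE[OF that(1)] IE[OF that(2)] by (cases a) (auto simp: s0 s1 aW)
  moreover have "(a * b) \<odot>\<^bsub>W\<^esub> A = a \<odot>\<^bsub>W\<^esub> (b \<odot>\<^bsub>W\<^esub> A)" if "A \<in> I" for a b :: bit and A
    using IE[OF that] by (cases a; cases b) (auto simp: s0 s1 aW simp del: mult_bit_eq_and)
  moreover have "(1::bit) \<odot>\<^bsub>W\<^esub> A = A" if "A \<in> I" for A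
    using IE[OF that] by (auto simp: s1)
  ultimately have "Module.module bit_ring W"
    using field_bit_ring unfolding field_def domain_def
    by (intro moduleI) (auto simp: cW bit_ring_def simp del: add_bit_eq_xor mult_bit_eq_and)
  then have "vectorspace bit_ring W"
    using field_bit_ring by (simp add: vectorspace_def)
  moreover have "finite (carrier W)"
    using assms by (simp add: cW I_def simplicial_def finite_cycles)
  ultimately have "card (carrier W) = 2 ^ vectorspace.dim bit_ring W" by (rule bit_space_card)
  moreover have "vectorspace.dim bit_ring W = homology_rank K L f q"
    by (simp add: homology_rank_def homology_map_image[OF assms] W_def I_def D_def)
  ultimately show ?thesis by (simp add: cW I_def chain_coset_count_def D_def)
qed

section \<open>Stability and additivity of the rank\<close>

lemma card_image_factor:
  assumes "finite U" "\<And>x y. x \<in> U \<Longrightarrow> y \<in> U \<Longrightarrow> p x = p y \<Longrightarrow> p' x = p' y"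
  shows "card (p' ` U) \<le> card (p ` U)"
proof -
  have "p' ` U \<subseteq> (\<lambda>a. p' (SOME x. x \<in> U \<and> p x = a)) ` p ` U"
  proof
    fix b assume "b \<in> p' ` U"
    then obtain x where x: "x \<in> U" "b = p' x" by auto
    have "(SOME y. y \<in> U \<and> p y = p x) \<in> U \<and> p (SOME y. y \<in> U \<and> p y = p x) = p x"
      by (rule someI[of _ x]) (use x in simp)
    then have "b = p' (SOME y. y \<in> U \<and> p y = p x)" using assms(2)[of _ x] x by metis
    then show "b \<in> (\<lambda>a. p' (SOME x. x \<in> U \<and> p x = a)) ` p ` U" using x by auto
  qed
  then show ?thesis
    by (meson assms(1) card_image_le card_mono finite_imageI order_trans)
qed

lemma chain_coset_count_mono:
  assumes "finite U'" "U \<subseteq> U'"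
  shows "chain_coset_count D f U \<le> chain_coset_count D f U'"
  unfolding chain_coset_count_def by (rule card_mono) (use assms in auto)

text \<open>Elements of \<open>U'\<close> with the same value of \<open>h\<close> differ by an element of \<open>U\<close>. With one
  representative for each value of \<open>h\<close>, all cosets over \<open>U'\<close> are thus translates of cosets over
  \<open>U\<close>.\<close>

lemma chain_coset_count_extend:
  assumes D: "chain_subspace D" and U: "finite U" "finite U'" "chain_subspace U'" "U \<subseteq> U'"
    and f: "\<And>x y. f (x + y) = f x + f y"
    and h: "h ` U' \<subseteq> H" "finite H" "\<And>x y. x \<in> U' \<Longrightarrow> y \<in> U' \<Longrightarrow> h x = h y \<Longrightarrow> x + y \<in> U"
  shows "chain_coset_count D f U' \<le> card H * chain_coset_count D f U"
proof -
  define r where "r = (\<lambda>t. SOME x. x \<in> U' \<and> h x = t)"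
  have "(\<lambda>z. chain_coset D (f z)) ` U' \<subseteq>
    (\<lambda>(t, A). (\<lambda>b. b + f (r t)) ` A) ` (H \<times> (\<lambda>z. chain_coset D (f z)) ` U)"
  proof
    fix A assume "A \<in> (\<lambda>z. chain_coset D (f z)) ` U'"
    then obtain x where x: "x \<in> U'" "A = chain_coset D (f x)" by auto
    have r: "r (h x) \<in> U' \<and> h (r (h x)) = h x"
      unfolding r_def by (rule someI[of _ x]) (use x in simp)
    then have u: "r (h x) + x \<in> U" using h(3)[of "r (h x)" x] x by simp
    have "f x = f (r (h x) + x) + f (r (h x))"
      by (simp add: f[symmetric] add.commute add.left_commute)
    then have "A = (\<lambda>b. b + f (r (h x))) ` chain_coset D (f (r (h x) + x))"
      by (simp add: x chain_coset_def image_image add.assoc)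
    moreover have "h x \<in> H" using h(1) x by blast
    ultimately show "A \<in> (\<lambda>(t, A). (\<lambda>b. b + f (r t)) ` A) ` (H \<times> (\<lambda>z. chain_coset D (f z)) ` U)"
      using u by (intro image_eqI[of _ _ "(h x, chain_coset D (f (r (h x) + x)))"]) auto
  qed
  then have "chain_coset_count D f U' \<le> card (H \<times> (\<lambda>z. chain_coset D (f z)) ` U)"
    unfolding chain_coset_count_def using U h by (meson card_image_le card_mono finite_SigmaI finite_imageI order_trans)
  then show ?thesis by (simp add: card_cartesian_product chain_coset_count_def)
qed

lemma chain_coset_count_coarsen:
  assumes "chain_subspace D" "chain_subspace D'" "D \<subseteq> D'" "finite U"
  shows "chain_coset_count D' f U \<le> chain_coset_count D f U"
  unfolding chain_coset_count_def
  by (rule card_image_factor) (use assms in \<open>auto simp: chain_coset_eq_iff\<close>)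

text \<open>The elements of \<open>T\<close> represent \<open>D'\<close> modulo \<open>D\<close>, so a coset of \<open>D'\<close> meets at most \<open>card T\<close>
  cosets of \<open>D\<close>.\<close>

lemma chain_coset_count_refine:
  assumes D: "chain_subspace D" "chain_subspace D'" and U: "finite U"
    and T: "finite T" "\<And>d. d \<in> D' \<Longrightarrow> \<exists>t\<in>T. d + t \<in> D"
  shows "chain_coset_count D f U \<le> card T * chain_coset_count D' f U"
proof -
  let ?p = "\<lambda>z. chain_coset D (f z)" and ?p' = "\<lambda>z. chain_coset D' (f z)"
  define r where "r = (\<lambda>A. SOME x. x \<in> U \<and> ?p' x = A)"
  have "?p ` U \<subseteq> (\<lambda>(t, A). chain_coset D (t + f (r A))) ` (T \<times> ?p' ` U)"
  proof
    fix A assume "A \<in> ?p ` U"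
    then obtain x where x: "x \<in> U" "A = ?p x" by auto
    have "r (?p' x) \<in> U \<and> ?p' (r (?p' x)) = ?p' x"
      unfolding r_def by (rule someI[of _ x]) (use x in simp)
    then have "f x + f (r (?p' x)) \<in> D'" using D(2) by (simp add: chain_coset_eq_iff add.commute)
    then obtain t where t: "t \<in> T" "f x + f (r (?p' x)) + t \<in> D" using T by blast
    then have "f x + (t + f (r (?p' x))) \<in> D" by (simp add: add.assoc add.commute add.left_commute)
    then have "A = chain_coset D (t + f (r (?p' x)))" using D(1) x by (simp add: chain_coset_eq_iff)
    then show "A \<in> (\<lambda>(t, A). chain_coset D (t + f (r A))) ` (T \<times> ?p' ` U)"
      using t x by (intro image_eqI[of _ _ "(t, ?p' x)"]) auto
  qed
  then have "chain_coset_count D f U \<le> card (T \<times> ?p' ` U)"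
    unfolding chain_coset_count_def using U T by (meson card_image_le card_mono finite_SigmaI finite_imageI order_trans)
  then show ?thesis by (simp add: card_cartesian_product chain_coset_count_def)
qed

lemma qchains_mono: "K \<subseteq> K' \<Longrightarrow> qchains K q \<subseteq> qchains K' q"
  by (auto simp: qchains_def)

lemma cycles_mono: "K \<subseteq> K' \<Longrightarrow> cycles K q \<subseteq> cycles K' q"
  using qchains_mono[of K K' q] by (auto simp: cycles_eq)

lemma boundaries_mono: "K \<subseteq> K' \<Longrightarrow> boundaries K q \<subseteq> boundaries K' q"
  using qchains_mono[of K K' "q + 1"] by (auto simp: boundaries_eq)

lemma cycles_add: "x \<in> cycles K q \<Longrightarrow> y \<in> cycles K q \<Longrightarrow> x + y \<in> cycles K q"
  using chain_subspace_cycles[of K q] by (simp add: chain_subspace_def)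

lemma boundaries_add: "x \<in> boundaries K q \<Longrightarrow> y \<in> boundaries K q \<Longrightarrow> x + y \<in> boundaries K q"
  using chain_subspace_boundaries[of K q] by (simp add: chain_subspace_def)

text \<open>Two cycles of the larger complex with the same coefficients on the new \<open>q\<close>-simplices
  differ by a cycle of the smaller one. Each new simplex thus at most doubles the number of
  classes in the image.\<close>

lemma rank_grow_source:
  assumes "simplicial f K L" "simplicial f K' L" "K \<subseteq> K'"
  shows "homology_rank K L f q \<le> homology_rank K' L f q"
    and "homology_rank K' L f q \<le> homology_rank K L f q + card {\<sigma> \<in> K' - K. card \<sigma> = q + 1}"
proof -
  let ?c = "chain_coset_count (boundaries L q) (chain_map f)"
  let ?E = "{\<sigma> \<in> K' - K. card \<sigma> = q + 1}"
  have fin: "finite K'" "finite K" using assms by (auto simp: simplicial_def)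
  have "(2::nat) ^ homology_rank K L f q \<le> 2 ^ homology_rank K' L f q"
    unfolding homology_rank_card[OF assms(1)] homology_rank_card[OF assms(2)]
    by (rule chain_coset_count_mono) (use assms fin finite_cycles cycles_mono[OF assms(3)] in auto)
  then show "homology_rank K L f q \<le> homology_rank K' L f q" by simp
  have "?c (cycles K' q) \<le> card (Pow ?E) * ?c (cycles K q)"
  proof (rule chain_coset_count_extend)
    show "(\<lambda>c. Poly_Mapping.keys c \<inter> ?E) ` cycles K' q \<subseteq> Pow ?E" by auto
    show "x + y \<in> cycles K q" if "x \<in> cycles K' q" "y \<in> cycles K' q"
      "Poly_Mapping.keys x \<inter> ?E = Poly_Mapping.keys y \<inter> ?E" for x y
    proof -
      have xy: "x + y \<in> cycles K' q" using that(1,2) by (rule cycles_add)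
      have "Poly_Mapping.keys (x + y) \<inter> ?E = {}" using that(3) unfolding keys_chain_add by blast
      then show ?thesis using xy by (auto simp: cycles_eq qchains_def)
    qed
  qed (use fin assms finite_cycles cycles_mono[OF assms(3)] chain_subspace_cycles chain_subspace_boundaries chain_map_add in auto)
  also have "card (Pow ?E) = 2 ^ card ?E" using fin by (simp add: card_Pow)
  finally have "(2::nat) ^ homology_rank K' L f q \<le> 2 ^ (card ?E + homology_rank K L f q)"
    unfolding homology_rank_card[OF assms(1), symmetric] homology_rank_card[OF assms(2), symmetric]
    by (simp add: power_add)
  then show "homology_rank K' L f q \<le> homology_rank K L f q + card ?E" by simp
qed

text \<open>A boundary in the larger complex becomes a boundary in the smaller one after adding the
  boundary of a chain of new \<open>(q + 1)\<close>-simplices. Each new simplex thus at most halves the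
  number of classes.\<close>

lemma rank_grow_target:
  assumes "simplicial f K L" "simplicial f K L'" "L \<subseteq> L'"
  shows "homology_rank K L' f q \<le> homology_rank K L f q"
    and "homology_rank K L f q \<le> homology_rank K L' f q + card {\<sigma> \<in> L' - L. card \<sigma> = q + 2}"
proof -
  let ?c = "\<lambda>L. chain_coset_count (boundaries L q) (chain_map f) (cycles K q)"
  let ?E = "{\<sigma> \<in> L' - L. card \<sigma> = q + 2}"
  have fin: "finite K" "finite L'" "finite L" using assms by (auto simp: simplicial_def)
  have "(2::nat) ^ homology_rank K L' f q \<le> 2 ^ homology_rank K L f q"
    unfolding homology_rank_card[OF assms(1)] homology_rank_card[OF assms(2)]
    by (rule chain_coset_count_coarsen)
      (use fin finite_cycles boundaries_mono[OF assms(3)] chain_subspace_boundaries in auto)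
  then show "homology_rank K L' f q \<le> homology_rank K L f q" by simp
  let ?T = "(\<lambda>A. chain_boundary (chain_of A)) ` Pow ?E"
  have "?c L \<le> card ?T * ?c L'"
  proof (rule chain_coset_count_refine)
    fix d assume "d \<in> boundaries L' q"
    then obtain c where c: "c \<in> qchains L' (q + 1)" "d = chain_boundary c" by (auto simp: boundaries_eq)
    define A where "A = Poly_Mapping.keys c \<inter> ?E"
    have kA: "Poly_Mapping.keys (chain_of A) = A"
      using fin by (intro keys_chain_of) (auto simp: A_def)
    have "Poly_Mapping.keys (c + chain_of A) = Poly_Mapping.keys c - A"
      unfolding keys_chain_add kA by (auto simp: A_def)
    then have "c + chain_of A \<in> qchains L (q + 1)" using c by (auto simp: qchains_def A_def)
    then have "d + chain_boundary (chain_of A) \<in> boundaries L q"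
      by (auto simp: boundaries_eq c chain_boundary_add[symmetric])
    then show "\<exists>t\<in>?T. d + t \<in> boundaries L q" by (auto simp: A_def)
  qed (use fin finite_cycles chain_subspace_boundaries in auto)
  also have "card ?T \<le> card (Pow ?E)" using fin by (intro card_image_le) auto
  also have "card (Pow ?E) = 2 ^ card ?E" using fin by (simp add: card_Pow)
  finally have "(2::nat) ^ homology_rank K L f q \<le> 2 ^ (card ?E + homology_rank K L' f q)"
    unfolding homology_rank_card[OF assms(1), symmetric] homology_rank_card[OF assms(2), symmetric]
    by (simp add: power_add)
  then show "homology_rank K L f q \<le> homology_rank K L' f q + card ?E" by simp
qed

text \<open>When \<open>K\<close> and \<open>L\<close> are replaced by \<open>K'\<close> and \<open>L'\<close>, the rank can only drop because cycles are
  lost together with \<open>q\<close>-simplices of the source, or because cycles become boundaries of new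
  \<open>(q + 1)\<close>-simplices of the target. The common subcomplexes separate the two effects.\<close>

theorem homology_rank_stable:
  assumes "simplicial f K L" "simplicial f K' L'"
  shows "homology_rank K L f q \<le> homology_rank K' L' f q
    + card {\<sigma> \<in> K - K'. card \<sigma> = q + 1}
    + card {\<sigma> \<in> L' - L. card \<sigma> = q + 2}"
proof -
  have s: "simplicial f (K \<inter> K') L" "simplicial f (K \<inter> K') (L \<inter> L')" "simplicial f (K \<inter> K') L'"
    using assms by (auto simp: simplicial_def)
  have e: "K - K \<inter> K' = K - K'" "L' - L \<inter> L' = L' - L" by auto
  note 1 = rank_grow_source(2)[OF s(1) assms(1) Int_lower1, of q, unfolded e]
  note 2 = rank_grow_target(1)[OF s(2,1) Int_lower1, of q]
  note 3 = rank_grow_target(2)[OF s(2,3) Int_lower2, of q, unfolded e]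
  note 4 = rank_grow_source(1)[OF s(3) assms(2) Int_lower2, of q]
  show ?thesis using 1 2 3 4 by linarith
qed

text \<open>Rank plus nullity, expressed by cardinalities.\<close>

lemma chain_coset_count_kernel:
  assumes D: "chain_subspace D" and U: "finite U" "chain_subspace U"
    and f: "\<And>x y. f (x + y) = f x + f y"
  shows "card U = chain_coset_count D f U * card {z \<in> U. f z \<in> D}"
proof -
  let ?p = "\<lambda>z. chain_coset D (f z)" and ?N = "{z \<in> U. f z \<in> D}"
  have "card {x \<in> U. ?p x = A} = card ?N" if A: "A \<in> ?p ` U" for A
  proof -
    obtain x where x: "x \<in> U" "A = ?p x" using A by auto
    have "bij_betw (\<lambda>z. z + x) ?N {x \<in> U. ?p x = A}"
    proof (rule bij_betw_byWitness[where f' = "\<lambda>z. z + x"])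
      show "(\<lambda>z. z + x) ` ?N \<subseteq> {x \<in> U. ?p x = A}" "(\<lambda>z. z + x) ` {x \<in> U. ?p x = A} \<subseteq> ?N"
        using x U(2) by (auto simp: chain_coset_eq_iff[OF D] f chain_subspace_def add.assoc)
    qed (auto simp: add.assoc)
    then show ?thesis by (simp add: bij_betw_same_card)
  qed
  moreover have "card U = (\<Sum>A\<in>?p ` U. card {x \<in> U. ?p x = A})"
    using sum.image_gen[OF U(1), of "\<lambda>_. 1::nat" ?p] by simp
  ultimately show ?thesis by (simp add: chain_coset_count_def)
qed

definition restrict_chain :: "'a set \<Rightarrow> ('a \<Rightarrow>\<^sub>0 bit) \<Rightarrow> ('a \<Rightarrow>\<^sub>0 bit)" where
  "restrict_chain K c = chain_of (Poly_Mapping.keys c \<inter> K)"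

lemma keys_restrict_chain [simp]: "Poly_Mapping.keys (restrict_chain K c) = Poly_Mapping.keys c \<inter> K"
  by (simp add: restrict_chain_def keys_chain_of)

lemma keys_chain_boundary:
  assumes "\<tau> \<in> Poly_Mapping.keys (chain_boundary c)"
  shows "\<tau> \<noteq> {} \<and> (\<exists>\<sigma>\<in>Poly_Mapping.keys c. \<tau> \<subseteq> \<sigma>)"
proof -
  obtain \<sigma> where s: "\<sigma> \<in> Poly_Mapping.keys c" "\<tau> \<in> Poly_Mapping.keys (face_sum \<sigma>)"
    using assms keys_lift[of face_sum c] unfolding chain_boundary_eq by blast
  have "Poly_Mapping.keys (face_sum \<sigma>) \<subseteq>
    (\<Union>v\<in>{v. v \<in> \<sigma> \<and> \<sigma> \<noteq> {v}}. Poly_Mapping.keys (Poly_Mapping.single (\<sigma> - {v}) (1::bit)))"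
    unfolding face_sum_def by (rule keys_sum)
  then have "\<tau> \<noteq> {} \<and> \<tau> \<subseteq> \<sigma>" using s(2) by auto
  then show ?thesis using s(1) by blast
qed

lemma split_qchains:
  assumes "c \<in> qchains (K1 \<union> K2) q" "K1 \<inter> K2 = {}"
  shows "restrict_chain K1 c \<in> qchains K1 q" "restrict_chain K2 c \<in> qchains K2 q"
    "c = restrict_chain K1 c + restrict_chain K2 c"
proof -
  have k: "Poly_Mapping.keys c \<subseteq> K1 \<union> K2" using assms by (auto simp: qchains_def)
  show "restrict_chain K1 c \<in> qchains K1 q" "restrict_chain K2 c \<in> qchains K2 q"
    using assms by (auto simp: qchains_def)
  show "c = restrict_chain K1 c + restrict_chain K2 c"
    by (rule chain_eqI) (use k assms(2) in \<open>auto simp: keys_chain_add\<close>)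
qed

lemma qchains_sum_unique:
  assumes "x \<in> qchains K1 q" "y \<in> qchains K2 q" "x' \<in> qchains K1 q" "y' \<in> qchains K2 q"
    "K1 \<inter> K2 = {}" "x + y = x' + y'"
  shows "x = x' \<and> y = y'"
proof -
  have *: "Poly_Mapping.keys u = Poly_Mapping.keys (u + v) \<inter> K1"
    "Poly_Mapping.keys v = Poly_Mapping.keys (u + v) \<inter> K2"
    if "u \<in> qchains K1 q" "v \<in> qchains K2 q" for u v
    using that assms(5) unfolding keys_chain_add qchains_def by blast+
  have "Poly_Mapping.keys x = Poly_Mapping.keys x'" "Poly_Mapping.keys y = Poly_Mapping.keys y'"
    using *[OF assms(1,2)] *[OF assms(3,4)] assms(6) by simp_all
  then show ?thesis by (auto intro: chain_eqI)
qed

lemma disjoint_boundaries_zero: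
  assumes "x \<in> qchains K1 q" "y \<in> qchains K2 q" "\<Union>K1 \<inter> \<Union>K2 = {}"
    "chain_boundary (x + y) = 0"
  shows "chain_boundary x = 0" "chain_boundary y = 0"
proof -
  have e: "chain_boundary x = chain_boundary y"
    using assms(4) unfolding chain_boundary_add by (metis chain_add_eq_iff add.right_neutral)
  have "Poly_Mapping.keys (chain_boundary x) = {}"
  proof (rule ccontr)
    assume "Poly_Mapping.keys (chain_boundary x) \<noteq> {}"
    then obtain \<tau> where "\<tau> \<in> Poly_Mapping.keys (chain_boundary x)" by blast
    then have "\<tau> \<noteq> {}" "\<exists>\<sigma>\<in>Poly_Mapping.keys x. \<tau> \<subseteq> \<sigma>" "\<exists>\<sigma>\<in>Poly_Mapping.keys y. \<tau> \<subseteq> \<sigma>"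
      using keys_chain_boundary e by metis+
    then show False using assms(1-3) unfolding qchains_def by blast
  qed
  then show "chain_boundary x = 0" by simp
  then show "chain_boundary y = 0" using e by simp
qed

text \<open>For complexes without common vertices, cycles and boundaries split uniquely into their two
  parts, and so does the kernel of the induced map. The claim follows by counting with
  \<open>chain_coset_count_kernel\<close>.\<close>

lemma homology_rank_union:
  assumes s: "simplicial f K1 L1" "simplicial f K2 L2"
    and K: "\<Union>K1 \<inter> \<Union>K2 = {}" and L: "\<Union>L1 \<inter> \<Union>L2 = {}" and ne: "{} \<notin> L1"
  shows "homology_rank (K1 \<union> K2) (L1 \<union> L2) f q = homology_rank K1 L1 f q + homology_rank K2 L2 f q"
proof -
  have s12: "simplicial f (K1 \<union> K2) (L1 \<union> L2)" using s by (auto simp: simplicial_def)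
  have Kd: "K1 \<inter> K2 = {}" using K s(1) by (auto simp: simplicial_def) blast
  have Ld: "L1 \<inter> L2 = {}"
  proof (rule equals0I)
    fix \<sigma> assume "\<sigma> \<in> L1 \<inter> L2"
    moreover from this ne obtain v where "v \<in> \<sigma>" by fastforce
    ultimately have "v \<in> \<Union>L1 \<inter> \<Union>L2" by auto
    then show False using L by simp
  qed
  let ?Z = "\<lambda>K. cycles K q" and ?B = "\<lambda>L. boundaries L q"
  let ?N = "\<lambda>K L. {z \<in> cycles K q. chain_map f z \<in> boundaries L q}"
  have bsum: "x + y \<in> ?B (L1 \<union> L2) \<longleftrightarrow> x \<in> ?B L1 \<and> y \<in> ?B L2"
    if xy: "x \<in> qchains L1 q" "y \<in> qchains L2 q" for x y
  proof
    assume "x \<in> ?B L1 \<and> y \<in> ?B L2"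
    then have "x \<in> ?B (L1 \<union> L2)" "y \<in> ?B (L1 \<union> L2)" using boundaries_mono[of L1 "L1 \<union> L2" q] boundaries_mono[of L2 "L1 \<union> L2" q] by auto
    then show "x + y \<in> ?B (L1 \<union> L2)" by (rule boundaries_add)
  next
    assume "x + y \<in> ?B (L1 \<union> L2)"
    then obtain c where c: "c \<in> qchains (L1 \<union> L2) (q+1)" "x + y = chain_boundary c"
      by (auto simp: boundaries_eq)
    let ?c1 = "restrict_chain L1 c" and ?c2 = "restrict_chain L2 c"
    note sp = split_qchains[OF c(1) Ld]
    have e: "x + y = chain_boundary ?c1 + chain_boundary ?c2"
      using c sp(3) chain_boundary_add by metis
    then have z: "(x + chain_boundary ?c1) = (y + chain_boundary ?c2)"
    proof -
      have "x = y + (chain_boundary ?c1 + chain_boundary ?c2)"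
        unfolding e[symmetric] by (simp add: add.commute[of x])
      then show ?thesis by (simp add: add.assoc add.left_commute add.commute)
    qed
    have "Poly_Mapping.keys (x + chain_boundary ?c1) = {}"
    proof (rule ccontr)
      assume "Poly_Mapping.keys (x + chain_boundary ?c1) \<noteq> {}"
      then obtain \<tau> where t: "\<tau> \<in> Poly_Mapping.keys (x + chain_boundary ?c1)" by blast
      then have t': "\<tau> \<in> Poly_Mapping.keys (y + chain_boundary ?c2)" using z by simp
      have 1: "\<tau> \<in> L1 \<or> \<tau> \<noteq> {} \<and> (\<exists>\<sigma>\<in>L1. \<tau> \<subseteq> \<sigma>)"
        using t keys_chain_boundary[of \<tau> ?c1] xy(1) sp(1) unfolding keys_chain_add qchains_def by blast
      have 2: "\<tau> \<in> L2 \<or> \<tau> \<noteq> {} \<and> (\<exists>\<sigma>\<in>L2. \<tau> \<subseteq> \<sigma>)"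
        using t' keys_chain_boundary[of \<tau> ?c2] xy(2) sp(2) unfolding keys_chain_add qchains_def by blast
      have "\<tau> \<noteq> {}" using 1 ne by metis
      moreover have "\<tau> \<subseteq> \<Union>L1" using 1 by (elim disjE conjE bexE) (auto intro: Sup_upper)
      moreover have "\<tau> \<subseteq> \<Union>L2" using 2 by (elim disjE conjE bexE) (auto intro: Sup_upper)
      ultimately have "\<Union>L1 \<inter> \<Union>L2 \<noteq> {}" by (metis Int_greatest subset_empty)
      then show False using L by simp
    qed
    then have "x = chain_boundary ?c1" "y = chain_boundary ?c2"
      using z by (simp_all add: chain_add_eq_iff)
    then show "x \<in> ?B L1 \<and> y \<in> ?B L2" using sp by (auto simp: boundaries_eq)
  qed
  have zsum: "x + y \<in> ?Z (K1 \<union> K2) \<longleftrightarrow> x \<in> ?Z K1 \<and> y \<in> ?Z K2"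
    if xy: "x \<in> qchains K1 q" "y \<in> qchains K2 q" for x y
  proof
    assume "x + y \<in> ?Z (K1 \<union> K2)"
    then show "x \<in> ?Z K1 \<and> y \<in> ?Z K2"
      using disjoint_boundaries_zero[OF xy K] xy by (auto simp: cycles_eq)
  next
    assume "x \<in> ?Z K1 \<and> y \<in> ?Z K2"
    then have "x \<in> ?Z (K1 \<union> K2)" "y \<in> ?Z (K1 \<union> K2)" using cycles_mono[of K1 "K1 \<union> K2" q] cycles_mono[of K2 "K1 \<union> K2" q] by auto
    then show "x + y \<in> ?Z (K1 \<union> K2)" by (rule cycles_add)
  qed
  have inj: "inj_on (\<lambda>(x, y). x + y) (qchains K1 q \<times> qchains K2 q)"
    using qchains_sum_unique[OF _ _ _ _ Kd] by (auto simp: inj_on_def)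
  have sub: "?Z K1 \<times> ?Z K2 \<subseteq> qchains K1 q \<times> qchains K2 q" by (auto simp: cycles_eq)
  have Zim: "?Z (K1 \<union> K2) = (\<lambda>(x, y). x + y) ` (?Z K1 \<times> ?Z K2)"
  proof -
    have "c \<in> (\<lambda>(x, y). x + y) ` (?Z K1 \<times> ?Z K2)" if c: "c \<in> ?Z (K1 \<union> K2)" for c
    proof -
      have "c \<in> qchains (K1 \<union> K2) q" using c by (simp add: cycles_eq)
      note sp = split_qchains[OF this Kd]
      have "restrict_chain K1 c \<in> ?Z K1 \<and> restrict_chain K2 c \<in> ?Z K2"
        using zsum[OF sp(1,2)] sp(3) c by simp
      then show ?thesis using sp(3) by (intro image_eqI[of _ _ "(restrict_chain K1 c, restrict_chain K2 c)"]) auto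
    qed
    then show ?thesis using zsum by (auto simp: cycles_eq)
  qed
  have ksum: "x + y \<in> ?N (K1 \<union> K2) (L1 \<union> L2) \<longleftrightarrow> x \<in> ?N K1 L1 \<and> y \<in> ?N K2 L2"
    if "x \<in> ?Z K1" "y \<in> ?Z K2" for x y
  proof -
    have q: "x \<in> qchains K1 q" "y \<in> qchains K2 q" using that by (auto simp: cycles_eq)
    show ?thesis
      using bsum[OF chain_map_qchains[OF s(1) q(1)] chain_map_qchains[OF s(2) q(2)]] zsum[OF q] that
      by (auto simp: chain_map_add)
  qed
  have Nim: "?N (K1 \<union> K2) (L1 \<union> L2) = (\<lambda>(x, y). x + y) ` (?N K1 L1 \<times> ?N K2 L2)"
  proof (intro equalityI subsetI)
    fix c assume c: "c \<in> ?N (K1 \<union> K2) (L1 \<union> L2)"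
    then obtain x y where "x \<in> ?Z K1" "y \<in> ?Z K2" "c = x + y" using Zim by auto
    then show "c \<in> (\<lambda>(x, y). x + y) ` (?N K1 L1 \<times> ?N K2 L2)"
      using ksum[of x y] c by (intro image_eqI[of _ _ "(x, y)"]) auto
  next
    fix c assume "c \<in> (\<lambda>(x, y). x + y) ` (?N K1 L1 \<times> ?N K2 L2)"
    then obtain x y where xy: "x \<in> ?N K1 L1" "y \<in> ?N K2 L2" "c = x + y" by auto
    then have "x \<in> ?Z K1" "y \<in> ?Z K2" by auto
    from ksum[OF this] xy show "c \<in> ?N (K1 \<union> K2) (L1 \<union> L2)" by blast
  qed
  have cZ: "card (?Z (K1 \<union> K2)) = card (?Z K1) * card (?Z K2)"
    unfolding Zim using card_image[OF inj_on_subset[OF inj sub]] by (simp add: card_cartesian_product)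
  have cN: "card (?N (K1 \<union> K2) (L1 \<union> L2)) = card (?N K1 L1) * card (?N K2 L2)"
    unfolding Nim using card_image[OF inj_on_subset[OF inj], of "?N K1 L1 \<times> ?N K2 L2"] sub
    by (auto simp: card_cartesian_product)
  have ker: "card (?Z K) = 2 ^ homology_rank K L f q * card (?N K L) \<and> card (?N K L) > 0"
    if "simplicial f K L" for K L
  proof
    have fz: "finite (?Z K)" using that by (simp add: simplicial_def finite_cycles)
    show "card (?Z K) = 2 ^ homology_rank K L f q * card (?N K L)"
      unfolding homology_rank_card[OF that]
      by (rule chain_coset_count_kernel)
        (use fz chain_subspace_boundaries chain_subspace_cycles chain_map_add in auto)
    have "0 \<in> ?N K L"
      using chain_subspace_boundaries[of L q] chain_subspace_cycles[of K q] by (simp add: chain_subspace_def)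
    then show "card (?N K L) > 0" using fz by (auto simp: card_gt_0_iff)
  qed
  have "(2::nat) ^ homology_rank (K1 \<union> K2) (L1 \<union> L2) f q = 2 ^ (homology_rank K1 L1 f q + homology_rank K2 L2 f q)"
    using ker[OF s12] ker[OF s(1)] ker[OF s(2)] unfolding cZ cN
    by (simp add: power_add)
  then show ?thesis by simp
qed

text \<open>The right inverse \<open>g'\<close> makes \<open>g\<close> surjective on cycles. As the square formed by \<open>f\<close>, \<open>f'\<close>,
  \<open>g\<close> and \<open>h\<close> commutes, \<open>h\<close> maps the image of the first induced map onto that of the second.\<close>

lemma homology_rank_transfer_le:
  assumes s: "simplicial f K L" "simplicial f' K' L'"
    and g: "simplicial g K K'" "simplicial g' K' K" "simplicial h L L'"
    and gg: "\<And>v. v \<in> \<Union>K' \<Longrightarrow> g (g' v) = v" and fg: "\<And>v. v \<in> \<Union>K \<Longrightarrow> f' (g v) = h (f v)"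
  shows "homology_rank K' L' f' q \<le> homology_rank K L f q"
proof -
  let ?p = "\<lambda>z. chain_coset (boundaries L q) (chain_map f z)"
  let ?p' = "\<lambda>z. chain_coset (boundaries L' q) (chain_map f' z)"
  have comm: "chain_map f' (chain_map g z) = chain_map h (chain_map f z)" if "z \<in> cycles K q" for z
    unfolding chain_map_comp
    by (rule chain_map_cong) (use that fg in \<open>auto simp: cycles_eq qchains_def\<close>)
  have surj: "cycles K' q \<subseteq> chain_map g ` cycles K q"
  proof
    fix z assume z: "z \<in> cycles K' q"
    have "chain_map g (chain_map g' z) = chain_map (\<lambda>v. v) z"
      unfolding chain_map_comp
      by (rule chain_map_cong) (use z gg in \<open>auto simp: cycles_eq qchains_def\<close>)
    then show "z \<in> chain_map g ` cycles K q"
      using chain_map_cycles[OF g(2) z] by (metis chain_map_id image_eqI)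
  qed
  have fin: "finite (cycles K q)" using s by (simp add: simplicial_def finite_cycles)
  have "card (?p' ` cycles K' q) \<le> card ((\<lambda>z. ?p' (chain_map g z)) ` cycles K q)"
    using surj fin by (intro card_mono) auto
  also have "\<dots> \<le> card (?p ` cycles K q)"
  proof (rule card_image_factor[OF fin])
    fix x y assume xy: "x \<in> cycles K q" "y \<in> cycles K q" "?p x = ?p y"
    then have "chain_map h (chain_map f x + chain_map f y) \<in> boundaries L' q"
      by (intro chain_map_boundaries[OF g(3)]) (simp add: chain_coset_eq_iff chain_subspace_boundaries)
    then show "?p' (chain_map g x) = ?p' (chain_map g y)"
      using xy by (simp add: chain_coset_eq_iff chain_subspace_boundaries comm chain_map_add)
  qed
  finally have "(2::nat) ^ homology_rank K' L' f' q \<le> 2 ^ homology_rank K L f q"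
    unfolding homology_rank_card[OF s(1)] homology_rank_card[OF s(2)] chain_coset_count_def .
  then show ?thesis by simp
qed

section \<open>The Cech radius\<close>

text \<open>The minimum that defines the radius is attained, since the intersections of balls whose
  radii decrease to the infimum are nested, compact and nonempty.\<close>

lemma cech_radius_le_iff:
  fixes \<sigma> :: "'a::euclidean_space set"
  assumes "finite \<sigma>" "\<sigma> \<noteq> {}"
  shows "cech_radius \<sigma> \<le> r \<longleftrightarrow> 0 \<le> r \<and> (\<exists>y. \<forall>x\<in>\<sigma>. dist x y \<le> r)"
proof -
  define S where "S = {t. 0 \<le> t \<and> (\<Inter>x\<in>\<sigma>. cball x t) \<noteq> {}}"
  define t0 where "t0 = Inf S"
  have S_iff: "t \<in> S \<longleftrightarrow> 0 \<le> t \<and> (\<exists>y. \<forall>x\<in>\<sigma>. dist x y \<le> t)" for t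
  proof -
    have "(\<Inter>x\<in>\<sigma>. cball x t) \<noteq> {} \<longleftrightarrow> (\<exists>y. y \<in> (\<Inter>x\<in>\<sigma>. cball x t))" by blast
    then show ?thesis by (simp add: S_def)
  qed
  have up: "t' \<in> S" if "t \<in> S" "t \<le> t'" for t t'
    using that unfolding S_iff by (meson order_trans)
  obtain a where a: "a \<in> \<sigma>" using assms by auto
  have "Max ((\<lambda>x. dist x a) ` \<sigma>) \<in> S"
    unfolding S_iff
  proof (intro conjI exI[of _ a] ballI)
    show "dist x a \<le> Max ((\<lambda>x. dist x a) ` \<sigma>)" if "x \<in> \<sigma>" for x using that assms by auto
    from this[OF a] show "0 \<le> Max ((\<lambda>x. dist x a) ` \<sigma>)" by simp
  qed
  then have Sne: "S \<noteq> {}" by auto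
  have bdd: "bdd_below S" by (rule bdd_belowI[of _ 0]) (auto simp: S_def)
  have t0: "0 \<le> t0" unfolding t0_def by (rule cInf_greatest[OF Sne]) (auto simp: S_def)
  define F where "F = (\<lambda>n::nat. \<Inter>x\<in>\<sigma>. cball x (t0 + 1 / real (Suc n)))"
  have "\<Inter> (range F) \<noteq> {}"
  proof (rule compact_nest)
    fix n
    show "compact (F n)" unfolding F_def using a by (intro compact_Inter) auto
    have "Inf S < t0 + 1 / real (Suc n)" by (simp add: t0_def)
    then obtain s where "s \<in> S" "s < t0 + 1 / real (Suc n)"
      using cInf_lessD[OF Sne] by blast
    then have "t0 + 1 / real (Suc n) \<in> S" using up by simp
    then show "F n \<noteq> {}" by (simp add: S_def F_def)
  next
    fix m n :: nat assume "m \<le> n"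
    then have "1 / real (Suc n) \<le> 1 / real (Suc m)" by (simp add: divide_simps)
    then show "F n \<subseteq> F m" unfolding F_def by (intro INF_mono) (auto intro!: bexI)
  qed
  then obtain y where y: "\<And>n. y \<in> F n" by auto
  have "dist x y \<le> t0" if x: "x \<in> \<sigma>" for x
  proof (rule field_le_epsilon)
    fix e :: real assume "e > 0"
    then obtain n where "1 / real (Suc n) < e" using nat_approx_posE by blast
    moreover have "dist x y \<le> t0 + 1 / real (Suc n)" using y[of n] x by (auto simp: F_def)
    ultimately show "dist x y \<le> t0 + e" by simp
  qed
  then have t0S: "t0 \<in> S" using t0 by (auto simp: S_iff)
  have "cech_radius \<sigma> = t0"
    unfolding cech_radius_def
  proof (rule Least_equality)
    show "0 \<le> t0 \<and> (\<Inter>x\<in>\<sigma>. cball x t0) \<noteq> {}" using t0S by (simp add: S_def)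
    show "t0 \<le> t" if "0 \<le> t \<and> (\<Inter>x\<in>\<sigma>. cball x t) \<noteq> {}" for t
      unfolding t0_def by (rule cInf_lower[OF _ bdd]) (use that in \<open>simp add: S_def\<close>)
  qed
  moreover have "t0 \<le> r \<longleftrightarrow> r \<in> S"
    using up[OF t0S] cInf_lower[OF _ bdd, of r] by (auto simp: t0_def)
  ultimately show ?thesis by (simp add: S_iff)
qed

lemma cech_radius_center:
  fixes \<sigma> :: "'a::euclidean_space set"
  assumes "finite \<sigma>" "\<sigma> \<noteq> {}"
  shows "0 \<le> cech_radius \<sigma>" "\<exists>y. \<forall>x\<in>\<sigma>. dist x y \<le> cech_radius \<sigma>"
  using cech_radius_le_iff[OF assms, of "cech_radius \<sigma>"] by auto

lemma cech_radius_mono: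
  fixes \<sigma> :: "'a::euclidean_space set"
  assumes "finite \<tau>" "\<sigma> \<noteq> {}" "\<sigma> \<subseteq> \<tau>"
  shows "cech_radius \<sigma> \<le> cech_radius \<tau>"
proof -
  have "finite \<sigma>" "\<tau> \<noteq> {}" using assms finite_subset by auto
  then show ?thesis
    using cech_radius_center[OF assms(1)] assms by (subst cech_radius_le_iff) blast+
qed

lemma dist_le_cech_radius:
  fixes \<sigma> :: "'a::euclidean_space set"
  assumes "finite \<sigma>" "x \<in> \<sigma>" "y \<in> \<sigma>"
  shows "dist x y \<le> 2 * cech_radius \<sigma>"
proof -
  obtain c where "\<forall>x\<in>\<sigma>. dist x c \<le> cech_radius \<sigma>" using cech_radius_center[of \<sigma>] assms by auto
  then have "dist x c \<le> cech_radius \<sigma>" "dist y c \<le> cech_radius \<sigma>" using assms by auto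
  then show ?thesis using dist_triangle2[of x y c] by simp
qed

lemma cech_radius_perturb:
  fixes \<sigma> :: "'a::euclidean_space set"
  assumes "finite \<sigma>" "\<sigma> \<noteq> {}" "\<And>x. x \<in> \<sigma> \<Longrightarrow> dist (g x) x \<le> e"
  shows "cech_radius (g ` \<sigma>) \<le> cech_radius \<sigma> + e" "cech_radius \<sigma> \<le> cech_radius (g ` \<sigma>) + e"
proof -
  have e: "0 \<le> e" using assms(2,3) by (meson all_not_in_conv order_trans zero_le_dist)
  have g: "finite (g ` \<sigma>)" "g ` \<sigma> \<noteq> {}" using assms by auto
  obtain c where c: "\<forall>x\<in>\<sigma>. dist x c \<le> cech_radius \<sigma>" using cech_radius_center(2)[OF assms(1,2)] by auto
  have "dist (g x) c \<le> cech_radius \<sigma> + e" if "x \<in> \<sigma>" for x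
    using c that assms(3)[OF that] dist_triangle[of "g x" c x] by fastforce
  then show "cech_radius (g ` \<sigma>) \<le> cech_radius \<sigma> + e"
    using e cech_radius_center(1)[OF assms(1,2)] by (subst cech_radius_le_iff[OF g]) auto
  obtain c where c: "\<forall>x\<in>g ` \<sigma>. dist x c \<le> cech_radius (g ` \<sigma>)" using cech_radius_center(2)[OF g] by auto
  have "dist x c \<le> cech_radius (g ` \<sigma>) + e" if "x \<in> \<sigma>" for x
    using c that assms(3)[OF that] dist_triangle[of x c "g x"] by (fastforce simp: dist_commute)
  then show "cech_radius \<sigma> \<le> cech_radius (g ` \<sigma>) + e"
    using e cech_radius_center(1)[OF g] by (subst cech_radius_le_iff[OF assms(1,2)]) auto
qed

lemma cech_radius_translate:
  fixes \<sigma> :: "'a::euclidean_space set"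
  assumes "finite \<sigma>" "\<sigma> \<noteq> {}"
  shows "cech_radius ((\<lambda>x. x + v) ` \<sigma>) = cech_radius \<sigma>"
proof -
  have le: "cech_radius ((\<lambda>x. x + v) ` \<sigma>) \<le> cech_radius \<sigma>" if fs: "finite \<sigma>" "\<sigma> \<noteq> {}" for \<sigma> :: "'a set" and v
  proof -
    obtain c where "\<forall>x\<in>\<sigma>. dist x c \<le> cech_radius \<sigma>" using cech_radius_center(2)[OF fs] by auto
    then have "\<forall>x\<in>(\<lambda>x. x + v) ` \<sigma>. dist x (c + v) \<le> cech_radius \<sigma>" by auto
    then have "0 \<le> cech_radius \<sigma> \<and> (\<exists>y. \<forall>x\<in>(\<lambda>x. x + v) ` \<sigma>. dist x y \<le> cech_radius \<sigma>)"
      using cech_radius_center(1)[OF fs] by blast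
    then show ?thesis using fs by (subst cech_radius_le_iff) auto
  qed
  have "(\<lambda>x. x + - v) ` (\<lambda>x. x + v) ` \<sigma> = \<sigma>" by (simp add: image_image)
  then show ?thesis
    using le[OF assms, of v] le[of "(\<lambda>x. x + v) ` \<sigma>" "- v"] assms by auto
qed

section \<open>Persistent ranks of multicover complexes\<close>

abbreviation lex_less :: "(real, 'd::{finite,linorder}) vec \<Rightarrow> (real, 'd) vec \<Rightarrow> bool" where
  "lex_less x y \<equiv> less_fun (vec_nth x) (vec_nth y)"

lemma lex_less_total: "x \<noteq> y \<Longrightarrow> lex_less x y \<or> lex_less y x"
  using less_fun_trichotomy[of "vec_nth x" "vec_nth y"] by (auto simp: vec_nth_inject)

lemma lex_less_trans: "lex_less x y \<Longrightarrow> lex_less y z \<Longrightarrow> lex_less x z"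
  by (rule less_fun_trans)

lemma lex_less_irrefl: "\<not> lex_less x x"
  by (rule less_fun_irrefl)

lemma lex_smallest_subset: "lex_smallest l \<phi> \<subseteq> \<phi>"
  by (auto simp: lex_smallest_def)

text \<open>The number of predecessors is strictly monotone, hence a bijection from the set onto an
  initial segment of the natural numbers.\<close>

lemma card_lex_smallest:
  assumes "finite \<phi>" "l \<le> card \<phi>"
  shows "card (lex_smallest l \<phi>) = l"
proof -
  define rk where "rk = (\<lambda>x. card {y \<in> \<phi>. lex_less y x})"
  have mono: "rk x < rk y" if "x \<in> \<phi>" "lex_less x y" for x y
    unfolding rk_def
  proof (rule psubset_card_mono)
    show "{z \<in> \<phi>. lex_less z x} \<subset> {z \<in> \<phi>. lex_less z y}"
      using that lex_less_irrefl[of x] lex_less_trans[of _ x y] by blast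
  qed (use assms in auto)
  have inj: "inj_on rk \<phi>"
    by (rule inj_onI) (metis lex_less_total mono less_irrefl)
  have "rk ` \<phi> \<subseteq> {..<card \<phi>}"
  proof
    fix i assume "i \<in> rk ` \<phi>"
    then obtain x where x: "x \<in> \<phi>" "i = rk x" by auto
    have "rk x < card \<phi>" unfolding rk_def
      by (rule psubset_card_mono) (use assms x lex_less_irrefl[of x] in auto)
    then show "i \<in> {..<card \<phi>}" using x by simp
  qed
  then have surj: "rk ` \<phi> = {..<card \<phi>}"
    using card_image[OF inj] by (intro card_subset_eq) auto
  have e: "lex_smallest l \<phi> = {x \<in> \<phi>. rk x < l}" by (simp add: lex_smallest_def rk_def)
  have "rk ` lex_smallest l \<phi> = {..<l}"
    using surj assms(2) unfolding e by (auto simp: image_iff set_eq_iff) (metis order_less_le_trans)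
  moreover have "inj_on rk (lex_smallest l \<phi>)" using inj lex_smallest_subset by (rule inj_on_subset)
  ultimately show ?thesis by (metis card_image card_lessThan)
qed

lemma lex_smallest_image:
  assumes "inj_on g \<phi>" "\<And>x y. x \<in> \<phi> \<Longrightarrow> y \<in> \<phi> \<Longrightarrow> lex_less (g x) (g y) \<longleftrightarrow> lex_less x y"
  shows "lex_smallest l (g ` \<phi>) = g ` lex_smallest l \<phi>"
proof -
  have "card {y \<in> g ` \<phi>. lex_less y (g x)} = card {y \<in> \<phi>. lex_less y x}" if "x \<in> \<phi>" for x
  proof -
    have "{y \<in> g ` \<phi>. lex_less y (g x)} = g ` {y \<in> \<phi>. lex_less y x}" using assms(2) that by auto
    moreover have "inj_on g {y \<in> \<phi>. lex_less y x}" by (rule inj_on_subset[OF assms(1)]) auto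
    ultimately show ?thesis by (simp add: card_image)
  qed
  then show ?thesis by (auto simp: lex_smallest_def)
qed

lemma multicover_iff:
  "\<Phi> \<in> multicover r k P \<longleftrightarrow> finite \<Phi> \<and> \<Phi> \<noteq> {} \<and> (\<forall>\<phi>\<in>\<Phi>. \<phi> \<subseteq> P \<and> finite \<phi> \<and> card \<phi> = k) \<and>
    \<Union>\<Phi> \<noteq> {} \<and> cech_radius (\<Union>\<Phi>) \<le> r"
  by (auto simp: multicover_def cech_def)

lemma finite_multicover: "finite P \<Longrightarrow> finite (multicover r k P)"
  by (rule finite_subset[of _ "Pow (Pow P)"]) (simp_all add: subset_iff multicover_iff)

lemma multicover_union:
  assumes "\<Phi> \<in> multicover r k P"
  shows "finite (\<Union>\<Phi>)" "\<Union>\<Phi> \<noteq> {}" "\<Union>\<Phi> \<subseteq> P" "cech_radius (\<Union>\<Phi>) \<le> r"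
  using assms by (auto simp: multicover_iff)

lemma simplicial_lex_smallest:
  fixes P :: "(real, 'd::{finite,linorder}) vec set"
  assumes "finite P'" "P \<subseteq> P'" "r \<le> s" "1 \<le> l" "l \<le> k"
  shows "simplicial (lex_smallest l) (multicover r k P) (multicover s l P')"
  unfolding simplicial_def
proof (intro conjI ballI)
  have "finite P" using assms finite_subset by auto
  then show "finite (multicover r k P)" "finite (multicover s l P')" using assms by (auto simp: finite_multicover)
  fix \<Phi> assume P: "\<Phi> \<in> multicover r k P"
  then show "finite \<Phi>" "\<Phi> \<noteq> {}" by (auto simp: multicover_iff)
  have sub: "lex_smallest l \<phi> \<subseteq> \<phi>" for \<phi> :: "(real, 'd) vec set" by (rule lex_smallest_subset)
  have c: "finite (lex_smallest l \<phi>) \<and> card (lex_smallest l \<phi>) = l \<and> lex_smallest l \<phi> \<subseteq> P'" if "\<phi> \<in> \<Phi>" for \<phi>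
  proof -
    have "finite \<phi>" "card \<phi> = k" "\<phi> \<subseteq> P" using P that by (auto simp: multicover_iff)
    then show ?thesis using sub[of \<phi>] assms card_lex_smallest[of \<phi> l] finite_subset by blast
  qed
  have U: "\<Union>(lex_smallest l ` \<Phi>) \<subseteq> \<Union>\<Phi>" using sub by blast
  obtain \<phi> where "\<phi> \<in> \<Phi>" using P by (auto simp: multicover_iff)
  then have "lex_smallest l \<phi> \<noteq> {}" using c[of \<phi>] assms(4) by auto
  then have ne: "\<Union>(lex_smallest l ` \<Phi>) \<noteq> {}" using \<open>\<phi> \<in> \<Phi>\<close> by blast
  have "cech_radius (\<Union>(lex_smallest l ` \<Phi>)) \<le> cech_radius (\<Union>\<Phi>)"
    using cech_radius_mono[OF multicover_union(1)[OF P] ne U] .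
  then have "cech_radius (\<Union>(lex_smallest l ` \<Phi>)) \<le> s" using multicover_union(4)[OF P] assms(3) by simp
  then show "lex_smallest l ` \<Phi> \<in> multicover s l P'"
    unfolding multicover_iff using c ne P by (auto simp: multicover_iff)
qed

lemma multicover_Int: "\<Phi> \<in> multicover r k (P \<inter> B) \<longleftrightarrow> \<Phi> \<in> multicover r k P \<and> \<Union>\<Phi> \<subseteq> B"
  unfolding multicover_iff le_inf_iff Sup_le_iff ball_conj_distrib by iprover

text \<open>The persistent Betti number for point sets \<open>A \<subseteq> A'\<close>: the source has radius \<open>r\<close> and
  multiplicity \<open>k\<close>, the target has radius \<open>s\<close> and multiplicity \<open>l\<close>.\<close>

definition prank :: "nat \<Rightarrow> real \<Rightarrow> nat \<Rightarrow> real \<Rightarrow> nat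
    \<Rightarrow> (real, 'd::{finite,linorder}) vec set \<Rightarrow> (real, 'd) vec set \<Rightarrow> nat" where
  "prank q r k s l A A' = homology_rank (multicover r k A) (multicover s l A') (lex_smallest l) q"

lemma simplicial_image:
  assumes "finite A" "inj_on g A"
    and rad: "\<And>\<sigma>. \<sigma> \<subseteq> A \<Longrightarrow> \<sigma> \<noteq> {} \<Longrightarrow> cech_radius \<sigma> \<le> r \<Longrightarrow> cech_radius (g ` \<sigma>) \<le> r'"
  shows "simplicial (image g) (multicover r k A) (multicover r' k (g ` A))"
  unfolding simplicial_def
proof (intro conjI ballI)
  show "finite (multicover r k A)" "finite (multicover r' k (g ` A))" using assms by (auto simp: finite_multicover)
  fix \<Phi> assume P: "\<Phi> \<in> multicover r k A"
  then show "finite \<Phi>" "\<Phi> \<noteq> {}" by (auto simp: multicover_iff)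
  have U: "\<Union>(image g ` \<Phi>) = g ` \<Union>\<Phi>" by blast
  have "cech_radius (g ` \<Union>\<Phi>) \<le> r'" using multicover_union[OF P] rad by blast
  moreover have "finite (g ` \<phi>) \<and> card (g ` \<phi>) = k \<and> g ` \<phi> \<subseteq> g ` A" if "\<phi> \<in> \<Phi>" for \<phi>
  proof -
    have "finite \<phi>" "card \<phi> = k" "\<phi> \<subseteq> A" using P that by (auto simp: multicover_iff)
    then show ?thesis using card_image[OF inj_on_subset[OF assms(2)], of \<phi>] by auto
  qed
  ultimately show "image g ` \<Phi> \<in> multicover r' k (g ` A)"
    unfolding multicover_iff U using P by (auto simp: multicover_iff)
qed

lemma prank_transfer_le:
  assumes A: "finite A'" "A \<subseteq> A'" and kl: "1 \<le> l" "l \<le> k" "r \<le> s" "r' \<le> s'"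
    and g: "inj_on g A'" "\<And>x y. x \<in> A' \<Longrightarrow> y \<in> A' \<Longrightarrow> lex_less (g x) (g y) \<longleftrightarrow> lex_less x y"
    and rad: "\<And>\<sigma>. \<sigma> \<subseteq> A \<Longrightarrow> \<sigma> \<noteq> {} \<Longrightarrow> cech_radius \<sigma> \<le> r \<longleftrightarrow> cech_radius (g ` \<sigma>) \<le> r'"
      "\<And>\<sigma>. \<sigma> \<subseteq> A' \<Longrightarrow> \<sigma> \<noteq> {} \<Longrightarrow> cech_radius \<sigma> \<le> s \<longleftrightarrow> cech_radius (g ` \<sigma>) \<le> s'"
  shows "prank q r' k s' l (g ` A) (g ` A') \<le> prank q r k s l A A'"
  unfolding prank_def
proof (rule homology_rank_transfer_le)
  let ?g' = "inv_into A g"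
  have fA: "finite A" using A finite_subset by auto
  have gA: "inj_on g A" using g(1) A(2) by (rule inj_on_subset)
  show "simplicial (lex_smallest l) (multicover r k A) (multicover s l A')"
    using A kl by (rule_tac simplicial_lex_smallest) auto
  show "simplicial (lex_smallest l) (multicover r' k (g ` A)) (multicover s' l (g ` A'))"
    using A kl by (rule_tac simplicial_lex_smallest) auto
  show "simplicial (image g) (multicover r k A) (multicover r' k (g ` A))"
    using rad(1) by (intro simplicial_image fA gA) auto
  show "simplicial (image g) (multicover s l A') (multicover s' l (g ` A'))"
    using rad(2) by (intro simplicial_image A(1) g(1)) auto
  have g'A: "?g' ` g ` A = A" using inv_into_image_cancel[OF gA, of A] by simp
  have "simplicial (image ?g') (multicover r' k (g ` A)) (multicover r k (?g' ` g ` A))"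
  proof (rule simplicial_image)
    fix \<sigma> assume "\<sigma> \<subseteq> g ` A" "\<sigma> \<noteq> {}" "cech_radius \<sigma> \<le> r'"
    moreover from this have "g ` ?g' ` \<sigma> = \<sigma>" by (metis image_inv_into_cancel)
    moreover have "?g' ` \<sigma> \<subseteq> A" using image_mono[OF \<open>\<sigma> \<subseteq> g ` A\<close>, of ?g'] g'A by simp
    ultimately show "cech_radius (?g' ` \<sigma>) \<le> r" using rad(1)[of "?g' ` \<sigma>"] by simp
  qed (use fA inj_on_inv_into in auto)
  then show "simplicial (image ?g') (multicover r' k (g ` A)) (multicover r k A)" by (simp only: g'A)
  show "g ` ?g' ` v = v" if "v \<in> \<Union>(multicover r' k (g ` A))" for v
    using that by (auto simp: multicover_iff image_image f_inv_into_f subset_iff)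
  show "lex_smallest l (g ` v) = g ` lex_smallest l v" if "v \<in> \<Union>(multicover r k A)" for v
  proof (rule lex_smallest_image)
    have "v \<subseteq> A" using that by (elim UnionE) (simp add: multicover_iff)
    then have v: "v \<subseteq> A'" using A by simp
    show "inj_on g v" using g(1) v by (rule inj_on_subset)
    show "lex_less (g x) (g y) \<longleftrightarrow> lex_less x y" if "x \<in> v" "y \<in> v" for x y using that v g(2) by blast
  qed
qed

text \<open>The rank depends only on the lexicographic order of the points and on the sets whose
  radius lies below the thresholds. Translations preserve both, which gives invariance; so does
  rounding to a fine grid with adapted thresholds, which gives measurability.\<close>

lemma prank_transfer:
  assumes A: "finite A'" "A \<subseteq> A'" and kl: "1 \<le> l" "l \<le> k" "r \<le> s" "r' \<le> s'"
    and g: "inj_on g A'" "\<And>x y. x \<in> A' \<Longrightarrow> y \<in> A' \<Longrightarrow> lex_less (g x) (g y) \<longleftrightarrow> lex_less x y"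
    and rad: "\<And>\<sigma>. \<sigma> \<subseteq> A \<Longrightarrow> \<sigma> \<noteq> {} \<Longrightarrow> cech_radius \<sigma> \<le> r \<longleftrightarrow> cech_radius (g ` \<sigma>) \<le> r'"
      "\<And>\<sigma>. \<sigma> \<subseteq> A' \<Longrightarrow> \<sigma> \<noteq> {} \<Longrightarrow> cech_radius \<sigma> \<le> s \<longleftrightarrow> cech_radius (g ` \<sigma>) \<le> s'"
  shows "prank q r' k s' l (g ` A) (g ` A') = prank q r k s l A A'"
proof (rule antisym)
  show "prank q r' k s' l (g ` A) (g ` A') \<le> prank q r k s l A A'"
    by (rule prank_transfer_le) (use assms in auto)
  let ?h = "inv_into A' g"
  have h: "?h ` g ` A = A" "?h ` g ` A' = A'"
    using inv_into_image_cancel[OF g(1)] A(2) by auto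
  have ghs: "g ` ?h ` \<sigma> = \<sigma>" if "\<sigma> \<subseteq> g ` A'" for \<sigma>
    using that by (metis image_inv_into_cancel)
  have "prank q r k s l (?h ` g ` A) (?h ` g ` A') \<le> prank q r' k s' l (g ` A) (g ` A')"
  proof (rule prank_transfer_le)
    show "lex_less (?h x) (?h y) \<longleftrightarrow> lex_less x y" if "x \<in> g ` A'" "y \<in> g ` A'" for x y
      using that g(2)[of "?h x" "?h y"] by (simp add: f_inv_into_f inv_into_into)
    show "cech_radius \<sigma> \<le> r' \<longleftrightarrow> cech_radius (?h ` \<sigma>) \<le> r" if s: "\<sigma> \<subseteq> g ` A" "\<sigma> \<noteq> {}" for \<sigma>
    proof -
      have "?h ` \<sigma> \<subseteq> A" using image_mono[OF s(1), of ?h] h(1) by simp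
      moreover have "g ` ?h ` \<sigma> = \<sigma>"
        by (rule ghs) (use s(1) image_mono[OF A(2), of g] in simp)
      ultimately show ?thesis using rad(1)[of "?h ` \<sigma>"] s by simp
    qed
    show "cech_radius \<sigma> \<le> s' \<longleftrightarrow> cech_radius (?h ` \<sigma>) \<le> s" if s: "\<sigma> \<subseteq> g ` A'" "\<sigma> \<noteq> {}" for \<sigma>
    proof -
      have "?h ` \<sigma> \<subseteq> A'" using image_mono[OF s(1), of ?h] h(2) by simp
      moreover have "g ` ?h ` \<sigma> = \<sigma>" by (rule ghs[OF s(1)])
      ultimately show ?thesis using rad(2)[of "?h ` \<sigma>"] s by simp
    qed
  qed (use A kl inj_on_inv_into in auto)
  then show "prank q r k s l A A' \<le> prank q r' k s' l (g ` A) (g ` A')" by (simp add: h)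
qed

lemma homology_rank_empty:
  fixes f :: "'v \<Rightarrow> 'u"
  shows "homology_rank {} {} f q = 0"
proof -
  have "simplicial f {} {}" by (simp add: simplicial_def)
  moreover have "cycles ({} :: 'v set set) q = {0}" by (auto simp: cycles_eq qchains_def)
  ultimately have "(2::nat) ^ homology_rank {} {} f q = 1"
    using homology_rank_card[of f "{}" "{}" q] by (simp add: chain_coset_count_def)
  then show ?thesis by simp
qed

text \<open>As the multiplicity is positive, a vertex of the complex over a region is a nonempty
  subset of this region. Complexes over disjoint regions therefore have no common vertex.\<close>

lemma multicover_rank_Union:
  fixes P :: "(real, 'a::{finite,linorder}) vec set"
  assumes "finite \<B>" "disjoint \<B>" "finite P'" "P \<subseteq> P'" "r \<le> s" "1 \<le> l" "l \<le> k"
  shows "homology_rank (\<Union>B\<in>\<B>. multicover r k (P \<inter> B)) (\<Union>B\<in>\<B>. multicover s l (P' \<inter> B)) (lex_smallest l) q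
    = (\<Sum>B\<in>\<B>. prank q r k s l (P \<inter> B) (P' \<inter> B))
    \<and> simplicial (lex_smallest l) (\<Union>B\<in>\<B>. multicover r k (P \<inter> B)) (\<Union>B\<in>\<B>. multicover s l (P' \<inter> B))"
  using assms(1,2)
proof (induction \<B> rule: finite_induct)
  case empty
  then show ?case by (simp add: homology_rank_empty simplicial_def)
next
  case (insert B \<B>)
  have dB: "B \<inter> C = {}" if "C \<in> \<B>" for C
    using insert that by (auto simp: disjoint_def)
  let ?K = "\<lambda>B. multicover r k (P \<inter> B)" and ?L = "\<lambda>B. multicover s l (P' \<inter> B)"
  have sB: "simplicial (lex_smallest l) (?K B) (?L B)"
    using assms by (intro simplicial_lex_smallest) auto
  have IH: "homology_rank (\<Union>B\<in>\<B>. ?K B) (\<Union>B\<in>\<B>. ?L B) (lex_smallest l) q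
    = (\<Sum>B\<in>\<B>. prank q r k s l (P \<inter> B) (P' \<inter> B))"
    and sU: "simplicial (lex_smallest l) (\<Union>B\<in>\<B>. ?K B) (\<Union>B\<in>\<B>. ?L B)"
    using insert by (auto simp: disjoint_def)
  have vdis: "\<Union>(multicover t j (Q \<inter> B)) \<inter> \<Union>(\<Union>C\<in>\<B>. multicover t j (Q \<inter> C)) = {}" if "1 \<le> j"
    for t j and Q :: "(real, 'a) vec set"
  proof (rule equals0I)
    fix \<phi> assume "\<phi> \<in> \<Union>(multicover t j (Q \<inter> B)) \<inter> \<Union>(\<Union>C\<in>\<B>. multicover t j (Q \<inter> C))"
    then obtain C where C: "C \<in> \<B>" "\<phi> \<subseteq> B" "\<phi> \<subseteq> C" "card \<phi> = j"
      by (auto simp: multicover_iff)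
    then have "\<phi> = {}" using dB[of C] by blast
    then show False using C that by simp
  qed
  have "homology_rank (?K B \<union> (\<Union>B\<in>\<B>. ?K B)) (?L B \<union> (\<Union>B\<in>\<B>. ?L B)) (lex_smallest l) q
     = prank q r k s l (P \<inter> B) (P' \<inter> B) + homology_rank (\<Union>B\<in>\<B>. ?K B) (\<Union>B\<in>\<B>. ?L B) (lex_smallest l) q"
    unfolding prank_def
    by (rule homology_rank_union[OF sB sU]) (use vdis assms in \<open>auto simp: multicover_iff\<close>)
  moreover have "simplicial (lex_smallest l) (?K B \<union> (\<Union>B\<in>\<B>. ?K B)) (?L B \<union> (\<Union>B\<in>\<B>. ?L B))"
    using sB sU unfolding simplicial_def by auto
  ultimately show ?case using insert IH by simp
qed

text \<open>Near additivity in deterministic form: the union of the complexes over the regions lacks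
  exactly the simplices that are contained in no region, and stability bounds their effect on
  the rank.\<close>

lemma prank_compare:
  fixes P :: "(real, 'd::{finite,linorder}) vec set"
  assumes "finite \<B>" "disjoint \<B>" "finite P'" "P \<subseteq> P'" "r \<le> s" "1 \<le> l" "l \<le> k"
  shows "\<bar>real (prank q r k s l P P') - (\<Sum>B\<in>\<B>. real (prank q r k s l (P \<inter> B) (P' \<inter> B)))\<bar> \<le>
    real (card {\<Phi> \<in> multicover r k P. card \<Phi> = q + 1 \<and> (\<forall>B\<in>\<B>. \<not> \<Union>\<Phi> \<subseteq> B)}) +
    real (card {\<Phi> \<in> multicover s l P'. card \<Phi> = q + 2 \<and> (\<forall>B\<in>\<B>. \<not> \<Union>\<Phi> \<subseteq> B)})"
proof -
  let ?K = "\<Union>B\<in>\<B>. multicover r k (P \<inter> B)" and ?L = "\<Union>B\<in>\<B>. multicover s l (P' \<inter> B)"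
  note U = multicover_rank_Union[OF assms, of q]
  have s: "simplicial (lex_smallest l) (multicover r k P) (multicover s l P')"
    using assms by (intro simplicial_lex_smallest) auto
  have sub: "?K \<subseteq> multicover r k P" "?L \<subseteq> multicover s l P'" by (auto simp: multicover_iff)
  have z: "{\<sigma> \<in> ?K - multicover r k P. card \<sigma> = q + 1} = {}"
    "{\<sigma> \<in> ?L - multicover s l P'. card \<sigma> = q + 2} = {}" using sub by auto
  have e: "{\<sigma> \<in> multicover t j Q - (\<Union>B\<in>\<B>. multicover t j (Q \<inter> B)). card \<sigma> = m} =
     {\<Phi> \<in> multicover t j Q. card \<Phi> = m \<and> (\<forall>B\<in>\<B>. \<not> \<Union>\<Phi> \<subseteq> B)}" for t j m and Q :: "(real, 'd) vec set"
    by (auto simp: multicover_Int)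
  note 1 = homology_rank_stable[OF s U[THEN conjunct2], of q, unfolded z e card.empty]
  note 2 = homology_rank_stable[OF U[THEN conjunct2] s, of q, unfolded z e card.empty]
  show ?thesis using 1 2 unfolding U[THEN conjunct1] prank_def[symmetric] of_nat_sum[symmetric]
    by linarith
qed

lemma card_small_subsets:
  assumes "finite N"
  shows "finite {\<sigma>. \<sigma> \<subseteq> N \<and> \<sigma> \<noteq> {} \<and> card \<sigma> \<le> K}"
    "card {\<sigma>. \<sigma> \<subseteq> N \<and> \<sigma> \<noteq> {} \<and> card \<sigma> \<le> K} \<le> card N ^ K"
proof -
  have "{\<sigma>. \<sigma> \<subseteq> N \<and> \<sigma> \<noteq> {} \<and> card \<sigma> \<le> K} \<subseteq> (\<lambda>f. f ` {..<K}) ` ({..<K} \<rightarrow>\<^sub>E N)"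
  proof
    fix \<sigma> assume "\<sigma> \<in> {\<sigma>. \<sigma> \<subseteq> N \<and> \<sigma> \<noteq> {} \<and> card \<sigma> \<le> K}"
    then have s: "\<sigma> \<subseteq> N" "\<sigma> \<noteq> {}" "card \<sigma> \<le> K" "finite \<sigma>" using assms finite_subset by auto
    obtain g where g: "bij_betw g {0..<card \<sigma>} \<sigma>" using ex_bij_betw_nat_finite[OF s(4)] by blast
    obtain a where a: "a \<in> \<sigma>" using s by auto
    define f where "f = (\<lambda>i\<in>{..<K}. if i < card \<sigma> then g i else a)"
    have fin: "f i \<in> \<sigma>" if "i < K" for i
      using that g a by (auto simp: f_def bij_betw_def)
    have "\<sigma> \<subseteq> f ` {..<K}"
    proof
      fix x assume "x \<in> \<sigma>"
      then obtain i where "i < card \<sigma>" "x = g i" using g by (force simp: bij_betw_def)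
      then show "x \<in> f ` {..<K}" using s(3) by (intro image_eqI[of _ _ i]) (auto simp: f_def)
    qed
    then have "\<sigma> = f ` {..<K}" using fin by auto
    moreover have "f \<in> {..<K} \<rightarrow>\<^sub>E N" using fin s(1) by (auto simp: f_def)
    ultimately show "\<sigma> \<in> (\<lambda>f. f ` {..<K}) ` ({..<K} \<rightarrow>\<^sub>E N)" by blast
  qed
  then have "card {\<sigma>. \<sigma> \<subseteq> N \<and> \<sigma> \<noteq> {} \<and> card \<sigma> \<le> K} \<le> card ({..<K} \<rightarrow>\<^sub>E N)"
    using assms by (meson card_image_le card_mono finite_PiE finite_imageI finite_lessThan order_trans)
  then show "card {\<sigma>. \<sigma> \<subseteq> N \<and> \<sigma> \<noteq> {} \<and> card \<sigma> \<le> K} \<le> card N ^ K"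
    by (simp add: card_funcsetE)
qed (use assms in auto)

text \<open>A simplex of radius at most \<open>T\<close> lies in the ball of radius \<open>2 * T\<close> around each of its
  points. If it is contained in no region, then neither is the part of \<open>P\<close> in this ball, and the
  simplex is charged to one of its points.\<close>

lemma card_bad_multicover:
  fixes P :: "'a::euclidean_space set"
  assumes "finite P" "t \<le> T" and j: "1 \<le> j"
  shows "card {\<Phi> \<in> multicover t j P. card \<Phi> = p \<and> (\<forall>B\<in>\<B>. \<not> \<Union>\<Phi> \<subseteq> B)}
    \<le> (\<Sum>x\<in>{x \<in> P. \<forall>B\<in>\<B>. \<not> P \<inter> cball x (2 * T) \<subseteq> B}. card (P \<inter> cball x (2 * T)) ^ (j * p))"
proof -
  let ?bad = "{x \<in> P. \<forall>B\<in>\<B>. \<not> P \<inter> cball x (2 * T) \<subseteq> B}"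
  let ?N = "\<lambda>x. P \<inter> cball x (2 * T)"
  let ?S = "\<lambda>x. {\<phi>. \<phi> \<subseteq> ?N x \<and> \<phi> \<noteq> {} \<and> card \<phi> \<le> j}"
  let ?X = "\<lambda>x. {\<Phi>. \<Phi> \<subseteq> ?S x \<and> \<Phi> \<noteq> {} \<and> card \<Phi> \<le> p}"
  have "{\<Phi> \<in> multicover t j P. card \<Phi> = p \<and> (\<forall>B\<in>\<B>. \<not> \<Union>\<Phi> \<subseteq> B)} \<subseteq> (\<Union>x\<in>?bad. ?X x)"
  proof safe
    fix \<Phi> assume P: "\<Phi> \<in> multicover t j P" and B: "\<forall>B\<in>\<B>. \<not> \<Union>\<Phi> \<subseteq> B" and p: "p = card \<Phi>"
    note U = multicover_union[OF P]
    obtain x where x: "x \<in> \<Union>\<Phi>" using U(2) by blast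
    have N: "\<Union>\<Phi> \<subseteq> ?N x"
    proof
      fix y assume y: "y \<in> \<Union>\<Phi>"
      have "dist x y \<le> 2 * cech_radius (\<Union>\<Phi>)" by (rule dist_le_cech_radius[OF U(1) x y])
      then show "y \<in> ?N x" using U(3,4) y assms(2) by auto
    qed
    have "\<Phi> \<subseteq> ?S x"
    proof
      fix \<phi> assume f: "\<phi> \<in> \<Phi>"
      then have "\<phi> \<subseteq> ?N x" using N by blast
      moreover have "card \<phi> = j" using P f by (auto simp: multicover_iff)
      ultimately show "\<phi> \<in> ?S x" using j by auto
    qed
    moreover have "\<Phi> \<noteq> {}" using P by (auto simp: multicover_iff)
    moreover have "x \<in> ?bad" using subsetD[OF U(3) x] B order_trans[OF N] by auto
    ultimately show "\<Phi> \<in> (\<Union>x\<in>?bad. {\<Phi>'. \<Phi>' \<subseteq> ?S x \<and> \<Phi>' \<noteq> {} \<and> card \<Phi>' \<le> card \<Phi>})" by blast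
  qed
  moreover have S: "finite (?S x)" "card (?S x) \<le> card (?N x) ^ j" for x
    using card_small_subsets[of "?N x" j] assms by auto
  have X: "finite (?X x)" "card (?X x) \<le> card (?N x) ^ (j * p)" for x
  proof -
    have "card (?X x) \<le> card (?S x) ^ p" by (rule card_small_subsets[OF S(1)])
    also have "\<dots> \<le> (card (?N x) ^ j) ^ p" using S(2) by (rule power_mono) simp
    finally show "card (?X x) \<le> card (?N x) ^ (j * p)" by (simp add: power_mult)
  qed (rule card_small_subsets[OF S(1)])
  ultimately have "card {\<Phi> \<in> multicover t j P. card \<Phi> = p \<and> (\<forall>B\<in>\<B>. \<not> \<Union>\<Phi> \<subseteq> B)} \<le> card (\<Union>x\<in>?bad. ?X x)"
    using assms by (intro card_mono) auto
  also have "\<dots> \<le> (\<Sum>x\<in>?bad. card (?X x))" using assms by (intro card_UN_le) auto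
  also have "\<dots> \<le> (\<Sum>x\<in>?bad. card (?N x) ^ (j * p))" by (intro sum_mono X)
  finally show ?thesis .
qed

section \<open>Cubes, cells and boundary layers\<close>

definition lattice_point :: "(int, 'd::finite) vec \<Rightarrow> (real, 'd) vec" where
  "lattice_point z = (\<chi> i. of_int (z $ i))"

definition hcube :: "(real, 'd::finite) vec \<Rightarrow> nat \<Rightarrow> (real, 'd) vec set" where
  "hcube v n = {x. \<forall>i. v $ i \<le> x $ i \<and> x $ i < v $ i + real n}"

text \<open>The closed unit cell at \<open>z\<close>, enlarged by \<open>R\<close> in every direction.\<close>

definition nbhd :: "nat \<Rightarrow> (int, 'd::finite) vec \<Rightarrow> (real, 'd) vec set" where
  "nbhd R z = {x. \<forall>i. of_int (z $ i) - real R \<le> x $ i \<and> x $ i \<le> of_int (z $ i) + 1 + real R}"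

definition ibox :: "nat \<Rightarrow> (int, 'd::finite) vec set" where
  "ibox n = {z. \<forall>i. 0 \<le> z $ i \<and> z $ i < int n}"

text \<open>The cells within distance \<open>w\<close> of the boundary of the cube of side \<open>n\<close>. For fixed \<open>w\<close> their
  number is of smaller order than the volume of the cube.\<close>

definition layer :: "nat \<Rightarrow> nat \<Rightarrow> (int, 'd::finite) vec set" where
  "layer n w = {z. (\<forall>i. - int w \<le> z $ i \<and> z $ i < int n + int w) \<and>
                   \<not> (\<forall>i. int w \<le> z $ i \<and> z $ i < int n - int w)}"

lemma lattice_point_simps [simp]:
  "lattice_point z $ i = of_int (z $ i)" "lattice_point 0 = 0"
  "lattice_point (z + w) = lattice_point z + lattice_point w"
  by (simp_all add: lattice_point_def vec_eq_iff)

lemma bounded_hcube: "bounded (hcube (v :: (real, 'd::finite) vec) n)"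
proof -
  have "hcube v n \<subseteq> cbox v (v + vec (real n))"
    by (auto simp: hcube_def mem_box_cart less_imp_le)
  then show ?thesis using bounded_cbox bounded_subset by blast
qed

lemma finite_card_vec_box:
  assumes "\<And>i. finite (S i)"
  shows "finite {z::('a, 'd::finite) vec. \<forall>i. z $ i \<in> S i}"
    and "card {z::('a, 'd::finite) vec. \<forall>i. z $ i \<in> S i} = (\<Prod>i\<in>UNIV. card (S i))"
proof -
  have b: "bij_betw vec_nth {z::('a, 'd) vec. \<forall>i. z $ i \<in> S i} (PiE UNIV S)"
    by (rule bij_betw_byWitness[where f' = vec_lambda]) auto
  then show "finite {z::('a, 'd) vec. \<forall>i. z $ i \<in> S i}"
    using assms by (simp add: bij_betw_finite finite_PiE)
  show "card {z::('a, 'd) vec. \<forall>i. z $ i \<in> S i} = (\<Prod>i\<in>UNIV. card (S i))"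
    using bij_betw_same_card[OF b] by (simp add: card_PiE)
qed

lemma ibox_eq: "ibox n = {z. \<forall>i. z $ i \<in> {0..<int n}}"
  by (auto simp: ibox_def)

lemma finite_ibox [simp]: "finite (ibox n)"
  unfolding ibox_eq by (rule finite_card_vec_box) simp

lemma ibox_shorten:
  assumes "m \<ge> 1"
  shows "ibox (n + 1 - m) \<subseteq> ibox n"
proof
  fix z assume z: "z \<in> ibox (n + 1 - m)"
  have "0 \<le> z $ i \<and> z $ i < int n" for i
  proof -
    have "0 \<le> z $ i" "z $ i < int (n + 1 - m)" using z by (auto simp: ibox_def)
    then show ?thesis using assms by linarith
  qed
  then show "z \<in> ibox n" by (simp add: ibox_def)
qed

lemma card_ibox: "card (ibox n :: (int, 'd::finite) vec set) = n ^ CARD('d)"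
  unfolding ibox_eq by (subst finite_card_vec_box(2)) auto

lemma layer_subset:
  "(layer n w :: (int, 'd::finite) vec set) \<subseteq> (\<Union>i. {z. \<forall>j. z $ j \<in> (if j = i then {- int w..<int w} \<union> {int n - int w..<int n + int w}
                                        else {- int w..<int n + int w})})"
proof
  fix z :: "(int, 'd) vec" assume z: "z \<in> layer n w"
  then obtain i where "\<not> (int w \<le> z $ i \<and> z $ i < int n - int w)" by (auto simp: layer_def)
  then have "\<forall>j. z $ j \<in> (if j = i then {- int w..<int w} \<union> {int n - int w..<int n + int w}
                                        else {- int w..<int n + int w})"
    using z by (auto simp: layer_def)
  then show "z \<in> (\<Union>i. {z. \<forall>j. z $ j \<in> (if j = i then {- int w..<int w} \<union> {int n - int w..<int n + int w}
                                        else {- int w..<int n + int w})})" by blast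
qed

lemma finite_layer [simp]: "finite (layer n w)"
  by (rule finite_subset[OF layer_subset]) (intro finite_UN_I finite_card_vec_box(1), auto)

definition layer_const :: "'d::finite itself \<Rightarrow> nat \<Rightarrow> nat" where
  "layer_const _ w = CARD('d) * (4 * w * (1 + 2 * w) ^ (CARD('d) - 1))"

lemma card_layer_le:
  assumes "n \<ge> 1"
  shows "card (layer n w :: (int, 'd::finite) vec set) \<le> layer_const TYPE('d) w * n ^ (CARD('d) - 1)"
proof -
  let ?S = "\<lambda>i j. if j = i then {- int w..<int w} \<union> {int n - int w..<int n + int w} else {- int w..<int n + int w}"
  \<comment> \<open>The layer is a union of slabs, one for each coordinate \<open>i\<close> that is close to \<open>0\<close> or \<open>n\<close>.\<close>
  have 1: "card {z::(int, 'd) vec. \<forall>j. z $ j \<in> ?S i j} \<le> (4 * w) * (n + 2 * w) ^ (CARD('d) - 1)" for i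
  proof -
    have "card {z::(int, 'd) vec. \<forall>j. z $ j \<in> ?S i j} = (\<Prod>j\<in>UNIV. card (?S i j))"
      by (rule finite_card_vec_box(2)) auto
    also have "\<dots> = card (?S i i) * (\<Prod>j\<in>UNIV - {i}. card (?S i j))"
      by (rule prod.remove) auto
    also have "(\<Prod>j\<in>UNIV - {i}. card (?S i j)) = (\<Prod>j\<in>UNIV - {i}. n + 2 * w)"
      by (rule prod.cong) auto
    also have "\<dots> = (n + 2 * w) ^ (CARD('d) - 1)" by (simp add: card_Diff_singleton)
    also have "card (?S i i) \<le> 4 * w"
      using card_Un_le[of "{- int w..<int w}" "{int n - int w..<int n + int w}"] by simp
    finally show ?thesis by simp
  qed
  have "card (layer n w :: (int, 'd) vec set) \<le> card (\<Union>i. {z::(int, 'd) vec. \<forall>j. z $ j \<in> ?S i j})"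
    by (rule card_mono[OF _ layer_subset]) (intro finite_UN_I finite_card_vec_box(1), auto)
  also have "\<dots> \<le> (\<Sum>i\<in>UNIV. card {z::(int, 'd) vec. \<forall>j. z $ j \<in> ?S i j})"
    by (rule card_UN_le) simp
  also have "\<dots> \<le> (\<Sum>i\<in>(UNIV::'d set). (4 * w) * (n + 2 * w) ^ (CARD('d) - 1))"
    by (rule sum_mono) (rule 1)
  also have "\<dots> = CARD('d) * ((4 * w) * (n + 2 * w) ^ (CARD('d) - 1))" by simp
  also have "(n + 2 * w) ^ (CARD('d) - 1) \<le> (n * (1 + 2 * w)) ^ (CARD('d) - 1)"
    using assms by (intro power_mono) (auto simp: algebra_simps)
  also have "(n * (1 + 2 * w)) ^ (CARD('d) - 1) = n ^ (CARD('d) - 1) * (1 + 2 * w) ^ (CARD('d) - 1)"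
    by (rule power_mult_distrib)
  finally show ?thesis by (simp add: layer_const_def mult_ac)
qed

text \<open>Greedy selection as in Vitali's covering lemma. A cube of maximal side \<open>s\<close> is only met by
  cubes whose corners lie in a cube of side \<open>2 * s\<close>; these are discarded, and the selection
  continues with the remaining ones.\<close>

lemma vitali_cubes:
  fixes A :: "(int, 'd::finite) vec set" and s :: "(int, 'd) vec \<Rightarrow> nat"
  defines "Q \<equiv> \<lambda>z. {w. \<forall>i. z $ i \<le> w $ i \<and> w $ i < z $ i + int (s z)}"
  assumes "finite A" "\<And>z. z \<in> A \<Longrightarrow> 1 \<le> s z"
  shows "\<exists>A'\<subseteq>A. (\<forall>z\<in>A'. \<forall>z'\<in>A'. z \<noteq> z' \<longrightarrow> Q z \<inter> Q z' = {}) \<and> card A \<le> (\<Sum>z\<in>A'. 2 ^ CARD('d) * s z ^ CARD('d))"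
  using assms(2,3)
proof (induction "card A" arbitrary: A rule: less_induct)
  case less
  show ?case
  proof (cases "A = {}")
    case True
    then show ?thesis by auto
  next
    case False
    have "Max (s ` A) \<in> s ` A" using less.prems(1) False by (intro Max_in) auto
    then obtain z0 where "z0 \<in> A" "s z0 = Max (s ` A)" by auto
    then have z0: "z0 \<in> A" "\<And>z. z \<in> A \<Longrightarrow> s z \<le> s z0"
      using less.prems(1) by auto
    let ?A1 = "{z \<in> A. Q z \<inter> Q z0 = {}}" and ?A2 = "{z \<in> A. Q z \<inter> Q z0 \<noteq> {}}"
    have "z0 \<in> Q z0" using less.prems(2)[OF z0(1)] by (auto simp: Q_def)
    then have "z0 \<notin> ?A1" by auto
    then have "card ?A1 < card A" using less.prems(1) z0(1) by (intro psubset_card_mono) auto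
    then obtain A1 where A1: "A1 \<subseteq> ?A1" "\<forall>z\<in>A1. \<forall>z'\<in>A1. z \<noteq> z' \<longrightarrow> Q z \<inter> Q z' = {}"
      "card ?A1 \<le> (\<Sum>z\<in>A1. 2 ^ CARD('d) * s z ^ CARD('d))"
      using less.hyps[of ?A1] less.prems by auto
    have "?A2 \<subseteq> {z. \<forall>i. z $ i \<in> {z0 $ i - int (s z0)..<z0 $ i + int (s z0)}}"
    proof
      fix z assume "z \<in> ?A2"
      then obtain w where w: "z \<in> A" "w \<in> Q z" "w \<in> Q z0" by auto
      have "z $ i \<in> {z0 $ i - int (s z0)..<z0 $ i + int (s z0)}" for i
      proof -
        have "z $ i \<le> w $ i" "w $ i < z $ i + int (s z)" "z0 $ i \<le> w $ i" "w $ i < z0 $ i + int (s z0)"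
          using w(2,3) by (auto simp: Q_def)
        then show ?thesis using z0(2)[OF w(1)] by simp
      qed
      then show "z \<in> {z. \<forall>i. z $ i \<in> {z0 $ i - int (s z0)..<z0 $ i + int (s z0)}}" by simp
    qed
    then have "card ?A2 \<le> card {z. \<forall>i. z $ i \<in> {z0 $ i - int (s z0)..<z0 $ i + int (s z0)}}"
      by (intro card_mono finite_card_vec_box) auto
    also have "\<dots> = (\<Prod>i\<in>(UNIV::'d set). card {z0 $ i - int (s z0)..<z0 $ i + int (s z0)})"
      by (rule finite_card_vec_box(2)) simp
    also have "\<dots> = (\<Prod>i\<in>(UNIV::'d set). 2 * s z0)" by (intro prod.cong) auto
    also have "\<dots> = 2 ^ CARD('d) * s z0 ^ CARD('d)" by (simp add: power_mult_distrib)
    finally have c2: "card ?A2 \<le> 2 ^ CARD('d) * s z0 ^ CARD('d)" .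
    have "A = ?A1 \<union> ?A2" by auto
    then have "card A \<le> card ?A1 + card ?A2" using card_Un_le[of ?A1 ?A2] by simp
    moreover have "z0 \<notin> A1" using A1(1) \<open>z0 \<notin> ?A1\<close> by blast
    moreover have "finite A1" using A1(1) less.prems(1) finite_subset[of A1 A] by auto
    ultimately have "card A \<le> (\<Sum>z\<in>insert z0 A1. 2 ^ CARD('d) * s z ^ CARD('d))"
      using A1(3) c2 by simp
    moreover have "insert z0 A1 \<subseteq> A" using A1(1) z0(1) by auto
    moreover have "\<forall>z\<in>insert z0 A1. \<forall>z'\<in>insert z0 A1. z \<noteq> z' \<longrightarrow> Q z \<inter> Q z' = {}"
      using A1(1,2) by auto
    ultimately show ?thesis by (intro exI[of _ "insert z0 A1"]) blast
  qed
qed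

text \<open>On each selected cube, the sum of \<open>a\<close> is at least \<open>l\<close> times the volume, and the selected
  cubes are disjoint.\<close>

lemma maximal_covering:
  fixes a :: "(int, 'd::finite) vec \<Rightarrow> real" and s :: "(int, 'd) vec \<Rightarrow> nat"
  assumes a: "\<And>z. 0 \<le> a z" and A: "A \<subseteq> ibox L"
    and s: "\<And>z. z \<in> A \<Longrightarrow> 1 \<le> s z \<and> s z \<le> N \<and> l * real (s z) ^ CARD('d) \<le> (\<Sum>w\<in>ibox (s z). a (z + w))"
    and l: "l > 0"
  shows "l * real (card A) \<le> 2 ^ CARD('d) * (\<Sum>w\<in>ibox (L + N). a w)"
proof -
  define Q where "Q = (\<lambda>z. {w. \<forall>i. z $ i \<le> w $ i \<and> w $ i < z $ i + int (s z)})"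
  have fA: "finite A" using A by (rule finite_subset) simp
  obtain A' where A': "A' \<subseteq> A" "\<forall>z\<in>A'. \<forall>z'\<in>A'. z \<noteq> z' \<longrightarrow> Q z \<inter> Q z' = {}"
    "card A \<le> (\<Sum>z\<in>A'. 2 ^ CARD('d) * s z ^ CARD('d))"
    using vitali_cubes[OF fA, of s] s unfolding Q_def by blast
  have fA': "finite A'" using A'(1) fA finite_subset by auto
  have Qim: "Q z = (\<lambda>w. z + w) ` ibox (s z)" for z
  proof -
    have "w \<in> (\<lambda>w. z + w) ` ibox (s z)" if "w \<in> Q z" for w
      using that by (intro image_eqI[of _ _ "w - z"]) (auto simp: Q_def ibox_def algebra_simps)
    then show ?thesis by (auto simp: Q_def ibox_def)
  qed
  have Qsum: "(\<Sum>w\<in>ibox (s z). a (z + w)) = sum a (Q z)" for z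
    unfolding Qim by (subst sum.reindex) auto
  have fQ: "finite (Q z)" for z unfolding Qim by simp
  have "l * real (card A) \<le> l * real (\<Sum>z\<in>A'. 2 ^ CARD('d) * s z ^ CARD('d))"
    using A'(3) l by (intro mult_left_mono of_nat_mono) auto
  also have "\<dots> = 2 ^ CARD('d) * (\<Sum>z\<in>A'. l * real (s z) ^ CARD('d))"
    by (simp add: sum_distrib_left mult_ac)
  also have "\<dots> \<le> 2 ^ CARD('d) * (\<Sum>z\<in>A'. sum a (Q z))"
    using s A'(1) unfolding Qsum[symmetric] by (intro mult_left_mono sum_mono) auto
  also have "(\<Sum>z\<in>A'. sum a (Q z)) = sum a (\<Union>z\<in>A'. Q z)"
    using A'(2) fA' fQ by (intro sum.UNION_disjoint[symmetric]) auto
  also have "\<dots> \<le> (\<Sum>w\<in>ibox (L + N). a w)"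
  proof (rule sum_mono2)
    show "(\<Union>z\<in>A'. Q z) \<subseteq> ibox (L + N)"
    proof safe
      fix z w assume z: "z \<in> A'" "w \<in> Q z"
      then have "z \<in> ibox L" "s z \<le> N" using A'(1) A s by auto
      have "0 \<le> w $ i \<and> w $ i < int (L + N)" for i
      proof -
        have "z $ i \<le> w $ i" "w $ i < z $ i + int (s z)" "0 \<le> z $ i" "z $ i < int L"
          using z(2) \<open>z \<in> ibox L\<close> by (auto simp: Q_def ibox_def)
        then show ?thesis using \<open>s z \<le> N\<close> by linarith
      qed
      then show "w \<in> ibox (L + N)" by (simp add: ibox_def)
    qed
  qed (use a in auto)
  finally show ?thesis by simp
qed

lemma mod_shift_card:
  fixes z :: int and S :: "int set"
  assumes "m \<ge> 1"
  shows "card {u \<in> {0..<int m}. (z - u) mod int m \<in> S} \<le> card (S \<inter> {0..<int m})"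
proof (rule card_inj_on_le)
  show "inj_on (\<lambda>u. (z - u) mod int m) {u \<in> {0..<int m}. (z - u) mod int m \<in> S}"
  proof (rule inj_onI)
    fix u v assume uv: "u \<in> {u \<in> {0..<int m}. (z - u) mod int m \<in> S}" "v \<in> {u \<in> {0..<int m}. (z - u) mod int m \<in> S}"
      "(z - u) mod int m = (z - v) mod int m"
    then have "int m dvd ((z - u) - (z - v))" by (simp add: mod_eq_dvd_iff)
    then have "int m dvd (v - u)" by simp
    then have "v mod int m = u mod int m" by (simp add: mod_eq_dvd_iff)
    moreover have "u mod int m = u" "v mod int m = v" using uv(1,2) by (auto intro: mod_pos_pos_trivial)
    ultimately show "u = v" by simp
  qed
  show "(\<lambda>u. (z - u) mod int m) ` {u \<in> {0..<int m}. (z - u) mod int m \<in> S} \<subseteq> S \<inter> {0..<int m}"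
    using assms by auto
qed simp

text \<open>Let \<open>B\<close> be cut into the disjoint pieces in \<open>\<B>\<close>. A cell is bad if interactions of range \<open>R\<close>
  between a point of the cell and other points of \<open>B\<close> may be destroyed.\<close>

definition bad :: "nat \<Rightarrow> (real, 'd::finite) vec set \<Rightarrow> (real, 'd) vec set set \<Rightarrow> (int, 'd) vec set" where
  "bad R B \<B> = {z. hcube (lattice_point z) 1 \<inter> B \<noteq> {} \<and> (\<forall>C\<in>\<B>. \<not> B \<inter> nbhd R z \<subseteq> C)}"

text \<open>The corners, congruent to \<open>u\<close> modulo \<open>m\<close>, of those cubes of side \<open>m\<close> that fit into the
  cube of side \<open>n\<close>.\<close>

definition offset_family :: "nat \<Rightarrow> nat \<Rightarrow> (int, 'd::finite) vec \<Rightarrow> (int, 'd) vec set" where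
  "offset_family n m u = {v \<in> ibox (n + 1 - m). (\<chi> i. v $ i mod int m) = u}"

lemma disjoint_offset_family:
  fixes u :: "(int, 'd::finite) vec"
  assumes "m \<ge> 1"
  shows "disjoint ((\<lambda>v. hcube (lattice_point v) m) ` offset_family n m u)"
    and "inj_on (\<lambda>v. hcube (lattice_point v) m) (offset_family n m u)"
proof -
  have *: "v = w" if vw: "v \<in> offset_family n m u" "w \<in> offset_family n m u"
    and x: "x \<in> hcube (lattice_point v) m" "x \<in> hcube (lattice_point w) m" for v w x
  proof (rule vec_eq_iff[THEN iffD2], rule allI)
    fix i
    have "v $ i mod int m = w $ i mod int m"
      using vw by (auto simp: offset_family_def vec_eq_iff)
    then have "int m dvd v $ i - w $ i" by (simp add: mod_eq_dvd_iff)
    moreover have "real_of_int (v $ i) \<le> x $ i" "x $ i < real_of_int (v $ i) + real m"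
      "real_of_int (w $ i) \<le> x $ i" "x $ i < real_of_int (w $ i) + real m"
      using x by (auto simp: hcube_def)
    then have "\<bar>v $ i - w $ i\<bar> < int m" by linarith
    ultimately show "v $ i = w $ i"
      using dvd_imp_le_int[of "v $ i - w $ i" "int m"] by (cases "v $ i - w $ i = 0") auto
  qed
  have ne: "lattice_point v \<in> hcube (lattice_point v) m" for v :: "(int, 'd) vec"
    using assms by (simp add: hcube_def)
  show "disjoint ((\<lambda>v. hcube (lattice_point v) m) ` offset_family n m u)"
    unfolding disjoint_def using * by fastforce
  show "inj_on (\<lambda>v. hcube (lattice_point v) m) (offset_family n m u)"
    using * ne by (intro inj_onI) blast
qed

lemma hcube_cell_meets:
  assumes "hcube (lattice_point z) 1 \<inter> hcube 0 n \<noteq> {}"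
  shows "z \<in> ibox n"
proof -
  obtain x where x: "x \<in> hcube (lattice_point z) 1" "x \<in> hcube 0 n" using assms by auto
  have "0 \<le> z $ i \<and> z $ i < int n" for i
  proof -
    have "of_int (z $ i) \<le> x $ i" "x $ i < of_int (z $ i) + 1" "0 \<le> x $ i" "x $ i < real n"
      using x by (auto simp: hcube_def)
    then show ?thesis by linarith
  qed
  then show ?thesis by (simp add: ibox_def)
qed

text \<open>A cell in the interior is bad for the offset \<open>u\<close> only if it is close to a face of its
  cube, that is, if one of its coordinates has one of at most \<open>2 * R + 1\<close> residues relative to
  \<open>u\<close>. Averaging over all \<open>m ^ CARD('d)\<close> offsets thus gains a factor of order \<open>1 / m\<close>.\<close>

lemma card_bad_offsets:
  fixes z :: "(int, 'd::finite) vec"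
  assumes m: "m \<ge> 1" and z: "\<And>i. int m \<le> z $ i" "\<And>i. z $ i < int n - int m"
  shows "card {u \<in> ibox m. z \<in> bad R (hcube 0 n) ((\<lambda>v. hcube (lattice_point v) m) ` offset_family n m u)}
    \<le> CARD('d) * ((2 * R + 1) * m ^ (CARD('d) - 1))"
proof -
  let ?bad = "{u \<in> ibox m. z \<in> bad R (hcube 0 n) ((\<lambda>v. hcube (lattice_point v) m) ` offset_family n m u)}"
  define S where "S = {..<int R} \<union> {int m - int R - 1..}"
  let ?T = "\<lambda>i j. if j = i then {u \<in> {0..<int m}. (z $ i - u) mod int m \<in> S} else {0..<int m}"
  have fT: "finite (?T i j)" for i j
    by (rule finite_subset[of _ "{0..<int m}"]) auto
  have "?bad \<subseteq> (\<Union>i. {u. \<forall>j. u $ j \<in> ?T i j})"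
  proof
    fix u assume u: "u \<in> ?bad"
    then have ui: "u $ i \<in> {0..<int m}" for i by (auto simp: ibox_def)
    have "\<exists>i. (z $ i - u $ i) mod int m \<in> S"
    proof (rule ccontr)
      assume "\<nexists>i. (z $ i - u $ i) mod int m \<in> S"
      then have s: "int R \<le> (z $ i - u $ i) mod int m" "(z $ i - u $ i) mod int m < int m - int R - 1" for i
        by (auto simp: S_def not_less not_le)
      \<comment> \<open>The corner of the cube of the family that contains the cell \<open>z\<close>.\<close>
      define v where "v = (\<chi> i. z $ i - (z $ i - u $ i) mod int m)"
      have "0 \<le> v $ i \<and> v $ i < int (n + 1 - m)" for i
      proof -
        have "0 \<le> (z $ i - u $ i) mod int m" "(z $ i - u $ i) mod int m < int m" using m by auto
        then have "0 \<le> v $ i" "v $ i < int n - int m" using z[of i] by (auto simp: v_def)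
        then show ?thesis by linarith
      qed
      moreover have "v $ i mod int m = u $ i" for i
      proof -
        have "v $ i mod int m = (z $ i - (z $ i - u $ i)) mod int m"
          unfolding v_def by (simp add: mod_diff_right_eq)
        then show ?thesis using ui[of i] by simp
      qed
      ultimately have v: "v \<in> offset_family n m u"
        by (simp add: offset_family_def ibox_def vec_eq_iff)
      have "nbhd R z \<subseteq> hcube (lattice_point v) m"
      proof
        fix x assume x: "x \<in> nbhd R z"
        have "of_int (v $ i) \<le> x $ i \<and> x $ i < of_int (v $ i) + real m" for i
        proof -
          have "of_int (z $ i) - real R \<le> x $ i" "x $ i \<le> of_int (z $ i) + 1 + real R"
            using x by (auto simp: nbhd_def)
          moreover have "v $ i \<le> z $ i - int R" "z $ i + 1 + int R < v $ i + int m"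
            using s[of i] by (auto simp: v_def)
          then have "real_of_int (v $ i) \<le> of_int (z $ i) - real R"
            "real_of_int (z $ i) + 1 + real R < of_int (v $ i) + real m"
            by linarith+
          ultimately show ?thesis by linarith
        qed
        then show "x \<in> hcube (lattice_point v) m" by (simp add: hcube_def)
      qed
      then show False using u v by (auto simp: bad_def)
    qed
    then obtain i where "(z $ i - u $ i) mod int m \<in> S" ..
    then have "\<forall>j. u $ j \<in> ?T i j" using ui by auto
    then show "u \<in> (\<Union>i. {u. \<forall>j. u $ j \<in> ?T i j})" by blast
  qed
  then have "card ?bad \<le> card (\<Union>i. {u. \<forall>j. u $ j \<in> ?T i j})"
    by (rule card_mono[rotated]) (intro finite_UN_I finite_card_vec_box(1) fT finite)
  also have "\<dots> \<le> (\<Sum>i\<in>UNIV. card {u. \<forall>j. u $ j \<in> ?T i j})"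
    by (rule card_UN_le) simp
  also have "\<dots> \<le> (\<Sum>i\<in>(UNIV::'d set). (2 * R + 1) * m ^ (CARD('d) - 1))"
  proof (rule sum_mono)
    fix i :: 'd
    have "card {u. \<forall>j. u $ j \<in> ?T i j} = (\<Prod>j\<in>UNIV. card (?T i j))"
      by (rule finite_card_vec_box(2)) (rule fT)
    also have "\<dots> = card (?T i i) * (\<Prod>j\<in>UNIV - {i}. card (?T i j))"
      by (rule prod.remove) auto
    also have "(\<Prod>j\<in>UNIV - {i}. card (?T i j)) = (\<Prod>j\<in>UNIV - {i}. m)"
      by (rule prod.cong) auto
    also have "\<dots> = m ^ (CARD('d) - 1)" by (simp add: card_Diff_singleton)
    also have "card (?T i i) \<le> card (S \<inter> {0..<int m})"
      using mod_shift_card[OF m, of "z $ i" S] by simp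
    also have "S \<inter> {0..<int m} \<subseteq> {0..<int R} \<union> {int m - int R - 1..<int m}"
      by (auto simp: S_def)
    then have "card (S \<inter> {0..<int m}) \<le> card ({0..<int R} \<union> {int m - int R - 1..<int m})"
      by (rule card_mono[rotated]) simp
    also have "\<dots> \<le> 2 * R + 1"
      using card_Un_le[of "{0..<int R}" "{int m - int R - 1..<int m}"] by simp
    finally show "card {u. \<forall>j. u $ j \<in> ?T i j} \<le> (2 * R + 1) * m ^ (CARD('d) - 1)" by simp
  qed
  also have "\<dots> = CARD('d) * ((2 * R + 1) * m ^ (CARD('d) - 1))" by simp
  finally show ?thesis .
qed

text \<open>Sets that agree with the cube of side \<open>n\<close> up to distance \<open>k\<close> from its boundary differ only
  there.\<close>

lemma bad_layer:
  assumes B: "\<And>x i. x \<in> B \<Longrightarrow> - real k \<le> x $ i \<and> x $ i \<le> real n + real k"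
    and C: "\<And>x. x \<in> B \<Longrightarrow> (\<And>i. real k \<le> x $ i \<and> x $ i \<le> real n - real k) \<Longrightarrow> x \<in> C"
  shows "bad R B {C} \<subseteq> layer n (k + R + 2)"
proof
  fix z assume z: "z \<in> bad R B {C}"
  then obtain x where x: "x \<in> hcube (lattice_point z) 1" "x \<in> B" by (auto simp: bad_def)
  have 1: "- int (k + R + 2) \<le> z $ i \<and> z $ i < int n + int (k + R + 2)" for i
  proof -
    have "of_int (z $ i) \<le> x $ i" "x $ i < of_int (z $ i) + 1" using x by (auto simp: hcube_def)
    with B[OF x(2), of i] show ?thesis by linarith
  qed
  have "\<not> (\<forall>i. int (k + R + 2) \<le> z $ i \<and> z $ i < int n - int (k + R + 2))"
  proof
    assume a: "\<forall>i. int (k + R + 2) \<le> z $ i \<and> z $ i < int n - int (k + R + 2)"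
    have "B \<inter> nbhd R z \<subseteq> C"
    proof
      fix y assume y: "y \<in> B \<inter> nbhd R z"
      show "y \<in> C"
      proof (rule C)
        fix i
        have "of_int (z $ i) - real R \<le> y $ i" "y $ i \<le> of_int (z $ i) + 1 + real R"
          using y by (auto simp: nbhd_def)
        moreover have "int (k + R + 2) \<le> z $ i" "z $ i < int n - int (k + R + 2)" using a by auto
        ultimately show "real k \<le> y $ i \<and> y $ i \<le> real n - real k" by linarith
      qed (use y in auto)
    qed
    then show False using z by (auto simp: bad_def)
  qed
  then show "z \<in> layer n (k + R + 2)" using 1 by (simp add: layer_def)
qed

section \<open>Bounds in the mean square\<close>

context prob_space begin

text \<open>An upper bound for the norm in the mean square, together with the integrability that makes
  the norm meaningful. In this form, bounds can be added and scaled without side conditions.\<close>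

definition L2le :: "('a \<Rightarrow> real) \<Rightarrow> real \<Rightarrow> bool" where
  "L2le g s \<longleftrightarrow> g \<in> borel_measurable M \<and> integrable M (\<lambda>x. (g x)\<^sup>2) \<and> 0 \<le> s \<and> (\<integral>x. (g x)\<^sup>2 \<partial>M) \<le> s\<^sup>2"

definition L2norm :: "('a \<Rightarrow> real) \<Rightarrow> real" where
  "L2norm g = sqrt (\<integral>x. (g x)\<^sup>2 \<partial>M)"

lemma L2le_norm:
  assumes "g \<in> borel_measurable M" "integrable M (\<lambda>x. (g x)\<^sup>2)"
  shows "L2le g (L2norm g)"
  using assms by (simp add: L2le_def L2norm_def)

lemma L2norm_le: "L2le g s \<Longrightarrow> L2norm g \<le> s"
  by (simp add: L2le_def L2norm_def real_le_lsqrt)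

lemma L2le_nonneg: "L2le g s \<Longrightarrow> 0 \<le> s"
  by (simp add: L2le_def)

lemma L2norm_nonneg: "0 \<le> L2norm g"
  by (simp add: L2norm_def)

lemma L2norm_sq: "(L2norm g)\<^sup>2 = (\<integral>x. (g x)\<^sup>2 \<partial>M)"
  by (simp add: L2norm_def)

lemma L2le_measurable [measurable_dest]: "L2le g s \<Longrightarrow> g \<in> borel_measurable M"
  by (simp add: L2le_def)

lemma L2le_integrable_sq: "L2le g s \<Longrightarrow> integrable M (\<lambda>x. (g x)\<^sup>2)"
  by (simp add: L2le_def)

lemma L2le_mono: "L2le g s \<Longrightarrow> s \<le> t \<Longrightarrow> L2le g t"
  unfolding L2le_def by (auto intro: order_trans power_mono)

lemma L2le_dominated:
  assumes g: "L2le g s" and f: "f \<in> borel_measurable M" "\<And>x. x \<in> space M \<Longrightarrow> \<bar>f x\<bar> \<le> g x"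
  shows "L2le f s"
proof -
  have le: "(f x)\<^sup>2 \<le> (g x)\<^sup>2" if "x \<in> space M" for x
    using f(2)[OF that] by (metis abs_ge_zero abs_le_square_iff abs_of_nonneg order_trans)
  have i: "integrable M (\<lambda>x. (f x)\<^sup>2)"
    by (rule Bochner_Integration.integrable_bound[OF L2le_integrable_sq[OF g]])
      (use f(1) le in auto)
  moreover have "(\<integral>x. (f x)\<^sup>2 \<partial>M) \<le> (\<integral>x. (g x)\<^sup>2 \<partial>M)"
    by (rule integral_mono[OF i L2le_integrable_sq[OF g] le])
  ultimately show ?thesis using g f(1) by (simp add: L2le_def)
qed

text \<open>Minkowski's inequality, obtained by integrating a weighted form of the convexity of the
  square.\<close>

lemma L2le_add:
  assumes f: "L2le f s" and g: "L2le g t"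
  shows "L2le (\<lambda>x. f x + g x) (s + t)"
proof -
  have [measurable]: "f \<in> borel_measurable M" "g \<in> borel_measurable M" using f g by (auto simp: L2le_def)
  note fi = L2le_integrable_sq[OF f] and gi = L2le_integrable_sq[OF g]
  have "integrable M (\<lambda>x. 2 * (f x)\<^sup>2 + 2 * (g x)\<^sup>2)" using fi gi by simp
  then have i: "integrable M (\<lambda>x. (f x + g x)\<^sup>2)"
  proof (rule Bochner_Integration.integrable_bound)
    show "AE x in M. norm ((f x + g x)\<^sup>2) \<le> norm (2 * (f x)\<^sup>2 + 2 * (g x)\<^sup>2)"
    proof (rule AE_I2)
      fix x
      have "0 \<le> (f x - g x)\<^sup>2" by simp
      then have "(f x + g x)\<^sup>2 \<le> 2 * (f x)\<^sup>2 + 2 * (g x)\<^sup>2" by (simp add: power2_eq_square algebra_simps)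
      then show "norm ((f x + g x)\<^sup>2) \<le> norm (2 * (f x)\<^sup>2 + 2 * (g x)\<^sup>2)" by simp
    qed
  qed simp
  have "sqrt (\<integral>x. (f x + g x)\<^sup>2 \<partial>M) \<le> s + t"
  proof (rule field_le_epsilon)
    fix e :: real assume e: "e > 0"
    \<comment> \<open>The weights must be positive, whereas \<open>s\<close> and \<open>t\<close> may vanish.\<close>
    define a b where "a = s + e / 2" and "b = t + e / 2"
    have ab: "a > 0" "b > 0" "s \<le> a" "t \<le> b" using e L2le_nonneg[OF f] L2le_nonneg[OF g] by (auto simp: a_def b_def)
    have pt: "(u + v)\<^sup>2 \<le> (a + b) * (u\<^sup>2 / a + v\<^sup>2 / b)" for u v :: real
    proof -
      have "(a + b) * (u\<^sup>2 / a + v\<^sup>2 / b) - (u + v)\<^sup>2 = (b * u - a * v)\<^sup>2 / (a * b)"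
        using ab by (simp add: field_simps power2_eq_square)
      moreover have "(b * u - a * v)\<^sup>2 / (a * b) \<ge> 0" using ab by simp
      ultimately show ?thesis by linarith
    qed
    have "(\<integral>x. (f x + g x)\<^sup>2 \<partial>M) \<le> (\<integral>x. (a + b) * ((f x)\<^sup>2 / a + (g x)\<^sup>2 / b) \<partial>M)"
      by (rule integral_mono[OF i]) (use fi gi pt in auto)
    also have "\<dots> = (a + b) * ((\<integral>x. (f x)\<^sup>2 \<partial>M) / a + (\<integral>x. (g x)\<^sup>2 \<partial>M) / b)"
      using fi gi by simp
    also have "\<dots> \<le> (a + b) * (a\<^sup>2 / a + b\<^sup>2 / b)"
    proof -
      have "(\<integral>x. (f x)\<^sup>2 \<partial>M) \<le> a\<^sup>2" "(\<integral>x. (g x)\<^sup>2 \<partial>M) \<le> b\<^sup>2"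
        using f g ab L2le_mono L2le_def by metis+
      then show ?thesis using ab by (intro mult_left_mono add_mono divide_right_mono) auto
    qed
    also have "\<dots> = (a + b)\<^sup>2" using ab by (simp add: power2_eq_square)
    finally have "sqrt (\<integral>x. (f x + g x)\<^sup>2 \<partial>M) \<le> a + b" using ab by (simp add: real_le_lsqrt)
    then show "sqrt (\<integral>x. (f x + g x)\<^sup>2 \<partial>M) \<le> s + t + e" by (simp add: a_def b_def)
  qed
  then have "(\<integral>x. (f x + g x)\<^sup>2 \<partial>M) \<le> (s + t)\<^sup>2" by (rule sqrt_le_D)
  then show ?thesis using i L2le_nonneg[OF f] L2le_nonneg[OF g] by (simp add: L2le_def)
qed

lemma L2le_cmult: "L2le f s \<Longrightarrow> L2le (\<lambda>x. a * f x) (\<bar>a\<bar> * s)"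
  unfolding L2le_def by (auto simp: power_mult_distrib intro!: mult_left_mono)

lemma L2le_zero: "L2le (\<lambda>x. 0) 0"
  by (simp add: L2le_def)

lemma L2le_sum:
  assumes "finite I" "\<And>i. i \<in> I \<Longrightarrow> L2le (f i) (s i)"
  shows "L2le (\<lambda>x. \<Sum>i\<in>I. f i x) (\<Sum>i\<in>I. s i)"
  using assms by (induction I rule: finite_induct) (auto simp: L2le_zero intro: L2le_add)

lemma L2le_integral:
  assumes "L2le f s"
  shows "integrable M f" "(\<integral>x. \<bar>f x\<bar> \<partial>M) \<le> s"
proof -
  show i: "integrable M f"
    by (rule square_integrable_imp_integrable) (use assms in \<open>auto simp only: L2le_def\<close>)
  show "(\<integral>x. \<bar>f x\<bar> \<partial>M) \<le> s"
  proof (rule field_le_epsilon)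
    fix e :: real assume e: "e > 0"
    define t where "t = s + e"
    have t: "t > 0" "s \<le> t" using e L2le_nonneg[OF assms] by (auto simp: t_def)
    \<comment> \<open>The inequality of arithmetic and geometric means for \<open>u\<^sup>2 / t\<close> and \<open>t\<close>.\<close>
    have pt: "\<bar>u\<bar> \<le> (u\<^sup>2 / t + t) / 2" for u :: real
    proof -
      have "(u\<^sup>2 / t + t) / 2 - \<bar>u\<bar> = (\<bar>u\<bar> - t)\<^sup>2 / (2 * t)"
        using t by (simp add: field_simps power2_eq_square)
      moreover have "(\<bar>u\<bar> - t)\<^sup>2 / (2 * t) \<ge> 0" using t by simp
      ultimately show ?thesis by linarith
    qed
    note i2 = L2le_integrable_sq[OF assms]
    have "(\<integral>x. \<bar>f x\<bar> \<partial>M) \<le> (\<integral>x. ((f x)\<^sup>2 / t + t) / 2 \<partial>M)"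
      by (rule integral_mono) (use i i2 pt in auto)
    also have "\<dots> = ((\<integral>x. (f x)\<^sup>2 \<partial>M) / t + t) / 2" using i2 by (simp add: prob_space)
    also have "\<dots> \<le> (t\<^sup>2 / t + t) / 2"
    proof -
      have "(\<integral>x. (f x)\<^sup>2 \<partial>M) \<le> t\<^sup>2" using L2le_mono[OF assms t(2)] by (simp add: L2le_def)
      then show ?thesis using t by (intro divide_right_mono add_right_mono) auto
    qed
    finally show "(\<integral>x. \<bar>f x\<bar> \<partial>M) \<le> s + e" using t by (simp add: power2_eq_square t_def)
  qed
qed

text \<open>By monotone convergence the sum of the \<open>h j\<close> has finite expectation.\<close>

lemma AE_summable_of_integral:
  fixes h :: "nat \<Rightarrow> 'a \<Rightarrow> real"
  assumes h: "\<And>j. integrable M (h j)" "\<And>j x. x \<in> space M \<Longrightarrow> 0 \<le> h j x"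
    and s: "summable c" "\<And>j. (\<integral>x. h j x \<partial>M) \<le> c j"
  shows "AE x in M. summable (\<lambda>j. h j x)"
proof -
  have c: "0 \<le> c j" for j
  proof -
    have "0 \<le> (\<integral>x. h j x \<partial>M)" by (rule integral_nonneg_AE) (use h(2) in auto)
    then show ?thesis using s(2)[of j] by linarith
  qed
  have "(\<integral>\<^sup>+x. suminf (\<lambda>j. ennreal (h j x)) \<partial>M) = suminf (\<lambda>j. \<integral>\<^sup>+x. ennreal (h j x) \<partial>M)"
    using h(1) by (intro nn_integral_suminf) (auto simp: borel_measurable_integrable)
  also have "\<dots> \<le> suminf (\<lambda>j. ennreal (c j))"
  proof (rule suminf_le)
    fix j
    have "(\<integral>\<^sup>+x. ennreal (h j x) \<partial>M) = ennreal (\<integral>x. h j x \<partial>M)"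
      by (rule nn_integral_eq_integral) (use h in auto)
    also have "\<dots> \<le> ennreal (c j)" using s(2) by (rule ennreal_leI)
    finally show "(\<integral>\<^sup>+x. ennreal (h j x) \<partial>M) \<le> ennreal (c j)" .
  qed auto
  also have "\<dots> = ennreal (suminf (\<lambda>j. c j))" using c s(1) by (rule suminf_ennreal2)
  also have "\<dots> < \<infinity>" by simp
  finally have "AE x in M. suminf (\<lambda>j. ennreal (h j x)) \<noteq> \<infinity>"
    using h(1) by (intro nn_integral_PInf_AE) (auto simp: borel_measurable_integrable)
  then show ?thesis
  proof (rule AE_mp, intro AE_I2 impI)
    fix x assume x: "x \<in> space M" "suminf (\<lambda>j. ennreal (h j x)) \<noteq> \<infinity>"
    then show "summable (\<lambda>j. h j x)"
      using h(2)[OF x(1)] by (intro summable_suminf_not_top) auto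
  qed
qed

end

lemma limsup_le_0_iff:
  fixes u :: "nat \<Rightarrow> real"
  assumes "\<And>n. 0 \<le> u n"
  shows "limsup (\<lambda>n. ereal (u n)) \<le> 0 \<longleftrightarrow> u \<longlonglongrightarrow> 0"
proof
  assume l: "limsup (\<lambda>n. ereal (u n)) \<le> 0"
  have "0 \<le> liminf (\<lambda>n. ereal (u n))" by (rule Liminf_bounded) (use assms in auto)
  then show "u \<longlonglongrightarrow> 0"
    using l by (intro limsup_le_liminf_real) (auto simp: zero_ereal_def)
next
  assume "u \<longlonglongrightarrow> 0"
  then have "(\<lambda>n. ereal (u n)) \<longlonglongrightarrow> ereal 0" by simp
  then show "limsup (\<lambda>n. ereal (u n)) \<le> 0"
    using lim_imp_Limsup[of sequentially "\<lambda>n. ereal (u n)" "ereal 0"] by (simp add: zero_ereal_def)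
qed

lemma tendsto_const_over_n: "(\<lambda>n. (x::real) + y / real n) \<longlonglongrightarrow> x"
  using tendsto_add[OF tendsto_const[of x] lim_const_over_n[of y]] by simp

section \<open>Ergodic spatial actions\<close>

text \<open>An ergodic, measure preserving action of the translations. The weights \<open>W R\<close> stand for the
  size of interactions of range \<open>R\<close> at the cell of the origin; moving the origin by at most \<open>k\<close>
  is absorbed by enlarging the range.\<close>

locale spatial_action = prob_space P for P :: "'s measure" +
  fixes \<theta> :: "(real, 'd::finite) vec \<Rightarrow> 's \<Rightarrow> 's" and W :: "nat \<Rightarrow> 's \<Rightarrow> real"
  assumes shift_measurable [measurable]: "\<theta> v \<in> measurable P P"
    and shift_distr: "distr P P (\<theta> v) = P"
    and shift_add: "\<nu> \<in> space P \<Longrightarrow> \<theta> v (\<theta> w \<nu>) = \<theta> (v + w) \<nu>"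
    and shift_zero: "\<nu> \<in> space P \<Longrightarrow> \<theta> 0 \<nu> = \<nu>"
    and ergodic: "A \<in> sets P \<Longrightarrow> (\<And>v \<nu>. \<nu> \<in> space P \<Longrightarrow> \<theta> v \<nu> \<in> A \<longleftrightarrow> \<nu> \<in> A) \<Longrightarrow> measure P A \<in> {0, 1}"
    and W_nonneg: "0 \<le> W R \<nu>"
    and W_measurable [measurable]: "W R \<in> borel_measurable P"
    and W_sq: "integrable P (\<lambda>\<nu>. (W R \<nu>)\<^sup>2)"
    and W_shift: "\<nu> \<in> space P \<Longrightarrow> (\<And>i. \<bar>v $ i\<bar> \<le> real k) \<Longrightarrow> W R (\<theta> v \<nu>) \<le> W (R + k) \<nu>"
begin

abbreviation lshift :: "(int, 'd) vec \<Rightarrow> 's \<Rightarrow> 's" where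
  "lshift z \<equiv> \<theta> (- lattice_point z)"

definition avg :: "nat \<Rightarrow> ('s \<Rightarrow> real) \<Rightarrow> 's \<Rightarrow> real" where
  "avg n g \<nu> = (\<Sum>z\<in>ibox n. g (lshift z \<nu>)) / real n ^ CARD('d)"

text \<open>The total weight of the boundary layer of the cube of side \<open>n\<close>, relative to the volume.\<close>

definition lsum :: "nat \<Rightarrow> nat \<Rightarrow> nat \<Rightarrow> 's \<Rightarrow> real" where
  "lsum R w n \<nu> = (\<Sum>z\<in>layer n w. W R (lshift z \<nu>)) / real n ^ CARD('d)"

lemma shift_space: "\<nu> \<in> space P \<Longrightarrow> \<theta> v \<nu> \<in> space P"
  using shift_measurable by (rule measurable_space)

lemma lshift_lshift: "\<nu> \<in> space P \<Longrightarrow> lshift z (lshift w \<nu>) = lshift (w + z) \<nu>"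
  by (simp add: shift_add algebra_simps)

lemma integrable_shift:
  fixes g :: "'s \<Rightarrow> real"
  assumes "integrable P g" shows "integrable P (\<lambda>\<nu>. g (\<theta> v \<nu>))"
  using assms integrable_distr_eq[of "\<theta> v" P P g] by (simp add: shift_distr borel_measurable_integrable)

lemma integral_shift:
  fixes g :: "'s \<Rightarrow> real"
  assumes "g \<in> borel_measurable P" shows "(\<integral>\<nu>. g (\<theta> v \<nu>) \<partial>P) = (\<integral>\<nu>. g \<nu> \<partial>P)"
  using integral_distr[of "\<theta> v" P P g] assms by (simp add: shift_distr)

lemma L2le_shift: "L2le g s \<Longrightarrow> L2le (\<lambda>\<nu>. g (\<theta> v \<nu>)) s"
  unfolding L2le_def
  using integrable_shift[of "\<lambda>\<nu>. (g \<nu>)\<^sup>2" v] integral_shift[of "\<lambda>\<nu>. (g \<nu>)\<^sup>2" v] by auto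

lemma shift_comp_measurable:
  "g \<in> borel_measurable P \<Longrightarrow> (\<lambda>\<nu>. g (\<theta> v \<nu>)) \<in> borel_measurable P"
  by (rule measurable_compose[OF shift_measurable])

lemma avg_measurable [measurable]: "g \<in> borel_measurable P \<Longrightarrow> avg n g \<in> borel_measurable P"
  unfolding avg_def[abs_def]
  by (rule borel_measurable_divide[OF borel_measurable_sum borel_measurable_const])
    (rule shift_comp_measurable)

lemma lsum_measurable [measurable]: "lsum R w n \<in> borel_measurable P"
  unfolding lsum_def[abs_def]
  by (rule borel_measurable_divide[OF borel_measurable_sum borel_measurable_const])
    (rule shift_comp_measurable[OF W_measurable])

lemma lsum_nonneg: "0 \<le> lsum R w n \<nu>"
  unfolding lsum_def using W_nonneg by (intro divide_nonneg_nonneg sum_nonneg) auto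

lemma integrable_avg: "integrable P g \<Longrightarrow> integrable P (avg n g)"
  unfolding avg_def[abs_def] by (intro integrable_divide Bochner_Integration.integrable_sum integrable_shift)

lemma integral_avg:
  assumes "integrable P g" "n \<ge> 1"
  shows "(\<integral>\<nu>. avg n g \<nu> \<partial>P) = (\<integral>\<nu>. g \<nu> \<partial>P)"
proof -
  have "(\<integral>\<nu>. avg n g \<nu> \<partial>P) = (\<Sum>z\<in>(ibox n :: (int, 'd) vec set). \<integral>\<nu>. g (lshift z \<nu>) \<partial>P) / real n ^ CARD('d)"
    unfolding avg_def using integrable_shift[OF assms(1)] by simp
  also have "\<dots> = (\<integral>\<nu>. g \<nu> \<partial>P)"
    using assms by (simp add: integral_shift borel_measurable_integrable card_ibox)
  finally show ?thesis .
qed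

lemma L2le_avg:
  assumes "L2le g s" "n \<ge> 1"
  shows "L2le (avg n g) s"
proof -
  have "L2le (\<lambda>\<nu>. (1 / real n ^ CARD('d)) * (\<Sum>z\<in>(ibox n :: (int, 'd) vec set). g (lshift z \<nu>)))
    (\<bar>1 / real n ^ CARD('d)\<bar> * (\<Sum>z\<in>(ibox n :: (int, 'd) vec set). s))"
    by (intro L2le_cmult L2le_sum L2le_shift assms) simp
  moreover have "\<bar>1 / real n ^ CARD('d)\<bar> * (\<Sum>z\<in>(ibox n :: (int, 'd) vec set). s) = s"
    using assms by (simp add: card_ibox)
  ultimately show ?thesis unfolding avg_def[abs_def] by simp
qed

lemma L2le_subset_sum:
  assumes "L2le g s" "n \<ge> 1" "S \<subseteq> layer n w"
  shows "L2le (\<lambda>\<nu>. (\<Sum>z\<in>S. g (lshift z \<nu>)) / real n ^ CARD('d)) (real (layer_const TYPE('d) w) * s / real n)"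
proof -
  have fS: "finite S" using assms(3) by (rule finite_subset) simp
  have "card S \<le> layer_const TYPE('d) w * n ^ (CARD('d) - 1)"
    using card_mono[OF finite_layer assms(3)] card_layer_le[OF assms(2), where w = w and 'd = 'd] by linarith
  then have "real (card S) \<le> real (layer_const TYPE('d) w * n ^ (CARD('d) - 1))" by (rule of_nat_mono)
  then have c: "real (card S) / real n ^ CARD('d) \<le> real (layer_const TYPE('d) w) / real n"
    using assms(2) by (cases "CARD('d)") (auto simp: field_simps)
  have "L2le (\<lambda>\<nu>. (1 / real n ^ CARD('d)) * (\<Sum>z\<in>S. g (lshift z \<nu>)))
    (\<bar>1 / real n ^ CARD('d)\<bar> * (\<Sum>z\<in>S. s))"
    by (intro L2le_cmult L2le_sum L2le_shift assms fS)
  moreover have "\<bar>1 / real n ^ CARD('d)\<bar> * (\<Sum>z\<in>S. s) \<le> real (layer_const TYPE('d) w) * s / real n"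
    using mult_right_mono[OF c L2le_nonneg[OF assms(1)]] by simp
  ultimately show ?thesis using L2le_mono by simp
qed

lemma L2le_W: "L2le (W R) (L2norm (W R))"
  by (rule L2le_norm) (auto simp: W_sq)

lemma L2le_lsum: "n \<ge> 1 \<Longrightarrow> L2le (lsum R w n) (real (layer_const TYPE('d) w) * L2norm (W R) / real n)"
  unfolding lsum_def[abs_def] by (rule L2le_subset_sum[OF L2le_W]) auto

text \<open>Wiener's maximal inequality by transference: \<open>maximal_covering\<close> is applied to the values
  of \<open>h\<close> along the orbit of a single point, seen through a cube of side \<open>L\<close>. Integration
  replaces the counts by the measure of the exceptional set, and \<open>L\<close> tends to infinity.\<close>

lemma maximal_inequality_upto:
  assumes h: "integrable P h" "\<And>\<nu>. \<nu> \<in> space P \<Longrightarrow> 0 \<le> h \<nu>" and l: "l > 0"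
  shows "measure P {\<nu> \<in> space P. \<exists>n\<in>{1..N}. avg n h \<nu> > l} \<le> 2 ^ CARD('d) * (\<integral>\<nu>. h \<nu> \<partial>P) / l"
proof -
  have [measurable]: "h \<in> borel_measurable P" using h(1) by (rule borel_measurable_integrable)
  define E where "E = {\<nu> \<in> space P. \<exists>n\<in>{1..N}. avg n h \<nu> > l}"
  have E [measurable]: "E \<in> sets P" unfolding E_def by measurable
  let ?I = "\<integral>\<nu>. h \<nu> \<partial>P"
  have main: "l * real L ^ CARD('d) * measure P E \<le> 2 ^ CARD('d) * (real (L + N) ^ CARD('d) * ?I)" for L
  proof -
    have pt: "l * (\<Sum>z\<in>(ibox L :: (int, 'd) vec set). indicator E (lshift z \<nu>)) \<le> 2 ^ CARD('d) * (\<Sum>w\<in>(ibox (L + N) :: (int, 'd) vec set). h (lshift w \<nu>))"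
      if \<nu>: "\<nu> \<in> space P" for \<nu>
    proof -
      define A where "A = {z \<in> ibox L. lshift z \<nu> \<in> E}"
      \<comment> \<open>The side of a cube at \<open>z\<close> on which the average of \<open>h\<close> exceeds \<open>l\<close>.\<close>
      define s where "s = (\<lambda>z. SOME n. n \<in> {1..N} \<and> avg n h (lshift z \<nu>) > l)"
      have s: "s z \<in> {1..N} \<and> avg (s z) h (lshift z \<nu>) > l" if "z \<in> A" for z
        unfolding s_def by (rule someI_ex) (use that in \<open>auto simp: A_def E_def\<close>)
      have "l * real (card A) \<le> 2 ^ CARD('d) * (\<Sum>w\<in>ibox (L + N). h (lshift w \<nu>))"
      proof (rule maximal_covering)
        fix z assume z: "z \<in> A"
        have "avg (s z) h (lshift z \<nu>) * real (s z) ^ CARD('d) = (\<Sum>w\<in>ibox (s z). h (lshift (z + w) \<nu>))"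
          using s[OF z] \<nu> by (simp add: avg_def lshift_lshift)
        moreover have "l * real (s z) ^ CARD('d) \<le> avg (s z) h (lshift z \<nu>) * real (s z) ^ CARD('d)"
          using s[OF z] by (intro mult_right_mono) auto
        ultimately show "1 \<le> s z \<and> s z \<le> N \<and> l * real (s z) ^ CARD('d) \<le> (\<Sum>w\<in>ibox (s z). h (lshift (z + w) \<nu>))"
          using s[OF z] by auto
      qed (use h(2) \<nu> l shift_space in \<open>auto simp: A_def\<close>)
      moreover have "(\<Sum>z\<in>(ibox L :: (int, 'd) vec set). indicator E (lshift z \<nu>)) = real (card A)"
        by (simp add: A_def sum.If_cases indicator_def Int_def)
      ultimately show ?thesis by simp
    qed
    have iE: "integrable P (indicator E :: 's \<Rightarrow> real)"
      by (rule integrable_real_indicator[OF E]) (simp add: emeasure_eq_measure)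
    note iE' = integrable_shift[OF iE] and ih' = integrable_shift[OF h(1)]
    have "(\<integral>\<nu>. l * (\<Sum>z\<in>(ibox L :: (int, 'd) vec set). indicator E (lshift z \<nu>)) \<partial>P)
      \<le> (\<integral>\<nu>. 2 ^ CARD('d) * (\<Sum>w\<in>(ibox (L + N) :: (int, 'd) vec set). h (lshift w \<nu>)) \<partial>P)"
      by (rule integral_mono) (use pt iE' ih' in auto)
    moreover have "(\<integral>\<nu>. l * (\<Sum>z\<in>(ibox L :: (int, 'd) vec set). indicator E (lshift z \<nu>)) \<partial>P) = l * real L ^ CARD('d) * measure P E"
    proof -
      have "(\<integral>\<nu>. indicator E (lshift z \<nu>) \<partial>P) = measure P E" for z
        by (subst integral_shift) auto
      then show ?thesis using iE' by (simp add: card_ibox)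
    qed
    moreover have "(\<integral>\<nu>. 2 ^ CARD('d) * (\<Sum>w\<in>(ibox (L + N) :: (int, 'd) vec set). h (lshift w \<nu>)) \<partial>P)
       = 2 ^ CARD('d) * (real (L + N) ^ CARD('d) * ?I)"
      using ih' by (simp add: integral_shift card_ibox)
    ultimately show ?thesis by linarith
  qed
  have lim: "(\<lambda>L. 2 ^ CARD('d) * ?I / l * (1 + real N / real L) ^ CARD('d)) \<longlonglongrightarrow> 2 ^ CARD('d) * ?I / l * (1 + 0) ^ CARD('d)"
    by (intro tendsto_intros lim_const_over_n)
  have "measure P E \<le> 2 ^ CARD('d) * ?I / l * (1 + 0) ^ CARD('d)"
  proof (rule LIMSEQ_le_const[OF lim], intro exI[of _ 1] allI impI)
    fix L :: nat assume L: "1 \<le> L"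
    have "real (L + N) = real L * (1 + real N / real L)" using L by (simp add: field_simps)
    then have "l * real L ^ CARD('d) * measure P E \<le> l * real L ^ CARD('d) * (2 ^ CARD('d) * ?I / l * (1 + real N / real L) ^ CARD('d))"
      using main[of L] l by (simp add: power_mult_distrib mult_ac)
    then show "measure P E \<le> 2 ^ CARD('d) * ?I / l * (1 + real N / real L) ^ CARD('d)"
      using l L by (subst (asm) mult_le_cancel_left_pos) auto
  qed
  then show ?thesis by (simp add: E_def)
qed

lemma maximal_inequality:
  assumes h: "integrable P h" "\<And>\<nu>. \<nu> \<in> space P \<Longrightarrow> 0 \<le> h \<nu>" and l: "l > 0"
  shows "measure P {\<nu> \<in> space P. \<exists>n\<ge>1. avg n h \<nu> > l} \<le> 2 ^ CARD('d) * (\<integral>\<nu>. h \<nu> \<partial>P) / l"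
proof -
  have [measurable]: "h \<in> borel_measurable P" using h(1) by (rule borel_measurable_integrable)
  define E where "E = (\<lambda>N. {\<nu> \<in> space P. \<exists>n\<in>{1..N}. avg n h \<nu> > l})"
  have "(\<lambda>N. measure P (E N)) \<longlonglongrightarrow> measure P (\<Union>N. E N)"
  proof (rule finite_Lim_measure_incseq)
    show "range E \<subseteq> sets P" unfolding E_def by auto
    show "incseq E" unfolding E_def incseq_def by (auto intro: order_trans)
  qed
  moreover have "measure P (E N) \<le> 2 ^ CARD('d) * (\<integral>\<nu>. h \<nu> \<partial>P) / l" for N
    unfolding E_def by (rule maximal_inequality_upto[OF assms])
  ultimately have "measure P (\<Union>N. E N) \<le> 2 ^ CARD('d) * (\<integral>\<nu>. h \<nu> \<partial>P) / l"
    by (intro LIMSEQ_le_const2) auto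
  moreover have "(\<Union>N. E N) = {\<nu> \<in> space P. \<exists>n\<ge>1. avg n h \<nu> > l}"
    unfolding E_def by (auto; fastforce)
  ultimately show ?thesis by simp
qed

text \<open>By ergodicity every sublevel set has measure zero or one. The constant is the infimum of
  the levels of full measure.\<close>

lemma invariant_constant:
  fixes X :: "'s \<Rightarrow> ereal"
  assumes X [measurable]: "X \<in> borel_measurable P" and inv: "\<And>v \<nu>. \<nu> \<in> space P \<Longrightarrow> X (\<theta> v \<nu>) = X \<nu>"
    and fin: "AE \<nu> in P. \<bar>X \<nu>\<bar> \<noteq> \<infinity>"
  shows "\<exists>b. AE \<nu> in P. X \<nu> = ereal b"
proof -
  have A [measurable]: "{\<nu> \<in> space P. X \<nu> \<le> ereal c} \<in> sets P" for c by measurable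
  have zo: "measure P {\<nu> \<in> space P. X \<nu> \<le> ereal c} \<in> {0, 1}" for c
    by (rule ergodic) (auto simp: inv shift_space)
  have cases: "(AE \<nu> in P. X \<nu> \<le> ereal c) \<or> (AE \<nu> in P. ereal c < X \<nu>)" for c
  proof -
    have "(AE \<nu> in P. X \<nu> \<le> ereal c)" if "measure P {\<nu> \<in> space P. X \<nu> \<le> ereal c} = 1"
      using that prob_eq_1[OF A] by (auto elim: AE_mp)
    moreover have "(AE \<nu> in P. ereal c < X \<nu>)" if "measure P {\<nu> \<in> space P. X \<nu> \<le> ereal c} = 0"
      using that prob_eq_0[OF A] by (auto elim!: AE_mp simp: not_le)
    ultimately show ?thesis using zo[of c] by auto
  qed
  define C where "C = {c. AE \<nu> in P. X \<nu> \<le> ereal c}"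
  have "\<exists>c. AE \<nu> in P. X \<nu> \<le> ereal c"
  proof (rule ccontr)
    assume "\<not> ?thesis"
    then have "AE \<nu> in P. ereal (real n) < X \<nu>" for n :: nat using cases by blast
    then have "AE \<nu> in P. \<forall>n::nat. ereal (real n) < X \<nu>" by (subst AE_all_countable) auto
    then have "AE \<nu> in P. False"
      using fin
    proof eventually_elim
      case (elim \<nu>)
      then obtain r where "X \<nu> = ereal r" by (cases "X \<nu>") auto
      moreover obtain n :: nat where "r < real n" using reals_Archimedean2 by blast
      ultimately show ?case using elim(1)[rule_format, of n] by simp
    qed
    then show False by simp
  qed
  then have Cne: "C \<noteq> {}" by (auto simp: C_def)
  have "\<exists>c. AE \<nu> in P. ereal c < X \<nu>"
  proof (rule ccontr)
    assume "\<not> ?thesis"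
    then have "AE \<nu> in P. X \<nu> \<le> ereal (- real n)" for n :: nat using cases by blast
    then have "AE \<nu> in P. \<forall>n::nat. X \<nu> \<le> ereal (- real n)" by (subst AE_all_countable) auto
    then have "AE \<nu> in P. False"
      using fin
    proof eventually_elim
      case (elim \<nu>)
      then obtain r where "X \<nu> = ereal r" by (cases "X \<nu>") auto
      moreover obtain n :: nat where "- r < real n" using reals_Archimedean2 by blast
      ultimately show ?case using elim(1)[rule_format, of n] by simp
    qed
    then show False by simp
  qed
  then obtain c0 where c0: "AE \<nu> in P. ereal c0 < X \<nu>" ..
  have bdd: "bdd_below C"
  proof (rule bdd_belowI[of _ c0])
    fix c assume "c \<in> C"
    then have AEc: "AE \<nu> in P. X \<nu> \<le> ereal c" by (simp add: C_def)
    show "c0 \<le> c"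
    proof (rule ccontr)
      assume "\<not> c0 \<le> c"
      then have c: "ereal c < ereal c0" by simp
      from AEc c0 have "AE \<nu> in P. False"
      proof eventually_elim
        case (elim \<nu>)
        then show False using c by (metis less_le_trans less_asym)
      qed
      then show False by simp
    qed
  qed
  define b where "b = Inf C"
  have up: "AE \<nu> in P. X \<nu> \<le> ereal (b + 1 / real (Suc n))" for n
  proof -
    have "Inf C < b + 1 / real (Suc n)" by (simp add: b_def)
    then obtain c where c: "c \<in> C" "c < b + 1 / real (Suc n)" using cInf_lessD[OF Cne] by blast
    then have "AE \<nu> in P. X \<nu> \<le> ereal c" by (simp add: C_def)
    then show ?thesis
      by eventually_elim (rule order_trans, assumption, use c(2) in simp)
  qed
  have lo: "AE \<nu> in P. ereal (b - 1 / real (Suc n)) \<le> X \<nu>" for n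
  proof -
    have "b - 1 / real (Suc n) \<notin> C"
      using cInf_lower[OF _ bdd, of "b - 1 / real (Suc n)"] by (auto simp: b_def)
    then have "AE \<nu> in P. ereal (b - 1 / real (Suc n)) < X \<nu>"
      using cases unfolding C_def by blast
    then show ?thesis by (auto elim!: AE_mp)
  qed
  have "AE \<nu> in P. \<forall>n. X \<nu> \<le> ereal (b + 1 / real (Suc n)) \<and> ereal (b - 1 / real (Suc n)) \<le> X \<nu>"
    unfolding AE_all_countable using up lo by auto
  then have "AE \<nu> in P. X \<nu> = ereal b"
    using fin
  proof eventually_elim
    case (elim \<nu>)
    then obtain r where r: "X \<nu> = ereal r" by (cases "X \<nu>") auto
    have "r \<le> b + e" "b \<le> r + e" if e: "e > 0" for e
    proof -
      obtain n where "1 / real (Suc n) < e" using nat_approx_posE[OF e] by blast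
      moreover have "r \<le> b + 1 / real (Suc n)" "b - 1 / real (Suc n) \<le> r"
        using elim(1)[rule_format, of n] r by auto
      ultimately show "r \<le> b + e" "b \<le> r + e" by auto
    qed
    then have "r \<le> b" "b \<le> r" by (auto intro: field_le_epsilon)
    then show ?case using r by simp
  qed
  then show ?thesis ..
qed

text \<open>Points along whose orbit all boundary layers are negligible. This condition is measurable,
  invariant and almost surely satisfied. The upper limit is used instead of convergence to zero
  because its measurability is immediate.\<close>

definition good :: "'s \<Rightarrow> bool" where
  "good \<nu> \<longleftrightarrow> (\<forall>R w. limsup (\<lambda>n. ereal (lsum R w n \<nu>)) \<le> 0)"

lemma good_measurable [measurable]: "Measurable.pred P good"
  unfolding good_def by measurable

lemma good_iff: "good \<nu> \<longleftrightarrow> (\<forall>R w. (\<lambda>n. lsum R w n \<nu>) \<longlonglongrightarrow> 0)"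
  unfolding good_def by (simp add: limsup_le_0_iff lsum_nonneg)

text \<open>The norm of a layer sum is of order \<open>1 / n\<close>, so its squares have summable expectations.\<close>

lemma AE_good: "AE \<nu> in P. good \<nu>"
proof -
  have "AE \<nu> in P. (\<lambda>n. lsum R w n \<nu>) \<longlonglongrightarrow> 0" for R w
  proof -
    let ?K = "real (layer_const TYPE('d) w) * L2norm (W R)"
    let ?c = "\<lambda>n. ?K\<^sup>2 * (1 / real (Suc n) ^ 2)"
    have L: "L2le (lsum R w (Suc n)) (?K / real (Suc n))" for n by (rule L2le_lsum) simp
    have "AE \<nu> in P. summable (\<lambda>n. (lsum R w (Suc n) \<nu>)\<^sup>2)"
    proof (rule AE_summable_of_integral)
      show "integrable P (\<lambda>\<nu>. (lsum R w (Suc n) \<nu>)\<^sup>2)" for n using L by (rule L2le_integrable_sq)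
      show "summable ?c"
        using summable_Suc_iff[THEN iffD2, OF inverse_power_summable[of 2, where 'a = real]]
        by (intro summable_mult) (simp add: inverse_eq_divide)
      show "(\<integral>\<nu>. (lsum R w (Suc n) \<nu>)\<^sup>2 \<partial>P) \<le> ?c n" for n
        using L[of n] by (simp add: L2le_def power_divide)
    qed simp
    then show ?thesis
    proof eventually_elim
      case (elim \<nu>)
      then have "(\<lambda>n. (lsum R w (Suc n) \<nu>)\<^sup>2) \<longlonglongrightarrow> 0" by (rule summable_LIMSEQ_zero)
      then have "(\<lambda>n. sqrt ((lsum R w (Suc n) \<nu>)\<^sup>2)) \<longlonglongrightarrow> sqrt 0" by (rule tendsto_real_sqrt)
      then have "(\<lambda>n. lsum R w (Suc n) \<nu>) \<longlonglongrightarrow> 0" by (simp add: lsum_nonneg)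
      then show ?case by (rule LIMSEQ_imp_Suc)
    qed
  qed
  then show ?thesis unfolding good_iff by (simp add: AE_all_countable)
qed

lemma good_shift:
  assumes \<nu>: "\<nu> \<in> space P" and g: "good \<nu>"
  shows "good (\<theta> v \<nu>)"
  unfolding good_iff
proof (intro allI)
  fix R w
  obtain k :: nat where k: "norm v \<le> real k" using real_arch_simple by blast
  have vi: "\<bar>v $ i\<bar> \<le> real k" for i using component_le_norm_cart[of v i] k by linarith
  have le: "lsum R w n (\<theta> v \<nu>) \<le> lsum (R + k) w n \<nu>" for n
  proof -
    have "W R (lshift z (\<theta> v \<nu>)) \<le> W (R + k) (lshift z \<nu>)" for z
    proof -
      have "lshift z (\<theta> v \<nu>) = \<theta> v (lshift z \<nu>)" using \<nu> by (simp add: shift_add add.commute)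
      then show ?thesis using W_shift[OF shift_space[OF \<nu>] vi] by simp
    qed
    then show ?thesis unfolding lsum_def by (intro divide_right_mono sum_mono) auto
  qed
  have "(\<lambda>n. lsum (R + k) w n \<nu>) \<longlonglongrightarrow> 0" using g by (simp add: good_iff)
  then show "(\<lambda>n. lsum R w n (\<theta> v \<nu>)) \<longlonglongrightarrow> 0"
    by (rule tendsto_sandwich[rotated 2, OF tendsto_const]) (use le lsum_nonneg in auto)
qed

lemma good_shift_iff: "\<nu> \<in> space P \<Longrightarrow> good (\<theta> v \<nu>) \<longleftrightarrow> good \<nu>"
  using good_shift[of \<nu> v] good_shift[of "\<theta> v \<nu>" "- v"] shift_space[of \<nu> v]
  by (auto simp: shift_add shift_zero)

end

section \<open>An ergodic theorem for nearly additive functionals\<close>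

text \<open>Functionals of bounded regions that commute with translations and are additive over
  disjoint pieces, up to \<open>c\<close> times the total weight of the bad cells.\<close>

locale near_additive = spatial_action P \<theta> W
  for P :: "'s measure" and \<theta> :: "(real, 'd::finite) vec \<Rightarrow> 's \<Rightarrow> 's" and W +
  fixes F :: "(real, 'd) vec set \<Rightarrow> 's \<Rightarrow> real" and R :: nat and c :: real
  assumes c_nonneg: "0 \<le> c"
    and F_measurable [measurable]: "F (hcube 0 n) \<in> borel_measurable P"
    and F_measurable_closed [measurable]: "F (cbox 0 (vec (real n))) \<in> borel_measurable P"
    and F_covariant: "\<nu> \<in> space P \<Longrightarrow> bounded B \<Longrightarrow> F ((\<lambda>x. x + v) ` B) (\<theta> v \<nu>) = F B \<nu>"
    and F_additive: "\<nu> \<in> space P \<Longrightarrow> bounded B \<Longrightarrow> finite \<B> \<Longrightarrow> disjoint \<B> \<Longrightarrow> (\<And>C. C \<in> \<B> \<Longrightarrow> C \<subseteq> B) \<Longrightarrow>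
      \<bar>F B \<nu> - (\<Sum>C\<in>\<B>. F C \<nu>)\<bar> \<le> c * (\<Sum>z\<in>bad R B \<B>. W R (\<theta> (- lattice_point z) \<nu>))"
begin

definition cube_density :: "nat \<Rightarrow> 's \<Rightarrow> real" where
  "cube_density n \<nu> = F (hcube 0 n) \<nu> / real n ^ CARD('d)"

lemma density_measurable [measurable]: "cube_density n \<in> borel_measurable P"
  unfolding cube_density_def[abs_def] by measurable

lemma F_hcube:
  assumes "\<nu> \<in> space P"
  shows "F (hcube (lattice_point v) m) \<nu> = F (hcube 0 m) (lshift v \<nu>)"
proof -
  have "(\<lambda>x. x + - lattice_point v) ` hcube (lattice_point v) m = hcube 0 m"
  proof (intro equalityI subsetI)
    fix x :: "(real, 'd) vec" assume "x \<in> hcube 0 m"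
    then show "x \<in> (\<lambda>x. x + - lattice_point v) ` hcube (lattice_point v) m"
      by (intro image_eqI[of _ _ "x + lattice_point v"]) (auto simp: hcube_def)
  qed (force simp: hcube_def algebra_simps)
  then show ?thesis using F_covariant[OF assms bounded_hcube, of "- lattice_point v" "lattice_point v" m] by simp
qed

abbreviation part_avg :: "nat \<Rightarrow> nat \<Rightarrow> ('s \<Rightarrow> real) \<Rightarrow> 's \<Rightarrow> real" where
  "part_avg n m g \<nu> \<equiv> (\<Sum>v\<in>ibox (n + 1 - m). g (lshift v \<nu>)) / real n ^ CARD('d)"

definition block_const :: real where
  "block_const = c * (real CARD('d) * (2 * real R + 1))"

lemma block_const_nonneg: "0 \<le> block_const"
  using c_nonneg by (simp add: block_const_def)

text \<open>The decompositions into cubes of side \<open>m\<close> are averaged over all offsets. Together they use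
  each cube of side \<open>m\<close> with a lattice corner exactly once, and by \<open>card_bad_offsets\<close> a cell
  away from the boundary is bad for only a fraction of order \<open>1 / m\<close> of the offsets.\<close>

lemma density_blocks:
  assumes \<nu>: "\<nu> \<in> space P" and m: "m \<ge> 1" and n: "n \<ge> 1"
  shows "\<bar>cube_density n \<nu> - part_avg n m (cube_density m) \<nu>\<bar> \<le> block_const / real m * avg n (W R) \<nu> + c * lsum R m n \<nu>"
proof -
  let ?fam = "\<lambda>u. (\<lambda>v. hcube (lattice_point v) m) ` (offset_family n m u :: (int, 'd) vec set)"
  let ?B = "hcube 0 n :: (real, 'd) vec set"
  let ?f = "\<lambda>k \<nu>. F (hcube 0 k) \<nu>"
  let ?U = "ibox m :: (int, 'd) vec set"
  let ?w = "\<lambda>z. W R (lshift z \<nu>)"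
  let ?K = "real (CARD('d) * ((2 * R + 1) * m ^ (CARD('d) - 1)))"
  have one: "\<bar>?f n \<nu> - (\<Sum>v\<in>offset_family n m u. ?f m (lshift v \<nu>))\<bar> \<le> c * (\<Sum>z\<in>ibox n. if z \<in> bad R ?B (?fam u) then ?w z else 0)" for u
  proof -
    have fin: "finite (offset_family n m u :: (int, 'd) vec set)" by (simp add: offset_family_def)
    have "\<bar>F ?B \<nu> - (\<Sum>C\<in>?fam u. F C \<nu>)\<bar> \<le> c * (\<Sum>z\<in>bad R ?B (?fam u). ?w z)"
    proof (rule F_additive[OF \<nu> bounded_hcube])
      fix C assume "C \<in> ?fam u"
      then obtain v where v: "C = hcube (lattice_point v) m" "v \<in> ibox (n + 1 - m)"
        by (auto simp: offset_family_def)
      have "0 \<le> v $ i \<and> v $ i + int m \<le> int n" for i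
      proof -
        have "0 \<le> v $ i" "v $ i < int (n + 1 - m)" using v(2) by (auto simp: ibox_def)
        then show ?thesis by linarith
      qed
      then have vi: "0 \<le> real_of_int (v $ i)" "real_of_int (v $ i) + real m \<le> real n" for i
        by (metis of_int_0_le_iff of_int_add of_int_le_iff of_int_of_nat_eq)+
      show "C \<subseteq> ?B"
      proof
        fix x assume "x \<in> C"
        then have "real_of_int (v $ i) \<le> x $ i \<and> x $ i < real_of_int (v $ i) + real m" for i
          by (simp add: v(1) hcube_def)
        then have "0 \<le> x $ i \<and> x $ i < real n" for i using vi[of i] by (meson order_trans order_less_le_trans)
        then show "x \<in> ?B" by (simp add: hcube_def)
      qed
    qed (use fin disjoint_offset_family(1)[OF m] in auto)
    moreover have "(\<Sum>C\<in>?fam u. F C \<nu>) = (\<Sum>v\<in>offset_family n m u. ?f m (lshift v \<nu>))"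
      by (subst sum.reindex[OF disjoint_offset_family(2)[OF m]]) (simp add: F_hcube[OF \<nu>])
    moreover have "bad R ?B (?fam u) \<subseteq> ibox n"
      using hcube_cell_meets by (auto simp: bad_def)
    then have "(\<Sum>z\<in>bad R ?B (?fam u). ?w z) = (\<Sum>z\<in>ibox n. if z \<in> bad R ?B (?fam u) then ?w z else 0)"
      by (simp add: sum.If_cases Int_absorb1)
    ultimately show ?thesis by simp
  qed
  \<comment> \<open>The families for the different offsets partition the set of all possible corners.\<close>
  have "real m ^ CARD('d) * ?f n \<nu> - (\<Sum>v\<in>ibox (n + 1 - m). ?f m (lshift v \<nu>)) =
    (\<Sum>u\<in>?U. ?f n \<nu> - (\<Sum>v\<in>offset_family n m u. ?f m (lshift v \<nu>)))"
  proof -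
    have "(\<Sum>u\<in>?U. \<Sum>v\<in>offset_family n m u. ?f m (lshift v \<nu>)) = (\<Sum>v\<in>ibox (n + 1 - m). ?f m (lshift v \<nu>))"
      unfolding offset_family_def
    proof (rule sum.group)
      show "(\<lambda>v. \<chi> i. v $ i mod int m) ` ibox (n + 1 - m) \<subseteq> ?U"
        using m by (auto simp: ibox_def)
    qed (rule finite_ibox)+
    then show ?thesis by (simp add: sum_subtractf card_ibox)
  qed
  also have "\<bar>\<dots>\<bar> \<le> (\<Sum>u\<in>?U. \<bar>?f n \<nu> - (\<Sum>v\<in>offset_family n m u. ?f m (lshift v \<nu>))\<bar>)"
    by (rule sum_abs)
  also have "\<dots> \<le> (\<Sum>u\<in>?U. c * (\<Sum>z\<in>ibox n. if z \<in> bad R ?B (?fam u) then ?w z else 0))"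
    by (rule sum_mono) (rule one)
  also have "\<dots> = c * (\<Sum>z\<in>ibox n. \<Sum>u\<in>?U. if z \<in> bad R ?B (?fam u) then ?w z else 0)"
    by (simp only: sum_distrib_left[symmetric] sum.swap[of _ "ibox n" ?U])
  also have "\<dots> = c * (\<Sum>z\<in>ibox n. real (card {u \<in> ?U. z \<in> bad R ?B (?fam u)}) * ?w z)"
    by (simp add: sum.If_cases Int_def)
  also have "\<dots> \<le> c * ((\<Sum>z\<in>ibox n. ?K * ?w z) + (\<Sum>z\<in>layer n m. real m ^ CARD('d) * ?w z))"
  proof (rule mult_left_mono[OF _ c_nonneg])
    \<comment> \<open>Cells in the layer of width \<open>m\<close> may be bad for every offset; there the trivial bound is
      used.\<close>
    let ?b = "\<lambda>z. real (card {u \<in> ?U. z \<in> bad R ?B (?fam u)})"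
    have "(\<Sum>z\<in>ibox n. ?b z * ?w z) \<le> (\<Sum>z\<in>ibox n. ?K * ?w z + (if z \<in> layer n m then real m ^ CARD('d) * ?w z else 0))"
    proof (rule sum_mono)
      fix z :: "(int, 'd) vec" assume z: "z \<in> ibox n"
      have w0: "0 \<le> ?w z" by (rule W_nonneg)
      show "?b z * ?w z \<le> ?K * ?w z + (if z \<in> layer n m then real m ^ CARD('d) * ?w z else 0)"
      proof (cases "z \<in> layer n m")
        case True
        have "card {u \<in> ?U. z \<in> bad R ?B (?fam u)} \<le> card ?U" by (rule card_mono) auto
        then have "?b z \<le> real m ^ CARD('d)" by (simp add: card_ibox flip: of_nat_power)
        then have "?b z * ?w z \<le> real m ^ CARD('d) * ?w z" using w0 by (rule mult_right_mono)
        moreover have "0 \<le> ?K * ?w z" using w0 by simp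
        ultimately show ?thesis using True by simp
      next
        case False
        have "- int m \<le> z $ i \<and> z $ i < int n + int m" for i
        proof -
          have "0 \<le> z $ i" "z $ i < int n" using z by (auto simp: ibox_def)
          then show ?thesis by linarith
        qed
        then have "\<forall>i. int m \<le> z $ i \<and> z $ i < int n - int m"
          using False unfolding layer_def by blast
        then have "card {u \<in> ?U. z \<in> bad R ?B (?fam u)} \<le> CARD('d) * ((2 * R + 1) * m ^ (CARD('d) - 1))"
          using m by (intro card_bad_offsets) auto
        then have "?b z \<le> ?K" by (rule of_nat_mono)
        then show ?thesis using False mult_right_mono[OF _ w0] by simp
      qed
    qed
    also have "\<dots> = (\<Sum>z\<in>ibox n. ?K * ?w z) + (\<Sum>z\<in>ibox n \<inter> layer n m. real m ^ CARD('d) * ?w z)"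
      by (simp add: sum.distrib sum.inter_restrict)
    also have "\<dots> \<le> (\<Sum>z\<in>ibox n. ?K * ?w z) + (\<Sum>z\<in>layer n m. real m ^ CARD('d) * ?w z)"
      using W_nonneg by (intro add_left_mono sum_mono2) auto
    finally show "(\<Sum>z\<in>ibox n. ?b z * ?w z) \<le> (\<Sum>z\<in>ibox n. ?K * ?w z) + (\<Sum>z\<in>layer n m. real m ^ CARD('d) * ?w z)" .
  qed
  finally have main: "\<bar>real m ^ CARD('d) * ?f n \<nu> - (\<Sum>v\<in>ibox (n + 1 - m). ?f m (lshift v \<nu>))\<bar> \<le>
    c * (?K * (\<Sum>z\<in>ibox n. ?w z) + real m ^ CARD('d) * (\<Sum>z\<in>layer n m. ?w z))"
    by (simp only: sum_distrib_left)
  let ?q = "real m ^ CARD('d) * real n ^ CARD('d)"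
  have q: "0 < ?q" using m n by simp
  have d: "cube_density n \<nu> - part_avg n m (cube_density m) \<nu> =
    (real m ^ CARD('d) * ?f n \<nu> - (\<Sum>v\<in>ibox (n + 1 - m). ?f m (lshift v \<nu>))) / ?q"
    using m n by (simp add: cube_density_def sum_divide_distrib[symmetric] field_simps)
  have pm: "real m ^ CARD('d) = real m * real m ^ (CARD('d) - 1)"
    by (cases "CARD('d)") auto
  have "\<bar>cube_density n \<nu> - part_avg n m (cube_density m) \<nu>\<bar> \<le>
    c * (?K * (\<Sum>z\<in>ibox n. ?w z) + real m ^ CARD('d) * (\<Sum>z\<in>layer n m. ?w z)) / ?q"
    unfolding d abs_divide using main q by (simp add: divide_right_mono)
  also have "\<dots> = block_const / real m * avg n (W R) \<nu> + c * lsum R m n \<nu>"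
  proof -
    have "real m ^ (CARD('d) - 1) \<noteq> 0" "real n ^ CARD('d) \<noteq> 0" "real m \<noteq> 0" using m n by auto
    then show ?thesis
      unfolding avg_def lsum_def block_const_def pm by (simp add: field_simps)
  qed
  finally show ?thesis .
qed

lemma integrable_density_sq: "integrable P (\<lambda>\<nu>. (cube_density n \<nu>)\<^sup>2)"
proof -
  have "L2le (\<lambda>\<nu>. (c / real n ^ CARD('d)) * (\<Sum>z\<in>(ibox n :: (int, 'd) vec set). W R (lshift z \<nu>)))
     (\<bar>c / real n ^ CARD('d)\<bar> * (\<Sum>z\<in>(ibox n :: (int, 'd) vec set). L2norm (W R)))"
    by (intro L2le_cmult L2le_sum L2le_shift L2le_W) simp
  then have "L2le (cube_density n) (\<bar>c / real n ^ CARD('d)\<bar> * (\<Sum>z\<in>(ibox n :: (int, 'd) vec set). L2norm (W R)))"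
  proof (rule L2le_dominated)
    fix \<nu> assume \<nu>: "\<nu> \<in> space P"
    \<comment> \<open>Near additivity over the empty family bounds the functional itself.\<close>
    have "\<bar>F (hcube 0 n) \<nu> - (\<Sum>C\<in>{}. F C \<nu>)\<bar> \<le> c * (\<Sum>z\<in>bad R (hcube 0 n) {}. W R (lshift z \<nu>))"
      by (rule F_additive[OF \<nu> bounded_hcube]) auto
    also have "\<dots> \<le> c * (\<Sum>z\<in>ibox n. W R (lshift z \<nu>))"
    proof (intro mult_left_mono sum_mono2)
      show "bad R (hcube 0 n) {} \<subseteq> ibox n" using hcube_cell_meets unfolding bad_def by blast
    qed (use W_nonneg c_nonneg in auto)
    finally have "\<bar>F (hcube 0 n) \<nu>\<bar> / real n ^ CARD('d) \<le> c * (\<Sum>z\<in>ibox n. W R (lshift z \<nu>)) / real n ^ CARD('d)"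
      by (intro divide_right_mono) auto
    then show "\<bar>cube_density n \<nu>\<bar> \<le> c / real n ^ CARD('d) * (\<Sum>z\<in>ibox n. W R (lshift z \<nu>))"
      by (simp add: cube_density_def abs_divide)
  qed simp
  then show ?thesis by (rule L2le_integrable_sq)
qed

lemma L2le_density: "L2le (cube_density n) (L2norm (cube_density n))"
  by (rule L2le_norm) (auto simp: integrable_density_sq)

lemma integrable_density: "integrable P (cube_density n)"
  using L2le_density by (rule L2le_integral)

text \<open>The distance in the mean square between the density at scale \<open>n\<close> and the average of the
  density at scale \<open>m\<close> is at most \<open>rate m + corr m / real n\<close>. The first summand comes from the
  cuts between the cubes of side \<open>m\<close>, the second from the boundary of the cube of side \<open>n\<close>.\<close>

definition rate :: "nat \<Rightarrow> real" where
  "rate m = block_const * L2norm (W R) / real m"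

definition corr :: "nat \<Rightarrow> real" where
  "corr m = c * (real (layer_const TYPE('d) m) * L2norm (W R)) + real (layer_const TYPE('d) m) * L2norm (cube_density m)"

lemma rate_nonneg: "0 \<le> rate m"
  using block_const_nonneg L2norm_nonneg by (simp add: rate_def)

lemma ibox_diff_layer: "ibox n - ibox (n + 1 - m) \<subseteq> (layer n m :: (int, 'd) vec set)"
proof
  fix z :: "(int, 'd) vec" assume z: "z \<in> ibox n - ibox (n + 1 - m)"
  then obtain i where "\<not> (z $ i < int (n + 1 - m))" "0 \<le> z $ i" "z $ i < int n" by (auto simp: ibox_def)
  then have "\<not> z $ i < int n - int m" by linarith
  moreover have "0 \<le> z $ j \<and> z $ j < int n" for j using z by (auto simp: ibox_def)
  moreover from this have "- int m \<le> z $ j \<and> z $ j < int n + int m" for j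
  proof -
    have "0 \<le> z $ j" "z $ j < int n" using z by (auto simp: ibox_def)
    then show ?thesis by linarith
  qed
  ultimately show "z \<in> layer n m" unfolding layer_def by blast
qed

lemma avg_part_avg:
  assumes "m \<ge> 1"
  shows "avg n g \<nu> - part_avg n m g \<nu> = (\<Sum>v\<in>ibox n - ibox (n + 1 - m). g (lshift v \<nu>)) / real n ^ CARD('d)"
proof -
  have "ibox (n + 1 - m) \<subseteq> (ibox n :: (int, 'd) vec set)" using assms by (rule ibox_shorten)
  then show ?thesis by (simp add: avg_def sum_diff diff_divide_distrib)
qed

lemma L2le_density_avg:
  assumes "m \<ge> 1" "n \<ge> 1"
  shows "L2le (\<lambda>\<nu>. cube_density n \<nu> - avg n (cube_density m) \<nu>) (rate m + corr m / real n)"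
proof -
  have 1: "L2le (\<lambda>\<nu>. block_const / real m * avg n (W R) \<nu> + c * lsum R m n \<nu>)
     (\<bar>block_const / real m\<bar> * L2norm (W R) + \<bar>c\<bar> * (real (layer_const TYPE('d) m) * L2norm (W R) / real n))"
    by (intro L2le_add L2le_cmult L2le_avg L2le_W L2le_lsum assms)
  have 2: "L2le (\<lambda>\<nu>. cube_density n \<nu> - part_avg n m (cube_density m) \<nu>)
     (\<bar>block_const / real m\<bar> * L2norm (W R) + \<bar>c\<bar> * (real (layer_const TYPE('d) m) * L2norm (W R) / real n))"
  proof (rule L2le_dominated[OF 1])
    show "(\<lambda>\<nu>. cube_density n \<nu> - part_avg n m (cube_density m) \<nu>) \<in> borel_measurable P"
      by (rule borel_measurable_diff[OF density_measurable
          borel_measurable_divide[OF borel_measurable_sum borel_measurable_const]])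
        (rule shift_comp_measurable[OF density_measurable])
  qed (rule density_blocks[OF _ assms])
  have 3: "L2le (\<lambda>\<nu>. - 1 * ((\<Sum>v\<in>ibox n - ibox (n + 1 - m). cube_density m (lshift v \<nu>)) / real n ^ CARD('d)))
     (\<bar>- 1\<bar> * (real (layer_const TYPE('d) m) * L2norm (cube_density m) / real n))"
    by (rule L2le_cmult) (rule L2le_subset_sum[OF L2le_density assms(2) ibox_diff_layer])
  have "(\<lambda>\<nu>. cube_density n \<nu> - avg n (cube_density m) \<nu>) = (\<lambda>\<nu>. (cube_density n \<nu> - part_avg n m (cube_density m) \<nu>)
     + - 1 * ((\<Sum>v\<in>ibox n - ibox (n + 1 - m). cube_density m (lshift v \<nu>)) / real n ^ CARD('d)))"
    using avg_part_avg[OF assms(1), of n "cube_density m"] by (auto simp: fun_eq_iff algebra_simps)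
  moreover have "(\<bar>block_const / real m\<bar> * L2norm (W R) + \<bar>c\<bar> * (real (layer_const TYPE('d) m) * L2norm (W R) / real n))
     + (\<bar>- 1\<bar> * (real (layer_const TYPE('d) m) * L2norm (cube_density m) / real n)) = rate m + corr m / real n"
    using block_const_nonneg c_nonneg by (simp add: rate_def corr_def add_divide_distrib)
  ultimately show ?thesis using L2le_add[OF 2 3] by simp
qed

lemma expectation_density_close:
  assumes "m \<ge> 1" "n \<ge> 1"
  shows "\<bar>(\<integral>\<nu>. cube_density n \<nu> \<partial>P) - (\<integral>\<nu>. cube_density m \<nu> \<partial>P)\<bar> \<le> rate m + corr m / real n"
proof -
  note L = L2le_density_avg[OF assms]
  have "(\<integral>\<nu>. cube_density n \<nu> \<partial>P) - (\<integral>\<nu>. cube_density m \<nu> \<partial>P) = (\<integral>\<nu>. cube_density n \<nu> - avg n (cube_density m) \<nu> \<partial>P)"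
    using integral_avg[OF integrable_density assms(2), of m] integrable_density integrable_avg by simp
  also have "\<bar>\<dots>\<bar> \<le> (\<integral>\<nu>. \<bar>cube_density n \<nu> - avg n (cube_density m) \<nu>\<bar> \<partial>P)" by (rule integral_abs_bound)
  also have "\<dots> \<le> rate m + corr m / real n" by (rule L2le_integral(2)[OF L])
  finally show ?thesis .
qed

definition mid :: "nat \<Rightarrow> nat \<Rightarrow> 's \<Rightarrow> real" where
  "mid m k \<nu> = (1 / 2) * cube_density m \<nu> + (1 / 2) * cube_density k \<nu>"

lemma L2le_mid: "L2le (mid m k) (L2norm (mid m k))"
proof -
  have "L2le (mid m k) (\<bar>1 / 2\<bar> * L2norm (cube_density m) + \<bar>1 / 2\<bar> * L2norm (cube_density k))"
    unfolding mid_def[abs_def] by (intro L2le_add L2le_cmult L2le_density)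
  then show ?thesis by (intro L2le_norm) (auto simp: L2le_def)
qed

text \<open>For large \<open>n\<close>, the density at scale \<open>n\<close> is close to the averages of the densities at
  scales \<open>m\<close> and \<open>k\<close>, hence to the average of their midpoint, and averaging does not increase
  the norm. Thus the midpoint cannot have a much smaller norm than the densities.\<close>

lemma L2norm_density_mid:
  assumes "m \<ge> 1" "k \<ge> 1" "n \<ge> 1"
  shows "L2norm (cube_density n) \<le> L2norm (mid m k) + (rate m + rate k) / 2 + (corr m + corr k) / 2 / real n"
proof -
  have "L2le (\<lambda>\<nu>. avg n (mid m k) \<nu> + ((1 / 2) * (cube_density n \<nu> - avg n (cube_density m) \<nu>) + (1 / 2) * (cube_density n \<nu> - avg n (cube_density k) \<nu>)))
     (L2norm (mid m k) + (\<bar>1 / 2\<bar> * (rate m + corr m / real n) + \<bar>1 / 2\<bar> * (rate k + corr k / real n)))"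
    by (intro L2le_add L2le_avg L2le_mid L2le_cmult L2le_density_avg assms)
  moreover have "avg n (mid m k) \<nu> + ((1 / 2) * (cube_density n \<nu> - avg n (cube_density m) \<nu>) + (1 / 2) * (cube_density n \<nu> - avg n (cube_density k) \<nu>)) = cube_density n \<nu>" for \<nu>
  proof -
    have "avg n (mid m k) \<nu> = (1 / 2) * avg n (cube_density m) \<nu> + (1 / 2) * avg n (cube_density k) \<nu>"
      by (simp add: avg_def mid_def sum.distrib sum_distrib_left[symmetric] sum_divide_distrib[symmetric]
          add_divide_distrib)
    then show ?thesis by argo
  qed
  ultimately have "L2le (cube_density n) (L2norm (mid m k) + (\<bar>1 / 2\<bar> * (rate m + corr m / real n) + \<bar>1 / 2\<bar> * (rate k + corr k / real n)))"
    by simp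
  from L2norm_le[OF this] show ?thesis by (simp add: add_divide_distrib)
qed

lemma rate_tendsto: "rate \<longlonglongrightarrow> 0"
  unfolding rate_def[abs_def] by (rule lim_const_over_n)

text \<open>The argument behind von Neumann's mean ergodic theorem. The norms of the densities
  approach the infimum \<open>a\<close>, and by \<open>L2norm_density_mid\<close> the norms of the midpoints are hardly
  smaller; by the parallelogram identity the densities are then close to each other.\<close>

lemma L2_Cauchy:
  assumes e: "e > 0"
  shows "\<exists>M\<ge>1. \<forall>m\<ge>M. \<forall>k\<ge>M. (\<integral>\<nu>. (cube_density m \<nu> - cube_density k \<nu>)\<^sup>2 \<partial>P) \<le> e"
proof -
  let ?N = "\<lambda>m. L2norm (cube_density m)"
  define a where "a = Inf ((\<lambda>m. ?N m + rate m) ` {1..})"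
  have bdd: "bdd_below ((\<lambda>m. ?N m + rate m) ` {1..})"
    by (rule bdd_belowI[of _ 0]) (auto intro: add_nonneg_nonneg L2norm_nonneg rate_nonneg)
  have a_le: "a \<le> ?N m + rate m" if "m \<ge> 1" for m
    unfolding a_def by (rule cInf_lower[OF _ bdd]) (use that in auto)
  have a0: "0 \<le> a"
    unfolding a_def by (rule cInf_greatest) (auto intro: add_nonneg_nonneg L2norm_nonneg rate_nonneg)
  have mid_ge: "a - (rate m + rate k) / 2 \<le> L2norm (mid m k)" if mk: "m \<ge> 1" "k \<ge> 1" for m k
  proof -
    have "a \<le> L2norm (mid m k) + (rate m + rate k) / 2 + (corr m + corr k) / 2 / real n + rate n" if "n \<ge> 1" for n
      using a_le[OF that] L2norm_density_mid[OF mk that] by linarith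
    moreover have "(\<lambda>n. L2norm (mid m k) + (rate m + rate k) / 2 + (corr m + corr k) / 2 / real n + rate n)
       \<longlonglongrightarrow> L2norm (mid m k) + (rate m + rate k) / 2 + 0"
      by (intro tendsto_add[OF tendsto_const_over_n rate_tendsto])
    ultimately have "a \<le> L2norm (mid m k) + (rate m + rate k) / 2 + 0"
      by (intro LIMSEQ_le_const) (auto intro!: exI[of _ 1])
    then show ?thesis by simp
  qed
  have up: "\<exists>M. \<forall>n\<ge>M. ?N n \<le> a + t" if t: "t > 0" for t
  proof -
    have "Inf ((\<lambda>m. ?N m + rate m) ` {1..}) < a + t" using t by (simp add: a_def)
    then obtain x where "x \<in> (\<lambda>m. ?N m + rate m) ` {1..}" "x < a + t"
      using cInf_lessD[of "(\<lambda>m. ?N m + rate m) ` {1..}" "a + t"] by auto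
    then obtain m where m: "m \<ge> 1" "?N m + rate m < a + t" by auto
    have lim: "(\<lambda>n. (?N m + rate m) + corr m / real n) \<longlonglongrightarrow> ?N m + rate m"
      by (rule tendsto_const_over_n)
    have "eventually (\<lambda>n. (?N m + rate m) + corr m / real n < a + t) sequentially"
      using order_tendstoD(2)[OF lim m(2)] .
    then obtain M where M: "\<forall>n\<ge>M. (?N m + rate m) + corr m / real n < a + t"
      by (auto simp: eventually_sequentially)
    have "?N n \<le> (?N m + rate m) + corr m / real n" if "n \<ge> 1" for n
    proof -
      have "L2le (\<lambda>\<nu>. (cube_density n \<nu> - avg n (cube_density m) \<nu>) + avg n (cube_density m) \<nu>) ((rate m + corr m / real n) + ?N m)"
        by (intro L2le_add L2le_density_avg L2le_avg L2le_density m that)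
      then have "L2le (cube_density n) ((rate m + corr m / real n) + ?N m)" by simp
      from L2norm_le[OF this] show ?thesis by linarith
    qed
    then show ?thesis using M by (intro exI[of _ "max M 1"]) (fastforce intro: less_imp_le order_le_less_trans)
  qed
  \<comment> \<open>Chosen such that the final bound \<open>16 * t * (a + 1)\<close> is at most \<open>e\<close>.\<close>
  define t where "t = min 1 (e / (16 * (a + 1)))"
  have t: "0 < t" "t \<le> 1" "16 * t * (a + 1) \<le> e"
  proof -
    show "0 < t" "t \<le> 1" using e a0 by (auto simp: t_def)
    have "t \<le> e / (16 * (a + 1))" by (simp add: t_def)
    then show "16 * t * (a + 1) \<le> e" using a0 by (simp add: field_simps)
  qed
  obtain M1 where M1: "\<And>n. n \<ge> M1 \<Longrightarrow> ?N n \<le> a + t" using up[OF t(1)] by blast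
  obtain M2 where M2: "\<And>n. n \<ge> M2 \<Longrightarrow> rate n < t"
    using order_tendstoD(2)[OF rate_tendsto t(1)] by (auto simp: eventually_sequentially)
  show ?thesis
  proof (intro exI[of _ "max 1 (max M1 M2)"] conjI allI impI)
    fix m k assume mk: "max 1 (max M1 M2) \<le> m" "max 1 (max M1 M2) \<le> k"
    have n1: "(?N m)\<^sup>2 \<le> (a + t)\<^sup>2" "(?N k)\<^sup>2 \<le> (a + t)\<^sup>2"
      using M1[of m] M1[of k] mk by (auto intro!: power_mono L2norm_nonneg)
    have r: "rate m < t" "rate k < t" using M2[of m] M2[of k] mk by auto
    have "a - (rate m + rate k) / 2 \<le> L2norm (mid m k)" by (rule mid_ge) (use mk in auto)
    then have "a - t \<le> L2norm (mid m k)" using r by argo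
    then have "max 0 (a - t) \<le> L2norm (mid m k)" using L2norm_nonneg[of "mid m k"] by simp
    then have n2: "(max 0 (a - t))\<^sup>2 \<le> (L2norm (mid m k))\<^sup>2" by (rule power_mono) simp
    \<comment> \<open>The parallelogram identity, solved for the difference.\<close>
    have par: "(x - y)\<^sup>2 = 2 * x\<^sup>2 + 2 * y\<^sup>2 - 4 * ((1 / 2) * x + (1 / 2) * y)\<^sup>2" for x y :: real
      by (simp add: power2_eq_square algebra_simps)
    have "(\<integral>\<nu>. (cube_density m \<nu> - cube_density k \<nu>)\<^sup>2 \<partial>P) = 2 * (?N m)\<^sup>2 + 2 * (?N k)\<^sup>2 - 4 * (L2norm (mid m k))\<^sup>2"
    proof -
      have "integrable P (\<lambda>\<nu>. (mid m k \<nu>)\<^sup>2)" by (rule L2le_integrable_sq[OF L2le_mid])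
      then show ?thesis
        unfolding L2norm_sq par mid_def using integrable_density_sq by simp
    qed
    also have "\<dots> \<le> 4 * (a + t)\<^sup>2 - 4 * (max 0 (a - t))\<^sup>2" using n1 n2 by simp
    also have "\<dots> \<le> 16 * t * (a + t)"
    proof (cases "a \<ge> t")
      case True
      then show ?thesis using t(1) by (simp add: power2_eq_square algebra_simps)
    next
      case False
      then have "(a + t)\<^sup>2 \<le> (a + t) * (2 * t)" using a0 t by (auto simp: power2_eq_square intro!: mult_left_mono)
      moreover have "0 \<le> t * (a + t)" using a0 t by simp
      moreover have "16 * t * (a + t) = 4 * ((a + t) * (2 * t)) + 8 * (t * (a + t))"
        by (simp add: algebra_simps)
      ultimately have "4 * (a + t)\<^sup>2 \<le> 16 * t * (a + t)" by linarith
      then show ?thesis using False by (simp add: max_def)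
    qed
    also have "\<dots> \<le> 16 * t * (a + 1)" using t by (intro mult_left_mono) auto
    also have "\<dots> \<le> e" by (rule t(3))
    finally show "(\<integral>\<nu>. (cube_density m \<nu> - cube_density k \<nu>)\<^sup>2 \<partial>P) \<le> e" .
  qed simp
qed

lemma F_near_cube:
  assumes \<nu>: "\<nu> \<in> space P" and B: "bounded B" "C \<subseteq> B"
    and k: "\<And>x i. x \<in> B \<Longrightarrow> - real k \<le> x $ i \<and> x $ i \<le> real n + real k"
    and C: "\<And>x. x \<in> B \<Longrightarrow> (\<And>i. real k \<le> x $ i \<and> x $ i \<le> real n - real k) \<Longrightarrow> x \<in> C"
  shows "\<bar>F B \<nu> - F C \<nu>\<bar> / real n ^ CARD('d) \<le> c * lsum R (k + R + 2) n \<nu>"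
proof -
  have "\<bar>F B \<nu> - (\<Sum>C\<in>{C}. F C \<nu>)\<bar> \<le> c * (\<Sum>z\<in>bad R B {C}. W R (lshift z \<nu>))"
    by (rule F_additive[OF \<nu> B(1)]) (use B(2) in \<open>auto simp: disjoint_def\<close>)
  also have "\<dots> \<le> c * (\<Sum>z\<in>layer n (k + R + 2). W R (lshift z \<nu>))"
    by (intro mult_left_mono[OF _ c_nonneg] sum_mono2 bad_layer[OF k C]) (auto simp: W_nonneg)
  finally have "\<bar>F B \<nu> - F C \<nu>\<bar> / real n ^ CARD('d) \<le> c * (\<Sum>z\<in>layer n (k + R + 2). W R (lshift z \<nu>)) / real n ^ CARD('d)"
    by (intro divide_right_mono) auto
  then show ?thesis by (simp add: lsum_def)
qed

text \<open>A cube and its translate by \<open>v\<close> agree away from a boundary layer of bounded width.\<close>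

lemma density_shift:
  assumes \<nu>: "\<nu> \<in> space P" and g: "good \<nu>"
  shows "(\<lambda>n. cube_density n (\<theta> v \<nu>) - cube_density n \<nu>) \<longlonglongrightarrow> 0"
proof -
  obtain k :: nat where k: "norm v < real k" using reals_Archimedean2 by blast
  have vi: "\<bar>v $ i\<bar> < real k" for i using component_le_norm_cart[of v i] k by linarith
  let ?l = "\<lambda>n. c * lsum R (k + R + 2) n \<nu>"
  have bd: "norm (cube_density n (\<theta> v \<nu>) - cube_density n \<nu>) \<le> ?l n + ?l n" for n
  proof -
    let ?H = "hcube 0 n :: (real, 'd) vec set" and ?H' = "hcube (- v) n"
    let ?B = "?H \<union> ?H'"
    have im: "(\<lambda>x. x + v) ` ?H' = ?H"
    proof (intro equalityI subsetI)
      fix x :: "(real, 'd) vec" assume x: "x \<in> ?H"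
      then show "x \<in> (\<lambda>x. x + v) ` ?H'"
        by (intro image_eqI[of _ _ "x - v"]) (auto simp: hcube_def)
    next
      fix x assume "x \<in> (\<lambda>x. x + v) ` ?H'"
      then obtain y where y: "y \<in> ?H'" "x = y + v" by auto
      have "0 \<le> x $ i \<and> x $ i < real n" for i
      proof -
        have "- v $ i \<le> y $ i" "y $ i < - v $ i + real n" using y(1) by (auto simp: hcube_def)
        then show ?thesis using y(2) by auto
      qed
      then show "x \<in> ?H" by (simp add: hcube_def)
    qed
    have e: "F ?H (\<theta> v \<nu>) = F ?H' \<nu>" using F_covariant[OF \<nu> bounded_hcube, of v "- v" n] im by simp
    have kB: "- real k \<le> x $ i \<and> x $ i \<le> real n + real k" if "x \<in> ?B" for x i
      using that
    proof
      assume "x \<in> ?H"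
      then have "0 \<le> x $ i" "x $ i < real n" by (auto simp: hcube_def)
      then show ?thesis by auto
    next
      assume "x \<in> ?H'"
      then have "- v $ i \<le> x $ i" "x $ i < - v $ i + real n" by (auto simp: hcube_def)
      then show ?thesis using vi[of i] by linarith
    qed
    have inH': "x \<in> ?H'" if x: "x \<in> ?B" "\<And>i. real k \<le> x $ i \<and> x $ i \<le> real n - real k" for x
      using x(1)
    proof
      assume H: "x \<in> ?H"
      have "- v $ i \<le> x $ i \<and> x $ i < - v $ i + real n" for i
        using x(2)[of i] vi[of i] by linarith
      then show ?thesis by (simp add: hcube_def)
    qed
    have inH: "x \<in> ?H" if x: "x \<in> ?B" "\<And>i. real k \<le> x $ i \<and> x $ i \<le> real n - real k" for x
      using x(1)
    proof
      assume H: "x \<in> ?H'"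
      have "0 \<le> x $ i \<and> x $ i < real n" for i
      proof -
        have "x $ i < - v $ i + real n" using H by (auto simp: hcube_def)
        then show ?thesis using x(2)[of i] vi[of i] by linarith
      qed
      then show ?thesis by (simp add: hcube_def)
    qed
    have 1: "\<bar>F ?B \<nu> - F ?H' \<nu>\<bar> / real n ^ CARD('d) \<le> ?l n"
      by (rule F_near_cube[OF \<nu> _ _ kB inH']) (auto simp: bounded_hcube)
    have 2: "\<bar>F ?B \<nu> - F ?H \<nu>\<bar> / real n ^ CARD('d) \<le> ?l n"
      by (rule F_near_cube[OF \<nu> _ _ kB inH]) (auto simp: bounded_hcube)
    have "\<bar>F ?H' \<nu> - F ?H \<nu>\<bar> / real n ^ CARD('d) \<le> (\<bar>F ?B \<nu> - F ?H' \<nu>\<bar> + \<bar>F ?B \<nu> - F ?H \<nu>\<bar>) / real n ^ CARD('d)"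
      by (intro divide_right_mono) auto
    also have "\<dots> \<le> ?l n + ?l n" using 1 2 by (simp add: add_divide_distrib)
    finally show ?thesis
      by (simp add: cube_density_def e abs_divide flip: diff_divide_distrib)
  qed
  have "(\<lambda>n. lsum R (k + R + 2) n \<nu>) \<longlonglongrightarrow> 0" using g by (simp add: good_iff)
  then have "(\<lambda>n. ?l n + ?l n) \<longlonglongrightarrow> c * 0 + c * 0" by (intro tendsto_intros)
  then have lim: "(\<lambda>n. ?l n + ?l n) \<longlonglongrightarrow> 0" by simp
  show ?thesis
    by (rule Lim_null_comparison[OF _ lim]) (rule always_eventually, rule allI, rule bd)
qed

text \<open>A rapidly converging subsequence converges almost surely, and its limit is invariant by
  \<open>density_shift\<close>, hence constant. Fatou's lemma shows that the full sequence converges to this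
  constant in the mean square.\<close>

lemma L2_limit:
  "\<exists>b. \<forall>e>0. \<exists>M. \<forall>m\<ge>M. L2le (\<lambda>\<nu>. cube_density m \<nu> - b) e"
proof -
  let ?g = cube_density
  have "\<forall>j. \<exists>M\<ge>1. \<forall>m\<ge>M. \<forall>k\<ge>M. (\<integral>\<nu>. (?g m \<nu> - ?g k \<nu>)\<^sup>2 \<partial>P) \<le> ((1 / 2) ^ j)\<^sup>2"
    using L2_Cauchy by simp
  then obtain M where M: "\<And>j m k. m \<ge> M j \<Longrightarrow> k \<ge> M j \<Longrightarrow> (\<integral>\<nu>. (?g m \<nu> - ?g k \<nu>)\<^sup>2 \<partial>P) \<le> ((1 / 2) ^ j)\<^sup>2"
    by metis
  \<comment> \<open>A monotone sequence above \<open>M\<close> that tends to infinity.\<close>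
  define r where "r = (\<lambda>j. \<Sum>i\<le>j. M i + 1)"
  have rM: "M j \<le> r j" for j 
  proof -
    have "M j + 1 \<le> (\<Sum>i\<le>j. M i + 1)" by (rule member_le_sum[of j "{..j}" "\<lambda>i. M i + 1"]) auto
    then show ?thesis by (simp add: r_def)
  qed
  have rS: "r j \<le> r (Suc j)" for j by (simp add: r_def)
  have rj: "j \<le> r j" for j by (induction j) (auto simp: r_def)
  have diff: "L2le (\<lambda>\<nu>. ?g m \<nu> - ?g k \<nu>) ((1 / 2) ^ j)" if "m \<ge> M j" "k \<ge> M j" for m k j
  proof -
    have "L2le (\<lambda>\<nu>. ?g m \<nu> + - 1 * ?g k \<nu>) (L2norm (?g m) + \<bar>- 1\<bar> * L2norm (?g k))"
      by (intro L2le_add L2le_cmult L2le_density)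
    then show ?thesis using M[OF that] by (simp add: L2le_def)
  qed
  have "AE \<nu> in P. summable (\<lambda>j. \<bar>?g (r (Suc j)) \<nu> - ?g (r j) \<nu>\<bar>)"
  proof (rule AE_summable_of_integral)
    have d: "L2le (\<lambda>\<nu>. ?g (r (Suc j)) \<nu> - ?g (r j) \<nu>) ((1 / 2) ^ j)" for j
      by (rule diff) (use rM[of j] rS[of j] in auto)
    show "integrable P (\<lambda>\<nu>. \<bar>?g (r (Suc j)) \<nu> - ?g (r j) \<nu>\<bar>)" for j
      using L2le_integral(1)[OF d] by (rule integrable_abs)
    show "(\<integral>\<nu>. \<bar>?g (r (Suc j)) \<nu> - ?g (r j) \<nu>\<bar> \<partial>P) \<le> (1 / 2) ^ j" for j
      by (rule L2le_integral(2)[OF d])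
    show "summable (\<lambda>j. (1 / 2) ^ j :: real)" by (rule summable_geometric) simp
  qed simp
  then have conv: "AE \<nu> in P. convergent (\<lambda>j. ?g (r j) \<nu>)"
  proof eventually_elim
    case (elim \<nu>)
    then have "summable (\<lambda>j. ?g (r (Suc j)) \<nu> - ?g (r j) \<nu>)" by (rule summable_rabs_cancel)
    then have "convergent (\<lambda>n. \<Sum>j<n. ?g (r (Suc j)) \<nu> - ?g (r j) \<nu>)" by (simp add: summable_iff_convergent)
    then have "convergent (\<lambda>n. ?g (r n) \<nu> - ?g (r 0) \<nu>)"
      by (simp add: sum_lessThan_telescope[of "\<lambda>j. ?g (r j) \<nu>"])
    then obtain l where "(\<lambda>n. ?g (r n) \<nu> - ?g (r 0) \<nu>) \<longlonglongrightarrow> l" by (auto simp: convergent_def)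
    then have "(\<lambda>n. ?g (r n) \<nu> - ?g (r 0) \<nu> + ?g (r 0) \<nu>) \<longlonglongrightarrow> l + ?g (r 0) \<nu>" by (intro tendsto_intros)
    then show ?case by (auto simp: convergent_def)
  qed
  \<comment> \<open>The limit is set to zero outside the invariant set of good points, so that it is invariant
    everywhere and not only almost surely.\<close>
  define X where "X = (\<lambda>\<nu>. if good \<nu> then limsup (\<lambda>j. ereal (?g (r j) \<nu>)) else 0)"
  have rlim: "filterlim r sequentially sequentially"
    by (rule filterlim_at_top_mono[OF filterlim_ident]) (use rj in auto)
  have "\<exists>b. AE \<nu> in P. X \<nu> = ereal b"
  proof (rule invariant_constant)
    show "X \<in> borel_measurable P" unfolding X_def by measurable
    fix v \<nu> assume \<nu>: "\<nu> \<in> space P"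
    show "X (\<theta> v \<nu>) = X \<nu>"
    proof (cases "good \<nu>")
      case True
      have "(\<lambda>j. ?g (r j) (\<theta> v \<nu>) - ?g (r j) \<nu>) \<longlonglongrightarrow> 0"
        using density_shift[OF \<nu> True] rlim by (rule filterlim_compose)
      then have "(\<lambda>j. ereal (?g (r j) (\<theta> v \<nu>) - ?g (r j) \<nu>)) \<longlonglongrightarrow> ereal 0" by simp
      then have "limsup (\<lambda>j. ereal (?g (r j) (\<theta> v \<nu>) - ?g (r j) \<nu>) + ereal (?g (r j) \<nu>)) = ereal 0 + limsup (\<lambda>j. ereal (?g (r j) \<nu>))"
        by (rule ereal_limsup_lim_add) simp
      then show ?thesis using True \<nu> by (simp add: X_def good_shift_iff zero_ereal_def[symmetric])
    next
      case False
      then show ?thesis using \<nu> by (simp add: X_def good_shift_iff)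
    qed
  next
    show "AE \<nu> in P. \<bar>X \<nu>\<bar> \<noteq> \<infinity>"
      using conv
    proof eventually_elim
      case (elim \<nu>)
      then obtain l where "(\<lambda>j. ?g (r j) \<nu>) \<longlonglongrightarrow> l" by (auto simp: convergent_def)
      then have "limsup (\<lambda>j. ereal (?g (r j) \<nu>)) = ereal l" by (intro lim_imp_Limsup) auto
      then show ?case by (simp add: X_def)
    qed
  qed
  then obtain b where b: "AE \<nu> in P. X \<nu> = ereal b" ..
  have lim_b: "AE \<nu> in P. (\<lambda>j. ?g (r j) \<nu>) \<longlonglongrightarrow> b"
    using b conv AE_good
  proof eventually_elim
    case (elim \<nu>)
    then obtain l where l: "(\<lambda>j. ?g (r j) \<nu>) \<longlonglongrightarrow> l" by (auto simp: convergent_def)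
    then have "limsup (\<lambda>j. ereal (?g (r j) \<nu>)) = ereal l" by (intro lim_imp_Limsup) auto
    then have "l = b" using elim by (simp add: X_def)
    then show ?case using l by simp
  qed
  show ?thesis
  proof (intro exI[of _ b] allI impI)
    fix e :: real assume e: "e > 0"
    obtain j where j: "(1 / 2) ^ j < e" using real_arch_pow_inv[OF e, of "1 / 2"] by auto
    have "L2le (\<lambda>\<nu>. ?g m \<nu> - b) e" if m: "m \<ge> M j" for m
    proof -
      have "(\<integral>\<^sup>+\<nu>. ennreal ((?g m \<nu> - b)\<^sup>2) \<partial>P) \<le> (\<integral>\<^sup>+\<nu>. liminf (\<lambda>i. ennreal ((?g m \<nu> - ?g (r i) \<nu>)\<^sup>2)) \<partial>P)"
      proof (rule nn_integral_mono_AE)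
        show "AE \<nu> in P. ennreal ((?g m \<nu> - b)\<^sup>2) \<le> liminf (\<lambda>i. ennreal ((?g m \<nu> - ?g (r i) \<nu>)\<^sup>2))"
          using lim_b
        proof eventually_elim
          case (elim \<nu>)
          have "(\<lambda>i. ennreal ((?g m \<nu> - ?g (r i) \<nu>)\<^sup>2)) \<longlonglongrightarrow> ennreal ((?g m \<nu> - b)\<^sup>2)"
            by (intro tendsto_intros elim)
          then show ?case by (subst lim_imp_Liminf) auto
        qed
      qed
      also have "\<dots> \<le> liminf (\<lambda>i. \<integral>\<^sup>+\<nu>. ennreal ((?g m \<nu> - ?g (r i) \<nu>)\<^sup>2) \<partial>P)"
        by (rule nn_integral_liminf) measurable
      also have "\<dots> \<le> ennreal (e\<^sup>2)"
      proof (rule Liminf_le)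
        show "\<forall>\<^sub>F i in sequentially. (\<integral>\<^sup>+\<nu>. ennreal ((?g m \<nu> - ?g (r i) \<nu>)\<^sup>2) \<partial>P) \<le> ennreal (e\<^sup>2)"
          using eventually_ge_at_top[of "M j"]
        proof eventually_elim
          case (elim i)
          have d: "L2le (\<lambda>\<nu>. ?g m \<nu> - ?g (r i) \<nu>) e"
            by (rule L2le_mono[OF diff[OF m]]) (use elim rj[of i] j in auto)
          have "(\<integral>\<^sup>+\<nu>. ennreal ((?g m \<nu> - ?g (r i) \<nu>)\<^sup>2) \<partial>P) = ennreal (\<integral>\<nu>. (?g m \<nu> - ?g (r i) \<nu>)\<^sup>2 \<partial>P)"
            using L2le_integrable_sq[OF d] by (rule nn_integral_eq_integral) simp
          then show ?case using d by (simp add: L2le_def ennreal_leI)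
        qed
      qed simp
      finally have le: "(\<integral>\<^sup>+\<nu>. ennreal ((?g m \<nu> - b)\<^sup>2) \<partial>P) \<le> ennreal (e\<^sup>2)" .
      have i: "integrable P (\<lambda>\<nu>. (?g m \<nu> - b)\<^sup>2)"
        by (rule integrableI_nonneg) (use le in \<open>auto intro: order_le_less_trans\<close>)
      then have "ennreal (\<integral>\<nu>. (?g m \<nu> - b)\<^sup>2 \<partial>P) \<le> ennreal (e\<^sup>2)"
        using le by (subst nn_integral_eq_integral[symmetric]) auto
      then show ?thesis using i e by (simp add: L2le_def)
    qed
    then show "\<exists>M. \<forall>m\<ge>M. L2le (\<lambda>\<nu>. ?g m \<nu> - b) e" by blast
  qed
qed

text \<open>By \<open>density_blocks\<close>, the distance of the density at scale \<open>n\<close> to \<open>b\<close> is at most the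
  average over the cube of side \<open>n\<close> of a function \<open>h\<close>, up to boundary layers. The expectation of
  \<open>h\<close> is small if \<open>m\<close> is large, so the maximal inequality bounds the probability that one of
  these averages is not small.\<close>

lemma AE_density_limit:
  assumes b: "\<And>e. e > 0 \<Longrightarrow> \<exists>M. \<forall>m\<ge>M. L2le (\<lambda>\<nu>. cube_density m \<nu> - b) e"
  shows "AE \<nu> in P. (\<lambda>n. cube_density n \<nu>) \<longlonglongrightarrow> b"
proof -
  let ?g = cube_density
  let ?X = "\<lambda>\<nu>. limsup (\<lambda>n. ereal \<bar>?g n \<nu> - b\<bar>)"
  define w where "w = (\<integral>\<nu>. W R \<nu> \<partial>P)"
  have w0: "0 \<le> w" unfolding w_def by (rule integral_nonneg_AE) (simp add: W_nonneg)
  have iW: "integrable P (W R)" using L2le_W by (rule L2le_integral)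
  have small: "measure P {\<nu> \<in> space P. good \<nu> \<and> ?X \<nu> > ereal l} = 0" if l: "l > 0" for l
  proof -
    have "measure P {\<nu> \<in> space P. good \<nu> \<and> ?X \<nu> > ereal l} \<le> e" if e: "e > 0" for e
    proof -
      \<comment> \<open>Both summands of \<open>h\<close> will have expectation at most \<open>t\<close>; the maximal inequality then
        yields exactly \<open>e\<close>.\<close>
      define t where "t = e * l / 2 ^ CARD('d) / 2"
      have t: "t > 0" "2 ^ CARD('d) * (t + t) / l = e" using e l by (auto simp: t_def)
      obtain M where M: "\<And>m. m \<ge> M \<Longrightarrow> L2le (\<lambda>\<nu>. ?g m \<nu> - b) t" using b[OF t(1)] by blast
      have "(\<lambda>m. block_const * w / real m) \<longlonglongrightarrow> 0" by (rule lim_const_over_n)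
      from order_tendstoD(2)[OF this t(1)] obtain M' where
        M': "\<And>m. m \<ge> M' \<Longrightarrow> block_const * w / real m < t" by (auto simp: eventually_sequentially)
      define m where "m = max 1 (max M M')"
      have m: "m \<ge> 1" "m \<ge> M" "m \<ge> M'" by (auto simp: m_def)
      define h where "h = (\<lambda>\<nu>. \<bar>?g m \<nu> - b\<bar> + block_const / real m * W R \<nu>)"
      have ig: "integrable P (\<lambda>\<nu>. ?g m \<nu> - b)" using L2le_integral(1)[OF M[OF m(2)]] .
      have ih: "integrable P h" unfolding h_def using ig iW by simp
      have h0: "0 \<le> h \<nu>" for \<nu> unfolding h_def using W_nonneg block_const_nonneg by simp
      have "(\<integral>\<nu>. h \<nu> \<partial>P) = (\<integral>\<nu>. \<bar>?g m \<nu> - b\<bar> \<partial>P) + block_const / real m * w"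
        unfolding h_def w_def using ig iW by simp
      also have "\<dots> \<le> t + t"
        using L2le_integral(2)[OF M[OF m(2)]] M'[OF m(3)] by simp
      finally have hI: "(\<integral>\<nu>. h \<nu> \<partial>P) \<le> t + t" .
      have sub: "{\<nu> \<in> space P. good \<nu> \<and> ?X \<nu> > ereal l} \<subseteq> {\<nu> \<in> space P. \<exists>n\<ge>1. avg n h \<nu> > l}"
      proof (rule subsetI, rule ccontr)
        fix \<nu> assume "\<nu> \<in> {\<nu> \<in> space P. good \<nu> \<and> ?X \<nu> > ereal l}"
          and n: "\<nu> \<notin> {\<nu> \<in> space P. \<exists>n\<ge>1. avg n h \<nu> > l}"
        then have \<nu>: "\<nu> \<in> space P" "good \<nu>" "?X \<nu> > ereal l" by auto
        have h_le: "avg n h \<nu> \<le> l" if "n \<ge> 1" for n using n \<nu> that by (auto simp: not_less)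
        let ?D = "\<bar>b\<bar> * real (layer_const TYPE('d) m)"
        have bd: "\<bar>?g n \<nu> - b\<bar> \<le> l + (c * lsum R m n \<nu> + ?D / real n)" if n: "n \<ge> 1" for n
        proof -
          let ?I = "ibox (n + 1 - m) :: (int, 'd) vec set" and ?J = "ibox n :: (int, 'd) vec set"
          let ?q = "real n ^ CARD('d)"
          have q: "0 < ?q" using n by simp
          have IJ: "?I \<subseteq> ?J" using m(1) by (rule ibox_shorten)
          have cJI: "real (card (?J - ?I)) / ?q \<le> real (layer_const TYPE('d) m) / real n"
          proof -
            have "card (?J - ?I) \<le> layer_const TYPE('d) m * n ^ (CARD('d) - 1)"
              using card_mono[OF finite_layer ibox_diff_layer[of n m]] card_layer_le[OF n, where w = m and 'd = 'd] by linarith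
            then have "real (card (?J - ?I)) \<le> real (layer_const TYPE('d) m * n ^ (CARD('d) - 1))" by (rule of_nat_mono)
            then show ?thesis using n by (cases "CARD('d)") (auto simp: field_simps)
          qed
          \<comment> \<open>The average runs over fewer than \<open>n ^ CARD('d)\<close> corners, which leaves a multiple of
            \<open>b\<close>.\<close>
          have "part_avg n m (?g m) \<nu> - b = (\<Sum>v\<in>?I. ?g m (lshift v \<nu>) - b) / ?q - b * (real (card (?J - ?I)) / ?q)"
          proof -
            have "real (card ?J) = ?q" by (simp add: card_ibox)
            moreover have "real (card (?J - ?I)) = real (card ?J) - real (card ?I)"
              using IJ by (simp add: card_Diff_subset card_mono of_nat_diff)
            ultimately have cI: "real (card ?I) = ?q - real (card (?J - ?I))" by simp
            have sI: "(\<Sum>v\<in>?I. ?g m (lshift v \<nu>) - b) = (\<Sum>v\<in>?I. ?g m (lshift v \<nu>)) - real (card ?I) * b"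
              by (simp only: sum_subtractf sum_constant)
            have "s / u - b = (s - (u - x) * b) / u - b * (x / u)" if "0 < u" for s u x :: real
              using that by (simp add: field_simps)
            then show ?thesis unfolding sI cI using q by blast
          qed
          also have "\<bar>\<dots>\<bar> \<le> (\<Sum>v\<in>?I. \<bar>?g m (lshift v \<nu>) - b\<bar>) / ?q + \<bar>b\<bar> * (real (layer_const TYPE('d) m) / real n)"
          proof -
            have "\<bar>(\<Sum>v\<in>?I. ?g m (lshift v \<nu>) - b) / ?q\<bar> \<le> (\<Sum>v\<in>?I. \<bar>?g m (lshift v \<nu>) - b\<bar>) / ?q"
              using q by (simp add: abs_divide divide_right_mono sum_abs)
            moreover have "\<bar>b * (real (card (?J - ?I)) / ?q)\<bar> \<le> \<bar>b\<bar> * (real (layer_const TYPE('d) m) / real n)"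
              using mult_left_mono[OF cJI abs_ge_zero[of b]] q by (simp add: abs_mult)
            ultimately show ?thesis by linarith
          qed
          also have "(\<Sum>v\<in>?I. \<bar>?g m (lshift v \<nu>) - b\<bar>) / ?q \<le> (\<Sum>v\<in>?J. \<bar>?g m (lshift v \<nu>) - b\<bar>) / ?q"
            using IJ q by (intro divide_right_mono sum_mono2) auto
          finally have 1: "\<bar>part_avg n m (?g m) \<nu> - b\<bar> \<le> (\<Sum>v\<in>?J. \<bar>?g m (lshift v \<nu>) - b\<bar>) / ?q + ?D / real n" by simp
          have 2: "avg n h \<nu> = (\<Sum>v\<in>?J. \<bar>?g m (lshift v \<nu>) - b\<bar>) / ?q + block_const / real m * avg n (W R) \<nu>"
            by (simp add: avg_def h_def sum.distrib sum_distrib_left[symmetric]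
                sum_divide_distrib[symmetric] add_divide_distrib)
          show ?thesis
            using 1 2 density_blocks[OF \<nu>(1) m(1) n] h_le[OF n] by linarith
        qed
        have lim: "(\<lambda>n. l + (c * lsum R m n \<nu> + ?D / real n)) \<longlonglongrightarrow> l + (c * 0 + 0)"
          using \<nu>(2) by (intro tendsto_intros lim_const_over_n) (auto simp: good_iff)
        have "?X \<nu> \<le> limsup (\<lambda>n. ereal (l + (c * lsum R m n \<nu> + ?D / real n)))"
          by (rule Limsup_mono) (auto intro!: eventually_sequentiallyI[of 1] bd)
        also have "\<dots> = ereal (l + (c * 0 + 0))" using lim by (intro lim_imp_Limsup) auto
        finally show False using \<nu>(3) by simp
      qed
      have [measurable]: "h \<in> borel_measurable P" using ih by (rule borel_measurable_integrable)
      have "measure P {\<nu> \<in> space P. good \<nu> \<and> ?X \<nu> > ereal l} \<le> measure P {\<nu> \<in> space P. \<exists>n\<ge>1. avg n h \<nu> > l}"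
        by (rule finite_measure_mono[OF sub]) measurable
      also have "\<dots> \<le> 2 ^ CARD('d) * (\<integral>\<nu>. h \<nu> \<partial>P) / l"
        using ih h0 l by (intro maximal_inequality) auto
      also have "\<dots> \<le> 2 ^ CARD('d) * (t + t) / l"
        using hI l by (intro divide_right_mono mult_left_mono) auto
      also have "\<dots> = e" by (rule t(2))
      finally show ?thesis .
    qed
    then have "measure P {\<nu> \<in> space P. good \<nu> \<and> ?X \<nu> > ereal l} \<le> 0" by (rule field_le_epsilon[of _ 0, simplified])
    then show ?thesis by (simp add: measure_le_0_iff)
  qed
  have "AE \<nu> in P. \<not> (good \<nu> \<and> ?X \<nu> > ereal (1 / real (Suc j)))" for j
  proof -
    have "{\<nu> \<in> space P. good \<nu> \<and> ?X \<nu> > ereal (1 / real (Suc j))} \<in> sets P" by measurable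
    moreover have "0 < 1 / real (Suc j)" by simp
    ultimately have "AE \<nu> in P. \<nu> \<notin> {\<nu> \<in> space P. good \<nu> \<and> ?X \<nu> > ereal (1 / real (Suc j))}"
      using prob_eq_0 small by blast
    then show ?thesis using AE_space by eventually_elim blast
  qed
  then have "AE \<nu> in P. \<forall>j. \<not> (good \<nu> \<and> ?X \<nu> > ereal (1 / real (Suc j)))"
    unfolding AE_all_countable by blast
  then show ?thesis
    using AE_good
  proof eventually_elim
    case (elim \<nu>)
    have "?X \<nu> \<le> 0"
    proof (rule ereal_le_epsilon2)
      fix e :: real assume "e > 0"
      then obtain j where "1 / real (Suc j) < e" using nat_approx_posE by blast
      moreover have "?X \<nu> \<le> ereal (1 / real (Suc j))" using elim(1)[rule_format, of j] elim(2) by (simp add: not_less)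
      ultimately show "?X \<nu> \<le> 0 + ereal e" by (simp add: order_trans)
    qed
    then have "(\<lambda>n. \<bar>?g n \<nu> - b\<bar>) \<longlonglongrightarrow> 0" by (simp add: limsup_le_0_iff)
    then have "(\<lambda>n. ?g n \<nu> - b) \<longlonglongrightarrow> 0" by (rule tendsto_rabs_zero_cancel)
    then show ?case by (simp add: LIM_zero_iff)
  qed
qed

lemma closed_cube_close:
  assumes "\<nu> \<in> space P"
  shows "\<bar>F (cbox 0 (vec (real n))) \<nu> - F (hcube 0 n) \<nu>\<bar> / real n ^ CARD('d) \<le> c * lsum R (1 + R + 2) n \<nu>"
proof (rule F_near_cube[OF assms bounded_cbox])
  show "hcube 0 n \<subseteq> cbox 0 (vec (real n))" by (auto simp: hcube_def mem_box_cart less_imp_le)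
next
  fix x :: "(real, 'd) vec" and i
  assume "x \<in> cbox 0 (vec (real n))"
  then have "0 \<le> x $ i" "x $ i \<le> real n" by (auto simp: mem_box_cart)
  then show "- real 1 \<le> x $ i \<and> x $ i \<le> real n + real 1" by simp
next
  fix x :: "(real, 'd) vec"
  assume x: "\<And>i. real 1 \<le> x $ i \<and> x $ i \<le> real n - real 1"
  have "0 \<le> x $ i \<and> x $ i < real n" for i using x[of i] by simp
  then show "x \<in> hcube 0 n" by (simp add: hcube_def)
qed

text \<open>The proof works with half-open cubes because they tile; the closed cubes differ from them
  by a boundary layer. The last conjunct is what makes uniform statements possible: the bound
  depends on the functional only through the weights, the range and \<open>c\<close>.\<close>

theorem ergodic_theorem:
  "\<exists>b. (AE \<nu> in P. (\<lambda>n. F (cbox 0 (vec (real n))) \<nu> / real n ^ CARD('d)) \<longlonglongrightarrow> b) \<and>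
     (\<lambda>n. (\<integral>\<nu>. F (cbox 0 (vec (real n))) \<nu> \<partial>P) / real n ^ CARD('d)) \<longlonglongrightarrow> b \<and>
     (\<forall>m\<ge>1. \<bar>b - (\<integral>\<nu>. F (hcube 0 m) \<nu> \<partial>P) / real m ^ CARD('d)\<bar> \<le> rate m)"
proof -
  let ?g = cube_density and ?C = "\<lambda>n \<nu>. F (cbox 0 (vec (real n))) \<nu> / real n ^ CARD('d)"
  obtain b where b: "\<And>e. e > 0 \<Longrightarrow> \<exists>M. \<forall>m\<ge>M. L2le (\<lambda>\<nu>. ?g m \<nu> - b) e" using L2_limit by blast
  have close: "\<bar>?C n \<nu> - ?g n \<nu>\<bar> \<le> c * lsum R (1 + R + 2) n \<nu>" if "\<nu> \<in> space P" for n \<nu>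
    using closed_cube_close[OF that, of n] by (simp add: cube_density_def flip: diff_divide_distrib)
  have "AE \<nu> in P. (\<lambda>n. ?g n \<nu>) \<longlonglongrightarrow> b" by (rule AE_density_limit) (rule b)
  then have "AE \<nu> in P. (\<lambda>n. ?C n \<nu>) \<longlonglongrightarrow> b"
    using AE_good AE_space
  proof eventually_elim
    case (elim \<nu>)
    have "(\<lambda>n. c * lsum R (1 + R + 2) n \<nu>) \<longlonglongrightarrow> c * 0"
      using elim(2) by (intro tendsto_intros) (simp add: good_iff)
    then have lim: "(\<lambda>n. c * lsum R (1 + R + 2) n \<nu>) \<longlonglongrightarrow> 0" by simp
    have "(\<lambda>n. ?C n \<nu> - ?g n \<nu>) \<longlonglongrightarrow> 0"
    proof (rule Lim_null_comparison[OF always_eventually lim], rule allI)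
      show "norm (?C n \<nu> - ?g n \<nu>) \<le> c * lsum R (1 + R + 2) n \<nu>" for n
        unfolding real_norm_def by (rule close[OF elim(3)])
    qed
    then have "(\<lambda>n. (?C n \<nu> - ?g n \<nu>) + ?g n \<nu>) \<longlonglongrightarrow> 0 + b" using elim(1) by (rule tendsto_add)
    then show ?case by simp
  qed
  moreover have Eg: "(\<lambda>n. \<integral>\<nu>. ?g n \<nu> \<partial>P) \<longlonglongrightarrow> b"
  proof (rule LIMSEQ_I)
    fix e :: real assume e: "e > 0"
    obtain M where M: "\<And>m. m \<ge> M \<Longrightarrow> L2le (\<lambda>\<nu>. ?g m \<nu> - b) (e / 2)" using b[of "e / 2"] e by auto
    have "norm ((\<integral>\<nu>. ?g m \<nu> \<partial>P) - b) < e" if "m \<ge> M" for m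
    proof -
      have "(\<integral>\<nu>. ?g m \<nu> \<partial>P) - b = (\<integral>\<nu>. ?g m \<nu> - b \<partial>P)"
        using integrable_density[of m] by (simp add: prob_space)
      also have "\<bar>\<dots>\<bar> \<le> (\<integral>\<nu>. \<bar>?g m \<nu> - b\<bar> \<partial>P)" by (rule integral_abs_bound)
      also have "\<dots> \<le> e / 2" by (rule L2le_integral(2)[OF M[OF that]])
      finally show ?thesis using e by simp
    qed
    then show "\<exists>no. \<forall>n\<ge>no. norm ((\<integral>\<nu>. ?g n \<nu> \<partial>P) - b) < e" by blast
  qed
  moreover have "(\<lambda>n. (\<integral>\<nu>. F (cbox 0 (vec (real n))) \<nu> \<partial>P) / real n ^ CARD('d)) \<longlonglongrightarrow> b"
  proof -
    let ?k = "c * (real (layer_const TYPE('d) (1 + R + 2)) * L2norm (W R))"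
    have bd: "norm ((\<integral>\<nu>. ?C n \<nu> \<partial>P) - (\<integral>\<nu>. ?g n \<nu> \<partial>P)) \<le> ?k / real n" if n: "n \<ge> 1" for n
    proof -
      have L: "L2le (\<lambda>\<nu>. c * lsum R (1 + R + 2) n \<nu>) (\<bar>c\<bar> * (real (layer_const TYPE('d) (1 + R + 2)) * L2norm (W R) / real n))"
        by (intro L2le_cmult L2le_lsum n)
      have d: "L2le (\<lambda>\<nu>. ?C n \<nu> - ?g n \<nu>) (\<bar>c\<bar> * (real (layer_const TYPE('d) (1 + R + 2)) * L2norm (W R) / real n))"
        by (rule L2le_dominated[OF L]) (use close in auto)
      have "L2le (\<lambda>\<nu>. (?C n \<nu> - ?g n \<nu>) + ?g n \<nu>) (\<bar>c\<bar> * (real (layer_const TYPE('d) (1 + R + 2)) * L2norm (W R) / real n) + L2norm (?g n))"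
        by (intro L2le_add d L2le_density)
      then have iC: "integrable P (?C n)" using L2le_integral(1) by simp
      have "(\<integral>\<nu>. ?C n \<nu> \<partial>P) - (\<integral>\<nu>. ?g n \<nu> \<partial>P) = (\<integral>\<nu>. ?C n \<nu> - ?g n \<nu> \<partial>P)"
        using iC integrable_density[of n] by (rule Bochner_Integration.integral_diff[symmetric])
      also have "\<bar>\<dots>\<bar> \<le> (\<integral>\<nu>. \<bar>?C n \<nu> - ?g n \<nu>\<bar> \<partial>P)" by (rule integral_abs_bound)
      also have "\<dots> \<le> \<bar>c\<bar> * (real (layer_const TYPE('d) (1 + R + 2)) * L2norm (W R) / real n)" by (rule L2le_integral(2)[OF d])
      finally show ?thesis using c_nonneg by simp
    qed
    have "(\<lambda>n. (\<integral>\<nu>. ?C n \<nu> \<partial>P) - (\<integral>\<nu>. ?g n \<nu> \<partial>P)) \<longlonglongrightarrow> 0"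
      by (rule Lim_null_comparison[OF _ lim_const_over_n[of ?k]])
        (use bd in \<open>auto intro!: eventually_sequentiallyI[of 1]\<close>)
    then have "(\<lambda>n. ((\<integral>\<nu>. ?C n \<nu> \<partial>P) - (\<integral>\<nu>. ?g n \<nu> \<partial>P)) + (\<integral>\<nu>. ?g n \<nu> \<partial>P)) \<longlonglongrightarrow> 0 + b"
      using Eg by (rule tendsto_add)
    then show ?thesis by simp
  qed
  moreover have "\<bar>b - (\<integral>\<nu>. F (hcube 0 m) \<nu> \<partial>P) / real m ^ CARD('d)\<bar> \<le> rate m" if m: "m \<ge> 1" for m
  proof -
    have "(\<lambda>n. \<bar>(\<integral>\<nu>. ?g n \<nu> \<partial>P) - (\<integral>\<nu>. ?g m \<nu> \<partial>P)\<bar>) \<longlonglongrightarrow> \<bar>b - (\<integral>\<nu>. ?g m \<nu> \<partial>P)\<bar>"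
      by (intro tendsto_intros Eg)
    then have "\<bar>b - (\<integral>\<nu>. ?g m \<nu> \<partial>P)\<bar> \<le> rate m"
      by (rule LIMSEQ_le[OF _ tendsto_const_over_n[of "rate m" "corr m"]])
        (use expectation_density_close[OF m] in \<open>auto intro!: exI[of _ 1]\<close>)
    then show ?thesis by (simp add: cube_density_def)
  qed
  ultimately show ?thesis by blast
qed

end

section \<open>Configurations and their atoms\<close>

lemma space_config_space:
  "space (config_space :: ('a::euclidean_space \<times> real) measure measure) =
    {\<nu>. sets \<nu> = sets borel \<and> (\<forall>C\<in>sets borel. bounded (fst ` C) \<longrightarrow> emeasure \<nu> C \<in> \<nat>)}"
  by (auto simp add: config_space_def space_Sup_eq_UN)

lemma config_space_sets: "\<nu> \<in> space config_space \<Longrightarrow> sets \<nu> = sets borel"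
  by (simp add: space_config_space)

lemma config_space_space: "\<nu> \<in> space config_space \<Longrightarrow> space \<nu> = UNIV"
  using sets_eq_imp_space_eq[OF config_space_sets] by simp

lemma emeasure_config_measurable [measurable]:
  "B \<in> sets borel \<Longrightarrow> (\<lambda>\<nu>. emeasure \<nu> B) \<in> borel_measurable config_space"
  by (auto intro!: measurable_Sup1 measurable_vimage_algebra1 simp: config_space_def)

lemma measure_config_measurable [measurable]:
  "B \<in> sets borel \<Longrightarrow> (\<lambda>\<nu>. measure \<nu> B) \<in> borel_measurable config_space"
  unfolding measure_def by (intro borel_measurable_enn2real emeasure_config_measurable)

lemma measurable_configI:
  "(\<And>x. x \<in> space M \<Longrightarrow> K x \<in> space config_space) \<Longrightarrow>
   (\<And>B. B \<in> sets borel \<Longrightarrow> (\<lambda>x. emeasure (K x) B) \<in> borel_measurable M) \<Longrightarrow>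
   K \<in> measurable M config_space"
  unfolding space_config_space
  by (auto intro!: measurable_Sup2 measurable_vimage_algebra2 simp: config_space_def)

lemma config_space_Nats:
  assumes "\<nu> \<in> space config_space" "C \<in> sets borel" "bounded (fst ` C)"
  obtains n :: nat where "emeasure \<nu> C = of_nat n" "measure \<nu> C = real n"
proof -
  have "emeasure \<nu> C \<in> \<nat>" using assms by (simp add: space_config_space)
  then obtain n :: nat where n: "emeasure \<nu> C = of_nat n" by (auto simp: Nats_def)
  then have "measure \<nu> C = real n" by (simp add: measure_def)
  then show thesis using n that by blast
qed

lemma sets_Times_borel:
  fixes A :: "'a::second_countable_topology set" and B :: "'b::second_countable_topology set"
  shows "A \<in> sets borel \<Longrightarrow> B \<in> sets borel \<Longrightarrow> A \<times> B \<in> sets (borel :: ('a \<times> 'b) measure)"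
  unfolding borel_prod[symmetric] by (rule pair_measureI)

lemma shift_map_measurable: "(\<lambda>(x, m). (x + v, m)) \<in> borel_measurable (borel :: ('a::euclidean_space \<times> real) measure)"
  by (intro borel_measurable_continuous_onI continuous_intros) (simp add: split_beta continuous_intros)

lemma emeasure_config_shift:
  assumes "\<nu> \<in> space config_space" "B \<in> sets borel"
  shows "emeasure (config_shift v \<nu>) B = emeasure \<nu> ((\<lambda>(x, m). (x + v, m)) -` B)"
    and "(\<lambda>(x, m). (x + v, m)) -` B \<in> sets borel"
proof -
  have m: "(\<lambda>(x, m). (x + v, m)) \<in> measurable \<nu> borel"
    using shift_map_measurable measurable_cong_sets[OF config_space_sets[OF assms(1)] refl] by blast
  show "emeasure (config_shift v \<nu>) B = emeasure \<nu> ((\<lambda>(x, m). (x + v, m)) -` B)"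
    unfolding config_shift_def using assms by (subst emeasure_distr[OF m]) (auto simp: config_space_space)
  show "(\<lambda>(x, m). (x + v, m)) -` B \<in> sets borel"
    using measurable_sets[OF shift_map_measurable assms(2)] by simp
qed

lemma shift_preimage_bounded:
  fixes B :: "('a::euclidean_space \<times> real) set"
  assumes "bounded (fst ` B)"
  shows "bounded (fst ` ((\<lambda>(x, m). (x + v, m)) -` B))"
proof -
  have "fst ` ((\<lambda>(x, m). (x + v, m)) -` B) \<subseteq> (\<lambda>x. x + - v) ` fst ` B"
    by (force simp: image_iff)
  moreover have "bounded ((\<lambda>x. x + - v) ` fst ` B)"
    using bounded_translation[OF assms, of "- v"] by (simp add: add.commute)
  ultimately show ?thesis by (rule bounded_subset[rotated])
qed

lemma config_shift_space:
  assumes "\<nu> \<in> space config_space" shows "config_shift v \<nu> \<in> space config_space"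
proof -
  have "emeasure (config_shift v \<nu>) C \<in> \<nat>" if "C \<in> sets borel" "bounded (fst ` C)" for C
    using assms that emeasure_config_shift[OF assms that(1), of v] shift_preimage_bounded[OF that(2), of v]
    by (simp add: space_config_space)
  then show ?thesis by (simp add: space_config_space) (simp add: config_shift_def)
qed

lemma config_shift_measurable [measurable]: "config_shift v \<in> measurable config_space config_space"
proof (rule measurable_configI)
  fix B :: "('a \<times> real) set" assume B: "B \<in> sets borel"
  have "(\<lambda>\<nu>. emeasure \<nu> ((\<lambda>(x, m). (x + v, m)) -` B)) \<in> borel_measurable config_space"
    using measurable_sets[OF shift_map_measurable B] by (intro emeasure_config_measurable) simp
  then show "(\<lambda>\<nu>. emeasure (config_shift v \<nu>) B) \<in> borel_measurable config_space"
    by (rule measurable_cong[THEN iffD1, rotated]) (simp add: emeasure_config_shift(1) B)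
qed (rule config_shift_space)

lemma config_shift_add:
  assumes "\<nu> \<in> space config_space"
  shows "config_shift v (config_shift w \<nu>) = config_shift (v + w) \<nu>"
proof (rule measure_eqI)
  show "sets (config_shift v (config_shift w \<nu>)) = sets (config_shift (v + w) \<nu>)"
    by (simp add: config_shift_def)
  fix B assume "B \<in> sets (config_shift v (config_shift w \<nu>))"
  then have B: "B \<in> sets borel" by (simp add: config_shift_def)
  have "(\<lambda>(x, m). (x + w, m)) -` (\<lambda>(x, m). (x + v, m)) -` B = (\<lambda>(x, m). (x + (v + w), m)) -` B"
    by (auto simp: add.assoc add.commute add.left_commute)
  then show "emeasure (config_shift v (config_shift w \<nu>)) B = emeasure (config_shift (v + w) \<nu>) B"
    using emeasure_config_shift[OF config_shift_space[OF assms] B]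
      emeasure_config_shift[OF assms] emeasure_config_shift(1)[OF assms B] by simp
qed

lemma config_shift_zero:
  assumes "\<nu> \<in> space config_space" shows "config_shift 0 \<nu> = \<nu>"
proof (rule measure_eqI)
  show "sets (config_shift 0 \<nu>) = sets \<nu>" by (simp add: config_shift_def config_space_sets[OF assms])
  fix B assume "B \<in> sets (config_shift 0 \<nu>)"
  then have B: "B \<in> sets borel" by (simp add: config_shift_def)
  have "(\<lambda>(x, m). (x + 0, m)) -` B = B" by auto
  then show "emeasure (config_shift 0 \<nu>) B = emeasure \<nu> B"
    using emeasure_config_shift(1)[OF assms B, of 0] by simp
qed

text \<open>The locations of the points with marks in \<open>J\<close>, without multiplicities.\<close>

definition atoms :: "real set \<Rightarrow> ('a::euclidean_space \<times> real) measure \<Rightarrow> 'a set" where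
  "atoms J \<nu> = {x. emeasure \<nu> ({x} \<times> J) \<noteq> 0}"

lemma singleton_Times_borel: "J \<in> sets borel \<Longrightarrow> {x::'a::euclidean_space} \<times> (J::real set) \<in> sets borel"
  by (intro sets_Times_borel) auto

lemma atoms_shift:
  assumes "\<nu> \<in> space config_space" "J \<in> sets borel"
  shows "atoms J (config_shift v \<nu>) = (\<lambda>x. x + v) ` atoms J \<nu>"
proof -
  have "(\<lambda>(x, m). (x + v, m)) -` ({x} \<times> J) = {x - v} \<times> J" for x by (auto simp: algebra_simps)
  then have e: "emeasure (config_shift v \<nu>) ({x} \<times> J) = emeasure \<nu> ({x - v} \<times> J)" for x
    by (simp add: emeasure_config_shift(1)[OF assms(1) singleton_Times_borel[OF assms(2)]])
  show ?thesis
  proof (intro equalityI subsetI)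
    fix x assume "x \<in> atoms J (config_shift v \<nu>)"
    then show "x \<in> (\<lambda>x. x + v) ` atoms J \<nu>"
      by (intro image_eqI[of _ _ "x - v"]) (auto simp: atoms_def e)
  qed (auto simp: atoms_def e)
qed

lemma atoms_mono:
  assumes "\<nu> \<in> space config_space" "J' \<in> sets borel" "J \<subseteq> J'"
  shows "atoms J \<nu> \<subseteq> atoms J' \<nu>"
proof
  fix x assume "x \<in> atoms J \<nu>"
  moreover have "emeasure \<nu> ({x} \<times> J) \<le> emeasure \<nu> ({x} \<times> J')"
    by (rule emeasure_mono)
      (use assms(3) in \<open>auto simp: config_space_sets[OF assms(1)] singleton_Times_borel[OF assms(2)]\<close>)
  ultimately show "x \<in> atoms J' \<nu>" by (auto simp: atoms_def)
qed

lemma bounded_fst_Times: "bounded B \<Longrightarrow> bounded (fst ` (B \<times> J))"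
  by (rule bounded_subset[of B]) auto

lemma atoms_card:
  assumes \<nu>: "\<nu> \<in> space config_space" and J: "J \<in> sets borel" and B: "B \<in> sets borel" "bounded B"
  shows "finite (atoms J \<nu> \<inter> B)" "real (card (atoms J \<nu> \<inter> B)) \<le> measure \<nu> (B \<times> UNIV)"
proof -
  have BU: "B \<times> (UNIV :: real set) \<in> sets borel" using B by (intro sets_Times_borel) auto
  obtain N where N: "emeasure \<nu> (B \<times> UNIV) = of_nat N" "measure \<nu> (B \<times> UNIV) = real N"
    using config_space_Nats[OF \<nu> BU bounded_fst_Times[OF B(2)]] .
  have "card S \<le> N" if S: "S \<subseteq> atoms J \<nu> \<inter> B" "finite S" for S
  proof -
    have one: "1 \<le> emeasure \<nu> ({x} \<times> J)" if x: "x \<in> S" for x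
    proof -
      obtain n where "emeasure \<nu> ({x} \<times> J) = of_nat n"
        using config_space_Nats[OF \<nu> singleton_Times_borel[OF J] bounded_fst_Times] by (metis bounded_insert bounded_empty)
      moreover have "emeasure \<nu> ({x} \<times> J) \<noteq> 0" using S(1) x by (auto simp: atoms_def)
      ultimately have "1 \<le> n" by (cases n) auto
      then have "(of_nat 1 :: ennreal) \<le> of_nat n" by (rule of_nat_mono)
      then show ?thesis using \<open>emeasure \<nu> ({x} \<times> J) = of_nat n\<close> by simp
    qed
    have "of_nat (card S) = (\<Sum>x\<in>S. 1 :: ennreal)" by simp
    also have "\<dots> \<le> (\<Sum>x\<in>S. emeasure \<nu> ({x} \<times> J))" by (rule sum_mono) (rule one)
    also have "\<dots> = emeasure \<nu> (\<Union>x\<in>S. {x} \<times> J)"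
      using S(2) J by (intro sum_emeasure) (auto simp: disjoint_family_on_def config_space_sets[OF \<nu>] singleton_Times_borel)
    also have "\<dots> \<le> emeasure \<nu> (B \<times> UNIV)"
      by (rule emeasure_mono) (use S(1) BU config_space_sets[OF \<nu>] in auto)
    finally have "(of_nat (card S) :: ennreal) \<le> of_nat N" by (simp add: N)
    then show ?thesis by simp
  qed
  then have "finite (atoms J \<nu> \<inter> B) \<and> card (atoms J \<nu> \<inter> B) \<le> N"
    by (intro finite_if_finite_subsets_card_bdd) auto
  then show "finite (atoms J \<nu> \<inter> B)" "real (card (atoms J \<nu> \<inter> B)) \<le> measure \<nu> (B \<times> UNIV)"
    by (auto simp: N)
qed

lemma finite_atoms:
  assumes "\<nu> \<in> space config_space" "J \<in> sets borel" "bounded B"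
  shows "finite (atoms J \<nu> \<inter> B)"
proof -
  obtain a e where "B \<subseteq> cball a e" using assms(3) by (auto simp: bounded_def subset_iff dist_commute)
  then show ?thesis using atoms_card(1)[OF assms(1,2), of "cball a e"] by (auto intro: finite_subset[rotated])
qed

text \<open>The measures of shrinking neighbourhoods converge to that of the point, which is zero. As
  they are integers, they vanish eventually.\<close>

lemma small_neighbourhood_null:
  assumes \<nu>: "\<nu> \<in> space config_space" and J: "J \<in> sets borel" and C: "C \<in> sets borel" "bounded C"
    and no: "atoms J \<nu> \<inter> C = {}"
  shows "\<exists>e>0. emeasure \<nu> ((ball x e \<inter> C) \<times> J) = 0"
proof -
  define A where "A = (\<lambda>n::nat. (ball x (1 / real (Suc n)) \<inter> C) \<times> J)"
  have As: "A n \<in> sets borel" for n unfolding A_def using C J by (intro sets_Times_borel) auto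
  have nat: "\<exists>k::nat. emeasure \<nu> (A n) = of_nat k" for n
  proof -
    have "bounded (ball x (1 / real (Suc n)) \<inter> C)" using C(2) by (rule bounded_subset) auto
    then show ?thesis using config_space_Nats[OF \<nu> As[of n]] bounded_fst_Times unfolding A_def by metis
  qed
  have "(\<lambda>n. emeasure \<nu> (A n)) \<longlonglongrightarrow> emeasure \<nu> (\<Inter>n. A n)"
  proof (rule Lim_emeasure_decseq)
    show "range A \<subseteq> sets \<nu>" using As by (auto simp: config_space_sets[OF \<nu>])
    show "decseq A"
    proof (rule decseq_SucI)
      fix n
      have "1 / real (Suc (Suc n)) \<le> 1 / real (Suc n)" by (simp add: divide_simps)
      then show "A (Suc n) \<subseteq> A n" unfolding A_def using subset_ball by blast
    qed
    show "emeasure \<nu> (A n) \<noteq> \<infinity>" for n using nat[of n] by auto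
  qed
  moreover have "(\<Inter>n. A n) \<subseteq> ({x} \<inter> C) \<times> J"
  proof
    fix p assume p: "p \<in> (\<Inter>n. A n)"
    obtain y m where ym: "p = (y, m)" by (cases p)
    have "dist x y \<le> 0"
    proof (rule field_le_epsilon)
      fix e :: real assume "e > 0"
      then obtain n where "1 / real (Suc n) < e" using nat_approx_posE by blast
      moreover have "dist x y < 1 / real (Suc n)" using p ym by (auto simp: A_def)
      ultimately show "dist x y \<le> 0 + e" by simp
    qed
    then show "p \<in> ({x} \<inter> C) \<times> J" using p ym by (auto simp: A_def)
  qed
  then have "emeasure \<nu> (\<Inter>n. A n) \<le> emeasure \<nu> (({x} \<inter> C) \<times> J)"
    by (rule emeasure_mono) (use C J in \<open>auto simp: config_space_sets[OF \<nu>] intro!: sets_Times_borel\<close>)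
  moreover have "emeasure \<nu> (({x} \<inter> C) \<times> J) = 0"
  proof (cases "x \<in> C")
    case True
    then have "{x} \<inter> C = {x}" "x \<notin> atoms J \<nu>" using no by auto
    then show ?thesis by (simp add: atoms_def)
  next
    case False
    then have "{x} \<inter> C = {}" by auto
    then show ?thesis by simp
  qed
  ultimately have "(\<lambda>n. emeasure \<nu> (A n)) \<longlonglongrightarrow> 0" by simp
  then have "eventually (\<lambda>n. emeasure \<nu> (A n) < 1) sequentially"
    by (rule order_tendstoD(2)) simp
  then obtain n where "emeasure \<nu> (A n) < 1" by (auto simp: eventually_sequentially)
  moreover obtain k :: nat where k: "emeasure \<nu> (A n) = of_nat k" using nat by blast
  ultimately have "k < 1" by (metis of_nat_1 of_nat_less_iff)
  then have "emeasure \<nu> (A n) = 0" using k by simp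
  then show ?thesis unfolding A_def by (intro exI[of _ "1 / real (Suc n)"]) auto
qed

text \<open>A bounded set without atoms is covered by finitely many null neighbourhoods. This ties the
  set of atoms to the evaluations that generate the \<open>\<sigma>\<close>-algebra.\<close>

lemma cell_charged_iff:
  assumes \<nu>: "\<nu> \<in> space config_space" and J: "J \<in> sets borel" and C: "C \<in> sets borel" "bounded C"
  shows "emeasure \<nu> (C \<times> J) \<noteq> 0 \<longleftrightarrow> atoms J \<nu> \<inter> C \<noteq> {}"
proof
  assume "atoms J \<nu> \<inter> C \<noteq> {}"
  then obtain x where x: "x \<in> C" "emeasure \<nu> ({x} \<times> J) \<noteq> 0" by (auto simp: atoms_def)
  have "emeasure \<nu> ({x} \<times> J) \<le> emeasure \<nu> (C \<times> J)"
    by (rule emeasure_mono) (use x C J in \<open>auto simp: config_space_sets[OF \<nu>] intro!: sets_Times_borel\<close>)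
  then show "emeasure \<nu> (C \<times> J) \<noteq> 0" using x by auto
next
  assume ne: "emeasure \<nu> (C \<times> J) \<noteq> 0"
  show "atoms J \<nu> \<inter> C \<noteq> {}"
  proof
    assume no: "atoms J \<nu> \<inter> C = {}"
    obtain e where e: "\<And>x. e x > 0 \<and> emeasure \<nu> ((ball x (e x) \<inter> C) \<times> J) = 0"
      using small_neighbourhood_null[OF assms no] by metis
    have c: "compact (closure C)" using C(2) by simp
    have sub: "closure C \<subseteq> (\<Union>x\<in>closure C. ball x (e x))"
      using e by (auto intro!: bexI)
    obtain D where D: "D \<subseteq> closure C" "finite D" "closure C \<subseteq> (\<Union>x\<in>D. ball x (e x))"
      using compactE_image[OF c open_ball sub] by blast
    have "C \<times> J \<subseteq> (\<Union>x\<in>D. (ball x (e x) \<inter> C) \<times> J)"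
      using D(3) closure_subset[of C] by blast
    then have "emeasure \<nu> (C \<times> J) \<le> emeasure \<nu> (\<Union>x\<in>D. (ball x (e x) \<inter> C) \<times> J)"
      by (rule emeasure_mono)
        (use C J D in \<open>auto simp: config_space_sets[OF \<nu>] intro!: sets.finite_UN sets_Times_borel\<close>)
    also have "\<dots> \<le> (\<Sum>x\<in>D. emeasure \<nu> ((ball x (e x) \<inter> C) \<times> J))"
      by (rule emeasure_subadditive_finite)
        (use C J D in \<open>auto simp: config_space_sets[OF \<nu>] intro!: sets_Times_borel\<close>)
    also have "\<dots> = 0" using e by simp
    finally show False using ne by simp
  qed
qed

lemma emeasure_config:
  assumes "B \<in> sets borel"
  shows "emeasure (config x m) B = emeasure (count_space UNIV) {i. (x i, m i) \<in> B}"
proof -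
  have "(\<lambda>i. (x i, m i)) -` B \<inter> space (count_space UNIV) = {i. (x i, m i) \<in> B}" by auto
  then show ?thesis unfolding config_def using assms by (subst emeasure_distr) auto
qed

lemma config_in_space:
  assumes "\<And>B. bounded B \<Longrightarrow> finite {i. x i \<in> B}"
  shows "config x m \<in> space config_space"
proof -
  have "emeasure (config x m) C \<in> \<nat>" if C: "C \<in> sets borel" "bounded (fst ` C)" for C
  proof -
    have "finite {i. (x i, m i) \<in> C}"
      by (rule finite_subset[OF _ assms[OF C(2)]]) force
    then show ?thesis by (simp add: emeasure_config[OF C(1)])
  qed
  then show ?thesis by (simp add: space_config_space) (simp add: config_def)
qed

lemma config_shift_config:
  assumes "\<And>B. bounded B \<Longrightarrow> finite {i. x i \<in> B}"
  shows "config_shift v (config x m) = config (\<lambda>i. x i + v) m"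
proof (rule measure_eqI)
  show "sets (config_shift v (config x m)) = sets (config (\<lambda>i. x i + v) m)"
    by (simp add: config_shift_def config_def)
  fix B assume "B \<in> sets (config_shift v (config x m))"
  then have B: "B \<in> sets borel" by (simp add: config_shift_def)
  then show "emeasure (config_shift v (config x m)) B = emeasure (config (\<lambda>i. x i + v) m) B"
    using emeasure_config_shift(1)[OF config_in_space[OF assms] B, of v m]
      emeasure_config_shift(2)[OF config_in_space[OF assms] B, of v]
    by (simp add: emeasure_config)
qed

lemma atoms_config:
  assumes "J \<in> sets borel"
  shows "atoms J (config x m) = {x i |i. m i \<in> J}"
proof -
  have "emeasure (count_space UNIV) A \<noteq> 0 \<longleftrightarrow> A \<noteq> {}" for A :: "nat set"
    by (cases "finite A") (auto simp: card_eq_0_iff)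
  then show ?thesis
    by (auto simp: atoms_def emeasure_config[OF singleton_Times_borel[OF assms]])
qed

lemma config_measurable:
  fixes X :: "nat \<Rightarrow> 'w \<Rightarrow> 'a::euclidean_space"
  assumes [measurable]: "\<And>i. X i \<in> borel_measurable \<Omega>" "\<And>i. M i \<in> borel_measurable \<Omega>"
    and fin: "\<And>\<omega> B. \<omega> \<in> space \<Omega> \<Longrightarrow> bounded B \<Longrightarrow> finite {i. X i \<omega> \<in> B}"
  shows "(\<lambda>\<omega>. config (\<lambda>i. X i \<omega>) (\<lambda>i. M i \<omega>)) \<in> measurable \<Omega> config_space"
proof (rule measurable_configI)
  fix B :: "('a \<times> real) set" assume B [measurable]: "B \<in> sets borel"
  have e: "emeasure (config (\<lambda>i. X i \<omega>) (\<lambda>i. M i \<omega>)) B = suminf (\<lambda>i. indicator B (X i \<omega>, M i \<omega>))" for \<omega>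
  proof -
    have "emeasure (count_space UNIV) {i. (X i \<omega>, M i \<omega>) \<in> B} = (\<integral>\<^sup>+i. indicator {i. (X i \<omega>, M i \<omega>) \<in> B} i \<partial>count_space UNIV)"
      by simp
    also have "\<dots> = suminf (\<lambda>i. indicator B (X i \<omega>, M i \<omega>))"
      by (subst nn_integral_count_space_nat) (auto intro!: suminf_cong simp: indicator_def)
    finally show ?thesis by (simp add: emeasure_config)
  qed
  have "(\<lambda>\<omega>. (X i \<omega>, M i \<omega>)) \<in> borel_measurable \<Omega>" for i by measurable
  then have "(\<lambda>\<omega>. indicator B (X i \<omega>, M i \<omega>) :: ennreal) \<in> borel_measurable \<Omega>" for i
    by (rule measurable_compose) measurable
  then show "(\<lambda>\<omega>. emeasure (config (\<lambda>i. X i \<omega>) (\<lambda>i. M i \<omega>)) B) \<in> borel_measurable \<Omega>"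
    unfolding e by (intro borel_measurable_suminf_order)
qed (rule config_in_space, rule fin)

section \<open>Measurability by dyadic rounding\<close>

definition dyadic :: "nat \<Rightarrow> (real, 'd::finite) vec \<Rightarrow> (real, 'd) vec" where
  "dyadic j x = (\<chi> i. of_int \<lfloor>2 ^ j * x $ i\<rfloor> / 2 ^ j)"

text \<open>A bound for the displacement of a point by \<open>dyadic j\<close>.\<close>

definition mesh :: "'d::finite itself \<Rightarrow> nat \<Rightarrow> real" where
  "mesh _ j = real CARD('d) / 2 ^ j"

lemma mesh_nonneg: "0 \<le> mesh TYPE('d::finite) j"
  by (simp add: mesh_def)

lemma mesh_tendsto: "mesh TYPE('d::finite) \<longlonglongrightarrow> 0"
proof -
  have "(\<lambda>j. real CARD('d) * (1 / 2) ^ j) \<longlonglongrightarrow> real CARD('d) * 0"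
    by (intro tendsto_intros LIMSEQ_realpow_zero) auto
  then show ?thesis by (simp add: mesh_def[abs_def] power_one_over field_simps)
qed

lemma dist_dyadic: "dist (dyadic j x) (x :: (real, 'd::finite) vec) \<le> mesh TYPE('d) j"
proof -
  have "\<bar>(dyadic j x - x) $ i\<bar> \<le> 1 / 2 ^ j" for i
  proof -
    have "(dyadic j x - x) $ i = (of_int \<lfloor>2 ^ j * x $ i\<rfloor> - 2 ^ j * x $ i) / 2 ^ j"
      by (simp add: dyadic_def diff_divide_distrib)
    moreover have "\<bar>of_int \<lfloor>2 ^ j * x $ i\<rfloor> - 2 ^ j * x $ i\<bar> \<le> 1" by linarith
    ultimately show ?thesis by (simp add: abs_divide divide_right_mono)
  qed
  then have "(\<Sum>i\<in>UNIV. \<bar>(dyadic j x - x) $ i\<bar>) \<le> (\<Sum>i\<in>(UNIV::'d set). 1 / 2 ^ j)" by (intro sum_mono)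
  then show ?thesis
    using norm_le_l1_cart[of "dyadic j x - x"] by (simp add: dist_norm mesh_def)
qed

text \<open>Rounding keeps equal coordinates equal, and on a fine grid it separates the first
  coordinates that differ. Hence it eventually preserves the lexicographic order.\<close>

lemma lex_less_dyadic:
  fixes x y :: "(real, 'd::{finite,linorder}) vec"
  assumes "lex_less x y"
  shows "eventually (\<lambda>j. lex_less (dyadic j x) (dyadic j y)) sequentially"
proof -
  obtain k where k: "x $ k < y $ k" "\<And>k'. k' < k \<Longrightarrow> x $ k' = y $ k'"
    using assms by (auto simp: less_fun_def)
  obtain N where N: "1 / (y $ k - x $ k) < 2 ^ N" using real_arch_pow[of 2 "1 / (y $ k - x $ k)"] by auto
  have "lex_less (dyadic j x) (dyadic j y)" if j: "j \<ge> N" for j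
  proof -
    have "(2::real) ^ N \<le> 2 ^ j" using j by (rule power_increasing) simp
    then have "1 / (y $ k - x $ k) < 2 ^ j" using N by linarith
    then have "1 < 2 ^ j * (y $ k - x $ k)" using k(1) by (simp add: field_simps)
    then have "2 ^ j * x $ k + 1 < 2 ^ j * y $ k" by (simp add: algebra_simps)
    then have "\<lfloor>2 ^ j * x $ k\<rfloor> < \<lfloor>2 ^ j * y $ k\<rfloor>" by linarith
    then have "dyadic j x $ k < dyadic j y $ k" by (simp add: dyadic_def divide_strict_right_mono)
    moreover have "dyadic j x $ k' = dyadic j y $ k'" if "k' < k" for k' using k(2)[OF that] by (simp add: dyadic_def)
    ultimately show ?thesis by (auto simp: less_fun_def)
  qed
  then show ?thesis by (auto simp: eventually_sequentially)
qed

lemma eventually_dyadic_order: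
  fixes A :: "(real, 'd::{finite,linorder}) vec set"
  assumes "finite A"
  shows "eventually (\<lambda>j. inj_on (dyadic j) A \<and>
    (\<forall>x\<in>A. \<forall>y\<in>A. lex_less (dyadic j x) (dyadic j y) \<longleftrightarrow> lex_less x y)) sequentially"
proof -
  have "eventually (\<lambda>j. (dyadic j x = dyadic j y \<longrightarrow> x = y) \<and> (lex_less (dyadic j x) (dyadic j y) \<longleftrightarrow> lex_less x y)) sequentially" for x y :: "(real, 'd) vec"
  proof -
    consider "x = y" | "lex_less x y" | "lex_less y x" using lex_less_total by blast
    then show ?thesis
    proof cases
      case 1
      then show ?thesis by (simp add: lex_less_irrefl)
    next
      case 2
      then show ?thesis
        using lex_less_dyadic[OF 2] by (auto elim!: eventually_mono simp: lex_less_irrefl)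
    next
      case 3
      then have "\<not> lex_less x y" using lex_less_trans lex_less_irrefl by blast
      moreover have "eventually (\<lambda>j. \<not> lex_less (dyadic j x) (dyadic j y) \<and> dyadic j x \<noteq> dyadic j y) sequentially"
        using lex_less_dyadic[OF 3]
        by (rule eventually_mono) (metis lex_less_trans lex_less_irrefl)
      ultimately show ?thesis by (auto elim!: eventually_mono)
    qed
  qed
  then have "eventually (\<lambda>j. \<forall>x\<in>A. \<forall>y\<in>A. (dyadic j x = dyadic j y \<longrightarrow> x = y) \<and> (lex_less (dyadic j x) (dyadic j y) \<longleftrightarrow> lex_less x y)) sequentially"
    using assms by (simp add: eventually_ball_finite_distrib)
  then show ?thesis by (rule eventually_mono) (auto simp: inj_on_def)
qed

lemma cech_radius_dyadic:
  fixes \<sigma> :: "(real, 'd::finite) vec set"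
  assumes "finite \<sigma>" "\<sigma> \<noteq> {}"
  shows "cech_radius (dyadic j ` \<sigma>) \<le> cech_radius \<sigma> + mesh TYPE('d) j"
    "cech_radius \<sigma> \<le> cech_radius (dyadic j ` \<sigma>) + mesh TYPE('d) j"
  using cech_radius_perturb[OF assms, of "dyadic j" "mesh TYPE('d) j"] dist_dyadic by auto

text \<open>Rounding may enlarge the radius by at most the mesh, so the tolerance never excludes a set
  with radius at most \<open>r\<close>; a set with larger radius is excluded once the mesh is small.\<close>

lemma eventually_radius_le:
  fixes A :: "(real, 'd::finite) vec set"
  assumes "finite A"
  shows "eventually (\<lambda>j. \<forall>\<sigma>. \<sigma> \<subseteq> A \<longrightarrow> \<sigma> \<noteq> {} \<longrightarrow>
     (cech_radius \<sigma> \<le> r \<longleftrightarrow> cech_radius (dyadic j ` \<sigma>) \<le> r + mesh TYPE('d) j)) sequentially"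
proof -
  have "eventually (\<lambda>j. cech_radius \<sigma> \<le> r \<longleftrightarrow> cech_radius (dyadic j ` \<sigma>) \<le> r + mesh TYPE('d) j) sequentially"
    if s: "\<sigma> \<subseteq> A" "\<sigma> \<noteq> {}" for \<sigma>
  proof -
    have fin: "finite \<sigma>" using s assms finite_subset by auto
    note c = cech_radius_dyadic[OF fin s(2)]
    show ?thesis
    proof (cases "cech_radius \<sigma> \<le> r")
      case True
      show ?thesis
      proof (intro always_eventually allI)
        fix j show "cech_radius \<sigma> \<le> r \<longleftrightarrow> cech_radius (dyadic j ` \<sigma>) \<le> r + mesh TYPE('d) j"
          using True c(1)[of j] by linarith
      qed
    next
      case False
      then have "0 < (cech_radius \<sigma> - r) / 2" by simp
      from order_tendstoD(2)[OF mesh_tendsto[where 'd = 'd] this] show ?thesis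
      proof (rule eventually_mono)
        fix j assume "mesh TYPE('d) j < (cech_radius \<sigma> - r) / 2"
        then show "cech_radius \<sigma> \<le> r \<longleftrightarrow> cech_radius (dyadic j ` \<sigma>) \<le> r + mesh TYPE('d) j"
          using False c(2)[of j] by (simp add: field_simps)
      qed
    qed
  qed
  then have "eventually (\<lambda>j. \<forall>\<sigma>\<in>{\<sigma>. \<sigma> \<subseteq> A \<and> \<sigma> \<noteq> {}}. cech_radius \<sigma> \<le> r \<longleftrightarrow> cech_radius (dyadic j ` \<sigma>) \<le> r + mesh TYPE('d) j) sequentially"
    using assms by (intro eventually_ball_finite) auto
  then show ?thesis by (rule eventually_mono) auto
qed

lemma eventually_radius_less:
  fixes A :: "(real, 'd::finite) vec set"
  assumes "finite A"
  shows "eventually (\<lambda>j. \<forall>\<sigma>. \<sigma> \<subseteq> A \<longrightarrow> \<sigma> \<noteq> {} \<longrightarrow>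
     (cech_radius \<sigma> < r \<longleftrightarrow> cech_radius (dyadic j ` \<sigma>) < r - 2 * mesh TYPE('d) j)) sequentially"
proof -
  have "eventually (\<lambda>j. cech_radius \<sigma> < r \<longleftrightarrow> cech_radius (dyadic j ` \<sigma>) < r - 2 * mesh TYPE('d) j) sequentially"
    if s: "\<sigma> \<subseteq> A" "\<sigma> \<noteq> {}" for \<sigma>
  proof -
    have fin: "finite \<sigma>" using s assms finite_subset by auto
    note c = cech_radius_dyadic[OF fin s(2)]
    show ?thesis
    proof (cases "cech_radius \<sigma> < r")
      case False
      show ?thesis
      proof (intro always_eventually allI)
        fix j show "cech_radius \<sigma> < r \<longleftrightarrow> cech_radius (dyadic j ` \<sigma>) < r - 2 * mesh TYPE('d) j"
          using c(2)[of j] False mesh_nonneg[of j, where 'd = 'd] by linarith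
      qed
    next
      case True
      then have "0 < (r - cech_radius \<sigma>) / 3" by simp
      from order_tendstoD(2)[OF mesh_tendsto[where 'd = 'd] this] show ?thesis
      proof (rule eventually_mono)
        fix j assume "mesh TYPE('d) j < (r - cech_radius \<sigma>) / 3"
        then have "3 * mesh TYPE('d) j < r - cech_radius \<sigma>" by simp
        then show "cech_radius \<sigma> < r \<longleftrightarrow> cech_radius (dyadic j ` \<sigma>) < r - 2 * mesh TYPE('d) j"
          using True c(1)[of j] by linarith
      qed
    qed
  qed
  then have "eventually (\<lambda>j. \<forall>\<sigma>\<in>{\<sigma>. \<sigma> \<subseteq> A \<and> \<sigma> \<noteq> {}}. cech_radius \<sigma> < r \<longleftrightarrow> cech_radius (dyadic j ` \<sigma>) < r - 2 * mesh TYPE('d) j) sequentially"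
    using assms by (intro eventually_ball_finite) auto
  then show ?thesis by (rule eventually_mono) auto
qed

lemma finite_dyadic_image:
  assumes "bounded (B :: (real, 'd::finite) vec set)"
  shows "finite (dyadic j ` B)"
proof -
  obtain a where a: "\<And>x. x \<in> B \<Longrightarrow> norm x \<le> a" using assms by (auto simp: bounded_iff)
  define S where "S = (\<lambda>k::int. of_int k / 2 ^ j :: real) ` {\<lfloor>- (2 ^ j * a)\<rfloor>..\<lfloor>2 ^ j * a\<rfloor>}"
  have "dyadic j ` B \<subseteq> {z. \<forall>i. z $ i \<in> S}"
  proof safe
    fix x i assume x: "x \<in> B"
    have "\<bar>x $ i\<bar> \<le> a" using a[OF x] component_le_norm_cart[of x i] by linarith
    then have "- a \<le> x $ i" "x $ i \<le> a" by auto
    then have "2 ^ j * - a \<le> 2 ^ j * x $ i" "2 ^ j * x $ i \<le> 2 ^ j * a" by (intro mult_left_mono; simp)+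
    then have "\<lfloor>- (2 ^ j * a)\<rfloor> \<le> \<lfloor>2 ^ j * x $ i\<rfloor>" "\<lfloor>2 ^ j * x $ i\<rfloor> \<le> \<lfloor>2 ^ j * a\<rfloor>"
      by (auto intro!: floor_mono)
    then show "dyadic j x $ i \<in> S" by (auto simp: S_def dyadic_def)
  qed
  moreover have "finite {z::(real, 'd) vec. \<forall>i. z $ i \<in> S}"
    by (rule finite_card_vec_box(1)) (simp add: S_def)
  ultimately show ?thesis by (rule finite_subset)
qed

lemma dyadic_cell_borel: "{x :: (real, 'd::finite) vec. dyadic j x = c} \<in> sets borel"
proof -
  have [measurable]: "(\<lambda>x::(real, 'd) vec. x $ i) \<in> borel_measurable borel" for i
    by (intro borel_measurable_continuous_onI continuous_intros)
  have "{x \<in> space borel. \<forall>i\<in>(UNIV::'d set). of_int \<lfloor>2 ^ j * (x :: (real, 'd) vec) $ i\<rfloor> / 2 ^ j = c $ i} \<in> sets borel"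
    by measurable
  then show ?thesis by (simp add: dyadic_def vec_eq_iff)
qed

text \<open>In a bounded region there are only finitely many possible rounded sets of atoms, and which
  of them occurs depends on the cells that carry mass. Functionals of the rounded sets are thus
  measurable, and so are their limits.\<close>

lemma measurable_atoms_functional:
  fixes B :: "(real, 'd::finite) vec set" and \<Psi> :: "(real, 'd) vec set \<Rightarrow> (real, 'd) vec set \<Rightarrow> real"
  assumes B: "B \<in> sets borel" "bounded B" and J: "J \<in> sets borel" "J' \<in> sets borel"
    and lim: "\<And>\<nu>. \<nu> \<in> space config_space \<Longrightarrow>
      (\<lambda>j. \<Psi>' j (dyadic j ` (atoms J \<nu> \<inter> B)) (dyadic j ` (atoms J' \<nu> \<inter> B))) \<longlonglongrightarrow> \<Psi> (atoms J \<nu> \<inter> B) (atoms J' \<nu> \<inter> B)"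
  shows "(\<lambda>\<nu>. \<Psi> (atoms J \<nu> \<inter> B) (atoms J' \<nu> \<inter> B)) \<in> borel_measurable config_space"
proof (rule borel_measurable_LIMSEQ_real)
  show "(\<lambda>\<nu>. \<Psi>' j (dyadic j ` (atoms J \<nu> \<inter> B)) (dyadic j ` (atoms J' \<nu> \<inter> B))) \<in> borel_measurable config_space" for j
  proof -
    let ?G = "dyadic j ` B"
    have fG: "finite ?G" by (rule finite_dyadic_image[OF B(2)])
    let ?c = "\<lambda>c. {x. dyadic j x = c} \<inter> B"
    have cb: "?c c \<in> sets borel" "bounded (?c c)" for c
      using dyadic_cell_borel B by (auto intro: bounded_subset)
    have mem: "c \<in> dyadic j ` (atoms I \<nu> \<inter> B) \<longleftrightarrow> emeasure \<nu> (?c c \<times> I) \<noteq> 0"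
      if "\<nu> \<in> space config_space" "I \<in> sets borel" for c I \<nu>
      unfolding cell_charged_iff[OF that cb] by auto
    let ?S = "\<lambda>I \<nu>. dyadic j ` (atoms I \<nu> \<inter> B)"
    have "(\<lambda>\<nu>. (?S J \<nu>, ?S J' \<nu>)) \<in> measurable config_space (count_space (Pow ?G \<times> Pow ?G))"
    proof (subst measurable_count_space_eq2)
      show "finite (Pow ?G \<times> Pow ?G)" using fG by simp
      have pred: "{\<nu> \<in> space config_space. ?S I \<nu> = A} \<in> sets config_space" if I: "I \<in> sets borel" and A: "A \<subseteq> ?G" for I A
      proof -
        have cI: "?c c \<times> I \<in> sets borel" for c using cb(1) I by (rule sets_Times_borel)
        have "{\<nu> \<in> space config_space. ?S I \<nu> = A} = {\<nu> \<in> space config_space. \<forall>c\<in>?G. emeasure \<nu> (?c c \<times> I) \<noteq> 0 \<longleftrightarrow> c \<in> A}"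
        proof (intro Collect_cong conj_cong refl)
          fix \<nu> :: "((real, 'd) vec \<times> real) measure" assume \<nu>: "\<nu> \<in> space config_space"
          have "?S I \<nu> = A \<longleftrightarrow> (\<forall>c\<in>?G. c \<in> ?S I \<nu> \<longleftrightarrow> c \<in> A)" using A by blast
          then show "?S I \<nu> = A \<longleftrightarrow> (\<forall>c\<in>?G. emeasure \<nu> (?c c \<times> I) \<noteq> 0 \<longleftrightarrow> c \<in> A)"
            using mem[OF \<nu> I] by simp
        qed
        also have "\<dots> \<in> sets config_space"
        proof (rule sets.sets_Collect_finite_All[OF _ fG])
          fix c
          have [measurable]: "(\<lambda>\<nu>. emeasure \<nu> (?c c \<times> I)) \<in> borel_measurable config_space"
            by (rule emeasure_config_measurable[OF cI])
          show "{\<nu> \<in> space config_space. emeasure \<nu> (?c c \<times> I) \<noteq> 0 \<longleftrightarrow> c \<in> A} \<in> sets config_space"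
            by measurable
        qed
        finally show ?thesis .
      qed
      show "(\<lambda>\<nu>. (?S J \<nu>, ?S J' \<nu>)) \<in> space config_space \<rightarrow> Pow ?G \<times> Pow ?G \<and>
        (\<forall>a\<in>Pow ?G \<times> Pow ?G. (\<lambda>\<nu>. (?S J \<nu>, ?S J' \<nu>)) -` {a} \<inter> space config_space \<in> sets config_space)"
      proof (intro conjI ballI)
        fix a assume a: "a \<in> Pow ?G \<times> Pow ?G"
        have "(\<lambda>\<nu>. (?S J \<nu>, ?S J' \<nu>)) -` {a} \<inter> space config_space =
          {\<nu> \<in> space config_space. ?S J \<nu> = fst a} \<inter> {\<nu> \<in> space config_space. ?S J' \<nu> = snd a}" by auto
        also have "\<dots> \<in> sets config_space" using a J by (intro sets.Int pred) auto
        finally show "(\<lambda>\<nu>. (?S J \<nu>, ?S J' \<nu>)) -` {a} \<inter> space config_space \<in> sets config_space" .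
      qed auto
    qed
    then have "(\<lambda>\<nu>. (\<lambda>(A, A'). \<Psi>' j A A') (?S J \<nu>, ?S J' \<nu>)) \<in> borel_measurable config_space"
      by (rule measurable_compose) simp
    then show ?thesis by simp
  qed
qed (rule lim)

section \<open>Counting small sets of points\<close>

definition small_sets :: "nat \<Rightarrow> 'a set \<Rightarrow> ('a set \<Rightarrow> bool) \<Rightarrow> 'a set set" where
  "small_sets K A Q = {\<sigma>. \<sigma> \<subseteq> A \<and> \<sigma> \<noteq> {} \<and> card \<sigma> \<le> K \<and> Q \<sigma>}"

lemma finite_small_sets: "finite A \<Longrightarrow> finite (small_sets K A Q)"
  by (rule finite_subset[of _ "Pow A"]) (auto simp: small_sets_def)

lemma card_small_sets_image:
  assumes "inj_on g A" "\<And>\<sigma>. \<sigma> \<subseteq> A \<Longrightarrow> \<sigma> \<noteq> {} \<Longrightarrow> Q' (g ` \<sigma>) \<longleftrightarrow> Q \<sigma>"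
  shows "card (small_sets K (g ` A) Q') = card (small_sets K A Q)"
proof -
  have c: "card (g ` \<sigma>) = card \<sigma>" if "\<sigma> \<subseteq> A" for \<sigma>
    using card_image[OF inj_on_subset[OF assms(1) that]] .
  have "small_sets K (g ` A) Q' = image g ` small_sets K A Q"
  proof (intro equalityI subsetI)
    fix \<tau> assume t: "\<tau> \<in> small_sets K (g ` A) Q'"
    then obtain \<sigma> where s: "\<sigma> \<subseteq> A" "\<tau> = g ` \<sigma>" by (auto simp: small_sets_def subset_image_iff)
    then have "\<sigma> \<in> small_sets K A Q" using t assms(2)[of \<sigma>] c by (auto simp: small_sets_def)
    then show "\<tau> \<in> image g ` small_sets K A Q" using s by blast
  next
    fix \<tau> assume "\<tau> \<in> image g ` small_sets K A Q"
    then obtain \<sigma> where s: "\<sigma> \<in> small_sets K A Q" "\<tau> = g ` \<sigma>" by auto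
    then show "\<tau> \<in> small_sets K (g ` A) Q'" using assms(2)[of \<sigma>] c[of \<sigma>] by (auto simp: small_sets_def)
  qed
  moreover have "inj_on (image g) (small_sets K A Q)"
    using inj_on_image_Pow[OF assms(1)] by (rule inj_on_subset) (auto simp: small_sets_def)
  ultimately show ?thesis by (simp add: card_image)
qed

lemma card_bad_small_sets:
  fixes P :: "'a::euclidean_space set"
  assumes "finite P"
  shows "card {\<sigma> \<in> small_sets K P Q. cech_radius \<sigma> \<le> T \<and> (\<forall>B\<in>\<B>. \<not> \<sigma> \<subseteq> B)}
    \<le> (\<Sum>x\<in>{x \<in> P. \<forall>B\<in>\<B>. \<not> P \<inter> cball x (2 * T) \<subseteq> B}. card (P \<inter> cball x (2 * T)) ^ K)"
proof -
  let ?bad = "{x \<in> P. \<forall>B\<in>\<B>. \<not> P \<inter> cball x (2 * T) \<subseteq> B}"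
  let ?N = "\<lambda>x. P \<inter> cball x (2 * T)"
  let ?X = "\<lambda>x. {\<sigma>. \<sigma> \<subseteq> ?N x \<and> \<sigma> \<noteq> {} \<and> card \<sigma> \<le> K}"
  have X: "finite (?X x)" "card (?X x) \<le> card (?N x) ^ K" for x
    using card_small_subsets[of "?N x" K] assms by auto
  have "{\<sigma> \<in> small_sets K P Q. cech_radius \<sigma> \<le> T \<and> (\<forall>B\<in>\<B>. \<not> \<sigma> \<subseteq> B)} \<subseteq> (\<Union>x\<in>?bad. ?X x)"
  proof
    fix \<sigma> assume "\<sigma> \<in> {\<sigma> \<in> small_sets K P Q. cech_radius \<sigma> \<le> T \<and> (\<forall>B\<in>\<B>. \<not> \<sigma> \<subseteq> B)}"
    then have s: "\<sigma> \<subseteq> P" "\<sigma> \<noteq> {}" "card \<sigma> \<le> K" "cech_radius \<sigma> \<le> T" "\<forall>B\<in>\<B>. \<not> \<sigma> \<subseteq> B"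
      by (auto simp: small_sets_def)
    obtain x where x: "x \<in> \<sigma>" using s by auto
    have fs: "finite \<sigma>" using s assms finite_subset by auto
    have N: "\<sigma> \<subseteq> ?N x"
    proof
      fix y assume y: "y \<in> \<sigma>"
      have "dist x y \<le> 2 * cech_radius \<sigma>" by (rule dist_le_cech_radius[OF fs x y])
      then show "y \<in> ?N x" using s y by auto
    qed
    have "x \<in> ?bad" using x s(1,5) order_trans[OF N] by auto
    then show "\<sigma> \<in> (\<Union>x\<in>?bad. ?X x)" using N s by auto
  qed
  then have "card {\<sigma> \<in> small_sets K P Q. cech_radius \<sigma> \<le> T \<and> (\<forall>B\<in>\<B>. \<not> \<sigma> \<subseteq> B)} \<le> card (\<Union>x\<in>?bad. ?X x)"
    using assms X by (intro card_mono) auto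
  also have "\<dots> \<le> (\<Sum>x\<in>?bad. card (?X x))" using assms by (intro card_UN_le) auto
  also have "\<dots> \<le> (\<Sum>x\<in>?bad. card (?N x) ^ K)" by (intro sum_mono X)
  finally show ?thesis .
qed

text \<open>A set counted on the left that is contained in no region is charged to one of its points,
  as in \<open>card_bad_multicover\<close>.\<close>

lemma small_sets_compare:
  fixes P :: "'a::euclidean_space set"
  assumes "finite P" "finite \<B>" "disjoint \<B>" "\<And>\<sigma>. Q \<sigma> \<Longrightarrow> cech_radius \<sigma> \<le> T"
  shows "\<bar>real (card (small_sets K P Q)) - (\<Sum>B\<in>\<B>. real (card (small_sets K (P \<inter> B) Q)))\<bar> \<le>
    (\<Sum>x\<in>{x \<in> P. \<forall>B\<in>\<B>. \<not> P \<inter> cball x (2 * T) \<subseteq> B}. real (card (P \<inter> cball x (2 * T)) ^ K))"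
proof -
  let ?R = "{\<sigma> \<in> small_sets K P Q. cech_radius \<sigma> \<le> T \<and> (\<forall>B\<in>\<B>. \<not> \<sigma> \<subseteq> B)}"
  let ?U = "\<Union>B\<in>\<B>. small_sets K (P \<inter> B) Q"
  have eq: "small_sets K P Q = ?R \<union> ?U"
    using assms(4) by (auto simp: small_sets_def)
  have "card (?R \<union> ?U) = card ?R + card ?U"
  proof (rule card_Un_disjoint)
    show "finite ?R" using finite_small_sets[OF assms(1)] by (rule finite_subset[rotated]) auto
    show "finite ?U" using assms(1,2) by (auto intro: finite_small_sets)
    show "?R \<inter> ?U = {}" by (auto simp: small_sets_def)
  qed
  then have "card (small_sets K P Q) = card ?R + card ?U"
    using arg_cong[OF eq, of card] by simp
  also have "card (\<Union>B\<in>\<B>. small_sets K (P \<inter> B) Q) = (\<Sum>B\<in>\<B>. card (small_sets K (P \<inter> B) Q))"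
  proof (rule card_UN_disjoint)
    show "\<forall>i\<in>\<B>. \<forall>j\<in>\<B>. i \<noteq> j \<longrightarrow> small_sets K (P \<inter> i) Q \<inter> small_sets K (P \<inter> j) Q = {}"
      using assms(3) unfolding disjoint_def small_sets_def by fastforce
  qed (use assms(1,2) in \<open>auto intro: finite_small_sets\<close>)
  finally have "real (card (small_sets K P Q)) - (\<Sum>B\<in>\<B>. real (card (small_sets K (P \<inter> B) Q))) = real (card ?R)" by simp
  moreover have "real (card ?R) \<le> real (\<Sum>x\<in>{x \<in> P. \<forall>B\<in>\<B>. \<not> P \<inter> cball x (2 * T) \<subseteq> B}. card (P \<inter> cball x (2 * T)) ^ K)"
    using card_bad_small_sets[OF assms(1)] by (rule of_nat_mono)
  ultimately show ?thesis by simp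
qed

section \<open>Laws of stationary ergodic point processes\<close>

lemma nbhd_eq_cbox: "nbhd R z = cbox (lattice_point z - vec (real R)) (lattice_point z + vec (1 + real R))"
  by (auto simp: nbhd_def mem_box_cart algebra_simps)

lemma nbhd_borel: "nbhd R z \<in> sets borel"
  unfolding nbhd_eq_cbox by simp

lemma bounded_nbhd: "bounded (nbhd R z)"
  unfolding nbhd_eq_cbox by (rule bounded_cbox)

lemma nbhd_Times_borel: "nbhd R z \<times> (UNIV :: real set) \<in> sets borel"
  using nbhd_borel by (intro sets_Times_borel) auto

text \<open>A power of the number of points near the cell of the origin.\<close>

definition weight :: "nat \<Rightarrow> nat \<Rightarrow> ((real, 'd::finite) vec \<times> real) measure \<Rightarrow> real" where
  "weight p R \<nu> = (measure \<nu> (nbhd R 0 \<times> UNIV)) ^ p"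

lemma measure_mono_config:
  assumes "\<nu> \<in> space config_space" "A \<subseteq> B" "A \<in> sets borel" "B \<in> sets borel" "bounded (fst ` B)"
  shows "measure \<nu> A \<le> measure \<nu> B"
proof (rule measure_mono_fmeasurable[OF assms(2)])
  obtain n :: nat where "emeasure \<nu> B = of_nat n" using config_space_Nats[OF assms(1,4,5)] by metis
  then show "B \<in> fmeasurable \<nu>" using assms by (intro fmeasurableI) (auto simp: config_space_sets of_nat_less_top)
qed (use assms in \<open>simp add: config_space_sets\<close>)

lemma measure_config_shift:
  assumes "\<nu> \<in> space config_space" "C \<in> sets borel"
  shows "measure (config_shift v \<nu>) (C \<times> UNIV) = measure \<nu> ((\<lambda>x. x + v) -` C \<times> UNIV)"
    and "(\<lambda>x. x + v) -` C \<in> sets borel"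
proof -
  have "(\<lambda>(x, m). (x + v, m)) -` (C \<times> (UNIV :: real set)) = ((\<lambda>x. x + v) -` C) \<times> UNIV" by auto
  moreover have "C \<times> (UNIV :: real set) \<in> sets borel" using assms(2) by (intro sets_Times_borel) auto
  ultimately show "measure (config_shift v \<nu>) (C \<times> UNIV) = measure \<nu> ((\<lambda>x. x + v) -` C \<times> UNIV)"
    using emeasure_config_shift(1)[OF assms(1)] by (simp add: measure_def)
  have "(\<lambda>x. x + v) \<in> borel_measurable borel" by measurable
  from measurable_sets[OF this assms(2)] show "(\<lambda>x. x + v) -` C \<in> sets borel" by simp
qed

lemma weight_lattice_shift:
  assumes "\<nu> \<in> space config_space"
  shows "weight p R (config_shift (- lattice_point z) \<nu>) = (measure \<nu> (nbhd R z \<times> UNIV)) ^ p"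
proof -
  have "(\<lambda>x. x + - lattice_point z) -` nbhd R 0 = nbhd R z" by (auto simp: nbhd_def algebra_simps)
  then show ?thesis unfolding weight_def using measure_config_shift(1)[OF assms nbhd_borel] by simp
qed

lemma weight_shift:
  assumes "\<nu> \<in> space config_space" "\<And>i. \<bar>v $ i\<bar> \<le> real k"
  shows "weight p R (config_shift v \<nu>) \<le> weight p (R + k) \<nu>"
proof -
  have sub: "(\<lambda>x. x + v) -` nbhd R 0 \<subseteq> nbhd (R + k) 0"
  proof
    fix x assume "x \<in> (\<lambda>x. x + v) -` nbhd R 0"
    then have that: "- real R \<le> x $ i + v $ i \<and> x $ i + v $ i \<le> 1 + real R" for i by (simp add: nbhd_def)
    have "- real (R + k) \<le> x $ i \<and> x $ i \<le> 1 + real (R + k)" for i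
    proof -
      have "- real R \<le> x $ i + v $ i" "x $ i + v $ i \<le> 1 + real R" "\<bar>v $ i\<bar> \<le> real k"
        using that assms(2) by auto
      then show ?thesis unfolding of_nat_add by linarith
    qed
    then show "x \<in> nbhd (R + k) 0" by (simp add: nbhd_def)
  qed
  have "measure \<nu> ((\<lambda>x. x + v) -` nbhd R 0 \<times> UNIV) \<le> measure \<nu> (nbhd (R + k) 0 \<times> UNIV)"
    by (rule measure_mono_config[OF assms(1)])
      (use sub in \<open>auto intro!: sets_Times_borel nbhd_Times_borel bounded_fst_Times bounded_nbhd
        measure_config_shift(2)[OF assms(1) nbhd_borel]\<close>)
  then show ?thesis
    unfolding weight_def measure_config_shift(1)[OF assms(1) nbhd_borel] by (rule power_mono) simp
qed

lemma power_sum_le: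
  fixes a :: "'i \<Rightarrow> real"
  assumes "finite Z" "Z \<noteq> {}" "\<And>z. z \<in> Z \<Longrightarrow> 0 \<le> a z"
  shows "(\<Sum>z\<in>Z. a z) ^ p \<le> real (card Z) ^ p * (\<Sum>z\<in>Z. a z ^ p)"
proof -
  have "Max (a ` Z) \<in> a ` Z" using assms(1,2) by (intro Max_in) auto
  then obtain z0 where z0: "z0 \<in> Z" "a z0 = Max (a ` Z)" by (auto simp: image_iff)
  have le: "a z \<le> a z0" if "z \<in> Z" for z using z0(2) that assms(1) by auto
  have "(\<Sum>z\<in>Z. a z) \<le> real (card Z) * a z0" by (rule sum_bounded_above[of Z a "a z0"]) (rule le)
  then have "(\<Sum>z\<in>Z. a z) ^ p \<le> (real (card Z) * a z0) ^ p"
    by (rule power_mono) (use assms in \<open>auto intro: sum_nonneg\<close>)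
  also have "\<dots> = real (card Z) ^ p * a z0 ^ p" by (rule power_mult_distrib)
  also have "a z0 ^ p \<le> (\<Sum>z\<in>Z. a z ^ p)"
    using assms z0(1) by (intro member_le_sum) auto
  finally show ?thesis by (simp add: mult_left_mono)
qed

text \<open>The law of a stationary and ergodic marked point process whose numbers of points in the
  unit cube have moments of all orders.\<close>

locale point_process_law = prob_space P for P :: "((real, 'd::finite) vec \<times> real) measure measure" +
  assumes sets_P: "sets P = sets config_space"
    and shift_P: "distr P config_space (config_shift v) = P"
    and ergodic_P: "A \<in> sets config_space \<Longrightarrow>
      (\<And>v \<nu>. \<nu> \<in> space config_space \<Longrightarrow> config_shift v \<nu> \<in> A \<longleftrightarrow> \<nu> \<in> A) \<Longrightarrow> measure P A \<in> {0, 1}"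
    and moments: "integrable P (\<lambda>\<nu>. (measure \<nu> (cbox 0 1 \<times> UNIV)) ^ p)"
begin

lemma space_P: "space P = space config_space"
  using sets_P by (rule sets_eq_imp_space_eq)

lemma measurable_P: "f \<in> borel_measurable config_space \<Longrightarrow> f \<in> borel_measurable P"
  using sets_P by (simp cong: measurable_cong_sets)

lemma shift_measurable_P: "config_shift v \<in> measurable P P"
  using config_shift_measurable[of v] measurable_cong_sets[OF sets_P sets_P] by blast

lemma shift_distr_P: "distr P P (config_shift v) = P"
proof -
  have "distr P P (config_shift v) = distr P config_space (config_shift v)"
    by (rule distr_cong) (auto simp: sets_P)
  then show ?thesis by (simp add: shift_P)
qed

text \<open>The neighbourhood is covered by finitely many translates of the unit cube, whose point
  counts all have the same distribution.\<close>

lemma weight_moments: "integrable P (weight p R)"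
proof -
  define Z where "Z = {z :: (int, 'd) vec. \<forall>i. z $ i \<in> {- int R..int R + 1}}"
  have fZ: "finite Z" unfolding Z_def by (rule finite_card_vec_box(1)) simp
  have Zne: "Z \<noteq> {}" unfolding Z_def by (auto intro!: exI[of _ 0])
  let ?a = "\<lambda>z \<nu>. measure (config_shift (- lattice_point z) \<nu>) (cbox 0 1 \<times> UNIV)"
  have cb: "cbox 0 (1 :: (real, 'd) vec) \<times> (UNIV :: real set) \<in> sets borel" by (intro sets_Times_borel) auto
  have "integrable P (\<lambda>\<nu>. (?a z \<nu>) ^ p)" for z
    using integrable_distr_eq[of "config_shift (- lattice_point z)" P P "\<lambda>\<nu>. (measure \<nu> (cbox 0 1 \<times> UNIV)) ^ p"]
      moments[of p] shift_measurable_P shift_distr_P by (simp add: borel_measurable_integrable)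
  then have "integrable P (\<lambda>\<nu>. real (card Z) ^ p * (\<Sum>z\<in>Z. (?a z \<nu>) ^ p))" by simp
  then show ?thesis
  proof (rule Bochner_Integration.integrable_bound)
    show "weight p R \<in> borel_measurable P"
      unfolding weight_def[abs_def]
      by (intro measurable_P borel_measurable_power measure_config_measurable nbhd_Times_borel)
    show "AE \<nu> in P. norm (weight p R \<nu>) \<le> norm (real (card Z) ^ p * (\<Sum>z\<in>Z. (?a z \<nu>) ^ p))"
    proof (rule AE_I2)
      fix \<nu> assume "\<nu> \<in> space P"
      then have \<nu>: "\<nu> \<in> space config_space" by (simp add: space_P)
      let ?C = "\<lambda>z. (\<lambda>x. x + - lattice_point z) -` cbox 0 1 :: (real, 'd) vec set"
      have C: "?C z \<in> sets borel" for z using measure_config_shift(2)[OF \<nu>, of "cbox 0 1" "- lattice_point z"] by simp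
      have Cc: "?C z = cbox (lattice_point z) (lattice_point z + 1)" for z
        by (auto simp: mem_box_cart algebra_simps)
      have sub: "nbhd R 0 \<subseteq> (\<Union>z\<in>Z. ?C z)"
      proof
        fix x :: "(real, 'd) vec" assume x: "x \<in> nbhd R 0"
        define z where "z = (\<chi> i. \<lfloor>x $ i\<rfloor>)"
        have "- real R \<le> x $ i" "x $ i \<le> 1 + real R" for i using x by (auto simp: nbhd_def)
        then have "- int R \<le> z $ i \<and> z $ i \<le> int R + 1" for i
        proof -
          have "- real R \<le> x $ i" "x $ i \<le> 1 + real R" using x by (auto simp: nbhd_def)
          then have "- int R \<le> \<lfloor>x $ i\<rfloor>" "\<lfloor>x $ i\<rfloor> \<le> int R + 1" by linarith+
          then show ?thesis by (simp add: z_def)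
        qed
        then have "z \<in> Z" by (simp add: Z_def)
        moreover have "of_int (z $ i) \<le> x $ i \<and> x $ i \<le> of_int (z $ i) + 1" for i
          unfolding z_def by (simp add: less_imp_le)
        then have "x \<in> ?C z" unfolding Cc by (simp add: mem_box_cart)
        ultimately show "x \<in> (\<Union>z\<in>Z. ?C z)" by blast
      qed
      have U: "(\<Union>z\<in>Z. ?C z) \<times> (UNIV :: real set) = (\<Union>z\<in>Z. ?C z \<times> UNIV)" by auto
      have "measure \<nu> (nbhd R 0 \<times> UNIV) \<le> measure \<nu> ((\<Union>z\<in>Z. ?C z) \<times> UNIV)"
      proof (rule measure_mono_config[OF \<nu>])
        show "bounded (fst ` ((\<Union>z\<in>Z. ?C z) \<times> (UNIV :: real set)))"
          unfolding Cc using fZ by (intro bounded_fst_Times bounded_UN) (auto intro: bounded_cbox)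
        show "(\<Union>z\<in>Z. ?C z) \<times> (UNIV :: real set) \<in> sets borel"
          using fZ C by (intro sets_Times_borel sets.finite_UN) auto
      qed (use sub nbhd_Times_borel in auto)
      also have "\<dots> \<le> (\<Sum>z\<in>Z. measure \<nu> (?C z \<times> UNIV))"
        unfolding U using fZ C by (intro measure_UNION_le) (auto simp: config_space_sets[OF \<nu>] intro!: sets_Times_borel)
      also have "\<dots> = (\<Sum>z\<in>Z. ?a z \<nu>)"
        by (simp add: measure_config_shift(1)[OF \<nu>])
      finally have "measure \<nu> (nbhd R 0 \<times> UNIV) ^ p \<le> (\<Sum>z\<in>Z. ?a z \<nu>) ^ p"
        by (rule power_mono) simp
      also have "\<dots> \<le> real (card Z) ^ p * (\<Sum>z\<in>Z. (?a z \<nu>) ^ p)"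
        by (rule power_sum_le[OF fZ Zne]) simp
      finally show "norm (weight p R \<nu>) \<le> norm (real (card Z) ^ p * (\<Sum>z\<in>Z. (?a z \<nu>) ^ p))"
        by (simp add: weight_def sum_nonneg)
    qed
  qed
qed

lemma spatial_action_P: "spatial_action P config_shift (weight p)"
proof (intro spatial_action.intro spatial_action_axioms.intro)
  show "prob_space P" by (rule prob_space_axioms)
  show "config_shift v \<in> measurable P P" for v by (rule shift_measurable_P)
  show "distr P P (config_shift v) = P" for v by (rule shift_distr_P)
  show "config_shift v (config_shift w \<nu>) = config_shift (v + w) \<nu>" if "\<nu> \<in> space P" for v w \<nu>
    using that by (simp add: space_P config_shift_add)
  show "config_shift 0 \<nu> = \<nu>" if "\<nu> \<in> space P" for \<nu> using that by (simp add: space_P config_shift_zero)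
  show "measure P A \<in> {0, 1}" if "A \<in> sets P" "\<And>v \<nu>. \<nu> \<in> space P \<Longrightarrow> config_shift v \<nu> \<in> A \<longleftrightarrow> \<nu> \<in> A" for A
    using that by (intro ergodic_P) (auto simp: sets_P space_P)
  show "0 \<le> weight p R \<nu>" for R \<nu> by (simp add: weight_def)
  show "weight p R \<in> borel_measurable P" for R using weight_moments by (rule borel_measurable_integrable)
  have sq: "(\<lambda>\<nu>. (weight p R \<nu>)\<^sup>2) = weight (p * 2) R" for R
    by (simp add: weight_def fun_eq_iff power_mult)
  show "integrable P (\<lambda>\<nu>. (weight p R \<nu>)\<^sup>2)" for R unfolding sq by (rule weight_moments)
  show "weight p R (config_shift v \<nu>) \<le> weight p (R + k) \<nu>" if "\<nu> \<in> space P" "\<And>i. \<bar>v $ i\<bar> \<le> real k" for R v k \<nu>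
    by (rule weight_shift) (use that in \<open>auto simp: space_P\<close>)
qed

end

lemma finite_bad:
  assumes "bounded B"
  shows "finite (bad R B \<B>)"
proof -
  obtain a where a: "\<And>x. x \<in> B \<Longrightarrow> norm x \<le> a" using assms by (auto simp: bounded_iff)
  have "bad R B \<B> \<subseteq> {z. \<forall>i. z $ i \<in> {\<lfloor>- a\<rfloor> - 1..\<lfloor>a\<rfloor>}}"
  proof
    fix z assume "z \<in> bad R B \<B>"
    then obtain x where x: "x \<in> B" "x \<in> hcube (lattice_point z) 1" by (auto simp: bad_def)
    have "z $ i \<in> {\<lfloor>- a\<rfloor> - 1..\<lfloor>a\<rfloor>}" for i
    proof -
      have "\<bar>x $ i\<bar> \<le> a" using a[OF x(1)] component_le_norm_cart[of x i] by linarith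
      moreover have "of_int (z $ i) \<le> x $ i" "x $ i < of_int (z $ i) + 1" using x(2) by (auto simp: hcube_def)
      ultimately have "of_int (z $ i) \<le> a" "- a - 1 < of_int (z $ i)" by linarith+
      then show ?thesis by (auto simp: le_floor_iff) linarith
    qed
    then show "z \<in> {z. \<forall>i. z $ i \<in> {\<lfloor>- a\<rfloor> - 1..\<lfloor>a\<rfloor>}}" by blast
  qed
  moreover have "finite {z::(int, 'a) vec. \<forall>i. z $ i \<in> {\<lfloor>- a\<rfloor> - 1..\<lfloor>a\<rfloor>}}"
    by (rule finite_card_vec_box(1)) simp
  ultimately show ?thesis by (rule finite_subset)
qed

text \<open>All points in the same cell are charged to this cell. Their number is at most the number
  of points near the cell, which raises the exponent by one.\<close>

lemma bad_points_weight:
  fixes B :: "(real, 'd::finite) vec set"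
  assumes \<nu>: "\<nu> \<in> space config_space" and J: "J \<in> sets borel" and B: "bounded B"
    and R: "2 * T \<le> real R" and p: "m + 1 \<le> p"
  shows "(\<Sum>x\<in>{x \<in> atoms J \<nu> \<inter> B. \<forall>C\<in>\<B>. \<not> (atoms J \<nu> \<inter> B) \<inter> cball x (2 * T) \<subseteq> C}.
      real (card ((atoms J \<nu> \<inter> B) \<inter> cball x (2 * T)) ^ m)) \<le>
    (\<Sum>z\<in>bad R B \<B>. weight p R (config_shift (- lattice_point z) \<nu>))"
proof -
  let ?A = "atoms J \<nu> \<inter> B"
  let ?X = "{x \<in> ?A. \<forall>C\<in>\<B>. \<not> ?A \<inter> cball x (2 * T) \<subseteq> C}"
  define fl :: "(real, 'd) vec \<Rightarrow> (int, 'd) vec" where "fl = (\<lambda>x. \<chi> i. \<lfloor>x $ i\<rfloor>)"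
  let ?N = "\<lambda>z. measure \<nu> (nbhd R z \<times> UNIV)"
  have fA: "finite ?A" by (rule finite_atoms[OF \<nu> J B])
  have cell: "x \<in> hcube (lattice_point (fl x)) 1" for x by (simp add: hcube_def fl_def)
  have ball_sub: "cball x (2 * T) \<subseteq> nbhd R (fl x)" for x
  proof
    fix y assume "y \<in> cball x (2 * T)"
    then have d: "norm (x - y) \<le> 2 * T" by (simp add: dist_norm)
    have "of_int \<lfloor>x $ i\<rfloor> - real R \<le> y $ i \<and> y $ i \<le> of_int \<lfloor>x $ i\<rfloor> + 1 + real R" for i
    proof -
      have "\<bar>x $ i - y $ i\<bar> \<le> real R" using component_le_norm_cart[of "x - y" i] d R by simp
      then show ?thesis by linarith
    qed
    then show "y \<in> nbhd R (fl x)" by (simp add: nbhd_def fl_def)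
  qed
  have cN: "real (card (?A \<inter> S)) \<le> ?N z" if "S \<subseteq> nbhd R z" for S z
  proof -
    have "card (?A \<inter> S) \<le> card (atoms J \<nu> \<inter> nbhd R z)"
      by (rule card_mono) (use that finite_atoms[OF \<nu> J bounded_nbhd] in auto)
    then show ?thesis using atoms_card(2)[OF \<nu> J nbhd_borel bounded_nbhd, of R z] by linarith
  qed
  have flbad: "fl x \<in> bad R B \<B>" if x: "x \<in> ?X" for x
    unfolding bad_def
  proof (rule CollectI, intro conjI ballI)
    show "hcube (lattice_point (fl x)) 1 \<inter> B \<noteq> {}" using cell[of x] x by auto
    fix C assume C: "C \<in> \<B>"
    have "\<not> ?A \<inter> cball x (2 * T) \<subseteq> C" using x C by auto
    then show "\<not> B \<inter> nbhd R (fl x) \<subseteq> C" using ball_sub[of x] by blast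
  qed
  have fX: "finite ?X" using fA by (rule finite_subset[rotated]) auto
  have "(\<Sum>x\<in>?X. real (card (?A \<inter> cball x (2 * T)) ^ m)) \<le> (\<Sum>x\<in>?X. ?N (fl x) ^ m)"
    unfolding of_nat_power by (intro sum_mono power_mono cN ball_sub) auto
  also have "\<dots> = (\<Sum>z\<in>bad R B \<B>. \<Sum>x\<in>{x \<in> ?X. fl x = z}. ?N (fl x) ^ m)"
    using flbad fX finite_bad[OF B] by (intro sum.group[symmetric]) auto
  also have "\<dots> \<le> (\<Sum>z\<in>bad R B \<B>. weight p R (config_shift (- lattice_point z) \<nu>))"
  proof (rule sum_mono)
    fix z assume "z \<in> bad R B \<B>"
    have "(\<Sum>x\<in>{x \<in> ?X. fl x = z}. ?N (fl x) ^ m) = (\<Sum>x\<in>{x \<in> ?X. fl x = z}. ?N z ^ m)"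
      by (rule sum.cong) auto
    also have "\<dots> = real (card {x \<in> ?X. fl x = z}) * ?N z ^ m" by simp
    also have "\<dots> \<le> ?N z * ?N z ^ m"
    proof (rule mult_right_mono)
      have "{x \<in> ?X. fl x = z} \<subseteq> ?A \<inter> nbhd R z"
      proof
        fix x assume x: "x \<in> {x \<in> ?X. fl x = z}"
        then have "of_int (z $ i) \<le> x $ i \<and> x $ i < of_int (z $ i) + 1" for i by (auto simp: fl_def)
        then have "of_int (z $ i) - real R \<le> x $ i \<and> x $ i \<le> of_int (z $ i) + 1 + real R" for i
          by (meson add_increasing2 diff_le_eq less_imp_le of_nat_0_le_iff order_trans)
        then show "x \<in> ?A \<inter> nbhd R z" using x by (auto simp: nbhd_def)
      qed
      then have "card {x \<in> ?X. fl x = z} \<le> card (?A \<inter> nbhd R z)" using fA by (intro card_mono) auto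
      then show "real (card {x \<in> ?X. fl x = z}) \<le> ?N z" using cN[OF order_refl, of z] by linarith
    qed simp
    also have "\<dots> = ?N z ^ (m + 1)" by simp
    also have "\<dots> \<le> ?N z ^ p"
    proof -
      obtain n :: nat where n: "?N z = real n"
        using config_space_Nats[OF \<nu> nbhd_Times_borel bounded_fst_Times[OF bounded_nbhd]] by metis
      show ?thesis
      proof (cases "n = 0")
        case False
        then have "1 \<le> ?N z" by (simp add: n)
        then show ?thesis using p by (intro power_increasing) auto
      qed (use p n in auto)
    qed
    finally show "(\<Sum>x\<in>{x \<in> ?X. fl x = z}. ?N (fl x) ^ m) \<le> weight p R (config_shift (- lattice_point z) \<nu>)"
      by (simp add: weight_lattice_shift[OF \<nu>])
  qed
  finally show ?thesis .
qed

lemma hcube_borel: "hcube v n \<in> sets (borel :: (real, 'd::finite) vec measure)"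
proof -
  have [measurable]: "(\<lambda>x::(real, 'd) vec. x $ i) \<in> borel_measurable borel" for i
    by (intro borel_measurable_continuous_onI continuous_intros)
  have "{x \<in> space borel. \<forall>i\<in>(UNIV::'d set). v $ i \<le> (x :: (real, 'd) vec) $ i \<and> x $ i < v $ i + real n} \<in> sets borel"
    by measurable
  then show ?thesis by (simp add: hcube_def)
qed

lemma lex_less_translate: "lex_less (x + v) (y + v) \<longleftrightarrow> lex_less x y"
  by (simp add: less_fun_def)

section \<open>Betti numbers and simplex counts of regions\<close>

text \<open>The source consists of the points in \<open>B\<close> with mark at most \<open>t\<close> and has radius \<open>r\<close> and
  multiplicity \<open>k\<close>; the target belongs to \<open>(s, u, l)\<close> in the same way.\<close>

definition region_betti ::
  "nat \<Rightarrow> real \<Rightarrow> real \<Rightarrow> nat \<Rightarrow> real \<Rightarrow> real \<Rightarrow> nat \<Rightarrow> (real, 'd::{finite,linorder}) vec set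
    \<Rightarrow> ((real, 'd) vec \<times> real) measure \<Rightarrow> real" where
  "region_betti q r t k s u l B \<nu> = real (prank q r k s l (atoms {..t} \<nu> \<inter> B) (atoms {..u} \<nu> \<inter> B))"

lemma region_betti_measurable:
  fixes B :: "(real, 'd::{finite,linorder}) vec set"
  assumes B: "B \<in> sets borel" "bounded B" and le: "r \<le> s" "t \<le> u" "1 \<le> l" "l \<le> k"
  shows "region_betti q r t k s u l B \<in> borel_measurable config_space"
proof -
  have "(\<lambda>\<nu>. real (prank q r k s l (atoms {..t} \<nu> \<inter> B) (atoms {..u} \<nu> \<inter> B))) \<in> borel_measurable config_space"
  proof (rule measurable_atoms_functional[OF B,
      where \<Psi>' = "\<lambda>j A A'. real (prank q (r + mesh TYPE('d) j) k (s + mesh TYPE('d) j) l A A')" and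
        \<Psi> = "\<lambda>A A'. real (prank q r k s l A A')"])
    fix \<nu> :: "((real, 'd) vec \<times> real) measure" assume \<nu>: "\<nu> \<in> space config_space"
    let ?A = "atoms {..t} \<nu> \<inter> B" and ?A' = "atoms {..u} \<nu> \<inter> B"
    have fA': "finite ?A'" using \<nu> B by (intro finite_atoms) auto
    have AA': "?A \<subseteq> ?A'" using atoms_mono[OF \<nu>, of "{..u}" "{..t}"] le by auto
    have "eventually (\<lambda>j. prank q (r + mesh TYPE('d) j) k (s + mesh TYPE('d) j) l (dyadic j ` ?A) (dyadic j ` ?A')
       = prank q r k s l ?A ?A') sequentially"
      using eventually_dyadic_order[OF fA'] eventually_radius_le[OF fA', of r] eventually_radius_le[OF fA', of s]
    proof eventually_elim
      case (elim j)
      show ?case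
      proof (rule prank_transfer[OF fA' AA' le(3,4,1)])
        show "cech_radius \<sigma> \<le> r \<longleftrightarrow> cech_radius (dyadic j ` \<sigma>) \<le> r + mesh TYPE('d) j"
          if "\<sigma> \<subseteq> ?A" "\<sigma> \<noteq> {}" for \<sigma>
          using elim(2) that AA' by blast
        show "cech_radius \<sigma> \<le> s \<longleftrightarrow> cech_radius (dyadic j ` \<sigma>) \<le> s + mesh TYPE('d) j"
          if "\<sigma> \<subseteq> ?A'" "\<sigma> \<noteq> {}" for \<sigma>
          using elim(3) that by blast
        show "lex_less (dyadic j x) (dyadic j y) \<longleftrightarrow> lex_less x y" if "x \<in> ?A'" "y \<in> ?A'" for x y
          using elim(1) that by blast
      qed (use elim(1) le in auto)
    qed
    then have "eventually (\<lambda>j. real (prank q (r + mesh TYPE('d) j) k (s + mesh TYPE('d) j) l (dyadic j ` ?A) (dyadic j ` ?A'))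
       = real (prank q r k s l ?A ?A')) sequentially" by (rule eventually_mono) simp
    then show "(\<lambda>j. real (prank q (r + mesh TYPE('d) j) k (s + mesh TYPE('d) j) l (dyadic j ` ?A) (dyadic j ` ?A')))
       \<longlonglongrightarrow> real (prank q r k s l ?A ?A')" by (rule tendsto_eventually)
  qed auto
  then show ?thesis unfolding region_betti_def[abs_def] .
qed

lemma region_betti_shift:
  fixes B :: "(real, 'd::{finite,linorder}) vec set"
  assumes \<nu>: "\<nu> \<in> space config_space" and B: "bounded B" and le: "r \<le> s" "t \<le> u" "1 \<le> l" "l \<le> k"
  shows "region_betti q r t k s u l ((\<lambda>x. x + v) ` B) (config_shift v \<nu>) = region_betti q r t k s u l B \<nu>"
proof -
  let ?A = "atoms {..t} \<nu> \<inter> B" and ?A' = "atoms {..u} \<nu> \<inter> B"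
  have fA': "finite ?A'" using \<nu> B by (intro finite_atoms) auto
  have AA': "?A \<subseteq> ?A'" using atoms_mono[OF \<nu>, of "{..u}" "{..t}"] le by auto
  have im: "atoms J (config_shift v \<nu>) \<inter> (\<lambda>x. x + v) ` B = (\<lambda>x. x + v) ` (atoms J \<nu> \<inter> B)" if "J \<in> sets borel" for J
    unfolding atoms_shift[OF \<nu> that] by (rule image_Int[symmetric]) (simp add: inj_on_def)
  have "prank q r k s l ((\<lambda>x. x + v) ` ?A) ((\<lambda>x. x + v) ` ?A') = prank q r k s l ?A ?A'"
  proof (rule prank_transfer[OF fA' AA' le(3,4,1,1)])
    have e: "cech_radius ((\<lambda>x. x + v) ` \<sigma>) = cech_radius \<sigma>" if "\<sigma> \<subseteq> ?A'" "\<sigma> \<noteq> {}" for \<sigma>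
      by (rule cech_radius_translate[OF finite_subset[OF that(1) fA'] that(2)])
    show "cech_radius \<sigma> \<le> s \<longleftrightarrow> cech_radius ((\<lambda>x. x + v) ` \<sigma>) \<le> s" if "\<sigma> \<subseteq> ?A'" "\<sigma> \<noteq> {}" for \<sigma>
      by (simp add: e[OF that])
    show "cech_radius \<sigma> \<le> r \<longleftrightarrow> cech_radius ((\<lambda>x. x + v) ` \<sigma>) \<le> r" if "\<sigma> \<subseteq> ?A" "\<sigma> \<noteq> {}" for \<sigma>
      by (subst e[OF order_trans[OF that(1) AA'] that(2)]) simp
  qed (auto simp: inj_on_def lex_less_translate)
  then show ?thesis by (simp add: region_betti_def im)
qed

text \<open>A simplex of dimension at most \<open>q + 1\<close> has at most \<open>q + 2\<close> vertices, each a set of at most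
  \<open>T\<close> points. This determines the exponent of the weight.\<close>

lemma region_betti_additive:
  fixes B :: "(real, 'd::{finite,linorder}) vec set"
  assumes \<nu>: "\<nu> \<in> space config_space" and B: "bounded B"
    and \<B>: "finite \<B>" "disjoint \<B>" "\<And>C. C \<in> \<B> \<Longrightarrow> C \<subseteq> B"
    and le: "r \<le> s" "s \<le> real T" "t \<le> u" "1 \<le> l" "l \<le> k" "k \<le> T"
  shows "\<bar>region_betti q r t k s u l B \<nu> - (\<Sum>C\<in>\<B>. region_betti q r t k s u l C \<nu>)\<bar> \<le>
    2 * (\<Sum>z\<in>bad (2 * T) B \<B>. weight (T * (q + 2) + 1) (2 * T) (config_shift (- lattice_point z) \<nu>))"
proof -
  let ?A = "atoms {..t} \<nu> \<inter> B" and ?A' = "atoms {..u} \<nu> \<inter> B"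
  let ?W = "\<Sum>z\<in>bad (2 * T) B \<B>. weight (T * (q + 2) + 1) (2 * T) (config_shift (- lattice_point z) \<nu>)"
  have fA': "finite ?A'" and fA: "finite ?A" using \<nu> B by (auto intro!: finite_atoms)
  have AA': "?A \<subseteq> ?A'" using atoms_mono[OF \<nu>, of "{..u}" "{..t}"] le by auto
  have e: "(atoms J \<nu> \<inter> B) \<inter> C = atoms J \<nu> \<inter> C" if "C \<in> \<B>" for C J using \<B>(3)[OF that] by auto
  have bd: "real (card {\<Phi> \<in> multicover h j (atoms J \<nu> \<inter> B). card \<Phi> = i \<and> (\<forall>C\<in>\<B>. \<not> \<Union>\<Phi> \<subseteq> C)}) \<le> ?W"
    if J: "J \<in> sets borel" and h: "h \<le> real T" "1 \<le> j" "j \<le> T" "i \<le> q + 2" for J h j i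
  proof -
    have "card {\<Phi> \<in> multicover h j (atoms J \<nu> \<inter> B). card \<Phi> = i \<and> (\<forall>C\<in>\<B>. \<not> \<Union>\<Phi> \<subseteq> C)} \<le>
      (\<Sum>x\<in>{x \<in> atoms J \<nu> \<inter> B. \<forall>C\<in>\<B>. \<not> atoms J \<nu> \<inter> B \<inter> cball x (2 * real T) \<subseteq> C}.
        card (atoms J \<nu> \<inter> B \<inter> cball x (2 * real T)) ^ (j * i))"
      by (rule card_bad_multicover[OF finite_atoms[OF \<nu> J B] h(1,2)])
    then have "real (card {\<Phi> \<in> multicover h j (atoms J \<nu> \<inter> B). card \<Phi> = i \<and> (\<forall>C\<in>\<B>. \<not> \<Union>\<Phi> \<subseteq> C)}) \<le>
      real (\<Sum>x\<in>{x \<in> atoms J \<nu> \<inter> B. \<forall>C\<in>\<B>. \<not> atoms J \<nu> \<inter> B \<inter> cball x (2 * real T) \<subseteq> C}.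
        card (atoms J \<nu> \<inter> B \<inter> cball x (2 * real T)) ^ (j * i))" by (rule of_nat_mono)
    also have "\<dots> = (\<Sum>x\<in>{x \<in> atoms J \<nu> \<inter> B. \<forall>C\<in>\<B>. \<not> atoms J \<nu> \<inter> B \<inter> cball x (2 * real T) \<subseteq> C}.
        real (card (atoms J \<nu> \<inter> B \<inter> cball x (2 * real T)) ^ (j * i)))" by simp
    also have "\<dots> \<le> ?W"
    proof (rule bad_points_weight[OF \<nu> J B])
      have "j * i \<le> T * (q + 2)" using h by (intro mult_le_mono) auto
      then show "j * i + 1 \<le> T * (q + 2) + 1" by simp
    qed simp
    finally show ?thesis .
  qed
  have "\<bar>real (prank q r k s l ?A ?A') - (\<Sum>C\<in>\<B>. real (prank q r k s l (?A \<inter> C) (?A' \<inter> C)))\<bar> \<le>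
    real (card {\<Phi> \<in> multicover r k ?A. card \<Phi> = q + 1 \<and> (\<forall>B\<in>\<B>. \<not> \<Union>\<Phi> \<subseteq> B)}) +
    real (card {\<Phi> \<in> multicover s l ?A'. card \<Phi> = q + 2 \<and> (\<forall>B\<in>\<B>. \<not> \<Union>\<Phi> \<subseteq> B)})"
    by (rule prank_compare[OF \<B>(1,2) fA' AA' le(1,4,5)])
  also have "\<dots> \<le> ?W + ?W"
    by (rule add_mono; rule bd) (use le in auto)
  also have "(\<Sum>C\<in>\<B>. real (prank q r k s l (?A \<inter> C) (?A' \<inter> C))) = (\<Sum>C\<in>\<B>. region_betti q r t k s u l C \<nu>)"
    by (rule sum.cong) (simp_all add: region_betti_def e)
  finally show ?thesis by (simp add: region_betti_def)
qed

text \<open>The condition \<open>Q\<close> may refer to the points with marks in \<open>J\<close>, so that conditions on radii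
  and conditions on marks have the same form.\<close>

definition region_count ::
  "nat \<Rightarrow> ((real, 'd::finite) vec set \<Rightarrow> (real, 'd) vec set \<Rightarrow> bool) \<Rightarrow> real set \<Rightarrow> (real, 'd) vec set
    \<Rightarrow> ((real, 'd) vec \<times> real) measure \<Rightarrow> real" where
  "region_count K Q J B \<nu> = real (card (small_sets K (atoms UNIV \<nu> \<inter> B) (Q (atoms J \<nu>))))"

lemma region_count_additive:
  fixes B :: "(real, 'd::finite) vec set"
  assumes \<nu>: "\<nu> \<in> space config_space" and B: "bounded B"
    and \<B>: "finite \<B>" "disjoint \<B>" "\<And>C. C \<in> \<B> \<Longrightarrow> C \<subseteq> B"
    and Q: "\<And>A \<sigma>. Q A \<sigma> \<Longrightarrow> cech_radius \<sigma> \<le> real T"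
  shows "\<bar>region_count K Q J B \<nu> - (\<Sum>C\<in>\<B>. region_count K Q J C \<nu>)\<bar> \<le>
    2 * (\<Sum>z\<in>bad (2 * T) B \<B>. weight (K + 1) (2 * T) (config_shift (- lattice_point z) \<nu>))"
proof -
  let ?A = "atoms UNIV \<nu> \<inter> B"
  let ?W = "\<Sum>z\<in>bad (2 * T) B \<B>. weight (K + 1) (2 * T) (config_shift (- lattice_point z) \<nu>)"
  have fA: "finite ?A" using \<nu> B by (auto intro!: finite_atoms)
  have e: "?A \<inter> C = atoms UNIV \<nu> \<inter> C" if "C \<in> \<B>" for C using \<B>(3)[OF that] by auto
  have "\<bar>real (card (small_sets K ?A (Q (atoms J \<nu>)))) - (\<Sum>C\<in>\<B>. real (card (small_sets K (?A \<inter> C) (Q (atoms J \<nu>)))))\<bar> \<le>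
    (\<Sum>x\<in>{x \<in> ?A. \<forall>C\<in>\<B>. \<not> ?A \<inter> cball x (2 * real T) \<subseteq> C}. real (card (?A \<inter> cball x (2 * real T)) ^ K))"
    by (rule small_sets_compare[OF fA \<B>(1,2) Q])
  also have "\<dots> \<le> ?W" by (rule bad_points_weight[OF \<nu> _ B]) auto
  also have "?W \<le> 2 * ?W" by (simp add: weight_def sum_nonneg)
  also have "(\<Sum>C\<in>\<B>. real (card (small_sets K (?A \<inter> C) (Q (atoms J \<nu>))))) = (\<Sum>C\<in>\<B>. region_count K Q J C \<nu>)"
    by (rule sum.cong) (simp_all add: region_count_def e)
  finally show ?thesis by (simp add: region_count_def)
qed

lemma region_count_shift:
  fixes B :: "(real, 'd::finite) vec set"
  assumes \<nu>: "\<nu> \<in> space config_space" and B: "bounded B" and J: "J \<in> sets borel"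
    and Q: "\<And>A \<sigma>. finite \<sigma> \<Longrightarrow> \<sigma> \<noteq> {} \<Longrightarrow> Q ((\<lambda>x. x + v) ` A) ((\<lambda>x. x + v) ` \<sigma>) \<longleftrightarrow> Q A \<sigma>"
  shows "region_count K Q J ((\<lambda>x. x + v) ` B) (config_shift v \<nu>) = region_count K Q J B \<nu>"
proof -
  have fA: "finite (atoms UNIV \<nu> \<inter> B)" using \<nu> B by (auto intro!: finite_atoms)
  have im: "atoms UNIV (config_shift v \<nu>) \<inter> (\<lambda>x. x + v) ` B = (\<lambda>x. x + v) ` (atoms UNIV \<nu> \<inter> B)"
    unfolding atoms_shift[OF \<nu> sets.top[of borel, unfolded space_borel]]
    by (rule image_Int[symmetric]) (simp add: inj_on_def)
  have "card (small_sets K ((\<lambda>x. x + v) ` (atoms UNIV \<nu> \<inter> B)) (Q ((\<lambda>x. x + v) ` atoms J \<nu>)))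
    = card (small_sets K (atoms UNIV \<nu> \<inter> B) (Q (atoms J \<nu>)))"
  proof (rule card_small_sets_image)
    show "Q ((\<lambda>x. x + v) ` atoms J \<nu>) ((\<lambda>x. x + v) ` \<sigma>) \<longleftrightarrow> Q (atoms J \<nu>) \<sigma>"
      if "\<sigma> \<subseteq> atoms UNIV \<nu> \<inter> B" "\<sigma> \<noteq> {}" for \<sigma>
      by (rule Q[OF finite_subset[OF that(1) fA] that(2)])
  qed (simp add: inj_on_def)
  then show ?thesis by (simp add: region_count_def im atoms_shift[OF \<nu> J])
qed

context point_process_law begin

text \<open>The weights are integrable to all orders by stationarity and the moment condition, so only
  measurability, invariance and near additivity of the functional remain to be shown.\<close>

lemma near_additive_law:
  assumes m: "\<And>B. B \<in> sets borel \<Longrightarrow> bounded B \<Longrightarrow> F B \<in> borel_measurable config_space"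
    and s: "\<And>\<nu> B v. \<nu> \<in> space config_space \<Longrightarrow> bounded B \<Longrightarrow> F ((\<lambda>x. x + v) ` B) (config_shift v \<nu>) = F B \<nu>"
    and a: "\<And>\<nu> B \<B>. \<nu> \<in> space config_space \<Longrightarrow> bounded B \<Longrightarrow> finite \<B> \<Longrightarrow> disjoint \<B> \<Longrightarrow> (\<And>C. C \<in> \<B> \<Longrightarrow> C \<subseteq> B) \<Longrightarrow>
      \<bar>F B \<nu> - (\<Sum>C\<in>\<B>. F C \<nu>)\<bar> \<le> 2 * (\<Sum>z\<in>bad R B \<B>. weight p R (config_shift (- lattice_point z) \<nu>))"
  shows "near_additive P config_shift (weight p) F R 2"
proof (intro near_additive.intro spatial_action_P near_additive_axioms.intro)
  show "F (hcube 0 n) \<in> borel_measurable P" for n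
    by (intro measurable_P m hcube_borel bounded_hcube)
  show "F (cbox 0 (vec (real n))) \<in> borel_measurable P" for n
    by (intro measurable_P m bounded_cbox) simp
qed (use s a in \<open>auto simp: space_P\<close>)

definition error_const :: "nat \<Rightarrow> nat \<Rightarrow> real" where
  "error_const p R = 2 * (real CARD('d) * (2 * real R + 1)) * L2norm (weight p R)"

lemma law_of_large_numbers:
  assumes "near_additive P config_shift (weight p) F R 2"
  shows "\<exists>b. (AE \<nu> in P. (\<lambda>n. F (cbox 0 (vec (real n))) \<nu> / real n ^ CARD('d)) \<longlonglongrightarrow> b) \<and>
     (\<lambda>n. (\<integral>\<nu>. F (cbox 0 (vec (real n))) \<nu> \<partial>P) / real n ^ CARD('d)) \<longlonglongrightarrow> b \<and>
     (\<forall>m\<ge>1. \<bar>b - (\<integral>\<nu>. F (hcube 0 m) \<nu> \<partial>P) / real m ^ CARD('d)\<bar> \<le> error_const p R / real m)"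
  using near_additive.ergodic_theorem[OF assms] near_additive.rate_def[OF assms]
    near_additive.block_const_def[OF assms]
  by (simp add: error_const_def)

end

section \<open>Contents of gaps\<close>

definition radius_gap :: "real \<Rightarrow> real \<Rightarrow> 'a::metric_space set \<Rightarrow> 'a set \<Rightarrow> bool" where
  "radius_gap a b A \<sigma> \<longleftrightarrow> a < cech_radius \<sigma> \<and> cech_radius \<sigma> < b"

definition mark_gap :: "real \<Rightarrow> 'a::metric_space set \<Rightarrow> 'a set \<Rightarrow> bool" where
  "mark_gap T A \<sigma> \<longleftrightarrow> cech_radius \<sigma> \<le> T \<and> \<sigma> \<inter> A \<noteq> {}"

lemma small_sets_cong: "(\<And>\<sigma>. \<sigma> \<subseteq> A \<Longrightarrow> \<sigma> \<noteq> {} \<Longrightarrow> Q \<sigma> \<longleftrightarrow> Q' \<sigma>) \<Longrightarrow> small_sets K A Q = small_sets K A Q'"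
  by (auto simp: small_sets_def)

lemma radius_gap_measurable:
  fixes B :: "(real, 'd::{finite,linorder}) vec set"
  assumes B: "B \<in> sets borel" "bounded B"
  shows "region_count K (radius_gap a b) {} B \<in> borel_measurable config_space"
proof -
  let ?P = "\<lambda>j A' \<sigma>. \<not> cech_radius \<sigma> \<le> a + mesh TYPE('d) j \<and> cech_radius \<sigma> < b - 2 * mesh TYPE('d) j"
  have "(\<lambda>\<nu>. (\<lambda>A A'. real (card (small_sets K A (radius_gap a b {})))) (atoms UNIV \<nu> \<inter> B) (atoms {} \<nu> \<inter> B)) \<in> borel_measurable config_space"
  proof (rule measurable_atoms_functional[OF B, where
      \<Psi>' = "\<lambda>j A A'. real (card (small_sets K A (?P j {})))"])
    fix \<nu> :: "((real, 'd) vec \<times> real) measure" assume \<nu>: "\<nu> \<in> space config_space"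
    let ?A = "atoms UNIV \<nu> \<inter> B"
    have fA: "finite ?A" using \<nu> B by (intro finite_atoms) auto
    have "eventually (\<lambda>j. card (small_sets K (dyadic j ` ?A) (?P j {})) = card (small_sets K ?A (radius_gap a b {}))) sequentially"
      using eventually_dyadic_order[OF fA] eventually_radius_le[OF fA, of a] eventually_radius_less[OF fA, of b]
    proof eventually_elim
      case (elim j)
      show ?case
      proof (rule card_small_sets_image)
        fix \<sigma> assume s: "\<sigma> \<subseteq> ?A" "\<sigma> \<noteq> {}"
        have "cech_radius \<sigma> \<le> a \<longleftrightarrow> cech_radius (dyadic j ` \<sigma>) \<le> a + mesh TYPE('d) j" using elim(2) s by blast
        moreover have "cech_radius \<sigma> < b \<longleftrightarrow> cech_radius (dyadic j ` \<sigma>) < b - 2 * mesh TYPE('d) j" using elim(3) s by blast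
        ultimately show "?P j {} (dyadic j ` \<sigma>) \<longleftrightarrow> radius_gap a b {} \<sigma>" by (auto simp: radius_gap_def)
      qed (use elim(1) in blast)
    qed
    then have "eventually (\<lambda>j. real (card (small_sets K (dyadic j ` ?A) (?P j {}))) = real (card (small_sets K ?A (radius_gap a b {})))) sequentially"
      by (rule eventually_mono) simp
    then show "(\<lambda>j. real (card (small_sets K (dyadic j ` ?A) (?P j {})))) \<longlonglongrightarrow> real (card (small_sets K ?A (radius_gap a b {})))"
      by (rule tendsto_eventually)
  qed auto
  moreover have "region_count K (radius_gap a b) {} B = (\<lambda>\<nu>. real (card (small_sets K (atoms UNIV \<nu> \<inter> B) (radius_gap a b {}))))"
    by (simp add: region_count_def[abs_def] radius_gap_def[abs_def])
  ultimately show ?thesis by simp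
qed

lemma mark_gap_measurable:
  fixes B :: "(real, 'd::{finite,linorder}) vec set"
  assumes B: "B \<in> sets borel" "bounded B" and J: "J \<in> sets borel"
  shows "region_count K (mark_gap T) J B \<in> borel_measurable config_space"
proof -
  let ?P = "\<lambda>j A' \<sigma>. cech_radius \<sigma> \<le> T + mesh TYPE('d) j \<and> \<sigma> \<inter> A' \<noteq> {}"
  have "(\<lambda>\<nu>. (\<lambda>A A'. real (card (small_sets K A (mark_gap T A')))) (atoms UNIV \<nu> \<inter> B) (atoms J \<nu> \<inter> B)) \<in> borel_measurable config_space"
  proof (rule measurable_atoms_functional[OF B, where
      \<Psi>' = "\<lambda>j A A'. real (card (small_sets K A (?P j A')))"])
    fix \<nu> :: "((real, 'd) vec \<times> real) measure" assume \<nu>: "\<nu> \<in> space config_space"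
    let ?A = "atoms UNIV \<nu> \<inter> B" and ?A' = "atoms J \<nu> \<inter> B"
    have fA: "finite ?A" using \<nu> B by (intro finite_atoms) auto
    have sub: "?A' \<subseteq> ?A" using atoms_mono[OF \<nu>, of UNIV J] by auto
    have "eventually (\<lambda>j. card (small_sets K (dyadic j ` ?A) (?P j (dyadic j ` ?A'))) = card (small_sets K ?A (mark_gap T ?A'))) sequentially"
      using eventually_dyadic_order[OF fA] eventually_radius_le[OF fA, of T]
    proof eventually_elim
      case (elim j)
      show ?case
      proof (rule card_small_sets_image)
        fix \<sigma> assume s: "\<sigma> \<subseteq> ?A" "\<sigma> \<noteq> {}"
        have "cech_radius \<sigma> \<le> T \<longleftrightarrow> cech_radius (dyadic j ` \<sigma>) \<le> T + mesh TYPE('d) j" using elim(2) s by blast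
        moreover have "dyadic j ` \<sigma> \<inter> dyadic j ` ?A' = dyadic j ` (\<sigma> \<inter> ?A')"
          using elim(1) s(1) sub by (metis inj_on_image_Int)
        ultimately show "?P j (dyadic j ` ?A') (dyadic j ` \<sigma>) \<longleftrightarrow> mark_gap T ?A' \<sigma>" by (simp add: mark_gap_def)
      qed (use elim(1) in blast)
    qed
    then have "eventually (\<lambda>j. real (card (small_sets K (dyadic j ` ?A) (?P j (dyadic j ` ?A')))) = real (card (small_sets K ?A (mark_gap T ?A')))) sequentially"
      by (rule eventually_mono) simp
    then show "(\<lambda>j. real (card (small_sets K (dyadic j ` ?A) (?P j (dyadic j ` ?A'))))) \<longlonglongrightarrow> real (card (small_sets K ?A (mark_gap T ?A')))"
      by (rule tendsto_eventually)
  qed (use J in auto)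
  moreover have "small_sets K (atoms UNIV \<nu> \<inter> B) (mark_gap T (atoms J \<nu>)) = small_sets K (atoms UNIV \<nu> \<inter> B) (mark_gap T (atoms J \<nu> \<inter> B))" for \<nu>
    by (rule small_sets_cong) (auto simp: mark_gap_def)
  ultimately show ?thesis unfolding region_count_def[abs_def] by simp
qed

locale lex_point_process_law = point_process_law P
  for P :: "((real, 'a::{finite,linorder}) vec \<times> real) measure measure"
begin

lemma near_additive_betti:
  assumes "r \<le> s" "s \<le> real T" "t \<le> u" "1 \<le> l" "l \<le> k" "k \<le> T"
  shows "near_additive P config_shift (weight (T * (q + 2) + 1)) (region_betti q r t k s u l) (2 * T) 2"
proof (rule near_additive_law)
  show "region_betti q r t k s u l B \<in> borel_measurable config_space" if "B \<in> sets borel" "bounded B" for B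
    using that assms by (intro region_betti_measurable) auto
  show "region_betti q r t k s u l ((\<lambda>x. x + v) ` B) (config_shift v \<nu>) = region_betti q r t k s u l B \<nu>"
    if "\<nu> \<in> space config_space" "bounded B" for \<nu> B v
    using that assms by (intro region_betti_shift) auto
  show "\<bar>region_betti q r t k s u l B \<nu> - (\<Sum>C\<in>\<B>. region_betti q r t k s u l C \<nu>)\<bar> \<le>
    2 * (\<Sum>z\<in>bad (2 * T) B \<B>. weight (T * (q + 2) + 1) (2 * T) (config_shift (- lattice_point z) \<nu>))"
    if "\<nu> \<in> space config_space" "bounded B" "finite \<B>" "disjoint \<B>" "\<And>C. C \<in> \<B> \<Longrightarrow> C \<subseteq> B" for \<nu> B \<B>
    using that assms by (intro region_betti_additive)
qed

lemma near_additive_radius_gap: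
  assumes "b \<le> real T"
  shows "near_additive P config_shift (weight (K + 1)) (region_count K (radius_gap a b) {}) (2 * T) 2"
proof (rule near_additive_law)
  show "region_count K (radius_gap a b) {} ((\<lambda>x. x + v) ` B) (config_shift v \<nu>) = region_count K (radius_gap a b) {} B \<nu>"
    if "\<nu> \<in> space config_space" "bounded B" for \<nu> B v
    by (rule region_count_shift[OF that]) (auto simp: radius_gap_def cech_radius_translate)
  show "\<bar>region_count K (radius_gap a b) {} B \<nu> - (\<Sum>C\<in>\<B>. region_count K (radius_gap a b) {} C \<nu>)\<bar> \<le>
    2 * (\<Sum>z\<in>bad (2 * T) B \<B>. weight (K + 1) (2 * T) (config_shift (- lattice_point z) \<nu>))"
    if "\<nu> \<in> space config_space" "bounded B" "finite \<B>" "disjoint \<B>" "\<And>C. C \<in> \<B> \<Longrightarrow> C \<subseteq> B" for \<nu> B \<B>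
    by (rule region_count_additive[OF that]) (use assms in \<open>auto simp: radius_gap_def\<close>)
qed (rule radius_gap_measurable)

lemma near_additive_mark_gap:
  assumes "J \<in> sets borel"
  shows "near_additive P config_shift (weight (K + 1)) (region_count K (mark_gap (real T)) J) (2 * T) 2"
proof (rule near_additive_law)
  show "region_count K (mark_gap (real T)) J ((\<lambda>x. x + v) ` B) (config_shift v \<nu>) = region_count K (mark_gap (real T)) J B \<nu>"
    if "\<nu> \<in> space config_space" "bounded B" for \<nu> :: "((real, 'a) vec \<times> real) measure" and B v
  proof (rule region_count_shift[OF that assms])
    fix A \<sigma> :: "(real, 'a) vec set" assume s: "finite \<sigma>" "\<sigma> \<noteq> {}"
    have "(\<lambda>x. x + v) ` \<sigma> \<inter> (\<lambda>x. x + v) ` A = (\<lambda>x. x + v) ` (\<sigma> \<inter> A)"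
      by (rule image_Int[symmetric]) (simp add: inj_on_def)
    then show "mark_gap (real T) ((\<lambda>x. x + v) ` A) ((\<lambda>x. x + v) ` \<sigma>) \<longleftrightarrow> mark_gap (real T) A \<sigma>"
      by (simp add: mark_gap_def cech_radius_translate[OF s])
  qed
  show "\<bar>region_count K (mark_gap (real T)) J B \<nu> - (\<Sum>C\<in>\<B>. region_count K (mark_gap (real T)) J C \<nu>)\<bar> \<le>
    2 * (\<Sum>z\<in>bad (2 * T) B \<B>. weight (K + 1) (2 * T) (config_shift (- lattice_point z) \<nu>))"
    if "\<nu> \<in> space config_space" "bounded B" "finite \<B>" "disjoint \<B>" "\<And>C. C \<in> \<B> \<Longrightarrow> C \<subseteq> B" for \<nu> B \<B>
    by (rule region_count_additive[OF that]) (auto simp: mark_gap_def)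
qed (rule mark_gap_measurable[OF _ _ assms])

text \<open>Near additivity over the empty family bounds the count itself by an integrable weight,
  which also serves as a dominating function below.\<close>

lemma region_count_integrable:
  assumes "bounded B" "region_count K Q J B \<in> borel_measurable config_space" "\<And>A \<sigma>. Q A \<sigma> \<Longrightarrow> cech_radius \<sigma> \<le> real T"
  shows "integrable P (region_count K Q J B)"
    and "integrable P (\<lambda>\<nu>. 2 * (\<Sum>z\<in>bad (2 * T) B {}. weight (K + 1) (2 * T) (config_shift (- lattice_point z) \<nu>)))"
    and "\<And>\<nu>. \<nu> \<in> space P \<Longrightarrow> region_count K Q J B \<nu> \<le> 2 * (\<Sum>z\<in>bad (2 * T) B {}. weight (K + 1) (2 * T) (config_shift (- lattice_point z) \<nu>))"
proof -
  let ?h = "\<lambda>\<nu>. 2 * (\<Sum>z\<in>bad (2 * T) B {}. weight (K + 1) (2 * T) (config_shift (- lattice_point z) \<nu>))"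
  show h: "integrable P ?h"
    by (intro integrable_mult_right Bochner_Integration.integrable_sum
        spatial_action.integrable_shift[OF spatial_action_P[of 0]] weight_moments)
  show le: "region_count K Q J B \<nu> \<le> ?h \<nu>" if "\<nu> \<in> space P" for \<nu>
    using region_count_additive[of \<nu> B "{}" Q T K J] that assms by (auto simp: space_P region_count_def)
  show "integrable P (region_count K Q J B)"
  proof (rule Bochner_Integration.integrable_bound[OF h measurable_P[OF assms(2)] AE_I2])
    fix \<nu> assume "\<nu> \<in> space P"
    from order_trans[OF le[OF this] abs_ge_self]
    show "norm (region_count K Q J B \<nu>) \<le> norm (?h \<nu>)" by (simp add: region_count_def)
  qed
qed

text \<open>Dominated convergence, with the integrable weight from \<open>region_count_integrable\<close> as the
  common bound.\<close>

lemma region_count_vanishing: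
  assumes B: "bounded B" "\<And>i. region_count K (Q i) (J i) B \<in> borel_measurable config_space"
    and Q: "\<And>i A \<sigma>. Q i A \<sigma> \<Longrightarrow> cech_radius \<sigma> \<le> real T"
    and van: "\<And>\<nu>. \<nu> \<in> space config_space \<Longrightarrow>
      eventually (\<lambda>i. small_sets K (atoms UNIV \<nu> \<inter> B) (Q i (atoms (J i) \<nu>)) = {}) sequentially"
  shows "(\<lambda>i. \<integral>\<nu>. region_count K (Q i) (J i) B \<nu> \<partial>P) \<longlonglongrightarrow> 0"
proof -
  have "(\<lambda>i. \<integral>\<nu>. region_count K (Q i) (J i) B \<nu> \<partial>P) \<longlonglongrightarrow> (\<integral>\<nu>. 0 \<partial>P)"
  proof (rule integral_dominated_convergence)
    show "integrable P (\<lambda>\<nu>. 2 * (\<Sum>z\<in>bad (2 * T) B {}. weight (K + 1) (2 * T) (config_shift (- lattice_point z) \<nu>)))"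
      by (rule region_count_integrable(2)[OF B(1) B(2)[of 0] Q])
    show "region_count K (Q i) (J i) B \<in> borel_measurable P" for i by (rule measurable_P[OF B(2)])
    show "AE \<nu> in P. (\<lambda>i. region_count K (Q i) (J i) B \<nu>) \<longlonglongrightarrow> 0"
    proof (rule AE_I2)
      fix \<nu> assume "\<nu> \<in> space P"
      then have "eventually (\<lambda>i. region_count K (Q i) (J i) B \<nu> = 0) sequentially"
        using van[of \<nu>] by (auto elim!: eventually_mono simp: space_P region_count_def)
      then show "(\<lambda>i. region_count K (Q i) (J i) B \<nu>) \<longlonglongrightarrow> 0" by (rule tendsto_eventually)
    qed
    show "AE \<nu> in P. norm (region_count K (Q i) (J i) B \<nu>) \<le> 2 * (\<Sum>z\<in>bad (2 * T) B {}. weight (K + 1) (2 * T) (config_shift (- lattice_point z) \<nu>))" for i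
      using region_count_integrable(3)[OF B(1) B(2)[of i] Q] by (intro AE_I2) (simp add: region_count_def)
  qed simp
  then show ?thesis by simp
qed

text \<open>The finitely many sets of points in \<open>B\<close> have finitely many radii, and an open interval
  with end point \<open>x\<close> avoids all of them once it is short enough.\<close>

lemma radius_gap_vanishing:
  assumes B: "B \<in> sets borel" "bounded B" and x: "x \<le> real T"
  shows "(\<lambda>i. \<integral>\<nu>. region_count K (radius_gap (x - 1 / real (Suc i)) x) {} B \<nu> \<partial>P) \<longlonglongrightarrow> 0"
    and "(\<lambda>i. \<integral>\<nu>. region_count K (radius_gap x (min (real T) (x + 1 / real (Suc i)))) {} B \<nu> \<partial>P) \<longlonglongrightarrow> 0"
proof -
  have lim: "(\<lambda>i. 1 / real (Suc i)) \<longlonglongrightarrow> 0" by (rule LIMSEQ_Suc) (rule lim_const_over_n)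
  have ev: "eventually (\<lambda>i. \<forall>\<sigma>\<in>Pow (atoms UNIV \<nu> \<inter> B). y \<sigma> \<noteq> 0 \<longrightarrow> 1 / real (Suc i) < \<bar>y \<sigma>\<bar>) sequentially"
    if "\<nu> \<in> space config_space" for \<nu> and y :: "(real, 'a) vec set \<Rightarrow> real"
  proof (rule eventually_ball_finite)
    show "finite (Pow (atoms UNIV \<nu> \<inter> B))" using finite_atoms[OF that _ B(2), of UNIV] by (simp del: Pow_Int_eq)
    show "\<forall>\<sigma>\<in>Pow (atoms UNIV \<nu> \<inter> B). eventually (\<lambda>i. y \<sigma> \<noteq> 0 \<longrightarrow> 1 / real (Suc i) < \<bar>y \<sigma>\<bar>) sequentially"
    proof
      fix \<sigma>
      show "eventually (\<lambda>i. y \<sigma> \<noteq> 0 \<longrightarrow> 1 / real (Suc i) < \<bar>y \<sigma>\<bar>) sequentially"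
      proof (cases "y \<sigma> = 0")
        case False
        then have "0 < \<bar>y \<sigma>\<bar>" by simp
        from order_tendstoD(2)[OF lim this] show ?thesis by (rule eventually_mono) simp
      qed simp
    qed
  qed
  show "(\<lambda>i. \<integral>\<nu>. region_count K (radius_gap (x - 1 / real (Suc i)) x) {} B \<nu> \<partial>P) \<longlonglongrightarrow> 0"
  proof (rule region_count_vanishing[where T = T, OF B(2) radius_gap_measurable[OF B]])
    fix \<nu> :: "((real, 'a) vec \<times> real) measure" assume \<nu>: "\<nu> \<in> space config_space"
    show "eventually (\<lambda>i. small_sets K (atoms UNIV \<nu> \<inter> B) (radius_gap (x - 1 / real (Suc i)) x (atoms {} \<nu>)) = {}) sequentially"
      using ev[OF \<nu>, of "\<lambda>\<sigma>. x - cech_radius \<sigma>"]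
      by (rule eventually_mono) (force simp: small_sets_def radius_gap_def)
  qed (use x in \<open>auto simp: radius_gap_def\<close>)
  show "(\<lambda>i. \<integral>\<nu>. region_count K (radius_gap x (min (real T) (x + 1 / real (Suc i)))) {} B \<nu> \<partial>P) \<longlonglongrightarrow> 0"
  proof (rule region_count_vanishing[where T = T, OF B(2) radius_gap_measurable[OF B]])
    fix \<nu> :: "((real, 'a) vec \<times> real) measure" assume \<nu>: "\<nu> \<in> space config_space"
    show "eventually (\<lambda>i. small_sets K (atoms UNIV \<nu> \<inter> B) (radius_gap x (min (real T) (x + 1 / real (Suc i))) (atoms {} \<nu>)) = {}) sequentially"
      using ev[OF \<nu>, of "\<lambda>\<sigma>. cech_radius \<sigma> - x"]
      by (rule eventually_mono) (force simp: small_sets_def radius_gap_def)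
  qed (auto simp: radius_gap_def)
qed

text \<open>Continuity from above, together with the fact that the measures are integers.\<close>

lemma decseq_marks_vanish:
  assumes \<nu>: "\<nu> \<in> space config_space" and B: "B \<in> sets borel" "bounded B"
    and J: "\<And>i. J i \<in> sets borel" "decseq J" "(\<Inter>i. J i) = {}"
  shows "eventually (\<lambda>i. atoms (J i) \<nu> \<inter> B = {}) sequentially"
proof -
  have s: "B \<times> J i \<in> sets borel" for i using B J by (intro sets_Times_borel) auto
  have nat: "\<exists>k::nat. emeasure \<nu> (B \<times> J i) = of_nat k" for i
    using config_space_Nats[OF \<nu> s bounded_fst_Times[OF B(2)]] by metis
  have "(\<lambda>i. emeasure \<nu> (B \<times> J i)) \<longlonglongrightarrow> emeasure \<nu> (\<Inter>i. B \<times> J i)"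
  proof (rule Lim_emeasure_decseq)
    show "range (\<lambda>i. B \<times> J i) \<subseteq> sets \<nu>" using s by (auto simp: config_space_sets[OF \<nu>])
    show "decseq (\<lambda>i. B \<times> J i)" using J(2) by (auto simp: decseq_def)
    show "emeasure \<nu> (B \<times> J i) \<noteq> \<infinity>" for i using nat[of i] by auto
  qed
  moreover have "(\<Inter>i. B \<times> J i) = {}" using J(3) by auto
  ultimately have "(\<lambda>i. emeasure \<nu> (B \<times> J i)) \<longlonglongrightarrow> 0" by simp
  then have "eventually (\<lambda>i. emeasure \<nu> (B \<times> J i) < 1) sequentially" by (rule order_tendstoD(2)) simp
  then show ?thesis
  proof (rule eventually_mono)
    fix i assume lt: "emeasure \<nu> (B \<times> J i) < 1"
    obtain k :: nat where k: "emeasure \<nu> (B \<times> J i) = of_nat k" using nat by blast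
    then have "k < 1" using lt by (metis of_nat_1 of_nat_less_iff)
    then have "emeasure \<nu> (B \<times> J i) = 0" using k by simp
    then show "atoms (J i) \<nu> \<inter> B = {}" using cell_charged_iff[OF \<nu> J(1) B] by blast
  qed
qed

lemma mark_gap_vanishing:
  assumes B: "B \<in> sets borel" "bounded B" and J: "\<And>i. J i \<in> sets borel" "decseq J" "(\<Inter>i. J i) = {}"
  shows "(\<lambda>i. \<integral>\<nu>. region_count K (mark_gap (real T)) (J i) B \<nu> \<partial>P) \<longlonglongrightarrow> 0"
proof (rule region_count_vanishing[where T = T, OF B(2) mark_gap_measurable[OF B J(1)]])
  fix \<nu> :: "((real, 'a) vec \<times> real) measure" assume \<nu>: "\<nu> \<in> space config_space"
  show "eventually (\<lambda>i. small_sets K (atoms UNIV \<nu> \<inter> B) (mark_gap (real T) (atoms (J i) \<nu>)) = {}) sequentially"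
    using decseq_marks_vanish[OF \<nu> B J] by (rule eventually_mono) (auto simp: small_sets_def mark_gap_def)
qed (auto simp: mark_gap_def)

end

section \<open>Partitions into gaps of small content\<close>

text \<open>Compactness of the interval in the form of Bolzano's bisection. Around \<open>x\<close>, the open
  pieces to the left and to the right of \<open>x\<close> both have small content, so a short interval is cut
  sufficiently by its end points and \<open>x\<close>.\<close>

lemma gap_partition:
  fixes \<mu> :: "real \<Rightarrow> real \<Rightarrow> real"
  assumes ab: "a \<le> b"
    and mono: "\<And>s t s' t'. s' \<le> s \<Longrightarrow> t \<le> t' \<Longrightarrow> \<mu> s t \<le> \<mu> s' t'"
    and loc: "\<And>x. a \<le> x \<Longrightarrow> x \<le> b \<Longrightarrow> \<exists>d>0. \<mu> (x - d) x < e \<and> \<mu> x (x + d) < e"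
  shows "\<exists>D. finite D \<and> a \<in> D \<and> b \<in> D \<and> (\<forall>s t. a \<le> s \<longrightarrow> s < t \<longrightarrow> t \<le> b \<longrightarrow> {s<..<t} \<inter> D = {} \<longrightarrow> \<mu> s t < e)"
  using ab
proof (induction rule: Bolzano)
  case (trans a b c)
  then obtain D1 D2 where D: "finite D1" "a \<in> D1" "b \<in> D1" "finite D2" "b \<in> D2" "c \<in> D2"
    "\<And>s t. a \<le> s \<Longrightarrow> s < t \<Longrightarrow> t \<le> b \<Longrightarrow> {s<..<t} \<inter> D1 = {} \<Longrightarrow> \<mu> s t < e"
    "\<And>s t. b \<le> s \<Longrightarrow> s < t \<Longrightarrow> t \<le> c \<Longrightarrow> {s<..<t} \<inter> D2 = {} \<Longrightarrow> \<mu> s t < e" by metis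
  show ?case
  proof (intro exI[of _ "D1 \<union> D2"] conjI allI impI)
    fix s t assume st: "a \<le> s" "s < t" "t \<le> c" "{s<..<t} \<inter> (D1 \<union> D2) = {}"
    then have "b \<notin> {s<..<t}" using D(3) by auto
    then consider "t \<le> b" | "b \<le> s" by fastforce
    then show "\<mu> s t < e"
    proof cases
      case 1 then show ?thesis using st by (intro D(7)) auto
    next
      case 2 then show ?thesis using st by (intro D(8)) auto
    qed
  qed (use D in auto)
next
  case (local x)
  then obtain d where d: "d > 0" "\<mu> (x - d) x < e" "\<mu> x (x + d) < e" using loc by blast
  show ?case
  proof (intro exI[of _ d] conjI allI impI)
    fix a b assume ab: "a \<le> x \<and> x \<le> b \<and> b - a < d"
    show "\<exists>D. finite D \<and> a \<in> D \<and> b \<in> D \<and> (\<forall>s t. a \<le> s \<longrightarrow> s < t \<longrightarrow> t \<le> b \<longrightarrow> {s<..<t} \<inter> D = {} \<longrightarrow> \<mu> s t < e)"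
    proof (intro exI[of _ "{a, x, b}"] conjI allI impI)
      fix s t assume st: "a \<le> s" "s < t" "t \<le> b" "{s<..<t} \<inter> {a, x, b} = {}"
      then consider "t \<le> x" | "x \<le> s" by fastforce
      then show "\<mu> s t < e"
      proof cases
        case 1
        then have "\<mu> s t \<le> \<mu> (x - d) x" using st ab by (intro mono) auto
        then show ?thesis using d by simp
      next
        case 2
        then have "\<mu> s t \<le> \<mu> x (x + d)" using st ab by (intro mono) auto
        then show ?thesis using d by simp
      qed
    qed auto
  qed (use d in auto)
qed

definition gaps :: "real set \<Rightarrow> (real \<times> real) set" where
  "gaps D = {(s, t). s \<in> D \<and> t \<in> D \<and> s < t \<and> {s<..<t} \<inter> D = {}}"

text \<open>A map that fixes the points of \<open>D\<close> and moves all other points to the midpoint of their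
  gap. It takes finitely many values, and it is monotone, so that it commutes with the maximum
  of two indices.\<close>

definition snap :: "real set \<Rightarrow> real \<Rightarrow> real" where
  "snap D r = (Max {d \<in> D. d \<le> r} + Min {d \<in> D. r \<le> d}) / 2"

lemma finite_gaps: "finite D \<Longrightarrow> finite (gaps D)"
  by (rule finite_subset[of _ "D \<times> D"]) (auto simp: gaps_def)

lemma snap:
  assumes D: "finite D" "a \<in> D" "b \<in> D" and r: "a \<le> r" "r \<le> b"
  shows "snap D r = r \<or> (\<exists>(s, t)\<in>gaps D. s < r \<and> r < t \<and> s < snap D r \<and> snap D r < t)"
    and "a \<le> snap D r" "snap D r \<le> b"
    and "snap D r \<in> (\<lambda>(s, t). (s + t) / 2) ` (D \<times> D)"
    and "\<And>r'. r \<le> r' \<Longrightarrow> r' \<le> b \<Longrightarrow> snap D r \<le> snap D r'"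
proof -
  let ?L = "\<lambda>r. {d \<in> D. d \<le> r}" and ?U = "\<lambda>r. {d \<in> D. r \<le> d}"
  have L: "finite (?L r)" "?L r \<noteq> {}" if "a \<le> r" for r using D that by auto
  have U: "finite (?U r)" "?U r \<noteq> {}" if "r \<le> b" for r using D that by auto
  have lo: "Max (?L r) \<in> ?L r" using Max_in[OF L[OF r(1)]] .
  have hi: "Min (?U r) \<in> ?U r" using Min_in[OF U[OF r(2)]] .
  have "a \<le> Max (?L r)" using D r by (intro Max_ge[OF L(1)[OF r(1)]]) auto
  moreover have "Min (?U r) \<le> b" using D r by (intro Min_le[OF U(1)[OF r(2)]]) auto
  ultimately show "a \<le> snap D r" "snap D r \<le> b" using lo hi by (auto simp: snap_def)
  show "snap D r \<in> (\<lambda>(s, t). (s + t) / 2) ` (D \<times> D)"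
    using lo hi by (intro image_eqI[of _ _ "(Max (?L r), Min (?U r))"]) (auto simp: snap_def)
  show "snap D r = r \<or> (\<exists>(s, t)\<in>gaps D. s < r \<and> r < t \<and> s < snap D r \<and> snap D r < t)"
  proof (cases "r \<in> D")
    case True
    have "Max (?L r) = r" using True by (intro Max_eqI) (use L r in auto)
    moreover have "Min (?U r) = r" using True by (intro Min_eqI) (use U r in auto)
    ultimately show ?thesis by (simp add: snap_def)
  next
    case False
    then have lt: "Max (?L r) < r" "r < Min (?U r)" using lo hi by (auto simp: less_le)
    have "{Max (?L r)<..<Min (?U r)} \<inter> D = {}"
    proof (rule equals0I)
      fix d assume d: "d \<in> {Max (?L r)<..<Min (?U r)} \<inter> D"
      show False
      proof (cases "d \<le> r")
        case True
        then have "d \<le> Max (?L r)" using d by (intro Max_ge[OF L(1)[OF r(1)]]) auto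
        then show False using d by simp
      next
        case False
        then have "Min (?U r) \<le> d" using d by (intro Min_le[OF U(1)[OF r(2)]]) auto
        then show False using d by simp
      qed
    qed
    then have "(Max (?L r), Min (?U r)) \<in> gaps D" using lo hi lt by (auto simp: gaps_def)
    then show ?thesis using lt by (intro disjI2 bexI[of _ "(Max (?L r), Min (?U r))"]) (auto simp: snap_def)
  qed
  show "snap D r \<le> snap D r'" if r': "r \<le> r'" "r' \<le> b" for r'
  proof -
    have "Max (?L r) \<le> Max (?L r')"
      using r r' by (intro Max_mono L) auto
    moreover have "Min (?U r) \<le> Min (?U r')"
      using r r' by (intro Min_antimono U) auto
    ultimately show ?thesis by (simp add: snap_def)
  qed
qed

section \<open>Stability of Betti numbers under changes of the index\<close>

lemma atoms_cover:
  assumes \<nu>: "\<nu> \<in> space config_space" and J: "J1 \<in> sets borel" "J2 \<in> sets borel" "J \<subseteq> J1 \<union> J2"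
  shows "atoms J \<nu> \<subseteq> atoms J1 \<nu> \<union> atoms J2 \<nu>"
proof
  fix x assume x: "x \<in> atoms J \<nu>"
  have s: "{x} \<times> J1 \<in> sets \<nu>" "{x} \<times> J2 \<in> sets \<nu>"
    using singleton_Times_borel J(1,2) by (auto simp: config_space_sets[OF \<nu>])
  have "emeasure \<nu> ({x} \<times> J) \<le> emeasure \<nu> ({x} \<times> J1 \<union> {x} \<times> J2)"
    by (rule emeasure_mono) (use J(3) s in auto)
  also have "\<dots> \<le> emeasure \<nu> ({x} \<times> J1) + emeasure \<nu> ({x} \<times> J2)" by (rule emeasure_subadditive[OF s])
  finally show "x \<in> atoms J1 \<nu> \<union> atoms J2 \<nu>" using x by (auto simp: atoms_def)
qed

definition same_gap :: "(real \<times> real) set \<Rightarrow> real \<Rightarrow> real \<Rightarrow> bool" where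
  "same_gap G r r' \<longleftrightarrow> r = r' \<or> (\<exists>(a, b)\<in>G. a < r \<and> r < b \<and> a < r' \<and> r' < b)"

text \<open>Let \<open>\<sigma>\<close> be the set of all points occurring in a simplex that is lost. Either the radius of
  \<open>\<sigma>\<close> exceeds \<open>h'\<close>, and then it lies in the gap containing \<open>h\<close> and \<open>h'\<close>; or \<open>\<sigma>\<close> contains a point
  whose mark lies between \<open>\<tau>'\<close> and \<open>\<tau>\<close>, that is, in the gap containing both. Hence \<open>\<sigma>\<close> is
  counted in the content of a gap, and it determines the simplex up to \<open>2 ^ 2 ^ K\<close> choices.\<close>

lemma card_multicover_difference:
  fixes B :: "(real, 'd::finite) vec set"
  assumes \<nu>: "\<nu> \<in> space config_space" and B: "bounded B" and ij: "i * j \<le> K" and h: "h \<le> T" and e: "0 \<le> e"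
    and r: "same_gap G1 h h'"
    and t: "same_gap G2 \<tau> \<tau>'"
    and G1: "\<And>a b. (a, b) \<in> G1 \<Longrightarrow> region_count K (radius_gap a b) {} B \<nu> \<le> e"
    and G2: "\<And>a b. (a, b) \<in> G2 \<Longrightarrow> region_count K (mark_gap T) {a<..<b} B \<nu> \<le> e"
  shows "real (card {\<Phi> \<in> multicover h j (atoms {..\<tau>} \<nu> \<inter> B) - multicover h' j (atoms {..\<tau>'} \<nu> \<inter> B). card \<Phi> = i})
    \<le> 2 ^ 2 ^ K * (2 * e)"
proof -
  let ?A = "atoms UNIV \<nu> \<inter> B"
  let ?X = "{\<Phi> \<in> multicover h j (atoms {..\<tau>} \<nu> \<inter> B) - multicover h' j (atoms {..\<tau>'} \<nu> \<inter> B). card \<Phi> = i}"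
  have fA: "finite ?A" using \<nu> B by (intro finite_atoms) auto
  have sub: "atoms {..\<tau>} \<nu> \<inter> B \<subseteq> ?A" using atoms_mono[OF \<nu>, of UNIV "{..\<tau>}"] by auto
  \<comment> \<open>\<open>N1\<close> collects the sets that are lost because of their radius, \<open>N2\<close> those that are lost
    because of a mark.\<close>
  obtain N1 where N1: "N1 \<subseteq> small_sets K ?A (\<lambda>_. True)" "real (card N1) \<le> e"
    "\<And>\<sigma>. \<sigma> \<in> small_sets K ?A (\<lambda>\<sigma>. h' < cech_radius \<sigma> \<and> cech_radius \<sigma> \<le> h) \<Longrightarrow> \<sigma> \<in> N1"
  proof (cases "h = h'")
    case True
    show ?thesis by (rule that[of "{}"]) (use True e in \<open>auto simp: small_sets_def\<close>)
  next
    case False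
    then obtain a b where ab: "(a, b) \<in> G1" "a < h" "h < b" "a < h'" "h' < b" using r unfolding same_gap_def by blast
    show ?thesis
      by (rule that[of "small_sets K ?A (radius_gap a b (atoms {} \<nu>))"])
        (use G1[OF ab(1)] ab in \<open>auto simp: small_sets_def radius_gap_def region_count_def\<close>)
  qed
  obtain N2 where N2: "N2 \<subseteq> small_sets K ?A (\<lambda>_. True)" "real (card N2) \<le> e"
    "\<And>\<sigma>. \<sigma> \<in> small_sets K ?A (\<lambda>\<sigma>. cech_radius \<sigma> \<le> h \<and> \<sigma> \<inter> (atoms {..\<tau>} \<nu> - atoms {..\<tau>'} \<nu>) \<noteq> {}) \<Longrightarrow> \<sigma> \<in> N2"
  proof (cases "\<tau> = \<tau>'")
    case True
    show ?thesis by (rule that[of "{}"]) (use True e in \<open>auto simp: small_sets_def\<close>)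
  next
    case False
    then obtain a b where ab: "(a, b) \<in> G2" "a < \<tau>" "\<tau> < b" "a < \<tau>'" "\<tau>' < b" using t unfolding same_gap_def by blast
    have "atoms {..\<tau>} \<nu> \<subseteq> atoms {..\<tau>'} \<nu> \<union> atoms {a<..<b} \<nu>"
      by (rule atoms_cover[OF \<nu>]) (use ab in auto)
    then have "mark_gap T (atoms {a<..<b} \<nu>) \<sigma>" if "cech_radius \<sigma> \<le> h" "\<sigma> \<inter> (atoms {..\<tau>} \<nu> - atoms {..\<tau>'} \<nu>) \<noteq> {}" for \<sigma>
      using that h by (auto simp: mark_gap_def)
    then show ?thesis
      by (intro that[of "small_sets K ?A (mark_gap T (atoms {a<..<b} \<nu>))"])
        (use G2[OF ab(1)] in \<open>auto simp: small_sets_def region_count_def\<close>)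
  qed
  have fN: "finite (N1 \<union> N2)" using N1(1) N2(1) finite_small_sets[OF fA] by (meson finite_UnI finite_subset)
  have "?X \<subseteq> (\<Union>\<sigma>\<in>N1 \<union> N2. Pow (Pow \<sigma>))"
  proof
    fix \<Phi> assume X: "\<Phi> \<in> ?X"
    then have m: "\<Phi> \<in> multicover h j (atoms {..\<tau>} \<nu> \<inter> B)" "\<Phi> \<notin> multicover h' j (atoms {..\<tau>'} \<nu> \<inter> B)" "card \<Phi> = i" by auto
    note u = multicover_union[OF m(1)]
    have "card (\<Union>\<Phi>) \<le> (\<Sum>\<phi>\<in>\<Phi>. card \<phi>)" by (rule card_Union_le_sum_card)
    also have "\<dots> = (\<Sum>\<phi>\<in>\<Phi>. j)" by (rule sum.cong) (use m(1) in \<open>auto simp: multicover_iff\<close>)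
    also have "\<dots> \<le> K" using m(3) ij by simp
    finally have c: "card (\<Union>\<Phi>) \<le> K" .
    have "\<Union>\<Phi> \<in> N1 \<union> N2"
    proof (cases "\<Union>\<Phi> \<subseteq> atoms {..\<tau>'} \<nu>")
      case True
      then have "\<forall>\<phi>\<in>\<Phi>. \<phi> \<subseteq> atoms {..\<tau>'} \<nu> \<inter> B" using u(3) by blast
      with m(1) have "\<Phi> \<in> multicover h' j (atoms {..\<tau>'} \<nu> \<inter> B)" if "cech_radius (\<Union>\<Phi>) \<le> h'"
        using that unfolding multicover_iff by (metis (no_types))
      with m(2) have "h' < cech_radius (\<Union>\<Phi>)" by (metis not_le)
      moreover have "\<Union>\<Phi> \<subseteq> ?A" using u(3) sub by (rule subset_trans)
      ultimately show ?thesis using u(2,4) c unfolding small_sets_def by (intro UnI1 N1(3)) (simp add: small_sets_def)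
    next
      case False
      then have "\<Union>\<Phi> \<inter> (atoms {..\<tau>} \<nu> - atoms {..\<tau>'} \<nu>) \<noteq> {}" using u(3) by blast
      moreover have "\<Union>\<Phi> \<subseteq> ?A" using u(3) sub by (rule subset_trans)
      ultimately show ?thesis using u(2,4) c unfolding small_sets_def by (intro UnI2 N2(3)) (simp add: small_sets_def)
    qed
    moreover have "\<Phi> \<in> Pow (Pow (\<Union>\<Phi>))" by auto
    ultimately show "\<Phi> \<in> (\<Union>\<sigma>\<in>N1 \<union> N2. Pow (Pow \<sigma>))" by (rule UN_I)
  qed
  moreover have fP: "finite (Pow (Pow \<sigma>))" "card (Pow (Pow \<sigma>)) \<le> 2 ^ 2 ^ K" if "\<sigma> \<in> N1 \<union> N2" for \<sigma>
  proof -
    have s: "\<sigma> \<subseteq> ?A" "card \<sigma> \<le> K" using that N1(1) N2(1) by (auto simp: small_sets_def)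
    have fs: "finite \<sigma>" using s(1) fA by (rule finite_subset)
    then show "finite (Pow (Pow \<sigma>))" by simp
    show "card (Pow (Pow \<sigma>)) \<le> 2 ^ 2 ^ K" using fs s(2) by (simp add: card_Pow del: power_increasing_iff) (intro power_increasing, auto)
  qed
  ultimately have "card ?X \<le> card (\<Union>\<sigma>\<in>N1 \<union> N2. Pow (Pow \<sigma>))"
    using fN by (intro card_mono finite_UN_I) auto
  also have "\<dots> \<le> (\<Sum>\<sigma>\<in>N1 \<union> N2. card (Pow (Pow \<sigma>)))" by (rule card_UN_le[OF fN])
  also have "\<dots> \<le> card (N1 \<union> N2) * 2 ^ 2 ^ K" using sum_bounded_above[of "N1 \<union> N2" "\<lambda>\<sigma>. card (Pow (Pow \<sigma>))"] fP(2) by simp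
  also have "\<dots> \<le> (card N1 + card N2) * 2 ^ 2 ^ K" by (rule mult_right_mono[OF card_Un_le]) simp
  finally have "real (card ?X) \<le> real ((card N1 + card N2) * 2 ^ 2 ^ K)" by (rule of_nat_mono)
  also have "\<dots> = 2 ^ 2 ^ K * (real (card N1) + real (card N2))" by simp
  also have "\<dots> \<le> 2 ^ 2 ^ K * (2 * e)" using N1(2) N2(2) by (intro mult_left_mono) auto
  finally show ?thesis .
qed

lemma region_betti_stable:
  fixes B :: "(real, 'd::{finite,linorder}) vec set"
  assumes \<nu>: "\<nu> \<in> space config_space" and B: "bounded B" and e: "0 \<le> e"
    and le: "r \<le> s" "s \<le> real T" "t \<le> u" "1 \<le> l" "l \<le> k" "k \<le> T"
    and le': "r' \<le> s'" "s' \<le> real T" "t' \<le> u'"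
    and gap: "same_gap G1 r r'" "same_gap G1 s s'" "same_gap G2 t t'" "same_gap G2 u u'"
    and G1: "\<And>a b. (a, b) \<in> G1 \<Longrightarrow> region_count (T * (q + 2)) (radius_gap a b) {} B \<nu> \<le> e"
    and G2: "\<And>a b. (a, b) \<in> G2 \<Longrightarrow> region_count (T * (q + 2)) (mark_gap (real T)) {a<..<b} B \<nu> \<le> e"
  shows "\<bar>region_betti q r t k s u l B \<nu> - region_betti q r' t' k s' u' l B \<nu>\<bar> \<le> 2 ^ 2 ^ (T * (q + 2)) * (4 * e)"
proof -
  have D: "real (card {\<Phi> \<in> multicover h j (atoms {..\<tau>} \<nu> \<inter> B) - multicover h' j (atoms {..\<tau>'} \<nu> \<inter> B). card \<Phi> = i})
    \<le> 2 ^ 2 ^ (T * (q + 2)) * (2 * e)"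
    if "i \<le> q + 2" "j \<le> T" "h \<le> real T" "same_gap G1 h h'" "same_gap G2 \<tau> \<tau>'" for h h' \<tau> \<tau>' j i
  proof (rule card_multicover_difference[OF \<nu> B _ that(3) e that(4,5) G1 G2])
    show "i * j \<le> T * (q + 2)" using mult_le_mono[OF that(1,2)] by (simp add: mult.commute)
  qed
  have sym: "same_gap G x y \<Longrightarrow> same_gap G y x" for G x y by (auto simp: same_gap_def)
  have simp': "simplicial (lex_smallest l) (multicover a k (atoms {..c} \<nu> \<inter> B)) (multicover b l (atoms {..d} \<nu> \<inter> B))"
    if "a \<le> b" "c \<le> d" for a b c d
  proof (rule simplicial_lex_smallest)
    show "finite (atoms {..d} \<nu> \<inter> B)" using \<nu> B by (intro finite_atoms) auto
    show "atoms {..c} \<nu> \<inter> B \<subseteq> atoms {..d} \<nu> \<inter> B" using atoms_mono[OF \<nu>, of "{..d}" "{..c}"] that by auto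
  qed (use le that in auto)
  \<comment> \<open>The estimate is symmetric in the two indices, so one direction suffices.\<close>
  have half: "region_betti q r t k s u l B \<nu> - region_betti q r' t' k s' u' l B \<nu> \<le> 2 ^ 2 ^ (T * (q + 2)) * (4 * e)"
    if le: "r \<le> s" "s \<le> real T" "t \<le> u" and le': "r' \<le> s'" "s' \<le> real T" "t' \<le> u'"
      and gap: "same_gap G1 r r'" "same_gap G1 s s'" "same_gap G2 t t'" "same_gap G2 u u'"
    for r s t u r' s' t' u'
  proof -
    have k: "k \<le> T" "l \<le> T" using assms(8,9) by auto
    have "region_betti q r t k s u l B \<nu> \<le> region_betti q r' t' k s' u' l B \<nu>
      + real (card {\<Phi> \<in> multicover r k (atoms {..t} \<nu> \<inter> B) - multicover r' k (atoms {..t'} \<nu> \<inter> B). card \<Phi> = q + 1})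
      + real (card {\<Phi> \<in> multicover s' l (atoms {..u'} \<nu> \<inter> B) - multicover s l (atoms {..u} \<nu> \<inter> B). card \<Phi> = q + 2})"
      unfolding region_betti_def prank_def of_nat_add[symmetric]
      by (rule of_nat_mono[OF homology_rank_stable[OF simp' simp']]) (use le le' in auto)
    also have "\<dots> \<le> region_betti q r' t' k s' u' l B \<nu> + 2 ^ 2 ^ (T * (q + 2)) * (2 * e) + 2 ^ 2 ^ (T * (q + 2)) * (2 * e)"
      using le le' k gap by (intro add_mono order_refl D sym[of G1 s s'] sym[of G2 u u']) auto
    finally show ?thesis by (simp add: algebra_simps)
  qed
  have "region_betti q r t k s u l B \<nu> - region_betti q r' t' k s' u' l B \<nu> \<le> 2 ^ 2 ^ (T * (q + 2)) * (4 * e)"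
    by (rule half) fact+
  moreover have "region_betti q r' t' k s' u' l B \<nu> - region_betti q r t k s u l B \<nu> \<le> 2 ^ 2 ^ (T * (q + 2)) * (4 * e)"
    by (rule half) (fact | rule sym, fact)+
  ultimately show ?thesis by (simp add: abs_le_iff)
qed

section \<open>Uniform convergence\<close>

lemma snap_same_gap:
  assumes "finite D" "a \<in> D" "b \<in> D" "a \<le> r" "r \<le> b"
  shows "same_gap (gaps D) r (snap D r)"
  using snap(1)[OF assms] by (auto simp: same_gap_def)

definition betti ::
    "nat \<Rightarrow> index \<Rightarrow> index \<Rightarrow> (real, 'd::{finite,linorder}) vec set \<Rightarrow> ((real, 'd) vec \<times> real) measure \<Rightarrow> real" where
  "betti q b d = (let (r, t, k) = b; (s, u, l) = index_max b d in region_betti q r t k s u l)"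

context lex_point_process_law begin

text \<open>Fix a cube so large that the rate in the law of large numbers is at most \<open>e / 2\<close>, and
  choose the gaps such that the expected content in this single cube has density below \<open>e / 2\<close>.
  As the rate is the same for all gaps, every gap then has asymptotic content below \<open>e\<close>.\<close>

lemma finite_gap_points:
  fixes Q :: "real \<Rightarrow> real \<Rightarrow> (real, 'a) vec set \<Rightarrow> (real, 'a) vec set \<Rightarrow> bool" and T K :: nat
  assumes na: "\<And>a b. b \<le> real T \<Longrightarrow> near_additive P config_shift (weight (K + 1)) (region_count K (Q a b) (J a b)) (2 * T) 2"
    and meas: "\<And>a b B. B \<in> sets borel \<Longrightarrow> bounded B \<Longrightarrow> region_count K (Q a b) (J a b) B \<in> borel_measurable config_space"
    and Q: "\<And>a b A \<sigma>. b \<le> real T \<Longrightarrow> Q a b A \<sigma> \<Longrightarrow> cech_radius \<sigma> \<le> real T"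
    and mono: "\<And>a b a' b' \<nu> \<sigma>. \<nu> \<in> space config_space \<Longrightarrow> a' \<le> a \<Longrightarrow> b \<le> b' \<Longrightarrow>
      Q a b (atoms (J a b) \<nu>) \<sigma> \<Longrightarrow> Q a' b' (atoms (J a' b') \<nu>) \<sigma>"
    and van1: "\<And>x m. x \<le> real T \<Longrightarrow>
      (\<lambda>i. \<integral>\<nu>. region_count K (Q (x - 1 / real (Suc i)) x) (J (x - 1 / real (Suc i)) x) (hcube 0 m) \<nu> \<partial>P) \<longlonglongrightarrow> 0"
    and van2: "\<And>x m. x \<le> real T \<Longrightarrow>
      (\<lambda>i. \<integral>\<nu>. region_count K (Q x (min (real T) (x + 1 / real (Suc i)))) (J x (min (real T) (x + 1 / real (Suc i)))) (hcube 0 m) \<nu> \<partial>P) \<longlonglongrightarrow> 0"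
    and e: "0 < e"
  shows "\<exists>D. finite D \<and> 0 \<in> D \<and> real T \<in> D \<and> (AE \<nu> in P. eventually (\<lambda>n. \<forall>(a, b)\<in>gaps D.
    region_count K (Q a b) (J a b) (cbox 0 (vec (real n))) \<nu> \<le> e * real n ^ CARD('a)) sequentially)"
proof -
  obtain m0 :: nat where "2 * error_const (K + 1) (2 * T) / e < real m0" using reals_Archimedean2 by blast
  define m where "m = Suc m0"
  have m: "1 \<le> m" "error_const (K + 1) (2 * T) / real m \<le> e / 2"
    using \<open>_ < real m0\<close> e by (auto simp: m_def field_simps)
  let ?\<Psi> = "\<lambda>s t. region_count K (Q s t) (J s t)"
  \<comment> \<open>Cutting off at \<open>T\<close> keeps the radii bounded, as near additivity requires, and does not
    affect the gaps inside \<open>[0, T]\<close>.\<close>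
  define \<mu> where "\<mu> = (\<lambda>s t. (\<integral>\<nu>. ?\<Psi> s (min (real T) t) (hcube 0 m) \<nu> \<partial>P) / real m ^ CARD('a))"
  have int: "integrable P (?\<Psi> s t (hcube 0 m))" if "t \<le> real T" for s t
    by (rule region_count_integrable(1)[where T = T, OF bounded_hcube meas[OF hcube_borel bounded_hcube] Q[OF that]])
  have "\<exists>D. finite D \<and> 0 \<in> D \<and> real T \<in> D \<and>
    (\<forall>s t. 0 \<le> s \<longrightarrow> s < t \<longrightarrow> t \<le> real T \<longrightarrow> {s<..<t} \<inter> D = {} \<longrightarrow> \<mu> s t < e / 2)"
  proof (rule gap_partition)
    fix s t s' t' :: real assume st: "s' \<le> s" "t \<le> t'"
    have "(\<integral>\<nu>. ?\<Psi> s (min (real T) t) (hcube 0 m) \<nu> \<partial>P) \<le> (\<integral>\<nu>. ?\<Psi> s' (min (real T) t') (hcube 0 m) \<nu> \<partial>P)"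
    proof (rule integral_mono)
      fix \<nu> assume "\<nu> \<in> space P"
      then have \<nu>: "\<nu> \<in> space config_space" by (simp add: space_P)
      have "Q s (min (real T) t) (atoms (J s (min (real T) t)) \<nu>) \<sigma> \<Longrightarrow>
          Q s' (min (real T) t') (atoms (J s' (min (real T) t')) \<nu>) \<sigma>" for \<sigma>
        by (rule mono[OF \<nu> st(1)]) (use st(2) in auto)
      then have "small_sets K (atoms UNIV \<nu> \<inter> hcube 0 m) (Q s (min (real T) t) (atoms (J s (min (real T) t)) \<nu>))
        \<subseteq> small_sets K (atoms UNIV \<nu> \<inter> hcube 0 m) (Q s' (min (real T) t') (atoms (J s' (min (real T) t')) \<nu>))"
        unfolding small_sets_def by blast
      then show "?\<Psi> s (min (real T) t) (hcube 0 m) \<nu> \<le> ?\<Psi> s' (min (real T) t') (hcube 0 m) \<nu>"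
        unfolding region_count_def
        by (intro of_nat_mono card_mono finite_small_sets finite_atoms[OF \<nu>] bounded_hcube) simp_all
    qed (intro int, simp)+
    then show "\<mu> s t \<le> \<mu> s' t'" unfolding \<mu>_def by (rule divide_right_mono) simp
  next
    fix x :: real assume x: "0 \<le> x" "x \<le> real T"
    have pos: "0 < e / 2 * real m ^ CARD('a)" using e m by simp
    have "eventually (\<lambda>i. \<mu> (x - 1 / real (Suc i)) x < e / 2) sequentially"
      using order_tendstoD(2)[OF van1[OF x(2), of m] pos]
      by (rule eventually_mono) (use m x in \<open>simp add: \<mu>_def pos_divide_less_eq min_absorb2\<close>)
    moreover have "eventually (\<lambda>i. \<mu> x (x + 1 / real (Suc i)) < e / 2) sequentially"
      using order_tendstoD(2)[OF van2[OF x(2), of m] pos]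
      by (rule eventually_mono) (use m in \<open>simp add: \<mu>_def pos_divide_less_eq\<close>)
    ultimately have "eventually (\<lambda>i. \<mu> (x - 1 / real (Suc i)) x < e / 2 \<and> \<mu> x (x + 1 / real (Suc i)) < e / 2) sequentially"
      by (rule eventually_conj)
    then obtain i where "\<mu> (x - 1 / real (Suc i)) x < e / 2 \<and> \<mu> x (x + 1 / real (Suc i)) < e / 2"
      using eventually_happens'[OF sequentially_bot] by blast
    then show "\<exists>d>0. \<mu> (x - d) x < e / 2 \<and> \<mu> x (x + d) < e / 2" by (intro exI[of _ "1 / real (Suc i)"]) simp
  qed simp
  then obtain D where D: "finite D" "0 \<in> D" "real T \<in> D"
    "\<And>s t. 0 \<le> s \<Longrightarrow> s < t \<Longrightarrow> t \<le> real T \<Longrightarrow> {s<..<t} \<inter> D = {} \<Longrightarrow> \<mu> s t < e / 2" by metis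
  \<comment> \<open>Points of \<open>D\<close> outside \<open>[0, T]\<close> would create gaps for which nothing is known.\<close>
  let ?D = "D \<inter> {0..real T}"
  have "AE \<nu> in P. eventually (\<lambda>n. ?\<Psi> (fst g) (snd g) (cbox 0 (vec (real n))) \<nu> \<le> e * real n ^ CARD('a)) sequentially"
    if g: "g \<in> gaps ?D" for g
  proof -
    have ab: "0 \<le> fst g" "fst g < snd g" "snd g \<le> real T" "{fst g<..<snd g} \<inter> D = {}"
      using g by (fastforce simp: gaps_def)+
    obtain b where b: "AE \<nu> in P. (\<lambda>n. ?\<Psi> (fst g) (snd g) (cbox 0 (vec (real n))) \<nu> / real n ^ CARD('a)) \<longlonglongrightarrow> b"
      "\<bar>b - (\<integral>\<nu>. ?\<Psi> (fst g) (snd g) (hcube 0 m) \<nu> \<partial>P) / real m ^ CARD('a)\<bar> \<le> error_const (K + 1) (2 * T) / real m"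
      using law_of_large_numbers[OF na[OF ab(3), of "fst g"]] m(1) by blast
    have "(\<integral>\<nu>. ?\<Psi> (fst g) (snd g) (hcube 0 m) \<nu> \<partial>P) / real m ^ CARD('a) < e / 2"
      using D(4)[OF ab] ab(3) by (simp add: \<mu>_def min_absorb2)
    then have "b < e" using b(2) m(2) by linarith
    show ?thesis using b(1)
    proof eventually_elim
      case (elim \<nu>)
      from order_tendstoD(2)[OF elim \<open>b < e\<close>] eventually_gt_at_top[of 0]
      show ?case
      proof eventually_elim
        case (elim n) then show ?case by (simp add: pos_divide_less_eq)
      qed
    qed
  qed
  then have "AE \<nu> in P. \<forall>g\<in>gaps ?D. eventually (\<lambda>n. ?\<Psi> (fst g) (snd g) (cbox 0 (vec (real n))) \<nu> \<le> e * real n ^ CARD('a)) sequentially"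
    by (intro AE_finite_allI finite_gaps) (use D in auto)
  then have "AE \<nu> in P. eventually (\<lambda>n. \<forall>g\<in>gaps ?D. ?\<Psi> (fst g) (snd g) (cbox 0 (vec (real n))) \<nu> \<le> e * real n ^ CARD('a)) sequentially"
  proof eventually_elim
    case (elim \<nu>)
    then show ?case by (intro eventually_ball_finite finite_gaps) (use D in auto)
  qed
  then show ?thesis using D by (intro exI[of _ ?D]) (auto simp: case_prod_beta)
qed

lemma near_additive_index_betti:
  assumes "b \<in> index_set T" "d \<in> index_set T"
  shows "near_additive P config_shift (weight (T * (q + 2) + 1)) (betti q b d) (2 * T) 2"
proof -
  obtain r t k s u l where eq: "b = (r, t, k)" "d = (s, u, l)" by (metis prod_cases3)
  have "near_additive P config_shift (weight (T * (q + 2) + 1)) (region_betti q r t k (max r s) (max t u) (min k l)) (2 * T) 2"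
    by (rule near_additive_betti) (use assms in \<open>auto simp: eq index_set_def\<close>)
  then show ?thesis by (simp add: eq betti_def index_max_def)
qed

text \<open>Snapping the radii and the mark thresholds of both indices to finitely many reference
  values changes the Betti number only by the content of gaps. The same comparison passes to the
  limits, because almost surely both the Betti numbers converge and the gap contents are
  eventually small.\<close>

lemma uniform_law_of_large_numbers:
  assumes lim: "\<And>b d. b \<in> index_set T \<Longrightarrow> d \<in> index_set T \<Longrightarrow>
      AE \<nu> in P. (\<lambda>n. betti q b d (cbox 0 (vec (real n))) \<nu> / real n ^ CARD('a)) \<longlonglongrightarrow> g b d"
    and e: "0 < e"
  shows "AE \<nu> in P. eventually (\<lambda>n. \<forall>b\<in>index_set T. \<forall>d\<in>index_set T.
    \<bar>betti q b d (cbox 0 (vec (real n))) \<nu> / real n ^ CARD('a) - g b d\<bar> \<le> e) sequentially"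
proof -
  define K where "K = T * (q + 2)"
  define C :: real where "C = 2 ^ 2 ^ K"
  \<comment> \<open>One third of \<open>e\<close> for the change of the Betti number, which is at most \<open>4 * C\<close> times the
    content of the gaps.\<close>
  define \<epsilon> where "\<epsilon> = e / (12 * C)"
  have C: "0 < C" and \<epsilon>: "0 < \<epsilon>" "C * (4 * \<epsilon>) = e / 3" using e by (auto simp: C_def \<epsilon>_def)
  obtain D1 where D1: "finite D1" "0 \<in> D1" "real T \<in> D1" "AE \<nu> in P. eventually (\<lambda>n. \<forall>(a, b)\<in>gaps D1.
    region_count K (radius_gap a b) {} (cbox 0 (vec (real n))) \<nu> \<le> \<epsilon> * real n ^ CARD('a)) sequentially"
  proof (rule exE[OF finite_gap_points[where Q = radius_gap and J = "\<lambda>a b. {}" and T = T and K = K,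
        OF near_additive_radius_gap radius_gap_measurable _ _
        radius_gap_vanishing(1)[OF hcube_borel bounded_hcube, where T = T]
        radius_gap_vanishing(2)[OF hcube_borel bounded_hcube, where T = T] \<epsilon>(1)]])
  qed (auto simp: radius_gap_def)
  have Jdec: "decseq (\<lambda>i. {x - 1 / real (Suc i)<..<x})" "(\<Inter>i. {x - 1 / real (Suc i)<..<x}) = {}"
    "decseq (\<lambda>i. {x<..<min (real T) (x + 1 / real (Suc i))})" "(\<Inter>i. {x<..<min (real T) (x + 1 / real (Suc i))}) = {}" for x :: real
  proof -
    have s: "1 / real (Suc j) \<le> 1 / real (Suc i)" if "i \<le> j" for i j using that by (simp add: frac_le)
    show "decseq (\<lambda>i. {x - 1 / real (Suc i)<..<x})" unfolding decseq_def
    proof (intro allI impI subsetI)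
      fix i j y assume "i \<le> j" "y \<in> {x - 1 / real (Suc j)<..<x}"
      then show "y \<in> {x - 1 / real (Suc i)<..<x}" using s[of i j] by simp
    qed
    show "decseq (\<lambda>i. {x<..<min (real T) (x + 1 / real (Suc i))})" unfolding decseq_def
    proof (intro allI impI subsetI)
      fix i j y assume "i \<le> j" "y \<in> {x<..<min (real T) (x + 1 / real (Suc j))}"
      then show "y \<in> {x<..<min (real T) (x + 1 / real (Suc i))}" using s[of i j] by simp
    qed
    have no: "\<exists>i. 1 / real (Suc i) < z" if "0 < z" for z :: real
      using reals_Archimedean[OF that] by (simp add: inverse_eq_divide)
    show "(\<Inter>i. {x - 1 / real (Suc i)<..<x}) = {}"
    proof (rule equals0I)
      fix y assume "y \<in> (\<Inter>i. {x - 1 / real (Suc i)<..<x})"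
      then have y: "x - 1 / real (Suc i) < y" "y < x" for i by auto
      then obtain i where "1 / real (Suc i) < x - y" using no[of "x - y"] by auto
      then show False using y(1)[of i] by linarith
    qed
    show "(\<Inter>i. {x<..<min (real T) (x + 1 / real (Suc i))}) = {}"
    proof (rule equals0I)
      fix y assume "y \<in> (\<Inter>i. {x<..<min (real T) (x + 1 / real (Suc i))})"
      then have y: "y < x + 1 / real (Suc i)" "x < y" for i by auto
      then obtain i where "1 / real (Suc i) < y - x" using no[of "y - x"] by auto
      then show False using y(1)[of i] by linarith
    qed
  qed
  obtain D2 where D2: "finite D2" "0 \<in> D2" "real T \<in> D2" "AE \<nu> in P. eventually (\<lambda>n. \<forall>(a, b)\<in>gaps D2.
    region_count K (mark_gap (real T)) {a<..<b} (cbox 0 (vec (real n))) \<nu> \<le> \<epsilon> * real n ^ CARD('a)) sequentially"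
  proof (rule exE[OF finite_gap_points[where Q = "\<lambda>a b. mark_gap (real T)" and J = "\<lambda>a b. {a<..<b}" and T = T and K = K and e = \<epsilon>]])
    show "near_additive P config_shift (weight (K + 1)) (region_count K (mark_gap (real T)) {a<..<b}) (2 * T) 2" for a b
      by (rule near_additive_mark_gap) simp
    show "region_count K (mark_gap (real T)) {a<..<b} B \<in> borel_measurable config_space" if "B \<in> sets borel" "bounded B" for a b and B :: "(real, 'a) vec set"
      by (rule mark_gap_measurable[OF that]) simp
    show "mark_gap (real T) (atoms {a'<..<b'} \<nu>) \<sigma>" if "\<nu> \<in> space config_space" "a' \<le> a" "b \<le> b'" "mark_gap (real T) (atoms {a<..<b} \<nu>) \<sigma>"
      for a b a' b' and \<nu> :: "((real, 'a) vec \<times> real) measure" and \<sigma>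
    proof -
      have "atoms {a<..<b} \<nu> \<subseteq> atoms {a'<..<b'} \<nu>"
        by (rule atoms_mono[OF that(1)]) (use that(2,3) in auto)
      then show ?thesis using that(4) unfolding mark_gap_def by blast
    qed
    show "(\<lambda>i. \<integral>\<nu>. region_count K (mark_gap (real T)) {x - 1 / real (Suc i)<..<x} (hcube 0 m) \<nu> \<partial>P) \<longlonglongrightarrow> 0" for x m
      by (rule mark_gap_vanishing[OF hcube_borel bounded_hcube _ Jdec(1,2)]) simp
    show "(\<lambda>i. \<integral>\<nu>. region_count K (mark_gap (real T)) {x<..<min (real T) (x + 1 / real (Suc i))} (hcube 0 m) \<nu> \<partial>P) \<longlonglongrightarrow> 0" for x m
      by (rule mark_gap_vanishing[OF hcube_borel bounded_hcube _ Jdec(3,4)]) simp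
  qed (use \<epsilon> in \<open>auto simp: mark_gap_def\<close>)
  define ref where "ref = (\<lambda>(r, t, k::nat). (snap D1 r, snap D2 t, k))"
  have ref_in: "ref b \<in> index_set T" if "b \<in> index_set T" for b
    using that snap(2,3)[OF D1(1-3)] snap(2,3)[OF D2(1-3)] by (auto simp: index_set_def ref_def)
  have "finite (ref ` index_set T)"
  proof (rule finite_subset)
    show "ref ` index_set T \<subseteq> ((\<lambda>(s, t). (s + t) / 2) ` (D1 \<times> D1)) \<times> ((\<lambda>(s, t). (s + t) / 2) ` (D2 \<times> D2)) \<times> {1..T}"
      using snap(4)[OF D1(1-3)] snap(4)[OF D2(1-3)] by (auto simp: index_set_def ref_def)
  qed (use D1 D2 in auto)
  then have fin: "finite (ref ` index_set T \<times> ref ` index_set T)" by simp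
  have mx: "snap D (max x y) = max (snap D x) (snap D y)"
    if "finite D" "0 \<in> D" "real T \<in> D" "0 \<le> x" "x \<le> real T" "0 \<le> y" "y \<le> real T" for D x y
    using snap(5)[OF that(1-3), of x y] snap(5)[OF that(1-3), of y x] that by (auto simp: max_def)
  have close: "\<bar>betti q b d (cbox 0 (vec (real n))) \<nu> / real n ^ CARD('a)
      - betti q (ref b) (ref d) (cbox 0 (vec (real n))) \<nu> / real n ^ CARD('a)\<bar> \<le> e / 3"
    if \<nu>: "\<nu> \<in> space P" and n: "0 < n" and bd: "b \<in> index_set T" "d \<in> index_set T"
      and G1: "\<forall>(a, b)\<in>gaps D1. region_count K (radius_gap a b) {} (cbox 0 (vec (real n))) \<nu> \<le> \<epsilon> * real n ^ CARD('a)"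
      and G2: "\<forall>(a, b)\<in>gaps D2. region_count K (mark_gap (real T)) {a<..<b} (cbox 0 (vec (real n))) \<nu> \<le> \<epsilon> * real n ^ CARD('a)"
    for \<nu> n b d
  proof -
    obtain r t k s u l where eq: "b = (r, t, k)" "d = (s, u, l)" by (metis prod_cases3)
    have b: "0 \<le> r" "r \<le> real T" "0 \<le> t" "t \<le> real T" "1 \<le> k" "k \<le> T"
      "0 \<le> s" "s \<le> real T" "0 \<le> u" "u \<le> real T" "1 \<le> l" "l \<le> T" using bd by (auto simp: eq index_set_def)
    let ?B = "cbox 0 (vec (real n)) :: (real, 'a) vec set"
    have B: "betti q b d = region_betti q r t k (max r s) (max t u) (min k l)" by (simp add: eq betti_def index_max_def)
    have B': "betti q (ref b) (ref d) = region_betti q (snap D1 r) (snap D2 t) k (snap D1 (max r s)) (snap D2 (max t u)) (min k l)"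
      using b by (simp add: eq betti_def index_max_def ref_def mx[OF D1(1-3)] mx[OF D2(1-3)])
    have "\<bar>betti q b d ?B \<nu> - betti q (ref b) (ref d) ?B \<nu>\<bar> \<le> 2 ^ 2 ^ (T * (q + 2)) * (4 * (\<epsilon> * real n ^ CARD('a)))"
      unfolding B B'
    proof (rule region_betti_stable)
      show "snap D1 (max r s) \<le> real T" using b by (intro snap(3)[OF D1(1-3)]) auto
      show "snap D1 r \<le> snap D1 (max r s)" using b by (intro snap(5)[OF D1(1-3)]) auto
      show "snap D2 t \<le> snap D2 (max t u)" using b by (intro snap(5)[OF D2(1-3)]) auto
      show "same_gap (gaps D1) r (snap D1 r)" "same_gap (gaps D1) (max r s) (snap D1 (max r s))"
        using b by (intro snap_same_gap[OF D1(1-3)]; simp)+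
      show "same_gap (gaps D2) t (snap D2 t)" "same_gap (gaps D2) (max t u) (snap D2 (max t u))"
        using b by (intro snap_same_gap[OF D2(1-3)]; simp)+
      show "region_count (T * (q + 2)) (radius_gap x y) {} ?B \<nu> \<le> \<epsilon> * real n ^ CARD('a)" if "(x, y) \<in> gaps D1" for x y
        using bspec[OF G1 that] by (simp add: K_def)
      show "region_count (T * (q + 2)) (mark_gap (real T)) {x<..<y} ?B \<nu> \<le> \<epsilon> * real n ^ CARD('a)" if "(x, y) \<in> gaps D2" for x y
        using bspec[OF G2 that] by (simp add: K_def)
    qed (use b \<nu> \<epsilon> in \<open>auto simp: space_P bounded_cbox\<close>)
    also have "\<dots> = e / 3 * real n ^ CARD('a)" using \<epsilon>(2) by (simp add: C_def K_def)
    finally show ?thesis using n by (simp add: pos_divide_le_eq flip: diff_divide_distrib)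
  qed
  have lim_close: "\<bar>g b d - g (ref b) (ref d)\<bar> \<le> e / 3" if bd: "b \<in> index_set T" "d \<in> index_set T" for b d
  proof -
    \<comment> \<open>A deterministic inequality: it holds as soon as a single configuration witnesses it.\<close>
    have "AE \<nu> in P. \<bar>g b d - g (ref b) (ref d)\<bar> \<le> e / 3"
      using D1(4) D2(4) lim[OF bd] lim[OF ref_in[OF bd(1)] ref_in[OF bd(2)]] AE_space
    proof eventually_elim
      case (elim \<nu>)
      have "(\<lambda>n. \<bar>betti q b d (cbox 0 (vec (real n))) \<nu> / real n ^ CARD('a)
        - betti q (ref b) (ref d) (cbox 0 (vec (real n))) \<nu> / real n ^ CARD('a)\<bar>) \<longlonglongrightarrow> \<bar>g b d - g (ref b) (ref d)\<bar>"
        by (intro tendsto_rabs tendsto_diff elim)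
      moreover have "eventually (\<lambda>n. \<bar>betti q b d (cbox 0 (vec (real n))) \<nu> / real n ^ CARD('a)
        - betti q (ref b) (ref d) (cbox 0 (vec (real n))) \<nu> / real n ^ CARD('a)\<bar> \<le> e / 3) sequentially"
        using elim(1,2) eventually_gt_at_top[of 0]
      proof eventually_elim
        case prems: (elim n)
        show ?case by (rule close[OF elim(5) prems(3) bd prems(1,2)])
      qed
      ultimately show ?case by (intro tendsto_upperbound[OF _ _ sequentially_bot])
    qed
    then show ?thesis by simp
  qed
  have "AE \<nu> in P. \<forall>p\<in>ref ` index_set T \<times> ref ` index_set T.
    (\<lambda>n. betti q (fst p) (snd p) (cbox 0 (vec (real n))) \<nu> / real n ^ CARD('a)) \<longlonglongrightarrow> g (fst p) (snd p)"
  proof (rule AE_finite_allI[OF fin])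
    fix p assume "p \<in> ref ` index_set T \<times> ref ` index_set T"
    then have "fst p \<in> index_set T" "snd p \<in> index_set T" using ref_in by auto
    then show "AE \<nu> in P. (\<lambda>n. betti q (fst p) (snd p) (cbox 0 (vec (real n))) \<nu> / real n ^ CARD('a)) \<longlonglongrightarrow> g (fst p) (snd p)"
      by (rule lim)
  qed
  then show ?thesis using D1(4) D2(4) AE_space
  proof eventually_elim
    case (elim \<nu>)
    have "eventually (\<lambda>n. \<forall>p\<in>ref ` index_set T \<times> ref ` index_set T.
      dist (betti q (fst p) (snd p) (cbox 0 (vec (real n))) \<nu> / real n ^ CARD('a)) (g (fst p) (snd p)) < e / 3) sequentially"
      by (rule eventually_ball_finite[OF fin], intro ballI tendstoD) (use elim(1) e in blast, use e in simp)
    then show ?case using elim(2,3) eventually_gt_at_top[of 0]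
    proof eventually_elim
      case prems: (elim n)
      show ?case
      proof (intro ballI)
        fix b d assume bd: "b \<in> index_set T" "d \<in> index_set T"
        let ?F = "\<lambda>b d. betti q b d (cbox 0 (vec (real n))) \<nu> / real n ^ CARD('a)"
        have "\<bar>?F (ref b) (ref d) - g (ref b) (ref d)\<bar> < e / 3"
          using bspec[OF prems(1), of "(ref b, ref d)"] bd by (simp add: dist_real_def)
        then show "\<bar>?F b d - g b d\<bar> \<le> e"
          using close[OF elim(4) prems(4) bd prems(2,3)] lim_close[OF bd] by linarith
      qed
    qed
  qed
qed

end

section \<open>Convergence for the point process\<close>

text \<open>Stationarity, ergodicity and the moment conditions are statements about the configuration
  only, so they transfer to its law.\<close>

lemma point_process_law_config:
  fixes X :: "nat \<Rightarrow> 'w \<Rightarrow> (real, 'd::{finite,linorder}) vec"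
  assumes \<Omega>: "prob_space \<Omega>" and mpp: "marked_point_process \<Omega> T X M" and st: "stationary \<Omega> X M" and er: "ergodic \<Omega> X M"
    and mom: "\<And>p::nat. p \<ge> 1 \<Longrightarrow> (\<integral>\<^sup>+\<omega>. point_count (\<lambda>i. X i \<omega>) (cbox 0 1) ^ p \<partial>\<Omega>) < \<infinity>"
  defines "\<Phi> \<equiv> \<lambda>\<omega>. config (\<lambda>i. X i \<omega>) (\<lambda>i. M i \<omega>)"
  shows "\<Phi> \<in> measurable \<Omega> config_space" and "lex_point_process_law (distr \<Omega> config_space \<Phi>)"
proof -
  have fin: "finite {i. X i \<omega> \<in> B}" if "\<omega> \<in> space \<Omega>" "bounded B" for \<omega> B
    using mpp that by (auto simp: marked_point_process_def)
  show meas [measurable]: "\<Phi> \<in> measurable \<Omega> config_space"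
    unfolding \<Phi>_def using mpp fin by (intro config_measurable) (auto simp: marked_point_process_def)
  interpret \<Omega>: prob_space \<Omega> by fact
  let ?P = "distr \<Omega> config_space \<Phi>"
  interpret P: prob_space ?P by (rule \<Omega>.prob_space_distr[OF meas])
  have cb: "cbox 0 (1 :: (real, 'd) vec) \<times> (UNIV :: real set) \<in> sets borel" by (intro sets_Times_borel) auto
  show "lex_point_process_law ?P"
  proof (intro lex_point_process_law.intro point_process_law.intro point_process_law_axioms.intro P.prob_space_axioms)
    show "distr ?P config_space (config_shift v) = ?P" for v
    proof -
      have "distr ?P config_space (config_shift v) = distr \<Omega> config_space (config_shift v \<circ> \<Phi>)"
        by (rule distr_distr) measurable
      also have "\<dots> = distr \<Omega> config_space (\<lambda>\<omega>. config (\<lambda>i. X i \<omega> + v) (\<lambda>i. M i \<omega>))"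
        by (rule distr_cong) (simp_all add: \<Phi>_def config_shift_config[OF fin])
      also have "\<dots> = ?P" using st by (simp add: stationary_def \<Phi>_def)
      finally show ?thesis .
    qed
    show "measure ?P A \<in> {0, 1}"
      if "A \<in> sets config_space" "\<And>v \<nu>. \<nu> \<in> space config_space \<Longrightarrow> config_shift v \<nu> \<in> A \<longleftrightarrow> \<nu> \<in> A" for A
    proof -
      have "measure ?P A = measure \<Omega> {\<omega> \<in> space \<Omega>. \<Phi> \<omega> \<in> A}"
        using that(1) by (subst measure_distr) (auto intro!: arg_cong[where f = "measure \<Omega>"])
      then show ?thesis using er that by (simp add: ergodic_def \<Phi>_def)
    qed
    show "integrable ?P (\<lambda>\<nu>. measure \<nu> (cbox 0 1 \<times> UNIV) ^ p)" for p :: nat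
    proof (cases "p = 0")
      case False
      have eq: "measure (\<Phi> \<omega>) (cbox 0 1 \<times> UNIV) ^ p = enn2real (point_count (\<lambda>i. X i \<omega>) (cbox 0 1) ^ p)"
        "point_count (\<lambda>i. X i \<omega>) (cbox 0 1) < \<top>" if "\<omega> \<in> space \<Omega>" for \<omega>
      proof -
        have f: "finite {i. X i \<omega> \<in> cbox 0 1}" by (rule fin[OF that bounded_cbox])
        have "emeasure (\<Phi> \<omega>) (cbox 0 1 \<times> UNIV) = point_count (\<lambda>i. X i \<omega>) (cbox 0 1)"
          by (simp add: \<Phi>_def emeasure_config[OF cb] point_count_def)
        moreover show "point_count (\<lambda>i. X i \<omega>) (cbox 0 1) < \<top>" using f by (simp add: point_count_def of_nat_less_top)
        ultimately show "measure (\<Phi> \<omega>) (cbox 0 1 \<times> UNIV) ^ p = enn2real (point_count (\<lambda>i. X i \<omega>) (cbox 0 1) ^ p)"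
          using f by (simp add: measure_def point_count_def flip: ennreal_of_nat_eq_real_of_nat of_nat_power)
      qed
      have m: "(\<lambda>\<nu>. measure \<nu> (cbox 0 1 \<times> (UNIV :: real set)) ^ p) \<in> borel_measurable (config_space :: ((real, 'd) vec \<times> real) measure measure)"
        using cb by (intro borel_measurable_power measure_config_measurable)
      have "integrable \<Omega> (\<lambda>\<omega>. measure (\<Phi> \<omega>) (cbox 0 1 \<times> UNIV) ^ p)"
      proof (rule integrableI_bounded)
        show "(\<lambda>\<omega>. measure (\<Phi> \<omega>) (cbox 0 1 \<times> UNIV) ^ p) \<in> borel_measurable \<Omega>" by (rule measurable_compose[OF meas m])
        have "(\<integral>\<^sup>+\<omega>. ennreal (norm (measure (\<Phi> \<omega>) (cbox 0 1 \<times> UNIV) ^ p)) \<partial>\<Omega>) = (\<integral>\<^sup>+\<omega>. point_count (\<lambda>i. X i \<omega>) (cbox 0 1) ^ p \<partial>\<Omega>)"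
        proof (rule nn_integral_cong)
          fix \<omega> assume w: "\<omega> \<in> space \<Omega>"
          have "norm (measure (\<Phi> \<omega>) (cbox 0 1 \<times> UNIV) ^ p) = enn2real (point_count (\<lambda>i. X i \<omega>) (cbox 0 1) ^ p)"
            using eq(1)[OF w] by simp
          then show "ennreal (norm (measure (\<Phi> \<omega>) (cbox 0 1 \<times> UNIV) ^ p)) = point_count (\<lambda>i. X i \<omega>) (cbox 0 1) ^ p"
            using eq(2)[OF w] by (simp add: power_less_top_ennreal)
        qed
        also have "\<dots> < \<infinity>" using False by (intro mom) simp
        finally show "(\<integral>\<^sup>+\<omega>. ennreal (norm (measure (\<Phi> \<omega>) (cbox 0 1 \<times> UNIV) ^ p)) \<partial>\<Omega>) < \<infinity>" .
      qed
      then show ?thesis by (subst integrable_distr_eq[OF meas m])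
    qed simp
  qed simp
qed

lemma persistent_betti_config:
  "real (persistent_betti q x m n b d) =
    betti q b d (cbox 0 (vec (real n))) (config x m)"
proof -
  obtain r t k s u l where eq: "b = (r, t, k)" "index_max (r, t, k) d = (s, u, l)" by (metis prod_cases3)
  have "{x i |i. x i \<in> B \<and> m i \<le> \<tau>} = atoms {..\<tau>} (config x m) \<inter> B" for B and \<tau> :: real
    by (auto simp: atoms_config)
  then show ?thesis
    by (simp add: persistent_betti_def filtration_complex_def betti_def eq region_betti_def prank_def Let_def)
qed

lemma SUP_ereal_tendsto_zero:
  fixes f :: "nat \<Rightarrow> 'a \<Rightarrow> real"
  assumes "S \<noteq> {}" and ev: "\<And>j. eventually (\<lambda>n. \<forall>x\<in>S. \<bar>f n x\<bar> \<le> 1 / real (Suc j)) sequentially"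
  shows "(\<lambda>n. SUP x\<in>S. ereal \<bar>f n x\<bar>) \<longlonglongrightarrow> 0"
proof (rule order_tendstoI)
  obtain x where x: "x \<in> S" using assms(1) by auto
  fix a :: ereal assume "a < 0"
  have "0 \<le> (SUP x\<in>S. ereal \<bar>f n x\<bar>)" for n by (rule SUP_upper2[OF x]) simp
  then show "eventually (\<lambda>n. a < (SUP x\<in>S. ereal \<bar>f n x\<bar>)) sequentially"
    using \<open>a < 0\<close> by (intro always_eventually allI) (rule less_le_trans)
next
  fix a :: ereal assume "0 < a"
  then obtain c where c: "0 < ereal c" "ereal c < a" using ereal_dense2 by blast
  then obtain j where j: "1 / real (Suc j) < c" using reals_Archimedean[of c] by (auto simp: inverse_eq_divide)
  show "eventually (\<lambda>n. (SUP x\<in>S. ereal \<bar>f n x\<bar>) < a) sequentially"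
    using ev[of j]
  proof eventually_elim
    case (elim n)
    have "(SUP x\<in>S. ereal \<bar>f n x\<bar>) \<le> ereal c" by (rule SUP_least) (use elim j in fastforce)
    then show ?case using c(2) by (rule le_less_trans)
  qed
qed

theorem theorem3p4:
  fixes \<Omega> :: "'w measure"
    and X :: "nat \<Rightarrow> 'w \<Rightarrow> (real, 'd::{finite,linorder}) vec"
    and M :: "nat \<Rightarrow> 'w \<Rightarrow> real"
    and T q :: nat
    and \<alpha> :: "(nat \<Rightarrow> (real, 'd) vec) measure"
    and P0 :: "real measure"
  assumes "prob_space \<Omega>"
    and "T \<ge> 1"
    and "marked_point_process \<Omega> (real T) X M"
    and "stationary \<Omega> X M"
    and "0 < intensity \<Omega> X" and "intensity \<Omega> X < \<infinity>"
    and "q \<le> CARD('d)"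
    and "ergodic \<Omega> X M"
    and "\<And>p::nat. p \<ge> 1 \<Longrightarrow> (\<integral>\<^sup>+\<omega>. point_count (\<lambda>i. X i \<omega>) (cbox 0 1) ^ p \<partial>\<Omega>) < \<infinity>"
    and "reduced_factorial_moment_measure \<Omega> X (q + 2) \<alpha>"
    and "absolutely_continuous (\<Pi>\<^sub>M j\<in>{1..<q + 2}. lborel) \<alpha>"
    and "typical_mark_distribution \<Omega> X M P0"
    and "\<And>t. emeasure P0 {t} = 0"
  shows "AE \<omega> in \<Omega>.
    (\<lambda>n. SUP (b, d) \<in> index_set T \<times> index_set T.
       ereal \<bar>real (persistent_betti q (\<lambda>i. X i \<omega>) (\<lambda>i. M i \<omega>) n b d) / real n ^ CARD('d)
               - limiting_betti \<Omega> X M q b d\<bar>) \<longlonglongrightarrow> 0"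
proof -
  define \<Phi> where "\<Phi> = (\<lambda>\<omega>. config (\<lambda>i. X i \<omega>) (\<lambda>i. M i \<omega>))"
  define P where "P = distr \<Omega> config_space \<Phi>"
  note law = point_process_law_config[OF assms(1,3,4,8,9), folded \<Phi>_def, folded P_def]
  have meas [measurable]: "\<Phi> \<in> measurable \<Omega> config_space" by (rule law(1))
  interpret lex_point_process_law P by (rule law(2))
  have fin: "finite {i. X i \<omega> \<in> B}" if "\<omega> \<in> space \<Omega>" "bounded B" for \<omega> B
    using assms(3) that by (auto simp: marked_point_process_def)
  have pb: "real (persistent_betti q (\<lambda>i. X i \<omega>) (\<lambda>i. M i \<omega>) n b d) = betti q b d (cbox 0 (vec (real n))) (\<Phi> \<omega>)"
    if "\<omega> \<in> space \<Omega>" for \<omega> n b d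
    unfolding \<Phi>_def by (rule persistent_betti_config)
  have lim: "AE \<nu> in P. (\<lambda>n. betti q b d (cbox 0 (vec (real n))) \<nu> / real n ^ CARD('d)) \<longlonglongrightarrow> limiting_betti \<Omega> X M q b d"
    if bd: "b \<in> index_set T" "d \<in> index_set T" for b d
  proof -
    note na = near_additive_index_betti[OF bd, of q]
    have bm: "betti q b d (cbox 0 (vec (real n)) :: (real, 'd) vec set) \<in> borel_measurable config_space" for n
      using near_additive.F_measurable_closed[OF na] by (simp add: measurable_cong_sets[OF sets_P refl])
    obtain c where c: "AE \<nu> in P. (\<lambda>n. betti q b d (cbox 0 (vec (real n))) \<nu> / real n ^ CARD('d)) \<longlonglongrightarrow> c"
      "(\<lambda>n. (\<integral>\<nu>. betti q b d (cbox 0 (vec (real n))) \<nu> \<partial>P) / real n ^ CARD('d)) \<longlonglongrightarrow> c"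
      using law_of_large_numbers[OF na] by blast
    have "(\<integral>\<omega>. real (persistent_betti q (\<lambda>i. X i \<omega>) (\<lambda>i. M i \<omega>) n b d) \<partial>\<Omega>) = (\<integral>\<nu>. betti q b d (cbox 0 (vec (real n))) \<nu> \<partial>P)" for n
      unfolding P_def integral_distr[OF meas bm] by (rule Bochner_Integration.integral_cong) (simp_all add: pb)
    then have "limiting_betti \<Omega> X M q b d = c" unfolding limiting_betti_def using limI[OF c(2)] by simp
    then show ?thesis using c(1) by simp
  qed
  have "AE \<nu> in P. \<forall>j::nat. eventually (\<lambda>n. \<forall>b\<in>index_set T. \<forall>d\<in>index_set T.
    \<bar>betti q b d (cbox 0 (vec (real n))) \<nu> / real n ^ CARD('d) - limiting_betti \<Omega> X M q b d\<bar> \<le> 1 / real (Suc j)) sequentially"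
    unfolding AE_all_countable by (intro allI uniform_law_of_large_numbers[OF lim]) simp_all
  then have "AE \<omega> in \<Omega>. \<forall>j::nat. eventually (\<lambda>n. \<forall>b\<in>index_set T. \<forall>d\<in>index_set T.
    \<bar>betti q b d (cbox 0 (vec (real n))) (\<Phi> \<omega>) / real n ^ CARD('d) - limiting_betti \<Omega> X M q b d\<bar> \<le> 1 / real (Suc j)) sequentially"
    unfolding P_def by (rule AE_distrD[OF meas])
  then show ?thesis using AE_space
  proof eventually_elim
    case (elim \<omega>)
    have ne: "index_set T \<times> index_set T \<noteq> {}" using assms(2) by (auto simp: index_set_def)
    have "(\<lambda>n. SUP p\<in>index_set T \<times> index_set T.
       ereal \<bar>real (persistent_betti q (\<lambda>i. X i \<omega>) (\<lambda>i. M i \<omega>) n (fst p) (snd p)) / real n ^ CARD('d)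
               - limiting_betti \<Omega> X M q (fst p) (snd p)\<bar>) \<longlonglongrightarrow> 0"
    proof (rule SUP_ereal_tendsto_zero[OF ne])
      fix j
      from elim(1) have "eventually (\<lambda>n. \<forall>b\<in>index_set T. \<forall>d\<in>index_set T.
        \<bar>betti q b d (cbox 0 (vec (real n))) (\<Phi> \<omega>) / real n ^ CARD('d) - limiting_betti \<Omega> X M q b d\<bar> \<le> 1 / real (Suc j)) sequentially"
        by blast
      then show "eventually (\<lambda>n. \<forall>p\<in>index_set T \<times> index_set T.
        \<bar>real (persistent_betti q (\<lambda>i. X i \<omega>) (\<lambda>i. M i \<omega>) n (fst p) (snd p)) / real n ^ CARD('d)
               - limiting_betti \<Omega> X M q (fst p) (snd p)\<bar> \<le> 1 / real (Suc j)) sequentially"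
        by (rule eventually_mono) (simp add: pb[OF elim(2)] mem_Times_iff)
    qed
    then show ?case by (simp add: case_prod_beta')
  qed
qed

end
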